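(* Fix $1/2<\sigma<1$. Let $T$ be large and let $J\le(\log T)^\sigma$ be a positive integer. Let $s_1,\dots,s_J$ be complex numbers with $\min_j\mathrm{Re}(s_j)=\sigma$ and $\max_j|\mathrm{Im}(s_j)|<T^{(\sigma-1/2)/4}$. Then there exist positive constants $c_1(\sigma),c_2(\sigma)$ such that for all $\mathbf u=(u_1,\dots,u_J),\mathbf v=(v_1,\dots,v_J)\in\mathbb R^J$ with $\max_j|u_j|,\max_j|v_j|\le c_1(\sigma)(\log T)^\sigma/J$, $$\Phi_T(\mathbf u,\mathbf v)=\Phi_{\mathrm{rand}}(\mathbf u,\mathbf v)+O\Big(\exp\Big(-c_2(\sigma)\frac{\log T}{\log\log T}\Big)\Big),$$ where $$\Phi_T(\mathbf u,\mathbf v)=\frac1T\int_T^{2T}\exp\Big(i\sum_{j=1}^J\big(u_j\,\mathrm{Re}\log\zeta(s_j+it)+v_j\,\mathrm{Im}\log\zeta(s_j+it)\big)\Big)dt$$ and $$\Phi_{\mathrm{rand}}(\mathbf u,\mathbf v)=\mathbb E\Big(\exp\Big(i\sum_{j=1}^J\big(u_j\,\mathrm{Re}\log\zeta(s_j,X)+v_j\,\mathrm{Im}\log\zeta(s_j,X)\big)\Big)\Big).$$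
   Context: $\zeta$ is the Riemann zeta function; for $\mathrm{Re}(s)>1/2$, $\log\zeta(s)$ is defined by continuous variation along the horizontal line from $+\infty$ (where it equals $\sum_n\Lambda(n)n^{-s}/\log n$), the measure-zero set of $t$ where this is undefined being irrelevant. Let $\{X(p)\}_p$, indexed by the primes, be independent random variables uniformly distributed on the unit circle, and $\log\zeta(s,X)=-\sum_p\log(1-X(p)p^{-s})$ (principal branches), which converges almost surely for $\mathrm{Re}(s)>1/2$. *)

theory Defs
  imports
    "HOL-Complex_Analysis.Complex_Analysis"
    "HOL-Number_Theory.Number_Theory"
    "HOL-Probability.Probability"
begin

section \<open>The Riemann zeta function\<close>

text \<open>
  The zeta function is needed only to the right of the critical line, so it is introduced on the
  half-plane \<open>Re s > 0\<close>, as the analytic continuation of the Dirichlet series. The value \<open>0\<close> at the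
  pole and to the left of the half-plane is a convention that makes the function unique.
\<close>

definition zeta_continuation :: "(complex \<Rightarrow> complex) \<Rightarrow> bool" where
  "zeta_continuation f \<longleftrightarrow>
     f holomorphic_on ({s. Re s > 0} - {1}) \<and>
     (\<forall>s. Re s > 1 \<longrightarrow> f s = (\<Sum>n. of_nat (Suc n) powr (-s)))"

definition zeta :: "complex \<Rightarrow> complex" where
  "zeta = (THE f. zeta_continuation f \<and> (\<forall>s. s = 1 \<or> Re s \<le> 0 \<longrightarrow> f s = 0))"

lemma zeta_continuation_unique:
  assumes "zeta_continuation f" "zeta_continuation g" "Re s > 0" "s \<noteq> 1"
  shows "f s = g s"
proof (rule analytic_continuation_open[where s = "{s. Re s > 1}" and s' = "{s. Re s > 0} - {1}"
      and f = f and g = g])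
  show "open {s. Re s > 1}" by (rule open_halfspace_Re_gt)
  show "open ({s. Re s > 0} - {1})" by (intro open_delete open_halfspace_Re_gt)
  show "{s. Re s > 1} \<noteq> {}" by (auto intro!: exI[of _ 2])
  have "convex {s. Re s > 0}" by (rule convex_halfspace_Re_gt)
  then show "connected ({s. Re s > 0} - {1})"
    by (intro connected_open_delete open_halfspace_Re_gt convex_connected) auto
qed (use assms in \<open>auto simp: zeta_continuation_def\<close>)

definition zeta_term :: "nat \<Rightarrow> complex \<Rightarrow> complex" where
  "zeta_term n s = of_nat (Suc n) powr (-s)
     - (of_nat (Suc (Suc n)) powr (1 - s) - of_nat (Suc n) powr (1 - s)) / (1 - s)"

lemma norm_zeta_term_le:
  assumes s: "Re s > 0" "s \<noteq> 1"
  shows "norm (zeta_term n s) \<le> norm s * real (Suc n) powr (- Re s - 1)"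
proof -
  define N where "N = real (Suc n)"
  have N: "N \<ge> 1" by (simp add: N_def)
  define B where "B = norm s * N powr (- Re s - 1)"
  define P where "P = (\<lambda>x::real. complex_of_real (N + x) powr (-s))"
  have nz: "complex_of_real (N + x) \<notin> \<real>\<^sub>\<le>\<^sub>0" if "x \<ge> 0" for x
    using N that by (auto simp: complex_nonpos_Reals_iff)
  have P: "norm (P 0 - P x) \<le> B" if x: "x \<in> {0..1}" for x
  proof -
    have "norm (P 0 - P x) \<le> B * norm (0 - x)"
    proof (rule differentiable_bound[where S = "{0..1}"
          and f' = "\<lambda>x h. of_real h * (-s * of_real (N + x) powr (-s - 1))"])
      fix y :: real assume y: "y \<in> {0..1}"
      show "(P has_derivative (\<lambda>h. of_real h * (-s * of_real (N + y) powr (-s - 1)))) (at y within {0..1})"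
      proof -
        have "((\<lambda>x. complex_of_real (N + x) powr (-s)) has_vector_derivative
            (-s * of_real (N + y) powr (-s - 1))) (at y within {0..1})"
          using nz[of y] y
          by (auto intro!: derivative_eq_intros has_vector_derivative_real_field)
        then show ?thesis
          unfolding has_vector_derivative_def P_def scaleR_conv_of_real .
      qed
      show "onorm (\<lambda>h. of_real h * (-s * of_real (N + y) powr (-s - 1))) \<le> B"
      proof (rule onorm_le)
        fix h :: real
        have "norm (complex_of_real (N + y) powr (-s - 1)) = (N + y) powr (- Re s - 1)"
          using N y by (subst norm_powr_real_powr) auto
        also have "\<dots> \<le> N powr (- Re s - 1)"
          using N y s by (intro powr_mono2') auto
        finally show "norm (of_real h * (-s * of_real (N + y) powr (-s - 1))) \<le> B * norm h"
          by (simp add: norm_mult B_def mult.commute mult.left_commute mult_left_mono)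
      qed
    qed (use x in auto)
    also have "\<dots> \<le> B" using x mult_left_le[of "norm x" B] by (auto simp: B_def)
    finally show ?thesis .
  qed
  define F where "F = (\<lambda>x::real. P 0 * of_real x - complex_of_real (N + x) powr (1 - s) / (1 - s))"
  have "norm (F 1 - F 0) \<le> B * norm (1 - 0 :: real)"
  proof (rule differentiable_bound[where S = "{0..1}" and f' = "\<lambda>x h. of_real h * (P 0 - P x)"])
    fix y :: real assume y: "y \<in> {0..1}"
    have "(F has_vector_derivative (P 0 - P y)) (at y within {0..1})"
      unfolding F_def P_def using nz[of y] y s(2)
      by (auto intro!: derivative_eq_intros has_vector_derivative_real_field)
    then show "(F has_derivative (\<lambda>h. of_real h * (P 0 - P y))) (at y within {0..1})"
      unfolding has_vector_derivative_def scaleR_conv_of_real .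
    show "onorm (\<lambda>h. of_real h * (P 0 - P y)) \<le> B"
      by (rule onorm_le) (use P[OF y] in \<open>simp add: norm_mult mult.commute[of B] mult_left_mono\<close>)
  qed auto
  also have "F 1 - F 0 = zeta_term n s"
    by (simp add: F_def P_def zeta_term_def N_def diff_divide_distrib algebra_simps)
  finally show ?thesis by (simp add: B_def N_def)
qed

lemma zeta_continuation_exists: "\<exists>f. zeta_continuation f"
proof (intro exI)
  define h where "h = (\<lambda>s. \<Sum>n. zeta_term n s)"
  let ?S = "{s. Re s > 0} - {1}"
  have oS: "open ?S" by (intro open_delete open_halfspace_Re_gt)
  have summable_bound: "summable (\<lambda>n. c * real (Suc n) powr (- a - 1))" if "a > 0" for a c :: real
    using that summable_real_powr_iff[of "- a - 1"]
    by (intro summable_mult, subst (asm) summable_Suc_iff[symmetric]) auto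
  have "h holomorphic_on ?S"
  proof (rule holomorphic_uniform_sequence[OF oS])
    show "(\<lambda>s. \<Sum>i<n. zeta_term i s) holomorphic_on ?S" for n
      unfolding zeta_term_def by (intro holomorphic_intros) auto
  next
    fix x assume "x \<in> ?S"
    then obtain d where d: "d > 0" "cball x d \<subseteq> ?S"
      using oS open_contains_cball_eq by blast
    have rx: "Re x > 0" using \<open>x \<in> ?S\<close> by simp
    define e where "e = min d (Re x / 2)"
    have e: "e > 0" "cball x e \<subseteq> ?S" using d rx by (auto simp: e_def subset_iff)
    have "uniform_limit (cball x e) (\<lambda>n s. \<Sum>i<n. zeta_term i s) (\<lambda>s. \<Sum>i. zeta_term i s) sequentially"
    proof (rule Weierstrass_m_test)
      fix n s assume s: "s \<in> cball x e"
      have "norm (x - s) \<le> e" using s by (simp add: dist_norm)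
      then have "Re s \<ge> Re x / 2" "norm s \<le> norm x + e"
        using abs_Re_le_cmod[of "x - s"] norm_triangle_ineq4[of x "x - s"] by (auto simp: e_def)
      have "norm (zeta_term n s) \<le> norm s * real (Suc n) powr (- Re s - 1)"
        using s e by (intro norm_zeta_term_le) auto
      also have "\<dots> \<le> (norm x + e) * real (Suc n) powr (- (Re x / 2) - 1)"
        using \<open>Re s \<ge> _\<close> \<open>norm s \<le> _\<close> e(1) by (intro mult_mono powr_mono) auto
      finally show "norm (zeta_term n s) \<le> (norm x + e) * real (Suc n) powr (- (Re x / 2) - 1)" .
    next
      show "summable (\<lambda>n. (norm x + e) * real (Suc n) powr (- (Re x / 2) - 1))"
        using rx by (intro summable_bound) auto
    qed
    then show "\<exists>d>0. cball x d \<subseteq> ?S \<and>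
        uniform_limit (cball x d) (\<lambda>n s. \<Sum>i<n. zeta_term i s) h sequentially"
      using e unfolding h_def by blast
  qed
  moreover have "h s + 1 / (s - 1) = (\<Sum>n. of_nat (Suc n) powr (-s))" if s: "Re s > 1" for s
  proof -
    define a where "a = (\<lambda>n. complex_of_nat (Suc n) powr (1 - s) / (1 - s))"
    have "s \<noteq> 1" using s by auto
    have "(\<lambda>n. complex_of_nat (Suc n) powr (1 - s)) \<longlonglongrightarrow> 0"
    proof (rule tendsto_norm_zero_cancel)
      have "norm (complex_of_nat (Suc n) powr (1 - s)) = real (Suc n) powr (1 - Re s)" for n
        using norm_powr_real_powr[of "of_nat (Suc n)" "1 - s"] by simp
      moreover have "(\<lambda>n. real (Suc n) powr (1 - Re s)) \<longlonglongrightarrow> 0"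
        using s by (intro tendsto_neg_powr filterlim_compose[OF filterlim_real_sequentially filterlim_Suc]) auto
      ultimately show "(\<lambda>n. norm (complex_of_nat (Suc n) powr (1 - s))) \<longlonglongrightarrow> 0" by simp
    qed
    then have "a \<longlonglongrightarrow> 0"
      unfolding a_def using tendsto_divide[of _ 0 _ "\<lambda>_. 1 - s"] \<open>s \<noteq> 1\<close> by fastforce
    then have "(\<lambda>n. a (Suc n) - a n) sums (0 - a 0)" by (rule telescope_sums)
    moreover have "0 - a 0 = 1 / (s - 1)"
      using \<open>s \<noteq> 1\<close> by (simp add: a_def field_simps)
    ultimately have tel: "(\<lambda>n. a (Suc n) - a n) sums (1 / (s - 1))"
      by simp
    have "summable (\<lambda>n. zeta_term n s)"
      by (rule summable_comparison_test'[OF summable_bound[of "Re s" "norm s"]])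
         (use s norm_zeta_term_le[of s] \<open>s \<noteq> 1\<close> in auto)
    then have "(\<lambda>n. zeta_term n s + (a (Suc n) - a n)) sums (h s + 1 / (s - 1))"
      unfolding h_def using tel by (intro sums_add) (auto simp: summable_sums)
    moreover have "zeta_term n s + (a (Suc n) - a n) = of_nat (Suc n) powr (-s)" for n
      by (simp add: zeta_term_def a_def diff_divide_distrib)
    ultimately show ?thesis by (simp add: sums_unique)
  qed
  ultimately show "zeta_continuation (\<lambda>s. h s + 1 / (s - 1))"
    unfolding zeta_continuation_def by (auto intro!: holomorphic_intros)
qed

lemma zeta_continuation_zeta: "zeta_continuation zeta"
  and zeta_eq_0: "s = 1 \<or> Re s \<le> 0 \<Longrightarrow> zeta s = 0"
proof -
  let ?P = "\<lambda>f. zeta_continuation f \<and> (\<forall>s. s = 1 \<or> Re s \<le> 0 \<longrightarrow> f s = 0)"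
  obtain f where f: "zeta_continuation f" using zeta_continuation_exists by blast
  define g where "g = (\<lambda>s. if s = 1 \<or> Re s \<le> 0 then 0 else f s)"
  have "g holomorphic_on ({s. Re s > 0} - {1}) \<longleftrightarrow> f holomorphic_on ({s. Re s > 0} - {1})"
    by (rule holomorphic_cong) (auto simp: g_def)
  then have g: "?P g" using f by (auto simp: zeta_continuation_def g_def)
  have "?P zeta"
    unfolding zeta_def
  proof (rule theI[of ?P, OF g])
    fix f' assume f': "?P f'"
    show "f' = g"
    proof
      fix s
      show "f' s = g s"
        using zeta_continuation_unique[of f' g s] f' g by (cases "s = 1 \<or> Re s \<le> 0") auto
    qed
  qed
  then show "zeta_continuation zeta" and "s = 1 \<or> Re s \<le> 0 \<Longrightarrow> zeta s = 0" by auto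
qed


section \<open>The logarithm of zeta\<close>

text \<open>
  A continuous logarithm of \<open>zeta\<close> along the horizontal ray from \<open>s\<close> to \<open>+\<infinity>\<close>, parametrised by the
  real part. Such a branch exists exactly if \<open>zeta\<close> has no zero and no pole on the ray (note that
  \<open>zeta 1 = 0\<close> here); it is then unique, as its values far to the right are prescribed.
  The summands for \<open>n = 0\<close> and \<open>n = 1\<close> vanish.
\<close>

definition log_zeta_branch :: "complex \<Rightarrow> (real \<Rightarrow> complex) \<Rightarrow> bool" where
  "log_zeta_branch s g \<longleftrightarrow>
     continuous_on {Re s..} g \<and>
     (\<forall>x\<ge>Re s. exp (g x) = zeta (Complex x (Im s))) \<and>
     (\<forall>x\<ge>Re s. x > 1 \<longrightarrow>
        g x = (\<Sum>n. mangoldt n * of_nat n powr (- Complex x (Im s)) / of_real (ln (real n))))"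

text \<open>For \<open>Re s > 1/2\<close> the exceptional value \<open>0\<close> is taken for a null set of \<open>Im s\<close> only.\<close>

definition log_zeta :: "complex \<Rightarrow> complex" where
  "log_zeta s = (if \<exists>g. log_zeta_branch s g
                 then (THE z. \<exists>g. log_zeta_branch s g \<and> z = g (Re s)) else 0)"


section \<open>The random model\<close>

definition unit_circle_measure :: "complex measure" where
  "unit_circle_measure = distr (uniform_measure lborel {0..2 * pi}) borel cis"

text \<open>Only the values \<open>X p\<close> at primes \<open>p\<close> matter.\<close>

definition random_model :: "'a measure \<Rightarrow> (nat \<Rightarrow> 'a \<Rightarrow> complex) \<Rightarrow> bool" where
  "random_model M X \<longleftrightarrow>
     prob_space M \<and>
     prob_space.indep_vars M (\<lambda>_. borel) X {p. prime p} \<and>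
     (\<forall>p. prime p \<longrightarrow> distr M borel (X p) = unit_circle_measure)"

text \<open>
  The sum over the primes is taken in increasing order: for \<open>1/2 < Re s \<le> 1\<close> it converges almost
  surely but not absolutely. Off the event of convergence the value is irrelevant.
\<close>

definition log_zeta_rand :: "(nat \<Rightarrow> 'a \<Rightarrow> complex) \<Rightarrow> complex \<Rightarrow> 'a \<Rightarrow> complex" where
  "log_zeta_rand X s \<omega> = - (\<Sum>p. if prime p then Ln (1 - X p \<omega> * of_nat p powr (-s)) else 0)"


section \<open>The characteristic functions\<close>

definition \<Phi>_T :: "real \<Rightarrow> nat \<Rightarrow> (nat \<Rightarrow> complex) \<Rightarrow> (nat \<Rightarrow> real) \<Rightarrow> (nat \<Rightarrow> real) \<Rightarrow> complex" where
  "\<Phi>_T T J s u v = 1 / of_real T * (LINT t:{T..2 * T}|lborel.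
     exp (\<i> * of_real (\<Sum>j=1..J. u j * Re (log_zeta (s j + \<i> * of_real t))
                            + v j * Im (log_zeta (s j + \<i> * of_real t)))))"

definition \<Phi>_rand :: "'a measure \<Rightarrow> (nat \<Rightarrow> 'a \<Rightarrow> complex) \<Rightarrow>
    nat \<Rightarrow> (nat \<Rightarrow> complex) \<Rightarrow> (nat \<Rightarrow> real) \<Rightarrow> (nat \<Rightarrow> real) \<Rightarrow> complex" where
  "\<Phi>_rand M X J s u v = (LINT \<omega>|M.
     exp (\<i> * of_real (\<Sum>j=1..J. u j * Re (log_zeta_rand X (s j) \<omega>)
                            + v j * Im (log_zeta_rand X (s j) \<omega>))))"

end

theory Submission
  imports Defs "HOL-Real_Asymp.Real_Asymp"
begin

text \<open>
  Let \<open>K = ln T / ln (ln T)\<close>. The integers up to \<open>exp (O(K))\<close> are split into blocks, the \<open>i\<close>-th one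
  ending at \<open>(ln T)\<close> to the power \<open>A 2\<^sup>i\<close>, and \<open>P\<^sub>i\<close> denotes the part of the Dirichlet series of
  \<open>log zeta\<close> over the block. Exponentials of block sums are truncated at a degree \<open>k\<^sub>i\<close> proportional
  to \<open>K / 2\<^sup>i\<close> (up to a factor \<open>ln (ln T)\<close> for \<open>i > 0\<close>), so that the product over all blocks is a
  Dirichlet polynomial of length a small power of \<open>T\<close>, while the truncation error
  \<open>\<bar>P\<^sub>i\<bar>\<close> to the power \<open>k\<^sub>i\<close>, divided by \<open>k\<^sub>i!\<close>, has mean \<open>exp (- c K)\<close>.

  This is used twice. The truncation of \<open>exp (- \<Sum> P\<^sub>i)\<close> mollifies zeta: \<open>zeta M - 1\<close> is small in mean
  on vertical lines to the right of the critical line, hence, by Cauchy's formula, uniformly small on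
  horizontal rays outside a set of ordinates of measure \<open>T exp (- c K)\<close>, where therefore \<open>log zeta\<close>
  is close to \<open>\<Sum> P\<^sub>i\<close>. No information on the zeros of zeta is needed. Secondly, the truncation turns
  the oscillating exponential in the characteristic function into a short Dirichlet polynomial, whose
  mean over \<open>[T, 2T]\<close> agrees with the expectation in the random model. There the truncation error
  is bounded by exponential moments, which factor over the primes; the block of the smallest primes
  contributes \<open>exp (O(c\<^sub>1 K))\<close> by Chebyshev's bound, which the gain \<open>exp (- k\<^sub>0)\<close> beats for small \<open>c\<^sub>1\<close>.
\<close>

section \<open>Dirichlet convolution and truncated exponentials\<close>

text \<open>The sum of all |u j| + |v j| is at most \<open>2 * c1 * L powr \<sigma>\<close> with
  \<open>L = ln T\<close>, so a prime p enters the phase with a coefficient of order (L / p) powr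
  \<sigma>, large for p < L. The logarithm of its exponential moment is bounded by this coefficient
  and by its square; the smaller of the two, summed over all primes, is O(L / ln L) = O(K). This
  fixes the admissible size of u and v and the K in the error. Integers up to exp (O(K)) are needed
  to represent log zeta with error exp (- c K), but truncating the exponential of the whole sum at a
  degree of order K gives length exp (O(K^2)), beyond every power of T. With l = ln L, block 0 costs
  exp (O(A c l K)), a small power of T, and each of the O(l) later blocks, of degree about c K /
  (2^i l), costs exp (O(A c K)). The lower degree suffices there because the primes exceed L to the
  power A 2^(i-1): the block is so small that each unit of degree gains exp (10 l 2^i). The value A
  = 100 / \<delta>, with \<delta> = \<sigma> - 1/2, pays for this gain; c is then small enough for a
  total length of at most T powr (\<delta> / 64).\<close>

definition dconv :: "(nat \<Rightarrow> real) \<Rightarrow> (nat \<Rightarrow> real) \<Rightarrow> nat \<Rightarrow> real" where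
  "dconv f g n = (\<Sum>d | d dvd n. f d * g (n div d))"

definition dunit :: "nat \<Rightarrow> real" where
  "dunit n = (if n = 1 then 1 else 0)"

primrec dpow :: "(nat \<Rightarrow> real) \<Rightarrow> nat \<Rightarrow> nat \<Rightarrow> real" where
  "dpow f 0 = dunit"
| "dpow f (Suc j) = dconv f (dpow f j)"

definition dexp :: "nat \<Rightarrow> (nat \<Rightarrow> real) \<Rightarrow> nat \<Rightarrow> real" where
  "dexp k f n = (\<Sum>j<k. dpow f j n / fact j)"

text \<open>With \<open>f i\<close> the negative of block i of log zeta this gives the coefficients
  of the mollifier; with the sign reversed it gives a nonnegative majorant of them.\<close>

primrec dmoll :: "(nat \<Rightarrow> nat \<Rightarrow> real) \<Rightarrow> (nat \<Rightarrow> nat) \<Rightarrow> nat \<Rightarrow> nat \<Rightarrow> real" where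
  "dmoll f k 0 = dunit"
| "dmoll f k (Suc i) = dconv (dexp (k i) (f i)) (dmoll f k i)"

definition dser :: "(nat \<Rightarrow> real) \<Rightarrow> nat \<Rightarrow> complex \<Rightarrow> complex" where
  "dser f N s = (\<Sum>n\<in>{1..N}. of_real (f n) * of_nat n powr (-s))"

text \<open>Every d divides 0, and a sum over an infinite set is 0 by convention. Hence identities
  such as associativity hold at every argument.\<close>

lemma dconv_0 [simp]: "dconv f g 0 = 0"
  by (simp add: dconv_def)

lemma finite_mult_eq: "n > 0 \<Longrightarrow> finite {(a, b). a * b = (n::nat)}"
  by (rule finite_subset[of _ "{..n} \<times> {..n}"]) (auto intro: dvd_imp_le)

lemma dconv_pairs: "n > 0 \<Longrightarrow> dconv f g n = (\<Sum>(a, b)\<in>{(a, b). a * b = n}. f a * g b)"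
  unfolding dconv_def
  by (rule sum.reindex_bij_witness[of _ fst "\<lambda>d. (d, n div d)"]) auto

lemma dconv_commute: "dconv f g = dconv g f"
proof
  fix n show "dconv f g n = dconv g f n"
  proof (cases "n = 0")
    case False
    then show ?thesis
      by (simp add: dconv_pairs)
         (rule sum.reindex_bij_witness[of _ "\<lambda>(a, b). (b, a)" "\<lambda>(a, b). (b, a)"], auto simp: mult.commute)
  qed simp
qed

text \<open>A form in which the three factors play symmetric roles; together with commutativity it
  yields associativity by permuting coordinates.\<close>

lemma dconv_triples:
  assumes "n > 0"
  shows "dconv (dconv f g) h n = (\<Sum>(a, b, c)\<in>{(a, b, c). a * b * c = n}. f a * g b * h c)"
proof -
  have "dconv (dconv f g) h n = (\<Sum>(d, c)\<in>{(d, c). d * c = n}. dconv f g d * h c)"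
    by (rule dconv_pairs[OF assms])
  also have "\<dots> = (\<Sum>p\<in>{(d, c). d * c = n}. \<Sum>q\<in>{(a, b). a * b = fst p}. f (fst q) * g (snd q) * h (snd p))"
    using assms by (intro sum.cong) (auto simp: dconv_pairs sum_distrib_right case_prod_unfold)
  also have "\<dots> = (\<Sum>(p, q)\<in>(SIGMA p:{(d, c). d * c = n}. {(a, b). a * b = fst p}). f (fst q) * g (snd q) * h (snd p))"
    using assms by (intro sum.Sigma finite_mult_eq) (auto intro!: finite_mult_eq)
  also have "\<dots> = (\<Sum>(a, b, c)\<in>{(a, b, c). a * b * c = n}. f a * g b * h c)"
    by (rule sum.reindex_bij_witness[of _ "\<lambda>(a, b, c). ((a * b, c), (a, b))" "\<lambda>((d, c), (a, b)). (a, b, c)"]) auto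
  finally show ?thesis .
qed

lemma dconv_assoc: "dconv (dconv f g) h = dconv f (dconv g h)"
proof
  fix n show "dconv (dconv f g) h n = dconv f (dconv g h) n"
  proof (cases "n = 0")
    case False
    then have n: "n > 0" by simp
    have "dconv f (dconv g h) n = dconv (dconv g h) f n" by (simp add: dconv_commute)
    then show ?thesis using n
      by (simp add: dconv_triples)
         (rule sum.reindex_bij_witness[of _ "\<lambda>(a, b, c). (c, a, b)" "\<lambda>(a, b, c). (b, c, a)"], auto simp: mult_ac)
  qed simp
qed

lemma dconv_left_commute: "dconv f (dconv g h) = dconv g (dconv f h)"
  by (metis dconv_assoc dconv_commute)

lemmas dconv_ac = dconv_assoc dconv_commute dconv_left_commute

lemma dconv_add: "dconv f (\<lambda>n. g n + h n) n = dconv f g n + dconv f h n"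
  by (simp add: dconv_def distrib_left sum.distrib)

lemma dconv_add_left: "dconv (\<lambda>n. g n + h n) f n = dconv g f n + dconv h f n"
  by (simp add: dconv_def distrib_right sum.distrib)

lemma dconv_cmult: "dconv f (\<lambda>n. c * g n) n = c * dconv f g n"
  by (simp add: dconv_def sum_distrib_left mult_ac)

lemma dconv_sum: "dconv f (\<lambda>n. \<Sum>j\<in>A. g j n) n = (\<Sum>j\<in>A. dconv f (g j) n)"
  by (induction A rule: infinite_finite_induct) (simp_all add: dconv_add, auto simp: dconv_def)

lemma dconv_cong:
  assumes "\<And>d. d dvd n \<Longrightarrow> f d = f' d" "\<And>d. d dvd n \<Longrightarrow> g d = g' d"
  shows "dconv f g n = dconv f' g' n"
  unfolding dconv_def by (intro sum.cong) (auto simp: assms div_dvd_iff_mult)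

lemma dconv_mono:
  assumes "\<And>n. n > 0 \<Longrightarrow> 0 \<le> f n" "\<And>n. n > 0 \<Longrightarrow> f n \<le> f' n" "\<And>n. n > 0 \<Longrightarrow> 0 \<le> g n" "\<And>n. n > 0 \<Longrightarrow> g n \<le> g' n"
  shows "dconv f g n \<le> dconv f' g' n"
proof (cases "n = 0")
  case False
  then show ?thesis unfolding dconv_def
    by (intro sum_mono mult_mono) (auto intro!: assms dest: dvd_pos_nat order_trans[OF assms(1,2)] simp: div_greater_zero_iff dvd_imp_le)
qed simp

lemma dconv_nonneg:
  assumes "\<And>n. 0 \<le> f n" "\<And>n. 0 \<le> g n"
  shows "0 \<le> dconv f g n"
  unfolding dconv_def by (intro sum_nonneg mult_nonneg_nonneg assms)

lemma abs_dconv_le: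
  assumes "\<And>n. \<bar>f n\<bar> \<le> F n" "\<And>n. \<bar>g n\<bar> \<le> G n"
  shows "\<bar>dconv f g n\<bar> \<le> dconv F G n"
proof -
  have "0 \<le> F n" for n using assms(1)[of n] by linarith
  then show ?thesis
    unfolding dconv_def
    by (intro order_trans[OF sum_abs] sum_mono) (auto simp: abs_mult intro!: mult_mono assms)
qed

text \<open>Multiplication by \<open>ln n\<close> is a derivation of the convolution ring: up to
  sign it is the derivative of the Dirichlet series with respect to s.\<close>

lemma ln_dconv:
  "ln (real n) * dconv f g n = dconv (\<lambda>n. ln (real n) * f n) g n + dconv f (\<lambda>n. ln (real n) * g n) n"
proof (cases "n = 0")
  case False
  then show ?thesis
    by (simp add: dconv_pairs sum_distrib_left sum.distrib[symmetric])
       (auto intro!: sum.cong simp: ln_mult algebra_simps)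
qed simp

lemma ln_dpow:
  "ln (real n) * dpow f (Suc j) n = real (Suc j) * dconv (\<lambda>n. ln (real n) * f n) (dpow f j) n"
proof (induction j arbitrary: n)
  case 0
  have "dconv f (\<lambda>n. ln (real n) * dunit n) n = 0"
    by (auto simp: dconv_def dunit_def intro!: sum.neutral)
  then show ?case by (simp only: dpow.simps ln_dconv)
next
  case (Suc j)
  have "ln (real n) * dpow f (Suc (Suc j)) n = dconv (\<lambda>n. ln (real n) * f n) (dpow f (Suc j)) n
      + dconv f (\<lambda>n. ln (real n) * dpow f (Suc j) n) n"
    by (subst dpow.simps(2)) (rule ln_dconv)
  also have "dconv f (\<lambda>n. ln (real n) * dpow f (Suc j) n) n
     = dconv f (\<lambda>n. real (Suc j) * dconv (\<lambda>n. ln (real n) * f n) (dpow f j) n) n"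
    by (simp only: Suc.IH)
  also have "\<dots> = real (Suc j) * dconv (\<lambda>n. ln (real n) * f n) (dpow f (Suc j)) n"
    by (simp add: dconv_cmult dconv_left_commute[of f])
  finally show ?case by (simp only: of_nat_Suc) (simp only: algebra_simps)
qed

lemma dexp_Suc: "dexp (Suc k) f n = dexp k f n + dpow f k n / fact k"
  by (simp add: dexp_def)

text \<open>The derivative of the exponential series, termwise: the term of degree j + 1 becomes the
  derivative of \<open>f\<close> times the term of degree j. Truncation therefore lowers the degree
  by one.\<close>

lemma ln_dexp:
  assumes "n > 0"
  shows "ln (real n) * dexp (Suc k) f n = dconv (\<lambda>n. ln (real n) * f n) (dexp k f) n"
proof -
  let ?f = "\<lambda>n. ln (real n) * f n"
  have "ln (real n) * dexp (Suc k) f n = (\<Sum>j<Suc k. ln (real n) * dpow f j n / fact j)"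
    by (simp add: dexp_def sum_distrib_left distrib_left)
  also have "\<dots> = (\<Sum>j<k. ln (real n) * dpow f (Suc j) n / fact (Suc j))"
    by (subst sum.lessThan_Suc_shift) (simp add: dunit_def del: dpow.simps(2) fact_Suc)
  also have "\<dots> = (\<Sum>j<k. (1 / fact j) * dconv ?f (dpow f j) n)"
    by (simp only: ln_dpow) (simp add: field_simps del: dpow.simps(2) of_nat_Suc)
  also have "\<dots> = dconv ?f (dexp k f) n"
  proof -
    have "dexp k f = (\<lambda>n. \<Sum>j<k. (1 / fact j) * dpow f j n)" by (auto simp: dexp_def)
    then show ?thesis by (simp only: dconv_sum dconv_cmult)
  qed
  finally show ?thesis .
qed

lemma dpow_eq_0_below:
  assumes "\<And>n. n < b \<Longrightarrow> f n = 0"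
  shows "n < b ^ j \<Longrightarrow> dpow f j n = 0"
proof (induction j arbitrary: n)
  case (Suc j)
  show ?case
  proof (cases "n = 0")
    case False
    from False have n: "n > 0" by simp
    show ?thesis unfolding dpow.simps dconv_pairs[OF n]
    proof (intro sum.neutral ballI, clarify)
      fix x y assume "n = x * y"
      then have "\<not> (x \<ge> b \<and> y \<ge> b ^ j)"
        using Suc.prems mult_le_mono[of b x "b ^ j" y] by auto
      then show "f x * dpow f j y = 0" using Suc.IH[of y] assms[of x] by force
    qed
  qed simp
qed (auto simp: dunit_def)

lemma dconv_eq_0_above:
  assumes "\<And>n. n > a \<Longrightarrow> f n = 0" "\<And>n. n > b \<Longrightarrow> g n = 0" "n > a * b"
  shows "dconv f g n = 0"
proof -
  have n: "n > 0" using assms(3) by auto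
  show ?thesis unfolding dconv_pairs[OF n]
  proof (intro sum.neutral ballI, clarify)
    fix x y assume "n = x * y"
    then have "\<not> (x \<le> a \<and> y \<le> b)"
      using assms(3) mult_le_mono[of x a y b] by auto
    then show "f x * g y = 0" using assms by (metis mult_zero_left mult_zero_right not_le)
  qed
qed

lemma dpow_eq_0_above:
  assumes "\<And>n. n > b \<Longrightarrow> f n = 0"
  shows "n > b ^ j \<Longrightarrow> dpow f j n = 0"
proof (induction j arbitrary: n)
  case (Suc j)
  then show ?case unfolding dpow.simps
    by (intro dconv_eq_0_above[of b f "b ^ j"]) (use assms in auto)
qed (auto simp: dunit_def)

lemma dexp_eq_0_above:
  assumes "\<And>n. n > b \<Longrightarrow> f n = 0" "b > 0" "n > b ^ k"
  shows "dexp k f n = 0"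
  unfolding dexp_def
proof (intro sum.neutral ballI)
  fix j assume "j \<in> {..<k}"
  then have "b ^ j \<le> b ^ k" using assms(2) by (intro power_increasing) auto
  then show "dpow f j n / fact j = 0" using dpow_eq_0_above[of b f j n] assms by auto
qed

lemma dmoll_eq_0_above:
  assumes "\<And>i n. n > b i \<Longrightarrow> f i n = 0" "\<And>i. b i > (0::nat)"
  shows "n > (\<Prod>i<N. b i ^ k i) \<Longrightarrow> dmoll f k N n = 0"
proof (induction N arbitrary: n)
  case (Suc N)
  show ?case unfolding dmoll.simps
    by (rule dconv_eq_0_above[of "b N ^ k N" _ "\<Prod>i<N. b i ^ k i"])
       (use Suc assms in \<open>auto simp: mult.commute intro!: dexp_eq_0_above[of "b N"]\<close>)
qed (auto simp: dunit_def)

lemma dconv_1 [simp]: "dconv f g (Suc 0) = f 1 * g 1"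
  by (simp add: dconv_def)

lemma dexp_1: "f 1 = 0 \<Longrightarrow> k > 0 \<Longrightarrow> dexp k f 1 = 1"
  by (cases k) (simp_all add: dexp_def sum.lessThan_Suc_shift dunit_def del: sum.lessThan_Suc)

lemma dmoll_1: "(\<And>i. f i 1 = 0) \<Longrightarrow> (\<And>i. k i > 0) \<Longrightarrow> dmoll f k N 1 = 1"
  by (induction N) (auto simp: dexp_1[unfolded One_nat_def] dunit_def)

lemma abs_dpow_le: "(\<And>n. \<bar>f n\<bar> \<le> F n) \<Longrightarrow> \<bar>dpow f j n\<bar> \<le> dpow F j n"
  by (induction j arbitrary: n) (auto simp: dunit_def intro: abs_dconv_le)

lemma abs_dexp_le: "(\<And>n. \<bar>f n\<bar> \<le> F n) \<Longrightarrow> \<bar>dexp k f n\<bar> \<le> dexp k F n"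
  unfolding dexp_def
  by (intro order_trans[OF sum_abs] sum_mono) (auto intro!: divide_right_mono abs_dpow_le)

lemma abs_dmoll_le: "(\<And>i n. \<bar>f i n\<bar> \<le> F i n) \<Longrightarrow> \<bar>dmoll f k N n\<bar> \<le> dmoll F k N n"
  by (induction N arbitrary: n) (auto simp: dunit_def intro!: abs_dconv_le abs_dexp_le)

lemma dpow_nonneg: "(\<And>n. 0 \<le> f n) \<Longrightarrow> 0 \<le> dpow f j n"
  by (induction j arbitrary: n) (auto simp: dunit_def intro: dconv_nonneg)

lemma dexp_nonneg: "(\<And>n. 0 \<le> f n) \<Longrightarrow> 0 \<le> dexp k f n"
  unfolding dexp_def by (intro sum_nonneg) (auto intro!: divide_nonneg_nonneg dpow_nonneg)

lemma dmoll_nonneg: "(\<And>i n. 0 \<le> f i n) \<Longrightarrow> 0 \<le> dmoll f k N n"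
  by (induction N arbitrary: n) (auto simp: dunit_def intro!: dconv_nonneg dexp_nonneg)

text \<open>For nonnegative \<open>f\<close> the truncations only discard nonnegative terms, so the
  differential equation of the exponential survives as an inequality.\<close>

lemma ln_dmoll_le:
  assumes f: "\<And>i n. 0 \<le> f i n" and n: "n > 0"
  shows "ln (real n) * dmoll f k N n \<le> dconv (\<lambda>n. \<Sum>i<N. ln (real n) * f i n) (dmoll f k N) n"
  using n
proof (induction N arbitrary: n)
  case 0
  then show ?case by (auto simp: dunit_def dconv_def)
next
  case (Suc N)
  let ?E = "dexp (k N) (f N)" and ?D = "dmoll f k N"
  let ?S = "\<lambda>n. \<Sum>i<N. ln (real n) * f i n" and ?l = "\<lambda>n. ln (real n) * f N n"
  have l: "0 \<le> ?l n" if "n > 0" for n using f that by auto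
  have E0: "0 \<le> ?E n" for n using f by (rule dexp_nonneg)
  have D0: "0 \<le> ?D n" for n using f by (rule dmoll_nonneg)
  have S0: "0 \<le> ?S n" for n using f by (cases "n = 0") (auto intro!: sum_nonneg)
  have E: "0 \<le> ln (real n) * ?E n" "ln (real n) * ?E n \<le> dconv ?l ?E n" if n: "n > 0" for n
  proof -
    show "0 \<le> ln (real n) * ?E n" using n E0 by auto
    show "ln (real n) * ?E n \<le> dconv ?l ?E n"
    proof (cases "k N")
      case 0
      then show ?thesis by (simp add: dexp_def dconv_def)
    next
      case (Suc j)
      show ?thesis unfolding Suc ln_dexp[OF n]
        using l f by (intro dconv_mono) (auto simp: dexp_Suc intro!: dexp_nonneg dpow_nonneg divide_nonneg_nonneg)
    qed
  qed
  have "ln (real n) * dmoll f k (Suc N) n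
     = dconv (\<lambda>n. ln (real n) * ?E n) ?D n + dconv ?E (\<lambda>n. ln (real n) * ?D n) n"
    by (simp add: ln_dconv)
  also have "\<dots> \<le> dconv (dconv ?l ?E) ?D n + dconv ?E (dconv ?S ?D) n"
    using D0 E0 E Suc.IH
    by (intro add_mono dconv_mono) (auto intro!: mult_nonneg_nonneg)
  also have "\<dots> = dconv ?l (dconv ?E ?D) n + dconv ?S (dconv ?E ?D) n"
    by (simp add: dconv_assoc dconv_left_commute[of ?E])
  also have "\<dots> = dconv (\<lambda>n. \<Sum>i<Suc N. ln (real n) * f i n) (dmoll f k (Suc N)) n"
    by (simp add: dconv_add_left add.commute)
  finally show ?case .
qed

lemma dmoll_le_1:
  assumes f: "\<And>i n. 0 \<le> f i n" and F: "\<And>n. n > 0 \<Longrightarrow> (\<Sum>i<N. ln (real n) * f i n) \<le> mangoldt n"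
    and f1: "\<And>i. f i 1 = 0"
  shows "n > 0 \<Longrightarrow> dmoll f k N n \<le> 1"
proof (induction n rule: less_induct)
  case (less n)
  show ?case
  proof (cases "n = 1")
    case True
    have "dmoll f k N 1 \<le> 1"
    proof (induction N)
      case (Suc N)
      have "dexp (k N) (f N) 1 \<le> 1"
        by (cases "k N > 0") (use dexp_1 f1 in \<open>auto simp: dexp_def\<close>)
      then show ?case using Suc dexp_nonneg[of "f N" "k N" 1] dmoll_nonneg[of f k N 1] f
        by (auto intro!: mult_le_one)
    qed (simp add: dunit_def)
    then show ?thesis using True by simp
  next
    case False
    with less.prems have n: "n > 1" by simp
    have "ln (real n) * dmoll f k N n \<le> (\<Sum>d | d dvd n. (\<Sum>i<N. ln (real d) * f i d) * dmoll f k N (n div d))"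
      using ln_dmoll_le[of f n k N] f less.prems by (simp add: dconv_def)
    also have "\<dots> \<le> (\<Sum>d | d dvd n. mangoldt d)"
    proof (intro sum_mono)
      fix d assume d: "d \<in> {d. d dvd n}"
      then have d0: "d > 0" using n by (auto intro: Nat.gr0I)
      show "(\<Sum>i<N. ln (real d) * f i d) * dmoll f k N (n div d) \<le> mangoldt d"
      proof (cases "d = 1")
        case False
        have "n div d < n" "n div d > 0" using d d0 False n by (auto simp: div_greater_zero_iff dvd_imp_le)
        then have "(\<Sum>i<N. ln (real d) * f i d) * dmoll f k N (n div d) \<le> (\<Sum>i<N. ln (real d) * f i d) * 1"
          using f d0 less.IH by (intro mult_left_mono sum_nonneg) auto
        then show ?thesis using F[OF d0] by simp
      qed (use F[of 1] in simp)
    qed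
    also have "\<dots> = ln (real n)" using n by (subst mangoldt_sum) auto
    finally show ?thesis using n by (simp add: mult_le_cancel_left1)
  qed
qed

text \<open>Below the threshold \<open>Z\<close> the truncation of the exponentials is invisible, so that the product
  satisfies the differential equation of the exponential of \<open>\<Sum>i<N. f i\<close>.\<close>

lemma ln_dmoll_eq:
  assumes f: "\<And>i n. n < b i \<Longrightarrow> f i n = 0" and b: "\<And>i. i < N \<Longrightarrow> Z \<le> b i ^ k i" and k: "\<And>i. k i > 0"
    and n: "n > 0" "n < Z"
  shows "ln (real n) * dmoll f k N n = dconv (\<lambda>n. \<Sum>i<N. ln (real n) * f i n) (dmoll f k N) n"
  using n b
proof (induction N arbitrary: n)
  case 0
  then show ?case by (auto simp: dunit_def dconv_def)
next
  case (Suc N)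
  let ?E = "dexp (k N) (f N)" and ?D = "dmoll f k N"
  let ?S = "\<lambda>n. \<Sum>i<N. ln (real n) * f i n" and ?l = "\<lambda>n. ln (real n) * f N n"
  have E: "ln (real n) * ?E n = dconv ?l ?E n" if n: "n > 0" "n < Z" for n
  proof -
    obtain j where j: "k N = Suc j" using k[of N] by (cases "k N") auto
    \<comment> \<open>This is the only term in which the right side of \<open>ln_dexp\<close> falls
      short of a full \<open>?E\<close>. By the power rule it is a multiple of
      \<open>ln n * dpow (f N) (Suc j) n\<close>, and that power is supported on integers from
      \<open>b N ^ Suc j \<ge> Z\<close> on.\<close>
    have "dconv ?l (dpow (f N) j) n = 0"
    proof -
      have "n < b N ^ Suc j" using n Suc.prems(3)[of N] j by auto
      then have "dpow (f N) (Suc j) n = 0" using f by (intro dpow_eq_0_below[of "b N"]) auto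
      then show ?thesis using ln_dpow[of n "f N" j] by (simp del: dpow.simps)
    qed
    moreover have "dconv ?l ?E n = dconv ?l (dexp j (f N)) n + (1 / fact j) * dconv ?l (dpow (f N) j) n"
      unfolding j dconv_cmult[symmetric] dconv_add[symmetric]
      by (intro dconv_cong) (auto simp: dexp_Suc)
    ultimately show ?thesis unfolding j ln_dexp[OF n(1)] by simp
  qed
  have dv: "d > 0 \<and> d < Z" if "d dvd n" for d
    using that Suc.prems(1,2) by (auto intro: Nat.gr0I dest: dvd_imp_le)
  have "ln (real n) * dmoll f k (Suc N) n
     = dconv (\<lambda>n. ln (real n) * ?E n) ?D n + dconv ?E (\<lambda>n. ln (real n) * ?D n) n"
    by (simp add: ln_dconv)
  also have "\<dots> = dconv (dconv ?l ?E) ?D n + dconv ?E (dconv ?S ?D) n"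
    by (intro arg_cong2[of _ _ _ _ "(+)"] dconv_cong) (use dv E Suc.IH Suc.prems in auto)
  also have "\<dots> = dconv ?l (dconv ?E ?D) n + dconv ?S (dconv ?E ?D) n"
    by (simp add: dconv_assoc dconv_left_commute[of ?E])
  also have "\<dots> = dconv (\<lambda>n. \<Sum>i<Suc N. ln (real n) * f i n) (dmoll f k (Suc N)) n"
    by (simp add: dconv_add_left add.commute)
  finally show ?case .
qed

text \<open>The derivation applied to 1 gives \<open>mangoldt\<close> convolved with 1, and applied
  to the mollifier it gives, below \<open>Z\<close>, minus \<open>mangoldt\<close> convolved with
  the mollifier. In the product zeta times mollifier the two cancel, and \<open>ln n\<close> is
  nonzero for n > 1.\<close>

lemma dconv_one_dmoll_eq_0:
  assumes f: "\<And>i n. n < b i \<Longrightarrow> f i n = 0" and b: "\<And>i. i < N \<Longrightarrow> Z \<le> b i ^ k i" and k: "\<And>i. k i > 0"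
    and F: "\<And>n. n > 0 \<Longrightarrow> n < Z \<Longrightarrow> (\<Sum>i<N. ln (real n) * f i n) = - mangoldt n"
    and n: "n > 1" "n < Z"
  shows "dconv (\<lambda>_. 1) (dmoll f k N) n = 0"
proof -
  let ?D = "dmoll f k N"
  let ?S = "\<lambda>n. \<Sum>i<N. ln (real n) * f i n"
  have dv: "d > 0 \<and> d < Z" if "d dvd n" for d
    using that n by (auto intro: Nat.gr0I dest: dvd_imp_le)
  have "ln (real n) * dconv (\<lambda>_. 1) ?D n
     = dconv (\<lambda>n. ln (real n) * 1) ?D n + dconv (\<lambda>_. 1) (\<lambda>n. ln (real n) * ?D n) n"
    by (simp add: ln_dconv)
  also have "dconv (\<lambda>n. ln (real n) * 1) ?D n = dconv (dconv mangoldt (\<lambda>_. 1)) ?D n"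
  proof (intro dconv_cong refl)
    fix d assume "d dvd n"
    then show "ln (real d) * 1 = dconv mangoldt (\<lambda>_. 1) d"
      using dv[of d] by (simp add: dconv_def mangoldt_sum)
  qed
  also have "dconv (\<lambda>_. 1) (\<lambda>n. ln (real n) * ?D n) n = dconv (\<lambda>_. 1) (dconv (\<lambda>n. -1 * mangoldt n) ?D) n"
  proof (intro dconv_cong refl)
    fix d assume d: "d dvd n"
    have "ln (real d) * ?D d = dconv ?S ?D d"
      using dv[OF d] by (intro ln_dmoll_eq[of b f N Z k] f b k) auto
    also have "\<dots> = dconv (\<lambda>n. -1 * mangoldt n) ?D d"
    proof (intro dconv_cong refl)
      fix e assume "e dvd d"
      then show "?S e = -1 * mangoldt e" using F[of e] dv[of e] d dvd_trans by auto
    qed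
    finally show "ln (real d) * ?D d = dconv (\<lambda>n. -1 * mangoldt n) ?D d" .
  qed
  also have "\<dots> = dconv (\<lambda>_. 1) (dconv ?D (\<lambda>n. -1 * mangoldt n)) n"
    by (simp only: dconv_commute)
  also have "\<dots> = - dconv (dconv mangoldt (\<lambda>_. 1)) ?D n"
    unfolding dconv_assoc[symmetric] dconv_cmult
    by (simp only: dconv_commute[of ?D] dconv_assoc dconv_left_commute[of mangoldt])
  finally show ?thesis using n by simp
qed

section \<open>Dirichlet polynomials with convolved coefficients, and the remainder of the
  exponential series\<close>

lemma dser_mono:
  assumes "N \<le> M" "\<And>n. n > N \<Longrightarrow> f n = 0"
  shows "dser f N s = dser f M s"
  unfolding dser_def using assms by (intro sum.mono_neutral_left) auto

lemma dser_mult: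
  assumes f: "\<And>n. n > N \<Longrightarrow> f n = 0" and g: "\<And>n. n > M \<Longrightarrow> g n = 0"
  shows "dser f N s * dser g M s = dser (dconv f g) (N * M) s"
proof -
  let ?F = "\<lambda>(a, b). of_real (f a * g b) * of_nat (a * b) powr (-s)"
  have "dser f N s * dser g M s = (\<Sum>p\<in>{1..N}\<times>{1..M}. ?F p)"
    unfolding dser_def sum_product sum.cartesian_product
    using powr_times_real[of "real _" "real _"]
    by (intro sum.cong) (auto simp: powr_times_real)
  also have "\<dots> = (\<Sum>p\<in>(\<Union>n\<in>{1..N*M}. {(a, b). a * b = n}). ?F p)"
  proof (rule sum.mono_neutral_left)
    show "finite (\<Union>n\<in>{1..N*M}. {(a, b). a * b = n})" by (auto intro!: finite_mult_eq)
    show "{1..N} \<times> {1..M} \<subseteq> (\<Union>n\<in>{1..N*M}. {(a, b). a * b = n})"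
      by (auto simp: Suc_le_eq intro!: mult_le_mono)
    show "\<forall>p\<in>(\<Union>n\<in>{1..N*M}. {(a, b). a * b = n}) - {1..N} \<times> {1..M}. ?F p = 0"
      using f g by (auto simp: Suc_le_eq not_le) (meson not_le)+
  qed
  also have "\<dots> = (\<Sum>n\<in>{1..N*M}. \<Sum>p\<in>{(a, b). a * b = n}. ?F p)"
    by (subst sum.UNION_disjoint) (auto intro!: finite_mult_eq)
  also have "\<dots> = dser (dconv f g) (N * M) s"
    unfolding dser_def
    by (intro sum.cong refl)
       (auto simp: dconv_pairs sum_distrib_right case_prod_unfold simp flip: of_nat_mult intro!: sum.cong)
  finally show ?thesis .
qed

lemma dser_dpow:
  assumes "\<And>n. n > b \<Longrightarrow> f n = 0"
  shows "dser (dpow f j) (b ^ j) s = dser f b s ^ j"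
proof (induction j)
  case 0
  then show ?case by (simp add: dser_def dunit_def)
next
  case (Suc j)
  show ?case unfolding dpow.simps power_Suc Suc.IH[symmetric]
    by (rule dser_mult[symmetric]) (use assms in \<open>auto intro: dpow_eq_0_above\<close>)
qed

lemma dser_dexp:
  assumes "\<And>n. n > b \<Longrightarrow> f n = 0" "b > 0"
  shows "dser (dexp k f) (b ^ k) s = (\<Sum>j<k. dser f b s ^ j / fact j)"
proof -
  have "dser (dexp k f) (b ^ k) s = (\<Sum>j<k. dser (dpow f j) (b ^ k) s / fact j)"
    unfolding dser_def dexp_def sum_divide_distrib of_real_sum sum_distrib_right
    by (subst sum.swap) simp
  also have "\<dots> = (\<Sum>j<k. dser (dpow f j) (b ^ j) s / fact j)"
    using assms by (intro sum.cong arg_cong2[of _ _ _ _ "(/)"] refl dser_mono[symmetric] power_increasing)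
      (auto intro: dpow_eq_0_above)
  finally show ?thesis using dser_dpow[of b f] assms by simp
qed

lemma dser_dmoll:
  assumes "\<And>i n. n > b i \<Longrightarrow> f i n = 0" "\<And>i. b i > 0"
  shows "dser (dmoll f k N) (\<Prod>i<N. b i ^ k i) s = (\<Prod>i<N. \<Sum>j<k i. dser (f i) (b i) s ^ j / fact j)"
proof (induction N)
  case 0
  then show ?case by (simp add: dser_def dunit_def)
next
  case (Suc N)
  have "dser (dmoll f k (Suc N)) (b N ^ k N * (\<Prod>i<N. b i ^ k i)) s
      = dser (dexp (k N) (f N)) (b N ^ k N) s * dser (dmoll f k N) (\<Prod>i<N. b i ^ k i) s"
    unfolding dmoll.simps
    by (rule dser_mult[symmetric]) (use assms in \<open>auto intro: dexp_eq_0_above dmoll_eq_0_above\<close>)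
  then show ?case using dser_dexp[of "b N" "f N"] Suc.IH assms by (simp add: mult.commute)
qed

text \<open>Since (j + k)! is at least j! k!, the tail is dominated by its leading size |z|^k / k!
  times the full series of exp |z|.\<close>

lemma norm_exp_sub_trunc_le:
  "norm (exp (z::complex) - (\<Sum>j<k. z ^ j / fact j)) \<le> norm z ^ k / fact k * exp (norm z)"
proof -
  have S: "(\<lambda>j. z ^ j / fact j) sums exp z"
    using exp_converges[of z] by (simp add: scaleR_conv_of_real field_simps)
  have s: "summable (\<lambda>j. norm z ^ j / fact j)"
    using summable_exp[of "norm z"] by (simp add: field_simps)
  have "exp z - (\<Sum>j<k. z ^ j / fact j) = (\<Sum>j. z ^ (j + k) / fact (j + k))"
    using suminf_minus_initial_segment[of "\<lambda>j. z ^ j / fact j" k] S by (simp add: sums_iff)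
  also have "norm \<dots> \<le> (\<Sum>j. norm z ^ k / fact k * (norm z ^ j / fact j))"
  proof (rule norm_suminf_le)
    fix j
    have "(fact k * fact j :: real) \<le> fact (j + k)"
      by (metis add.commute fact_fact_dvd_fact dvd_imp_le fact_gt_zero of_nat_fact of_nat_le_iff of_nat_mult)
    then show "norm (z ^ (j + k) / fact (j + k)) \<le> norm z ^ k / fact k * (norm z ^ j / fact j)"
      by (simp add: norm_divide norm_power norm_mult power_add frac_le mult.commute)
  qed (intro summable_mult s)
  also have "\<dots> = norm z ^ k / fact k * exp (norm z)"
    using s by (subst suminf_mult) (auto simp: exp_def scaleR_conv_of_real field_simps)
  finally show ?thesis .
qed

section \<open>Zeta and its logarithm\<close>

definition dcount :: "nat \<Rightarrow> real" where
  "dcount n = real (card {d. d dvd n})"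

lemma dcount_nonneg: "0 \<le> dcount n"
  by (simp add: dcount_def)

lemma dcount_ge_1: "n > 0 \<Longrightarrow> 1 \<le> dcount n"
proof -
  assume n: "n > 0"
  then have "card {1::nat} \<le> card {d. d dvd n}" by (intro card_mono) auto
  then show ?thesis by (simp add: dcount_def)
qed

text \<open>A pair of divisors \<open>a, b\<close> of \<open>n\<close> yields the factorisation of \<open>n\<close> into the four factors
  \<open>gcd a b\<close>, \<open>a / gcd a b\<close>, \<open>b / gcd a b\<close>, \<open>n / lcm a b\<close>, from which it can be recovered.\<close>

lemma sum_dcount_sq_le:
  "(\<Sum>n=1..X. dcount n ^ 2 * real n powr (-w)) \<le> (\<Sum>n=1..X. real n powr (-w)) ^ 4"
proof -
  let ?D = "\<lambda>n::nat. {d. d dvd n}" and ?U = "{1..X}"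
  let ?S = "SIGMA n:?U. ?D n \<times> ?D n"
  define \<psi> where "\<psi> = (\<lambda>(g::nat, a::nat, b::nat, r::nat). (g * a * b * r, g * a, g * b))"
  define \<phi> where "\<phi> = (\<lambda>(n::nat, a::nat, b::nat). (gcd a b, a div gcd a b, b div gcd a b, n div lcm a b))"
  define F where "F = (\<lambda>(g::nat, a::nat, b::nat, r::nat). real (g * a * b * r) powr (-w))"
  have inv: "\<psi> (\<phi> x) = x \<and> F (\<phi> x) = real (fst x) powr (-w) \<and> \<phi> x \<in> ?U \<times> ?U \<times> ?U \<times> ?U" if "x \<in> ?S" for x
  proof -
    obtain n a b where x: "x = (n, a, b)" by (cases x)
    have n: "n \<in> ?U" and a: "a dvd n" and b: "b dvd n" using that x by auto
    have pos: "a > 0" "b > 0" using a b n by (auto intro: Nat.gr0I)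
    have l: "lcm a b dvd n" using a b by simp
    have l2: "gcd a b * (a div gcd a b) * (b div gcd a b) = lcm a b"
      by (simp add: lcm_nat_def div_mult_swap mult.commute)
    have e: "gcd a b * (a div gcd a b) * (b div gcd a b) * (n div lcm a b) = n"
      unfolding l2 using l by simp
    have dv: "d \<in> ?U" if "d dvd n" for d using that n by (auto intro: Nat.gr0I dest: dvd_imp_le simp: Suc_le_eq)
    have "gcd a b dvd n" using a by (meson dvd_trans gcd_dvd1)
    moreover have "a div gcd a b dvd n" "b div gcd a b dvd n" "n div lcm a b dvd n"
      by (metis dvd_mult2 dvd_triv_left dvd_triv_right e)+
    ultimately have "\<phi> x \<in> ?U \<times> ?U \<times> ?U \<times> ?U" unfolding x \<phi>_def using dv by (simp del: atLeastAtMost_iff)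
    moreover have "\<psi> (\<phi> x) = x" unfolding x \<phi>_def \<psi>_def prod.case e by simp
    moreover have "F (\<phi> x) = real (fst x) powr (-w)" unfolding x \<phi>_def F_def prod.case e by simp
    ultimately show ?thesis by blast
  qed
  have fin: "finite (?D n)" if "n \<in> ?U" for n using that by auto
  have "(\<Sum>n=1..X. dcount n ^ 2 * real n powr (-w)) = (\<Sum>n\<in>?U. \<Sum>p\<in>?D n \<times> ?D n. real n powr (-w))"
    by (simp add: dcount_def card_cartesian_product power2_eq_square)
  also have "\<dots> = (\<Sum>x\<in>?S. real (fst x) powr (-w))"
    using fin by (subst sum.Sigma) (auto simp: case_prod_unfold)
  also have "\<dots> = (\<Sum>x\<in>?S. F (\<phi> x))" using inv by (intro sum.cong) auto
  also have "\<dots> = (\<Sum>q\<in>\<phi> ` ?S. F q)"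
    using inv by (subst sum.reindex) (auto intro: inj_on_inverseI[of _ \<psi>])
  also have "\<dots> \<le> (\<Sum>q\<in>?U \<times> ?U \<times> ?U \<times> ?U. F q)"
  proof (rule sum_mono2)
    show "\<phi> ` ?S \<subseteq> ?U \<times> ?U \<times> ?U \<times> ?U" using inv by (intro image_subsetI) blast
    show "0 \<le> F q" for q by (simp add: F_def split: prod.split)
  qed simp
  also have "\<dots> = (\<Sum>n=1..X. real n powr (-w)) ^ 4"
    by (simp add: F_def powr_mult sum.cartesian_product[symmetric] sum_distrib_left[symmetric]
        sum_distrib_right[symmetric] mult.assoc numeral_eq_Suc)
  finally show ?thesis .
qed

lemma summable_nat_powr: "w > 1 \<Longrightarrow> summable (\<lambda>n. real n powr (-w))"
  using summable_real_powr_iff[of "-w"] by simp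

lemma sum_nat_powr_le: "w > 1 \<Longrightarrow> finite A \<Longrightarrow> (\<Sum>n\<in>A. real n powr (-w)) \<le> (\<Sum>n. real n powr (-w))"
  by (intro sum_le_suminf summable_nat_powr) auto

lemma summable_dcount_sq: 
  assumes "w > 1" shows "summable (\<lambda>n. dcount n ^ 2 * real n powr (-w))"
proof -
  have "summable (\<lambda>n. dcount (Suc n) ^ 2 * real (Suc n) powr (-w))"
  proof (rule summableI_nonneg_bounded)
    fix n
    have "(\<Sum>i<n. dcount (Suc i) ^ 2 * real (Suc i) powr (-w)) = (\<Sum>n=1..n. dcount n ^ 2 * real n powr (-w))"
      by (rule sum.reindex_bij_witness[of _ "\<lambda>n. n - 1" Suc]) auto
    also have "\<dots> \<le> (\<Sum>n. real n powr (-w)) ^ 4"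
      by (intro order_trans[OF sum_dcount_sq_le] power_mono sum_nat_powr_le assms sum_nonneg) auto
    finally show "(\<Sum>i<n. dcount (Suc i) ^ 2 * real (Suc i) powr (-w)) \<le> (\<Sum>n. real n powr (-w)) ^ 4" .
  qed auto
  then show ?thesis by (subst (asm) summable_Suc_iff)
qed

lemma abs_dconv_le_dcount:
  assumes "\<And>n. \<bar>f n\<bar> \<le> 1" "\<And>n. \<bar>g n\<bar> \<le> 1"
  shows "\<bar>dconv f g n\<bar> \<le> dcount n"
proof -
  have "\<bar>dconv f g n\<bar> \<le> (\<Sum>d | d dvd n. 1 * 1)"
    unfolding dconv_def using assms
    by (intro order_trans[OF sum_abs] sum_mono) (auto simp: abs_mult intro!: mult_le_one)
  then show ?thesis by (simp add: dcount_def)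
qed

text \<open>The coefficients of the Dirichlet series of log zeta: 1 / k at the k-th power of a
  prime, 0 elsewhere.\<close>

definition lam :: "nat \<Rightarrow> real" where
  "lam n = mangoldt n / ln (real n)"

lemma mangoldt_le_ln: "n > 0 \<Longrightarrow> mangoldt n \<le> ln (real n)"
proof -
  assume n: "n > 0"
  have "mangoldt n \<le> (\<Sum>d | d dvd n. mangoldt d :: real)"
    using n by (intro member_le_sum) (auto simp: mangoldt_nonneg)
  then show ?thesis using n by (simp add: mangoldt_sum)
qed

lemma lam_nonneg: "0 \<le> lam n"
  by (cases "n = 0") (auto simp: lam_def mangoldt_nonneg)

lemma lam_le_1: "lam n \<le> 1"
  using mangoldt_le_ln[of n] by (cases "n \<le> 1") (auto simp: lam_def divide_le_eq le_Suc_eq)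

lemma lam_0 [simp]: "lam 0 = 0" "lam (Suc 0) = 0"
  by (auto simp: lam_def)

lemma ln_lam: "ln (real n) * lam n = mangoldt n"
  by (cases "n \<le> 1") (auto simp: lam_def le_Suc_eq)

definition Lser :: "complex \<Rightarrow> complex" where
  "Lser s = (\<Sum>n. mangoldt n * of_nat n powr (-s) / of_real (ln (real n)))"

lemma Lser_term: "mangoldt n * of_nat n powr (-s) / complex_of_real (ln (real n)) = of_real (lam n) * of_nat n powr (-s)"
  by (simp add: lam_def mangoldt_def)

lemma norm_Lser_term_le:
  assumes "a \<le> Re s" shows "norm (of_real (lam n) * of_nat n powr (-s)) \<le> real n powr (-a)"
proof (cases "n = 0")
  case False
  have "norm (of_real (lam n) * complex_of_nat n powr (-s)) = lam n * real n powr (- Re s)"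
    using False lam_nonneg by (simp add: norm_mult norm_powr_real_powr)
  also have "\<dots> \<le> 1 * real n powr (-a)"
    using False assms lam_le_1 lam_nonneg by (intro mult_mono powr_mono) auto
  finally show ?thesis by simp
qed simp

lemma Lser_sums:
  assumes "Re s > 1" shows "(\<lambda>n. of_real (lam n) * of_nat n powr (-s)) sums Lser s"
proof -
  have "summable (\<lambda>n. of_real (lam n) * complex_of_nat n powr (-s))"
    by (rule summable_comparison_test'[OF summable_nat_powr[OF assms]]) (rule norm_Lser_term_le, simp)
  then show ?thesis unfolding Lser_def Lser_term by (rule summable_sums)
qed

lemma continuous_on_Lser: "continuous_on {s. Re s > 1} Lser"
proof -
  have *: "continuous_on {s. Re s \<ge> a} Lser" if a: "a > 1" for a
  proof (rule uniform_limit_theorem)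
    show "uniform_limit {s. Re s \<ge> a} (\<lambda>N s. \<Sum>n<N. of_real (lam n) * of_nat n powr (-s)) Lser sequentially"
      unfolding Lser_def[abs_def] Lser_term
      by (rule Weierstrass_m_test[OF _ summable_nat_powr[OF a]]) (auto intro: norm_Lser_term_le)
    have "continuous_on {s. Re s \<ge> a} (\<lambda>s. \<Sum>n<N. of_real (lam n) * of_nat n powr (-s))" for N
    proof (intro continuous_on_sum)
      fix n show "continuous_on {s. Re s \<ge> a} (\<lambda>s. of_real (lam n) * of_nat n powr (-s))"
        by (cases "n = 0") (auto intro!: continuous_intros)
    qed
    then show "\<forall>\<^sub>F N in sequentially. continuous_on {s. Re s \<ge> a} (\<lambda>s. \<Sum>n<N. of_real (lam n) * of_nat n powr (-s))"
      by simp
  qed auto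
  show ?thesis
  proof (rule continuous_on_eq_continuous_at[THEN iffD2, OF open_halfspace_Re_gt], safe)
    fix s assume s: "1 < Re s"
    have "continuous_on {z. Re z > (1 + Re s) / 2} Lser"
      by (rule continuous_on_subset[OF *[of "(1 + Re s) / 2"]]) (use s in auto)
    then show "isCont Lser s" using s
      by (subst (asm) continuous_on_eq_continuous_at[OF open_halfspace_Re_gt]) auto
  qed
qed

lemma zeta_sums: "Re s > 1 \<Longrightarrow> (\<lambda>n. of_nat (Suc n) powr (-s)) sums zeta s"
proof -
  assume s: "Re s > 1"
  have "summable (\<lambda>n. complex_of_nat (Suc n) powr (-s))"
  proof (rule summable_comparison_test')
    show "summable (\<lambda>n. real (Suc n) powr (- Re s))"
      using summable_nat_powr[OF s] by (subst summable_Suc_iff)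
    show "norm (complex_of_nat (Suc n) powr (-s)) \<le> real (Suc n) powr (- Re s)" for n
      using norm_powr_real_powr[of "of_nat (Suc n)" "-s"] by simp
  qed
  then show ?thesis using zeta_continuation_zeta s
    by (simp add: zeta_continuation_def summable_sums)
qed

text \<open>Obtained from the mollifier with a single block \<open>{2..Y}\<close> and degree
  \<open>Y\<close> rather than from an Euler product: zeta times the truncated exponential differs
  from 1 by at most a tail of a convergent divisor sum, while the truncated exponential tends to exp
  (- Lser s) as Y grows.\<close>

lemma exp_Lser:
  assumes s: "Re s > 1" shows "exp (Lser s) = zeta s"
proof -
  define x where "x = Re s"
  define f where "f = (\<lambda>Y n. if n \<le> Y then - lam n else 0)"
  define P where "P = (\<lambda>Y. \<Sum>n\<in>{1..Y}. of_real (lam n) * of_nat n powr (-s))"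
  define M where "M = (\<lambda>Y. \<Sum>j<Y. (- P Y) ^ j / fact j)"
  define g where "g = (\<lambda>n. dcount n ^ 2 * real n powr (-x))"
  have sg: "summable g" unfolding g_def by (rule summable_dcount_sq) (use s x_def in simp)
  have g0: "0 \<le> g n" for n by (simp add: g_def)
  define R where "R = (\<lambda>Y. \<Sum>n. g (n + Suc Y))"
  have dserf: "dser (f Y) Y s = - P Y" for Y
    by (simp add: dser_def f_def P_def sum_negf[symmetric])
  have dsum: "dser h N s = (\<Sum>n<N. of_real (h (Suc n)) * of_nat (Suc n) powr (-s))" for h N
    unfolding dser_def by (rule sum.reindex_bij_witness[of _ Suc "\<lambda>n. n - 1"]) auto
  have main: "norm (zeta s * M Y - 1) \<le> R Y" if Y: "Y > 0" for Y
  proof -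
    define D where "D = dmoll (\<lambda>_. f Y) (\<lambda>_. Y) 1"
    have fb: "f Y n = 0" if "n > Y" for n using that by (simp add: f_def)
    have MD: "M Y = dser D (Y ^ Y) s"
      using dser_dmoll[of "\<lambda>_. Y" "\<lambda>_. f Y" "\<lambda>_. Y" 1 s] fb Y by (simp add: D_def M_def dserf)
    have D1: "\<bar>D n\<bar> \<le> 1" for n
    proof (cases "n = 0")
      case True
      then show ?thesis by (simp add: D_def)
    next
      case False
      have "\<bar>D n\<bar> \<le> dmoll (\<lambda>_ n. if n \<le> Y then lam n else 0) (\<lambda>_. Y) 1 n"
        unfolding D_def by (intro abs_dmoll_le) (auto simp: f_def lam_nonneg)
      also have "\<dots> \<le> 1" using False
        by (intro dmoll_le_1) (auto simp: lam_nonneg ln_lam mangoldt_nonneg)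
      finally show ?thesis .
    qed
    have D0: "D n = 0" if "n > Y ^ Y" for n
      unfolding D_def using that Y fb by (intro dmoll_eq_0_above[of "\<lambda>_. Y"]) auto
    have D11: "D 1 = 1" unfolding D_def using Y by (intro dmoll_1) (auto simp: f_def)
    have van: "dconv (\<lambda>_. 1) D n = 0" if "1 < n" "n < Suc Y" for n
      unfolding D_def
    \<comment> \<open>The support of \<open>f Y\<close> starts at 2, so degree \<open>Y\<close>
      hides the truncation up to 2 ^ Y, which exceeds Y.\<close>
    proof (rule dconv_one_dmoll_eq_0[of "\<lambda>_. 2" _ _ "Suc Y"])
      show "Suc Y \<le> 2 ^ Y" using less_exp[of Y] by (rule Suc_leI)
      show "n < 2 \<Longrightarrow> f Y n = 0" for n by (auto simp: f_def less_2_cases_iff)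
    qed (use that Y in \<open>auto simp: f_def ln_lam\<close>)
    have "norm (dser (\<lambda>n. if n \<le> N then 1 else 0) N s * M Y - 1) \<le> R Y" if N: "N > Y" for N
    proof -
      define o1 where "o1 = (\<lambda>n. if n \<le> N then 1 else (0::real))"
      define K where "K = N * Y ^ Y"
      have K: "K \<ge> 1" using N Y by (simp add: K_def Suc_le_eq)
      define c where "c = dconv o1 D"
      have c1: "c 1 = 1" using D11 N by (simp add: c_def o1_def)
      have cv: "c n = 0" if "1 < n" "n \<le> Y" for n
      proof -
        have "c n = dconv (\<lambda>_. 1) D n" unfolding c_def
          using that N by (intro dconv_cong) (auto simp: o1_def dest: dvd_imp_le)
        then show ?thesis using van that by simp
      qed
      have "dser o1 N s * M Y = dser c K s"
        unfolding MD c_def K_def by (rule dser_mult) (auto simp: o1_def D0)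
      also have "\<dots> = (\<Sum>n\<in>{1..K}. of_real (c n) * of_nat n powr (-s))" by (simp add: dser_def)
      also have "{1..K} = insert 1 {2..K}" using K by auto
      also have "(\<Sum>n\<in>\<dots>. of_real (c n) * of_nat n powr (-s)) = 1 + (\<Sum>n\<in>{2..K}. of_real (c n) * of_nat n powr (-s))"
        using c1 by simp
      finally have "norm (dser o1 N s * M Y - 1) = norm (\<Sum>n\<in>{2..K}. of_real (c n) * of_nat n powr (-s))" by simp
      also have "\<dots> = norm (\<Sum>n\<in>{Suc Y..K}. of_real (c n) * of_nat n powr (-s))"
        using cv Y by (intro arg_cong[of _ _ norm] sum.mono_neutral_right) auto
      also have "\<dots> \<le> (\<Sum>n\<in>{Suc Y..K}. g n)"
      proof (intro sum_norm_le)
        fix n assume n: "n \<in> {Suc Y..K}"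
        have "norm (of_real (c n) * of_nat n powr (-s)) = \<bar>c n\<bar> * real n powr (-x)"
          using n by (simp add: norm_mult norm_powr_real_powr x_def)
        \<comment> \<open>The square is a harmless loss that allows the summability of
          \<open>dcount n ^ 2\<close> to be used.\<close>
        also have "\<dots> \<le> dcount n ^ 2 * real n powr (-x)"
        proof (intro mult_right_mono)
          have "\<bar>c n\<bar> \<le> dcount n" unfolding c_def
            by (intro abs_dconv_le_dcount D1) (auto simp: o1_def)
          also have "\<dots> \<le> dcount n ^ 2" using n dcount_ge_1[of n]
            by (simp add: power2_eq_square)
          finally show "\<bar>c n\<bar> \<le> dcount n ^ 2" .
        qed auto
        finally show "norm (of_real (c n) * of_nat n powr (-s)) \<le> g n" by (simp add: g_def)
      qed
      also have "\<dots> = (\<Sum>n<Suc K - Suc Y. g (n + Suc Y))"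
        by (rule sum.reindex_bij_witness[of _ "\<lambda>n. n + Suc Y" "\<lambda>n. n - Suc Y"]) auto
      also have "\<dots> \<le> R Y" unfolding R_def
        using sg g0 by (intro sum_le_suminf) (auto simp: summable_iff_shift simp del: add_Suc_right)
      finally show ?thesis by (simp add: o1_def)
    qed
    moreover have "(\<lambda>N. norm (dser (\<lambda>n. if n \<le> N then 1 else 0) N s * M Y - 1)) \<longlonglongrightarrow> norm (zeta s * M Y - 1)"
    proof -
      have "dser (\<lambda>n. if n \<le> N then 1 else 0) N s = (\<Sum>n<N. of_nat (Suc n) powr (-s))" for N
        unfolding dsum by (intro sum.cong) auto
      then show ?thesis
        using zeta_sums[OF s] by (auto simp: sums_def intro!: tendsto_intros)
    qed
    ultimately show ?thesis
      by (intro tendsto_upperbound[where F = sequentially]) (auto intro: eventually_sequentiallyI[of "Suc Y"])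
  qed
  have R0: "R \<longlonglongrightarrow> 0" unfolding R_def using suminf_exist_split2[OF sg] by (rule LIMSEQ_Suc)
  have Pl: "P \<longlonglongrightarrow> Lser s"
  proof -
    have "P = (\<lambda>Y. \<Sum>n<Suc Y. of_real (lam n) * of_nat n powr (-s))"
      unfolding P_def by (intro ext sum.mono_neutral_left) auto
    then show ?thesis using LIMSEQ_Suc[OF Lser_sums[OF s, unfolded sums_def]] by (simp only:)
  qed
  then obtain B where B: "norm (P Y) \<le> B" for Y
    by (meson Bseq_def convergentI convergent_imp_Bseq)
  have "(\<lambda>Y. M Y - exp (- P Y)) \<longlonglongrightarrow> 0"
  proof (rule Lim_null_comparison)
    show "\<forall>\<^sub>F Y in sequentially. norm (M Y - exp (- P Y)) \<le> B ^ Y / fact Y * exp B"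
    proof (intro always_eventually allI)
      fix Y
      have "norm (M Y - exp (- P Y)) \<le> norm (P Y) ^ Y / fact Y * exp (norm (P Y))"
        using norm_exp_sub_trunc_le[of "- P Y" Y] by (simp add: M_def norm_minus_commute)
      also have "\<dots> \<le> B ^ Y / fact Y * exp B"
        using B order_trans[OF norm_ge_zero B[of 0]] by (intro mult_mono divide_right_mono power_mono) auto
      finally show "norm (M Y - exp (- P Y)) \<le> B ^ Y / fact Y * exp B" .
    qed
    show "(\<lambda>Y. B ^ Y / fact Y * exp B) \<longlonglongrightarrow> 0"
      using tendsto_mult_left_zero[OF summable_LIMSEQ_zero[OF summable_exp[of B]], of "exp B"]
      by (simp add: field_simps)
  qed
  from tendsto_add[OF this tendsto_exp[OF tendsto_minus[OF Pl]]]
  have "M \<longlonglongrightarrow> exp (- Lser s)" by simp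
  then have "(\<lambda>Y. zeta s * M Y - 1) \<longlonglongrightarrow> zeta s * exp (- Lser s) - 1" by (intro tendsto_intros)
  moreover have "(\<lambda>Y. zeta s * M Y - 1) \<longlonglongrightarrow> 0"
    by (rule Lim_null_comparison[OF _ R0]) (use main in \<open>auto intro: eventually_sequentiallyI[of 1]\<close>)
  ultimately have "zeta s * exp (- Lser s) - 1 = 0" by (rule LIMSEQ_unique)
  then show ?thesis by (simp add: exp_minus field_simps)
qed

text \<open>The difference of two logarithms takes values in the multiples of 2 pi i, a discrete
  set, so it is constant on a connected set.\<close>

lemma exp_eq_unique_on_connected:
  fixes g h :: "'a::topological_space \<Rightarrow> complex"
  assumes "connected S" "continuous_on S g" "continuous_on S h"
    and e: "\<And>x. x \<in> S \<Longrightarrow> exp (g x) = exp (h x)" and a: "a \<in> S" "g a = h a" and x: "x \<in> S"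
  shows "g x = h x"
proof -
  have dc: "continuous_on S (\<lambda>x. g x - h x)" using assms by (intro continuous_intros)
  have "(\<lambda>x. g x - h x) constant_on S"
  proof (rule continuous_discrete_range_constant[OF assms(1) dc])
    fix x assume x: "x \<in> S"
    have "2 * pi \<le> norm ((g y - h y) - (g x - h x))" if y: "y \<in> S" and ne: "g y - h y \<noteq> g x - h x" for y
    proof -
      obtain m n :: int where "g y = h y + of_int (2 * m) * (of_real pi * \<i>)" "g x = h x + of_int (2 * n) * (of_real pi * \<i>)"
        using e[OF x] e[OF y] unfolding exp_eq by auto
      then have *: "(g y - h y) - (g x - h x) = of_int (2 * (m - n)) * (of_real pi * \<i>)"
        by (simp add: algebra_simps)
      then have "m \<noteq> n" using ne by auto
      then have "1 \<le> \<bar>real_of_int (m - n)\<bar>" by linarith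
      then have "2 * 1 * pi \<le> 2 * \<bar>real_of_int (m - n)\<bar> * pi" by simp
      then show ?thesis unfolding * by (simp add: norm_mult abs_mult del: of_int_diff of_int_mult)
    qed
    then show "\<exists>e>0. \<forall>y. y \<in> S \<and> g y - h y \<noteq> g x - h x \<longrightarrow> e \<le> norm ((g y - h y) - (g x - h x))"
      by (intro exI[of _ "2 * pi"]) auto
  qed
  then obtain c where "\<And>x. x \<in> S \<Longrightarrow> g x - h x = c" by (auto simp: constant_on_def)
  with a x show ?thesis by (metis eq_iff_diff_eq_0)
qed

section \<open>Branches of log zeta on horizontal rays: uniqueness, extension, measurability,
  approximation\<close>

lemma log_zeta_branch_unique:
  assumes "log_zeta_branch s g" "log_zeta_branch s h" "x \<ge> Re s"
  shows "g x = h x"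
proof -
  \<comment> \<open>At this abscissa, which exceeds 1, both branches are given by the Dirichlet
    series.\<close>
  define a where "a = max (Re s) 2"
  show ?thesis
    by (rule exp_eq_unique_on_connected[of "{Re s..}" g h a])
       (use assms in \<open>auto simp: log_zeta_branch_def a_def\<close>)
qed

lemma log_zeta_eq_branch: "log_zeta_branch s g \<Longrightarrow> log_zeta s = g (Re s)"
  unfolding log_zeta_def
  by (auto intro!: the_equality dest: log_zeta_branch_unique)

lemma isCont_Complex_line: "continuous_on A (\<lambda>x. Complex x y)"
  unfolding Complex_eq by (intro continuous_intros)

lemma log_zeta_eq_Lser:
  assumes "Re s > 1" shows "log_zeta s = Lser s"
proof -
  have "log_zeta_branch s (\<lambda>x. Lser (Complex x (Im s)))"
    unfolding log_zeta_branch_def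
  proof (intro conjI allI impI)
    show "continuous_on {Re s..} (\<lambda>x. Lser (Complex x (Im s)))"
      by (rule continuous_on_compose2[OF continuous_on_Lser isCont_Complex_line]) (use assms in auto)
  qed (use assms in \<open>auto simp: exp_Lser, auto simp: Lser_def\<close>)
  from log_zeta_eq_branch[OF this] show ?thesis by simp
qed

text \<open>It suffices to control a logarithm on a bounded segment with the right normalisation at
  its end 3: to the right of 1 it must coincide with \<open>Lser\<close>, which then continues it to
  infinity.\<close>

lemma log_zeta_eqI:
  assumes x0: "x0 \<le> 2" and G: "continuous_on {x0..3} G"
    and e: "\<And>x. x \<in> {x0..3} \<Longrightarrow> exp (G x) = zeta (Complex x y)" and G3: "G 3 = Lser (Complex 3 y)"
  shows "log_zeta (Complex x0 y) = G x0"
proof -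
  let ?L = "\<lambda>x. Lser (Complex x y)"
  have cL: "continuous_on {1<..} ?L"
    by (rule continuous_on_compose2[OF continuous_on_Lser isCont_Complex_line]) auto
  \<comment> \<open>The interval is open on the left because \<open>x0\<close> may lie at or below
    1. The endpoint \<open>x0\<close> itself is recovered from \<open>{2..3}\<close> if x0 = 2 and
    by a separate argument if 1 < x0 < 2.\<close>
  have GL: "G x = ?L x" if x: "x \<in> {max x0 1<..3} \<union> {2..3}" for x
  proof (rule exp_eq_unique_on_connected[of "{max x0 1<..3} \<union> {2..3}" G ?L 3])
    show "connected ({max x0 1<..3} \<union> {2..3})" 
    proof (rule connected_Un)
      have "3 \<in> {max x0 1<..3} \<inter> {2..3}" using x0 by auto
      then show "{max x0 1<..3} \<inter> {2..3} \<noteq> {}" by blast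
    qed auto
    show "continuous_on ({max x0 1<..3} \<union> {2..3}) G"
      by (rule continuous_on_subset[OF G]) (use x0 in auto)
    show "continuous_on ({max x0 1<..3} \<union> {2..3}) ?L"
      by (rule continuous_on_subset[OF cL]) auto
    show "exp (G x) = exp (?L x)" if "x \<in> {max x0 1<..3} \<union> {2..3}" for x
      using that x0 e[of x] by (auto simp: exp_Lser)
  qed (use x G3 in auto)
  define g where "g = (\<lambda>x. if x \<le> 3 then G x else ?L x)"
  have "log_zeta_branch (Complex x0 y) g"
    unfolding log_zeta_branch_def
  proof (intro conjI allI impI)
    have "continuous_on ({x0..3} \<union> {3..}) g"
      unfolding g_def
    proof (rule continuous_on_If)
      show "continuous_on {3..} ?L" by (rule continuous_on_subset[OF cL]) auto
    qed (use G G3 in auto)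
    moreover have "{x0..3} \<union> {3..} = {x0..}" using x0 by auto
    ultimately show "continuous_on {Re (Complex x0 y)..} g" by simp
    show "exp (g x) = zeta (Complex x (Im (Complex x0 y)))" if "x \<ge> Re (Complex x0 y)" for x
      using that e[of x] by (auto simp: g_def exp_Lser)
    show "g x = (\<Sum>n. mangoldt n * of_nat n powr (- Complex x (Im (Complex x0 y))) / of_real (ln (real n)))"
      if "x \<ge> Re (Complex x0 y)" "x > 1" for x
    proof -
      have "g x = ?L x"
      proof (cases "x = x0")
        case False
        then show ?thesis using that GL[of x] by (auto simp: g_def)
      next
        case True
        show ?thesis
        proof (cases "x \<ge> 2")
          case False
          then have x1: "1 < x0" "x0 < 2" using that True by auto
          have "G x0 = ?L x0"
          proof (rule exp_eq_unique_on_connected[of "{x0..3}" G ?L 3])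
            show "continuous_on {x0..3} ?L"
              by (rule continuous_on_subset[OF cL]) (use x1 in auto)
          qed (use x1 G G3 e in \<open>auto simp: exp_Lser\<close>)
          then show ?thesis using True x1 by (simp add: g_def)
        qed (use GL[of x] that in \<open>auto simp: g_def\<close>)
      qed
      then show ?thesis by (simp add: Lser_def)
    qed
  qed
  from log_zeta_eq_branch[OF this] show ?thesis using x0 by (simp add: g_def)
qed

lemma zeta_holomorphic: "zeta holomorphic_on ({s. Re s > 0} - {1})"
  using zeta_continuation_zeta by (simp add: zeta_continuation_def)

lemma open_zeta_domain: "open ({s. Re s > 0} - {1})"
  by (intro open_delete open_halfspace_Re_gt)

text \<open>Near a horizontal ray without zeros, the branch of the logarithm on the ray extends to a
  holomorphic logarithm on a rectangle, so that \<open>log_zeta\<close> is continuous across the ray.\<close>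

lemma log_zeta_line_continuous:
  assumes x0: "0 < x0" "x0 \<le> 2"
  defines "O1 \<equiv> {y. \<forall>x\<in>{x0..3}. zeta (Complex x y) \<noteq> 0}"
  shows "open O1" "continuous_on O1 (\<lambda>y. log_zeta (Complex x0 y))"
proof -
  define U where "U = {s \<in> {s. Re s > 0} - {1}. zeta s \<noteq> 0}"
  have cz: "continuous_on ({s. Re s > 0} - {1}) zeta"
    by (rule holomorphic_on_imp_continuous_on[OF zeta_holomorphic])
  have oU: "open U"
  proof -
    have "open (({s. Re s > 0} - {1}) \<inter> zeta -` (- {0}))"
      by (rule continuous_open_preimage[OF cz open_zeta_domain]) auto
    moreover have "U = ({s. Re s > 0} - {1}) \<inter> zeta -` (- {0})" by (auto simp: U_def)
    ultimately show ?thesis by simp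
  qed
  have *: "\<exists>e>0. ball y e \<subseteq> O1 \<and> continuous_on (ball y e) (\<lambda>y. log_zeta (Complex x0 y))" if y: "y \<in> O1" for y
  proof -
    let ?K = "(\<lambda>x. Complex x y) ` {x0..3}"
    have K: "compact ?K" by (intro compact_continuous_image isCont_Complex_line) auto
    have KU: "?K \<subseteq> U"
      using y x0 zeta_eq_0[of 1] by (auto simp: O1_def U_def)
    obtain e where e: "e > 0" "(\<Union>z\<in>?K. ball z e) \<subseteq> U"
      using compact_subset_open_imp_ball_epsilon_subset[OF K oU KU] .
    \<comment> \<open>A margin of \<open>e / 2\<close> in each direction keeps every point of
      \<open>R\<close> within distance \<open>e\<close> of the segment, as the norm is at most the
      sum of the two coordinates.\<close>
    define R where "R = {z. x0 - e / 2 < Re z} \<inter> {z. Re z < 3 + e / 2} \<inter> {z. y - e / 2 < Im z} \<inter> {z. Im z < y + e / 2}"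
    have cR: "convex R" unfolding R_def
      by (intro convex_Int convex_halfspace_Re_gt convex_halfspace_Re_lt convex_halfspace_Im_gt convex_halfspace_Im_lt)
    have RU: "R \<subseteq> U"
    proof
      fix z assume z: "z \<in> R"
      define x where "x = max x0 (min 3 (Re z))"
      have xx: "\<bar>x - Re z\<bar> < e / 2"
        using z e(1) x0 unfolding R_def x_def by (auto simp: max_def min_def abs_if)
      have "norm (Complex x y - z) \<le> \<bar>x - Re z\<bar> + \<bar>y - Im z\<bar>"
        using cmod_le[of "Complex x y - z"] by simp
      also have "\<dots> < e"
      proof -
        have "\<bar>y - Im z\<bar> < e / 2" using z unfolding R_def by (auto simp: abs_if)
        with xx show ?thesis by linarith
      qed
      finally have "z \<in> ball (Complex x y) e" by (simp add: dist_norm)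
      moreover have "x \<in> {x0..3}" using x0 by (auto simp: x_def)
      ultimately show "z \<in> U" using e(2) by blast
    qed
    have "zeta holomorphic_on R"
      by (rule holomorphic_on_subset[OF zeta_holomorphic]) (use RU in \<open>auto simp: U_def\<close>)
    then obtain g0 where g0: "g0 holomorphic_on R" "\<And>z. z \<in> R \<Longrightarrow> zeta z = exp (g0 z)"
      using contractible_imp_holomorphic_log[OF _ convex_imp_contractible[OF cR]] RU U_def
      by (smt (verit) mem_Collect_eq subsetD)
    define z1 where "z1 = Complex 3 y"
    have z1: "z1 \<in> R" using x0 e by (auto simp: z1_def R_def)
    \<comment> \<open>The added constant is a multiple of 2 pi i, so \<open>g\<close> is still a
      logarithm, and it now agrees with \<open>Lser\<close> at abscissa 3.\<close>
    define g where "g = (\<lambda>z. g0 z + (Lser z1 - g0 z1))"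
    have "exp (Lser z1 - g0 z1) = 1"
      using g0(2)[OF z1] exp_Lser[of z1] by (simp add: exp_diff z1_def)
    then have ge: "exp (g z) = zeta z" if "z \<in> R" for z
      using g0(2)[OF that] by (simp add: g_def exp_add)
    have cg: "continuous_on R g" unfolding g_def
      using holomorphic_on_imp_continuous_on[OF g0(1)] by (intro continuous_intros)
    have gL: "g z = Lser z" if z: "z \<in> R" "Re z > 1" for z
    proof (rule exp_eq_unique_on_connected[of "R \<inter> {z. Re z > 1}" g Lser z1])
      show "connected (R \<inter> {z. Re z > 1})"
        by (intro convex_connected convex_Int cR convex_halfspace_Re_gt)
      show "continuous_on (R \<inter> {z. Re z > 1}) g" by (rule continuous_on_subset[OF cg]) auto
      show "continuous_on (R \<inter> {z. Re z > 1}) Lser" by (rule continuous_on_subset[OF continuous_on_Lser]) auto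
    qed (use z z1 ge in \<open>auto simp: exp_Lser z1_def g_def\<close>)
    have inR: "Complex x t \<in> R" if "t \<in> ball y (e / 2)" "x \<in> {x0..3}" for t x
    proof -
      have "\<bar>y - t\<bar> < e / 2" "x0 \<le> x" "x \<le> 3" using that by (auto simp: dist_real_def)
      then show ?thesis using e(1) unfolding R_def by (auto simp: abs_if split: if_splits)
    qed
    have lz: "log_zeta (Complex x0 t) = g (Complex x0 t)" if t: "t \<in> ball y (e / 2)" for t
    proof (rule log_zeta_eqI[OF x0(2)])
      show "continuous_on {x0..3} (\<lambda>x. g (Complex x t))"
        by (rule continuous_on_compose2[OF cg isCont_Complex_line]) (use inR[OF t] in auto)
    qed (use inR[OF t] ge gL x0 in auto)
    have "continuous_on (ball y (e / 2)) (\<lambda>t. g (Complex x0 t))"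
    proof (rule continuous_on_compose2[OF cg])
      show "continuous_on (ball y (e / 2)) (\<lambda>t. Complex x0 t)" unfolding Complex_eq by (intro continuous_intros)
    qed (use inR x0 in auto)
    then have "continuous_on (ball y (e / 2)) (\<lambda>t. log_zeta (Complex x0 t))"
      using lz by (subst continuous_on_cong[OF refl lz])
    moreover have "ball y (e / 2) \<subseteq> O1"
      using inR ge unfolding O1_def by (smt (verit) exp_not_eq_zero mem_Collect_eq subsetI)
    ultimately show ?thesis using e by (intro exI[of _ "e / 2"]) auto
  qed
  show o: "open O1" unfolding open_contains_ball using * by blast
  show "continuous_on O1 (\<lambda>y. log_zeta (Complex x0 y))"
    unfolding continuous_on_eq_continuous_at[OF o]
  proof
    fix y assume "y \<in> O1"
    then obtain e where "e > 0" "continuous_on (ball y e) (\<lambda>y. log_zeta (Complex x0 y))" using * by blast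
    then show "isCont (\<lambda>y. log_zeta (Complex x0 y)) y"
      by (auto simp: continuous_on_eq_continuous_at)
  qed
qed

text \<open>For abscissa at most 2, the function of the ordinate is continuous on the open set
  \<open>O1\<close> of ordinates without zero on the segment, and it has the default value 0
  elsewhere because no branch exists there.\<close>

lemma log_zeta_line_measurable:
  assumes "Re s > 0" shows "(\<lambda>t. log_zeta (s + \<i> * of_real t)) \<in> borel_measurable borel"
proof -
  have "(\<lambda>y. log_zeta (Complex (Re s) y)) \<in> borel_measurable borel"
  proof (cases "Re s \<le> 2")
    case True
    define O1 where "O1 = {y. \<forall>x\<in>{Re s..3}. zeta (Complex x y) \<noteq> 0}"
    note O1 = log_zeta_line_continuous[OF assms True, folded O1_def]
    have "log_zeta (Complex (Re s) y) = 0" if ny: "y \<notin> O1" for y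
    proof -
      obtain x where "x \<in> {Re s..3}" "zeta (Complex x y) = 0" using ny unfolding O1_def by blast
      then have x: "x \<ge> Re s" "zeta (Complex x y) = 0" by auto
      then have "\<not> log_zeta_branch (Complex (Re s) y) g" for g
        unfolding log_zeta_branch_def by (metis complex.sel exp_not_eq_zero)
      then show ?thesis by (simp add: log_zeta_def)
    qed
    then have "(\<lambda>y. log_zeta (Complex (Re s) y)) = (\<lambda>y. if y \<in> O1 then log_zeta (Complex (Re s) y) else 0)" by auto
    also have "\<dots> \<in> borel_measurable borel"
      using O1 by (intro borel_measurable_continuous_on_if) auto
    finally show ?thesis .
  next
    case False
    have "continuous_on UNIV (\<lambda>y. Lser (Complex (Re s) y))"
    proof (rule continuous_on_compose2[OF continuous_on_Lser])
      show "continuous_on UNIV (\<lambda>y. Complex (Re s) y)" unfolding Complex_eq by (intro continuous_intros)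
    qed (use False in auto)
    then show ?thesis using False by (simp add: log_zeta_eq_Lser borel_measurable_continuous_onI)
  qed
  from measurable_compose[OF _ this, of "\<lambda>t. Im s + t"]
  have "(\<lambda>t. log_zeta (Complex (Re s) (Im s + t))) \<in> borel_measurable borel" by simp
  moreover have "Complex (Re s) (Im s + t) = s + \<i> * of_real t" for t by (simp add: complex_eq_iff)
  ultimately show ?thesis by simp
qed

text \<open>\<open>P\<close> approximates the logarithm on the whole horizontal segment as soon as \<open>zeta * exp (- P)\<close> stays
  close to \<open>1\<close>; the normalisation at abscissa \<open>3\<close> excludes multiples of \<open>2 * pi * \<i>\<close>.\<close>

lemma log_zeta_approx_of_quotient:
  assumes x0: "x0 \<le> 2" and P: "continuous_on {x0..3} P" and Z: "continuous_on {x0..3} (\<lambda>x. zeta (Complex x y))"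
    and F: "\<And>x. x \<in> {x0..3} \<Longrightarrow> norm (zeta (Complex x y) * exp (- P x) - 1) \<le> \<eta>" and \<eta>: "\<eta> < 1 / 2"
    and P3: "norm (Lser (Complex 3 y) - P 3) < 1"
  shows "norm (log_zeta (Complex x0 y) - P x0) \<le> 2 * \<eta>"
proof -
  define F where "F = (\<lambda>x. zeta (Complex x y) * exp (- P x))"
  have F': "norm (F x - 1) < 1 / 2" if "x \<in> {x0..3}" for x
    using F[OF that] \<eta> by (simp add: F_def)
  have Fpos: "F x \<notin> \<real>\<^sub>\<le>\<^sub>0" "F x \<noteq> 0" if "x \<in> {x0..3}" for x
    using F'[OF that] abs_Re_le_cmod[of "F x - 1"] by (auto simp: complex_nonpos_Reals_iff)
  have e3: "exp (Lser (Complex 3 y) - P 3) = F 3"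
    by (simp add: F_def exp_diff exp_minus exp_Lser divide_inverse)
  have "\<bar>Im (Lser (Complex 3 y) - P 3)\<bar> < 1" using P3 abs_Im_le_cmod[of "Lser (Complex 3 y) - P 3"] by linarith
  then have "Ln (F 3) = Lser (Complex 3 y) - P 3"
    unfolding e3[symmetric] using pi_gt3 by (intro Ln_exp) (auto simp: abs_if split: if_splits)
  then have G3: "P 3 + Ln (F 3) = Lser (Complex 3 y)" by simp
  have "log_zeta (Complex x0 y) = P x0 + Ln (F x0)"
  proof (rule log_zeta_eqI[OF x0, where G = "\<lambda>x. P x + Ln (F x)"])
    have "continuous_on {x0..3} F" unfolding F_def by (intro continuous_intros P Z)
    then show "continuous_on {x0..3} (\<lambda>x. P x + Ln (F x))"
      using Fpos by (intro continuous_intros P) auto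
    show "exp (P x + Ln (F x)) = zeta (Complex x y)" if "x \<in> {x0..3}" for x
      using Fpos[OF that] by (simp add: exp_add exp_minus F_def)
  qed (rule G3)
  moreover have "norm (Ln (F x0)) \<le> 2 * norm (F x0 - 1)"
    using norm_Ln_le[of "F x0 - 1"] F'[of x0] x0 by simp
  ultimately show ?thesis using F[of x0] x0 by (simp add: F_def)
qed

section \<open>Zeta as a Dirichlet polynomial in mean\<close>

text \<open>\<open>zeta\<close> is defined by a description, so a formula in the strip must come
  from uniqueness: the series of Euler-Maclaurin terms plus 1 / (s - 1) is a continuation of the
  Dirichlet series.\<close>

lemma zeta_term_sums:
  assumes "Re s > 0" "s \<noteq> 1" shows "(\<lambda>n. zeta_term n s) sums (zeta s - 1 / (s - 1))"
proof -
  let ?S = "{s. Re s > 0} - {1}"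
  define h where "h = (\<lambda>s. \<Sum>n. zeta_term n s)"
  have sb: "summable (\<lambda>n. c * real (Suc n) powr (- a - 1))" if "a > 0" for a c :: real
    using that summable_real_powr_iff[of "- a - 1"]
    by (intro summable_mult, subst (asm) summable_Suc_iff[symmetric]) auto
  have sz: "summable (\<lambda>n. zeta_term n s)" if "s \<in> ?S" for s
    by (rule summable_comparison_test'[OF sb[of "Re s" "norm s"]]) (use that norm_zeta_term_le[of s] in auto)
  have "h holomorphic_on ?S"
  proof (rule holomorphic_uniform_sequence[OF open_zeta_domain])
    show "(\<lambda>s. \<Sum>i<n. zeta_term i s) holomorphic_on ?S" for n
      unfolding zeta_term_def by (intro holomorphic_intros) auto
  next
    fix x assume "x \<in> ?S"
    then obtain d where d: "d > 0" "cball x d \<subseteq> ?S"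
      using open_zeta_domain open_contains_cball_eq by blast
    have rx: "Re x > 0" using \<open>x \<in> ?S\<close> by simp
    define e where "e = min d (Re x / 2)"
    have e: "e > 0" "cball x e \<subseteq> ?S" using d rx by (auto simp: e_def subset_iff)
    have "uniform_limit (cball x e) (\<lambda>n s. \<Sum>i<n. zeta_term i s) (\<lambda>s. \<Sum>i. zeta_term i s) sequentially"
    proof (rule Weierstrass_m_test)
      fix n s assume s: "s \<in> cball x e"
      have "norm (x - s) \<le> e" using s by (simp add: dist_norm)
      then have *: "Re s \<ge> Re x / 2" "norm s \<le> norm x + e"
        using abs_Re_le_cmod[of "x - s"] norm_triangle_ineq4[of x "x - s"] by (auto simp: e_def)
      have "norm (zeta_term n s) \<le> norm s * real (Suc n) powr (- Re s - 1)"
        using s e by (intro norm_zeta_term_le) auto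
      also have "\<dots> \<le> (norm x + e) * real (Suc n) powr (- (Re x / 2) - 1)"
        using * e(1) by (intro mult_mono powr_mono) auto
      finally show "norm (zeta_term n s) \<le> (norm x + e) * real (Suc n) powr (- (Re x / 2) - 1)" .
    next
      show "summable (\<lambda>n. (norm x + e) * real (Suc n) powr (- (Re x / 2) - 1))"
        using rx by (intro sb) auto
    qed
    then show "\<exists>d>0. cball x d \<subseteq> ?S \<and> uniform_limit (cball x d) (\<lambda>n s. \<Sum>i<n. zeta_term i s) h sequentially"
      using e unfolding h_def by blast
  qed
  moreover have "h s + 1 / (s - 1) = (\<Sum>n. of_nat (Suc n) powr (-s))" if s: "Re s > 1" for s
  proof -
    define a where "a = (\<lambda>n. complex_of_nat (Suc n) powr (1 - s) / (1 - s))"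
    have "s \<noteq> 1" using s by auto
    have "(\<lambda>n. complex_of_nat (Suc n) powr (1 - s)) \<longlonglongrightarrow> 0"
    proof (rule tendsto_norm_zero_cancel)
      have "norm (complex_of_nat (Suc n) powr (1 - s)) = real (Suc n) powr (1 - Re s)" for n
        using norm_powr_real_powr[of "of_nat (Suc n)" "1 - s"] by simp
      moreover have "(\<lambda>n. real (Suc n) powr (1 - Re s)) \<longlonglongrightarrow> 0"
        using s by (intro tendsto_neg_powr filterlim_compose[OF filterlim_real_sequentially filterlim_Suc]) auto
      ultimately show "(\<lambda>n. norm (complex_of_nat (Suc n) powr (1 - s))) \<longlonglongrightarrow> 0" by simp
    qed
    then have "a \<longlonglongrightarrow> 0"
      unfolding a_def using tendsto_divide[of _ 0 _ "\<lambda>_. 1 - s"] \<open>s \<noteq> 1\<close> by fastforce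
    then have "(\<lambda>n. a (Suc n) - a n) sums (0 - a 0)" by (rule telescope_sums)
    moreover have "0 - a 0 = 1 / (s - 1)" using \<open>s \<noteq> 1\<close> by (simp add: a_def field_simps)
    ultimately have "(\<lambda>n. a (Suc n) - a n) sums (1 / (s - 1))" by simp
    then have "(\<lambda>n. zeta_term n s + (a (Suc n) - a n)) sums (h s + 1 / (s - 1))"
      unfolding h_def using s \<open>s \<noteq> 1\<close> by (intro sums_add summable_sums sz) auto
    moreover have "zeta_term n s + (a (Suc n) - a n) = of_nat (Suc n) powr (-s)" for n
      by (simp add: zeta_term_def a_def diff_divide_distrib)
    ultimately show ?thesis by (simp add: sums_unique)
  qed
  ultimately have "zeta_continuation (\<lambda>s. h s + 1 / (s - 1))"
    unfolding zeta_continuation_def by (auto intro!: holomorphic_intros)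
  from zeta_continuation_unique[OF zeta_continuation_zeta this assms]
  have "zeta s - 1 / (s - 1) = h s" by simp
  then show ?thesis unfolding h_def using sz[of s] assms by (simp add: summable_sums)
qed

lemma sum_zeta_term:
  "(\<Sum>n<N. zeta_term n s) = (\<Sum>n=1..N. of_nat n powr (-s)) - (of_nat (Suc N) powr (1 - s) - 1) / (1 - s)"
  by (induction N) (auto simp: zeta_term_def diff_divide_distrib)

text \<open>Beyond \<open>N2\<close> the Euler-Maclaurin terms are bounded trivially, which is
  affordable when \<open>N2\<close> is a high power of \<open>N\<close>; the terms between
  \<open>N\<close> and \<open>N2\<close> are kept, to be bounded in mean only.\<close>

lemma zeta_partial_sum:
  assumes "Re s > 1 / 2" "s \<noteq> 1" "N \<le> N2" "N2 > 0"
  shows "norm (zeta s - ((\<Sum>n=1..N. of_nat n powr (-s)) - of_nat (Suc N) powr (1 - s) / (1 - s)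
            + (\<Sum>n\<in>{N..<N2}. zeta_term n s))) \<le> norm s * (real N2 powr (- 1 / 4) * (\<Sum>n. real n powr (- (5 / 4))))"
proof -
  have z: "(\<lambda>n. zeta_term n s) sums (zeta s - 1 / (s - 1))" using assms by (intro zeta_term_sums) auto
  have sm: "summable (\<lambda>n. real (n + N2 + 1) powr (- (5 / 4)))"
    using summable_ignore_initial_segment[OF summable_nat_powr[of "5/4"], of "N2 + 1"] by (simp add: add_ac)
  have "zeta s - 1 / (s - 1) - (\<Sum>n<N2. zeta_term n s) = (\<Sum>n. zeta_term (n + N2) s)"
    using suminf_minus_initial_segment[of "\<lambda>n. zeta_term n s" N2] z by (simp add: sums_iff)
  also have "norm \<dots> \<le> (\<Sum>n. norm s * real N2 powr (- 1 / 4) * real (n + N2 + 1) powr (- (5 / 4)))"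
  proof (rule norm_suminf_le)
    fix n
    have "norm (zeta_term (n + N2) s) \<le> norm s * real (Suc (n + N2)) powr (- Re s - 1)"
      using assms by (intro norm_zeta_term_le) auto
    \<comment> \<open>The exponent - 3 / 2 is split into - 1 / 4, which is the saving, and - 5 / 4,
      which leaves a convergent sum.\<close>
    also have "real (Suc (n + N2)) powr (- Re s - 1) \<le> real (Suc (n + N2)) powr (- 1 / 4 + - (5 / 4))"
      using assms by (intro powr_mono) auto
    also have "\<dots> = real (Suc (n + N2)) powr (- 1 / 4) * real (Suc (n + N2)) powr (- (5 / 4))"
      by (rule powr_add)
    also have "\<dots> \<le> real N2 powr (- 1 / 4) * real (n + N2 + 1) powr (- (5 / 4))"
      using assms by (intro mult_mono powr_mono2') auto
    finally show "norm (zeta_term (n + N2) s) \<le> norm s * real N2 powr (- 1 / 4) * real (n + N2 + 1) powr (- (5 / 4))"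
      by (simp add: mult_left_mono mult.assoc)
  qed (intro summable_mult sm)
  also have "\<dots> = norm s * real N2 powr (- 1 / 4) * (\<Sum>n. real (n + N2 + 1) powr (- (5 / 4)))"
    by (rule suminf_mult[OF sm])
  also have "\<dots> \<le> norm s * real N2 powr (- 1 / 4) * (\<Sum>n. real n powr (- (5 / 4)))"
  proof (intro mult_left_mono)
    have "(\<Sum>n. real (n + (N2 + 1)) powr (- (5 / 4))) = (\<Sum>n. real n powr (- (5 / 4))) - (\<Sum>n<N2 + 1. real n powr (- (5 / 4)))"
      by (rule suminf_minus_initial_segment[OF summable_nat_powr]) auto
    then show "(\<Sum>n. real (n + N2 + 1) powr (- (5 / 4))) \<le> (\<Sum>n. real n powr (- (5 / 4)))"
      using sum_nonneg[of "{..<N2 + 1}" "\<lambda>n. real n powr (- (5 / 4))"] by (simp add: add.assoc)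
  qed auto
  finally have *: "norm (zeta s - 1 / (s - 1) - (\<Sum>n<N2. zeta_term n s)) \<le> norm s * (real N2 powr (- 1 / 4) * (\<Sum>n. real n powr (- (5 / 4))))"
    by (simp add: mult.assoc)
  moreover have "(\<Sum>n<N2. zeta_term n s) = (\<Sum>n<N. zeta_term n s) + (\<Sum>n\<in>{N..<N2}. zeta_term n s)"
    using assms by (subst sum.union_disjoint[symmetric]) (auto intro!: sum.cong)
  moreover have "1 / (s - 1) = - 1 / (1 - s)" using assms by (simp add: field_simps)
  ultimately have "zeta s - ((\<Sum>n=1..N. of_nat n powr (-s)) - of_nat (Suc N) powr (1 - s) / (1 - s)
            + (\<Sum>n\<in>{N..<N2}. zeta_term n s)) = zeta s - 1 / (s - 1) - (\<Sum>n<N2. zeta_term n s)"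
    by (simp add: sum_zeta_term[of _ N] diff_divide_distrib)
  then show ?thesis using * by (simp only:)
qed

text \<open>Integration by parts. For fixed v, a sum of such terms is a generalised Dirichlet
  polynomial in the frequencies \<open>ln (Suc n + v)\<close>, to which a mean value bound
  applies.\<close>

lemma zeta_term_integral:
  assumes "s \<noteq> 1"
  shows "((\<lambda>v. s * (of_real (1 - v) * of_real (real (Suc n) + v) powr (- s - 1))) has_integral zeta_term n s) {0..1}"
proof -
  define B where "B = (\<lambda>a (v::real). complex_of_real (real (Suc n) + v) powr a)"
  define F where "F = (\<lambda>v. (- 1) * (of_real (1 - v) * B (-s) v) - 1 / (1 - s) * B (1 - s) v)"
  have nz: "complex_of_real (real (Suc n) + x) \<notin> \<real>\<^sub>\<le>\<^sub>0" if "x \<ge> 0" for x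
    using that by (auto simp: complex_nonpos_Reals_iff)
  have "((\<lambda>v. s * (of_real (1 - v) * B (- s - 1) v)) has_integral F 1 - F 0) {0..1}"
  proof (rule fundamental_theorem_of_calculus)
    fix v :: real assume v: "v \<in> {0..1}"
    have d1: "(B a has_vector_derivative a * B (a - 1) v) (at v within {0..1})" for a
      unfolding B_def using nz[of v] v
      by (auto intro!: derivative_eq_intros has_vector_derivative_real_field)
    have d2: "((\<lambda>v. complex_of_real (1 - v)) has_vector_derivative - 1) (at v within {0..1})"
      by (auto intro!: derivative_eq_intros)
    have "(F has_vector_derivative (- 1) * (of_real (1 - v) * (- s * B (- s - 1) v) + - 1 * B (-s) v)
        - 1 / (1 - s) * ((1 - s) * B (1 - s - 1) v)) (at v within {0..1})"
      unfolding F_def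
      by (intro has_vector_derivative_diff has_vector_derivative_mult_right has_vector_derivative_mult d1 d2)
    also have "(- 1) * (of_real (1 - v) * (- s * B (- s - 1) v) + - 1 * B (-s) v)
        - 1 / (1 - s) * ((1 - s) * B (1 - s - 1) v) = s * (of_real (1 - v) * B (- s - 1) v)"
      using assms by simp
    finally show "(F has_vector_derivative s * (of_real (1 - v) * B (- s - 1) v)) (at v within {0..1})" .
  qed simp
  also have "F 1 - F 0 = zeta_term n s"
    by (simp add: F_def B_def zeta_term_def diff_divide_distrib add.commute)
  finally show ?thesis by (simp add: B_def)
qed

section \<open>Mean values of Dirichlet polynomials and of mollified zeta on vertical lines\<close>

lemma cis_integral_bound:
  assumes "\<theta> \<noteq> 0" "a \<le> b"
  obtains I where "((\<lambda>t. cis (\<theta> * t)) has_integral I) {a..b}" "norm I \<le> 2 / \<bar>\<theta>\<bar>"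
proof
  define F where "F = (\<lambda>t. cis (\<theta> * t) / (\<i> * of_real \<theta>))"
  show "((\<lambda>t. cis (\<theta> * t)) has_integral F b - F a) {a..b}"
  proof (rule fundamental_theorem_of_calculus[OF assms(2)])
    fix t show "(F has_vector_derivative cis (\<theta> * t)) (at t within {a..b})"
      unfolding F_def cis_conv_exp using assms
      by (auto intro!: derivative_eq_intros has_vector_derivative_real_field simp: field_simps)
  qed
  have "norm (F b - F a) \<le> norm (F b) + norm (F a)" by (rule norm_triangle_ineq4)
  also have "\<dots> = 2 / \<bar>\<theta>\<bar>" by (simp add: F_def norm_divide norm_mult)
  finally show "norm (F b - F a) \<le> 2 / \<bar>\<theta>\<bar>" .
qed

text \<open>From ln z <= z - 1 at the quotient of the smaller by the larger number. The minimum lets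
  each off-diagonal product be split evenly between its two indices.\<close>

lemma inverse_ln_diff_le:
  fixes x y :: real
  assumes "x > 0" "y > 0" "x \<noteq> y"
  shows "1 / \<bar>ln x - ln y\<bar> \<le> 1 + min x y / \<bar>x - y\<bar>"
proof -
  have *: "1 / \<bar>ln x - ln y\<bar> \<le> 1 + min x y / \<bar>x - y\<bar>" if "0 < y" "y < x" for x y :: real
  proof -
    have "ln (y / x) \<le> y / x - 1" using that by (intro ln_le_minus_one) auto
    then have "(x - y) / x \<le> ln x - ln y" using that by (simp add: ln_div field_simps)
    moreover have "0 < (x - y) / x" using that by simp
    ultimately have "1 / \<bar>ln x - ln y\<bar> \<le> 1 / ((x - y) / x)" by (intro frac_le) linarith+
    also have "\<dots> = 1 + min x y / \<bar>x - y\<bar>" using that by (simp add: field_simps)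
    finally show ?thesis .
  qed
  show ?thesis using *[of y x] *[of x y] assms
    by (cases "y < x") (auto simp: min.commute abs_minus_commute)
qed

lemma sum_inverse_dist_le:
  assumes A: "A \<subseteq> {1..K}" "n \<in> A"
  shows "(\<Sum>m\<in>A-{n}. 1 / \<bar>real m - real n\<bar>) \<le> 2 * (1 + ln (real K))"
proof -
  have K: "K > 0" and nK: "n \<le> K" "n \<ge> 1" using A by auto
  have fA: "finite A" using A finite_subset by blast
  have "(\<Sum>m\<in>A-{n}. 1 / \<bar>real m - real n\<bar>) \<le> (\<Sum>m\<in>{1..<n} \<union> {n<..K}. 1 / \<bar>real m - real n\<bar>)"
    using A by (intro sum_mono2) auto
  also have "\<dots> = (\<Sum>m\<in>{1..<n}. 1 / \<bar>real m - real n\<bar>) + (\<Sum>m\<in>{n<..K}. 1 / \<bar>real m - real n\<bar>)"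
    by (rule sum.union_disjoint) auto
  also have "(\<Sum>m\<in>{1..<n}. 1 / \<bar>real m - real n\<bar>) = (\<Sum>d\<in>{1..n - 1}. 1 / real d)"
    by (rule sum.reindex_bij_witness[of _ "\<lambda>d. n - d" "\<lambda>m. n - m"]) (auto simp: of_nat_diff)
  also have "\<dots> \<le> (\<Sum>d\<in>{1..K}. 1 / real d)" using nK by (intro sum_mono2) auto
  also have "(\<Sum>m\<in>{n<..K}. 1 / \<bar>real m - real n\<bar>) = (\<Sum>d\<in>{1..K - n}. 1 / real d)"
    using nK by (intro sum.reindex_bij_witness[of _ "\<lambda>d. n + d" "\<lambda>m. m - n"]) (auto simp: of_nat_diff)
  also have "\<dots> \<le> (\<Sum>d\<in>{1..K}. 1 / real d)" using nK by (intro sum_mono2) auto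
  also have "(\<Sum>d\<in>{1..K}. 1 / real d) = harm K" by (simp add: harm_def inverse_eq_divide)
  also have "\<dots> \<le> 1 + ln (real K)" using K decseqD[OF decseq_harm_diff_ln, of 0 "K - 1"] by (simp add: harm_expand)
  finally show ?thesis by simp
qed

text \<open>A mean value theorem with a loss of a logarithm in place of Hilbert's inequality:
  off-diagonal integrals are at most 2 over the gap of the frequencies, 2 |c m c n| is at most the
  sum of the squares, and the reciprocal gaps add up to a harmonic sum. To the right of the critical
  line the logarithm is absorbed by a power saving. The shift \<open>v\<close> serves the
  Euler-Maclaurin terms.\<close>

lemma mean_value_bound:
  fixes c :: "nat \<Rightarrow> complex" and \<nu> :: "nat \<Rightarrow> real"
  assumes A: "A \<subseteq> {1..K}" and ab: "a \<le> b" and \<nu>: "\<And>n. n \<in> A \<Longrightarrow> \<nu> n = real n + v" and v: "v \<ge> 0"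
  shows "integral {a..b} (\<lambda>t. norm (\<Sum>n\<in>A. c n * cis (- t * ln (\<nu> n))) ^ 2)
    \<le> (b - a) * (\<Sum>n\<in>A. norm (c n) ^ 2) + 2 * (\<Sum>n\<in>A. norm (c n)) ^ 2
       + 4 * (1 + ln (real K)) * (\<Sum>n\<in>A. norm (c n) ^ 2 * \<nu> n)"
proof (cases "A = {}")
  case False
  then have K: "K \<ge> 1" using A by fastforce
  have fA: "finite A" using A finite_subset by blast
  have \<nu>pos: "\<nu> n > 0" if "n \<in> A" for n using \<nu>[OF that] that A v by (force)
  define G where "G = (\<lambda>t. \<Sum>n\<in>A. c n * cis (- t * ln (\<nu> n)))"
  have "\<exists>I. ((\<lambda>t. cis ((ln (\<nu> n) - ln (\<nu> m)) * t)) has_integral I) {a..b}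
       \<and> (m = n \<longrightarrow> norm I = b - a) \<and> (m \<noteq> n \<longrightarrow> norm I \<le> 2 / \<bar>ln (\<nu> n) - ln (\<nu> m)\<bar>)"
    if mn: "m \<in> A" "n \<in> A" for m n
  proof (cases "m = n")
    case True
    then show ?thesis using ab has_integral_const_real[of "1::complex" a b]
      by (intro exI[of _ "of_real (b - a)"]) (auto simp: scaleR_conv_of_real simp flip: of_real_diff)
  next
    case False
    then have "\<nu> n \<noteq> \<nu> m" using \<nu> mn by simp
    then have "ln (\<nu> n) - ln (\<nu> m) \<noteq> 0" using \<nu>pos mn by simp
    from cis_integral_bound[OF this ab] False show ?thesis by metis
  qed
  then obtain I where I: "\<And>m n. m \<in> A \<Longrightarrow> n \<in> A \<Longrightarrow> ((\<lambda>t. cis ((ln (\<nu> n) - ln (\<nu> m)) * t)) has_integral I m n) {a..b}"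
     and I1: "\<And>n. n \<in> A \<Longrightarrow> norm (I n n) = b - a"
     and I2: "\<And>m n. m \<in> A \<Longrightarrow> n \<in> A \<Longrightarrow> m \<noteq> n \<Longrightarrow> norm (I m n) \<le> 2 / \<bar>ln (\<nu> n) - ln (\<nu> m)\<bar>"
    by metis
  have G2: "norm (G t) ^ 2 = Re (\<Sum>m\<in>A. \<Sum>n\<in>A. (c m * cnj (c n)) * cis ((ln (\<nu> n) - ln (\<nu> m)) * t))" for t
  proof -
    have "complex_of_real (norm (G t) ^ 2) = G t * cnj (G t)" by (rule complex_norm_square)
    also have "\<dots> = (\<Sum>m\<in>A. \<Sum>n\<in>A. (c m * cis (- t * ln (\<nu> m))) * (cnj (c n) * cis (t * ln (\<nu> n))))"
      unfolding G_def cnj_sum sum_product by (simp add: cis_cnj)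
    also have "\<dots> = (\<Sum>m\<in>A. \<Sum>n\<in>A. (c m * cnj (c n)) * cis ((ln (\<nu> n) - ln (\<nu> m)) * t))"
    proof (intro sum.cong refl)
      fix m n
      have "(c m * cis (- t * ln (\<nu> m))) * (cnj (c n) * cis (t * ln (\<nu> n)))
         = (c m * cnj (c n)) * (cis (- t * ln (\<nu> m)) * cis (t * ln (\<nu> n)))" by (simp only: mult_ac)
      also have "cis (- t * ln (\<nu> m)) * cis (t * ln (\<nu> n)) = cis ((ln (\<nu> n) - ln (\<nu> m)) * t)"
        unfolding cis_mult by (simp add: algebra_simps)
      finally show "(c m * cis (- t * ln (\<nu> m))) * (cnj (c n) * cis (t * ln (\<nu> n)))
         = (c m * cnj (c n)) * cis ((ln (\<nu> n) - ln (\<nu> m)) * t)" .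
    qed
    finally show ?thesis by (metis Re_complex_of_real)
  qed
  have "((\<lambda>t. norm (G t) ^ 2) has_integral Re (\<Sum>m\<in>A. \<Sum>n\<in>A. (c m * cnj (c n)) * I m n)) {a..b}"
    unfolding G2
    by (rule has_integral_linear[OF _ bounded_linear_Re, unfolded o_def])
       (intro has_integral_sum fA has_integral_mult_right I)
  then have "integral {a..b} (\<lambda>t. norm (G t) ^ 2) = Re (\<Sum>m\<in>A. \<Sum>n\<in>A. (c m * cnj (c n)) * I m n)"
    by (rule integral_unique)
  also have "\<dots> \<le> norm (\<Sum>m\<in>A. \<Sum>n\<in>A. (c m * cnj (c n)) * I m n)" by (rule complex_Re_le_cmod)
  also have "\<dots> \<le> (\<Sum>m\<in>A. \<Sum>n\<in>A. norm (c m) * norm (c n) * norm (I m n))"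
    by (intro sum_norm_le) (auto simp: norm_mult)
  also have "\<dots> \<le> (\<Sum>m\<in>A. \<Sum>n\<in>A. (if m = n then (b - a) * norm (c n) ^ 2 else 0) + 2 * (norm (c m) * norm (c n))
       + (if m = n then 0 else (norm (c m) ^ 2 * \<nu> m + norm (c n) ^ 2 * \<nu> n) * (1 / \<bar>real m - real n\<bar>)))"
  proof (intro sum_mono)
    fix m n assume mn: "m \<in> A" "n \<in> A"
    show "norm (c m) * norm (c n) * norm (I m n) \<le> (if m = n then (b - a) * norm (c n) ^ 2 else 0) + 2 * (norm (c m) * norm (c n))
       + (if m = n then 0 else (norm (c m) ^ 2 * \<nu> m + norm (c n) ^ 2 * \<nu> n) * (1 / \<bar>real m - real n\<bar>))"
    proof (cases "m = n")
      case True
      then show ?thesis using I1[of n] mn by (simp add: power2_eq_square)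
    next
      case False
      have d: "\<bar>\<nu> n - \<nu> m\<bar> = \<bar>real m - real n\<bar>" "\<nu> n \<noteq> \<nu> m" "\<bar>real m - real n\<bar> > 0" using \<nu> mn False by auto
      have "norm (I m n) \<le> 2 * (1 / \<bar>ln (\<nu> n) - ln (\<nu> m)\<bar>)" using I2[OF mn False] by simp
      also have "\<dots> \<le> 2 * (1 + min (\<nu> n) (\<nu> m) / \<bar>real m - real n\<bar>)"
        using inverse_ln_diff_le[OF \<nu>pos \<nu>pos d(2)] mn d(1) by simp
      finally have "norm (c m) * norm (c n) * norm (I m n) \<le> norm (c m) * norm (c n) * (2 * (1 + min (\<nu> n) (\<nu> m) / \<bar>real m - real n\<bar>))"
        by (intro mult_left_mono) auto
      also have "\<dots> = 2 * (norm (c m) * norm (c n)) + (2 * norm (c m) * norm (c n) * min (\<nu> n) (\<nu> m)) * (1 / \<bar>real m - real n\<bar>)"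
        by (simp add: algebra_simps)
      also have "2 * norm (c m) * norm (c n) * min (\<nu> n) (\<nu> m) \<le> norm (c m) ^ 2 * \<nu> m + norm (c n) ^ 2 * \<nu> n"
      proof -
        have "2 * norm (c m) * norm (c n) * min (\<nu> n) (\<nu> m) \<le> (norm (c m) ^ 2 + norm (c n) ^ 2) * min (\<nu> n) (\<nu> m)"
          using sum_squares_bound[of "norm (c m)" "norm (c n)"] \<nu>pos[OF mn(1)] \<nu>pos[OF mn(2)]
          by (intro mult_right_mono) auto
        also have "\<dots> \<le> norm (c m) ^ 2 * \<nu> m + norm (c n) ^ 2 * \<nu> n"
          unfolding distrib_right by (intro add_mono mult_left_mono) auto
        finally show ?thesis .
      qed
      finally show ?thesis using False by (simp add: mult_right_mono divide_right_mono)
    qed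
  qed
  also have "\<dots> = (b - a) * (\<Sum>n\<in>A. norm (c n) ^ 2) + 2 * (\<Sum>n\<in>A. norm (c n)) ^ 2
     + (\<Sum>m\<in>A. \<Sum>n\<in>A. if m = n then 0 else (norm (c m) ^ 2 * \<nu> m + norm (c n) ^ 2 * \<nu> n) * (1 / \<bar>real m - real n\<bar>))"
  proof -
    have "(\<Sum>m\<in>A. \<Sum>n\<in>A. 2 * (norm (c m) * norm (c n))) = 2 * (\<Sum>n\<in>A. norm (c n)) ^ 2"
      unfolding power2_eq_square sum_product by (simp only: sum_distrib_left)
    moreover have "(\<Sum>m\<in>A. \<Sum>n\<in>A. if m = n then (b - a) * norm (c n) ^ 2 else 0) = (b - a) * (\<Sum>n\<in>A. norm (c n) ^ 2)"
      using fA by (simp add: sum_distrib_left)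
    ultimately show ?thesis by (simp only: sum.distrib)
  qed
  also have "(\<Sum>m\<in>A. \<Sum>n\<in>A. if m = n then 0 else (norm (c m) ^ 2 * \<nu> m + norm (c n) ^ 2 * \<nu> n) * (1 / \<bar>real m - real n\<bar>))
     = 2 * (\<Sum>m\<in>A. norm (c m) ^ 2 * \<nu> m * (\<Sum>n\<in>A. if m = n then 0 else 1 / \<bar>real m - real n\<bar>))"
  proof -
    have "(\<Sum>m\<in>A. \<Sum>n\<in>A. if m = n then 0 else (norm (c m) ^ 2 * \<nu> m + norm (c n) ^ 2 * \<nu> n) * (1 / \<bar>real m - real n\<bar>))
      = (\<Sum>m\<in>A. \<Sum>n\<in>A. (if m = n then 0 else norm (c m) ^ 2 * \<nu> m * (1 / \<bar>real m - real n\<bar>)))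
       + (\<Sum>m\<in>A. \<Sum>n\<in>A. (if m = n then 0 else norm (c n) ^ 2 * \<nu> n * (1 / \<bar>real m - real n\<bar>)))"
      unfolding sum.distrib[symmetric] by (intro sum.cong) (auto simp: distrib_right add_divide_distrib)
    also have "(\<Sum>m\<in>A. \<Sum>n\<in>A. (if m = n then 0 else norm (c n) ^ 2 * \<nu> n * (1 / \<bar>real m - real n\<bar>)))
       = (\<Sum>m\<in>A. \<Sum>n\<in>A. (if m = n then 0 else norm (c m) ^ 2 * \<nu> m * (1 / \<bar>real m - real n\<bar>)))"
      by (subst sum.swap) (intro sum.cong, auto simp: abs_minus_commute)
    also have "(\<Sum>m\<in>A. \<Sum>n\<in>A. (if m = n then 0 else norm (c m) ^ 2 * \<nu> m * (1 / \<bar>real m - real n\<bar>)))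
       = (\<Sum>m\<in>A. norm (c m) ^ 2 * \<nu> m * (\<Sum>n\<in>A. if m = n then 0 else 1 / \<bar>real m - real n\<bar>))"
      unfolding sum_distrib_left by (intro sum.cong refl) auto
    finally show ?thesis by simp
  qed
  also have "(\<Sum>m\<in>A. norm (c m) ^ 2 * \<nu> m * (\<Sum>n\<in>A. if m = n then 0 else 1 / \<bar>real m - real n\<bar>))
     \<le> (\<Sum>m\<in>A. norm (c m) ^ 2 * \<nu> m * (2 * (1 + ln (real K))))"
  proof (intro sum_mono mult_left_mono)
    fix m assume m: "m \<in> A"
    have "(\<Sum>n\<in>A. if m = n then 0 else 1 / \<bar>real m - real n\<bar>) = (\<Sum>n\<in>A-{m}. 1 / \<bar>real n - real m\<bar>)"
      using fA by (intro sum.mono_neutral_cong_right) (auto simp: abs_minus_commute)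
    then show "(\<Sum>n\<in>A. if m = n then 0 else 1 / \<bar>real m - real n\<bar>) \<le> 2 * (1 + ln (real K))"
      using sum_inverse_dist_le[OF A m] by simp
    show "0 \<le> norm (c m) ^ 2 * \<nu> m" using \<nu>pos[OF m] by simp
  qed
  also have "2 * (\<Sum>m\<in>A. norm (c m) ^ 2 * \<nu> m * (2 * (1 + ln (real K)))) = 4 * (1 + ln (real K)) * (\<Sum>n\<in>A. norm (c n) ^ 2 * \<nu> n)"
    unfolding sum_distrib_right[symmetric] by simp
  finally show ?thesis unfolding G_def by simp
qed simp

text \<open>The Cauchy-Schwarz inequality, from 2 e |G| <= e^2 + |G|^2 pointwise with e = sqrt
  E.\<close>

lemma integral_norm_le_sqrt:
  fixes G :: "real \<Rightarrow> complex"
  assumes ab: "a < b" and G: "continuous_on {a..b} G"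
    and E: "integral {a..b} (\<lambda>t. norm (G t) ^ 2) \<le> (b - a) * E" "E > 0"
  shows "integral {a..b} (\<lambda>t. norm (G t)) \<le> (b - a) * sqrt E"
proof -
  define e where "e = sqrt E"
  have e: "e > 0" "E = e * e" using E by (auto simp: e_def)
  have "integral {a..b} (\<lambda>t. norm (G t)) \<le> integral {a..b} (\<lambda>t. e / 2 + norm (G t) ^ 2 / (2 * e))"
  proof (rule integral_le)
    fix t
    have "2 * e * norm (G t) \<le> e ^ 2 + norm (G t) ^ 2" by (rule sum_squares_bound)
    then have "norm (G t) \<le> (e ^ 2 + norm (G t) ^ 2) / (2 * e)" using e by (simp add: pos_le_divide_eq mult.commute)
    also have "\<dots> = e / 2 + norm (G t) ^ 2 / (2 * e)"
      using e(1) by (simp add: add_divide_distrib power2_eq_square)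
    finally show "norm (G t) \<le> e / 2 + norm (G t) ^ 2 / (2 * e)" .
  qed (auto intro!: integrable_continuous_interval continuous_intros G simp: e(1)[THEN dual_order.strict_implies_not_eq])
  also have "\<dots> = (b - a) * (e / 2) + integral {a..b} (\<lambda>t. norm (G t) ^ 2) / (2 * e)"
    using ab by (subst integral_add) (auto intro!: integrable_continuous_interval continuous_intros G simp: e(1)[THEN dual_order.strict_implies_not_eq])
  also have "\<dots> \<le> (b - a) * (e / 2) + (b - a) * E / (2 * e)"
    using E e(1) by (intro add_left_mono divide_right_mono) auto
  also have "(b - a) * E / (2 * e) = (b - a) * (e / 2)" using e by simp
  finally show ?thesis unfolding e_def by (simp add: algebra_simps)
qed

lemma powr_line:
  assumes "y > 0" shows "complex_of_real y powr (- Complex x t) = of_real (y powr (-x)) * cis (- t * ln y)"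
  using assms
  by (simp add: powr_def exp_eq_polar Ln_of_real cis.ctr complex_eq_iff)

text \<open>In mean square the diagonal saves Z powr (- \<delta> / 4) because the sum starts at Z;
  the other two terms save a power of T, hence at least as much since Z <= T. The square root halves
  the exponent. Length T powr (1 + \<delta> / 16) makes room for a partial sum of zeta up to T times
  a short mollifier.\<close>

lemma mean_tail_le:
  fixes \<delta> :: real assumes \<delta>: "0 < \<delta>" "\<delta> < 1 / 2"
  obtains C where "C > 0" "\<And>T Z K c x. T \<ge> 4 \<Longrightarrow> 1 \<le> Z \<Longrightarrow> real Z \<le> T \<Longrightarrow> real K \<le> T powr (1 + \<delta> / 16) \<Longrightarrow>
     1 / 2 + \<delta> / 2 \<le> x \<Longrightarrow> (\<And>n. \<bar>c n\<bar> \<le> dcount n) \<Longrightarrow>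
     integral {T/4..4*T} (\<lambda>t. norm (\<Sum>n\<in>{Z..K}. of_real (c n) * of_nat n powr (- Complex x t))) \<le> C * T * real Z powr (- \<delta> / 8)"
proof -
  \<comment> \<open>The exponent 1 + \<delta> / 8 is what convergence costs; the rest of the
    available exponent 1 + \<delta> is spent on savings.\<close>
  define C2 where "C2 = (\<Sum>n. dcount n ^ 2 * real n powr (- (1 + \<delta> / 8)))"
  have sm: "summable (\<lambda>n. dcount n ^ 2 * real n powr (- (1 + \<delta> / 8)))" using \<delta> by (intro summable_dcount_sq) auto
  have C2: "(\<Sum>n\<in>A. dcount n ^ 2 * real n powr (- (1 + \<delta> / 8))) \<le> C2" if "finite A" for A
    unfolding C2_def using that by (intro sum_le_suminf sm) auto
  have C20: "C2 \<ge> 0" using C2[of "{}"] by simp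
  have "eventually (\<lambda>T. (1 + 2 * ln T) * T powr (- \<delta> / 2) \<le> T powr (- \<delta> / 4)) at_top"
    using \<delta> by real_asymp
  then obtain T1 where T1: "\<And>T. T \<ge> T1 \<Longrightarrow> (1 + 2 * ln T) * T powr (- \<delta> / 2) \<le> T powr (- \<delta> / 4)"
    by (auto simp: eventually_at_top_linorder)
  \<comment> \<open>Makes the absorption of the logarithm valid for all T >= 4 instead of only from
    \<open>T1\<close> on.\<close>
  define C3 where "C3 = 1 + (1 + 2 * ln (max T1 4)) * (max T1 4) powr (\<delta> / 4)"
  have C3: "(1 + 2 * ln T) * T powr (- \<delta> / 2) \<le> C3 * T powr (- \<delta> / 4)" if T: "T \<ge> 4" for T
  proof (cases "T \<ge> T1")
    case True
    have "1 \<le> C3" unfolding C3_def by auto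
    then have "1 * T powr (- \<delta> / 4) \<le> C3 * T powr (- \<delta> / 4)" by (intro mult_right_mono) auto
    then show ?thesis using T1[OF True] by linarith
  next
    case False
    define M where "M = max T1 4"
    have M: "T \<le> M" "M \<ge> 4" using False by (auto simp: M_def)
    have "(1 + 2 * ln T) * T powr (- \<delta> / 2) \<le> (1 + 2 * ln M) * 1"
      using T M \<delta> powr_mono[of "- \<delta> / 2" 0 T] by (intro mult_mono) auto
    also have "\<dots> \<le> (1 + 2 * ln M) * (M powr (\<delta> / 4) * T powr (- \<delta> / 4))"
    proof (intro mult_left_mono)
      have "T powr (\<delta> / 4) \<le> M powr (\<delta> / 4)" using T M \<delta> by (intro powr_mono2) auto
      then show "1 \<le> M powr (\<delta> / 4) * T powr (- \<delta> / 4)" using T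
        by (simp add: powr_minus field_simps)
    qed (use M in auto)
    also have "\<dots> \<le> C3 * T powr (- \<delta> / 4)" unfolding C3_def M_def by (simp add: distrib_right mult.assoc)
    finally show ?thesis .
  qed
  have C30: "C3 \<ge> 1" unfolding C3_def by auto
  define E where "E = C2 + C2 ^ 2 + 2 * C3 * C2 + 1"
  have E0: "E > 0" unfolding E_def using C20 C30 by (intro add_nonneg_pos add_nonneg_nonneg) auto
  show ?thesis
  proof (rule that[of "4 * sqrt E"])
    show "4 * sqrt E > 0" using E0 by simp
    fix T x :: real and Z K :: nat and c :: "nat \<Rightarrow> real"
    assume T: "T \<ge> 4" and Z: "1 \<le> Z" "real Z \<le> T" and K: "real K \<le> T powr (1 + \<delta> / 16)" and x: "1 / 2 + \<delta> / 2 \<le> x"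
      and c: "\<And>n. \<bar>c n\<bar> \<le> dcount n"
    define A where "A = {Z..K}"
    define a where "a = (\<lambda>n. complex_of_real (c n * real n powr (-x)))"
    define G where "G = (\<lambda>t. \<Sum>n\<in>A. a n * cis (- t * ln (real n)))"
    have G: "(\<Sum>n\<in>{Z..K}. of_real (c n) * of_nat n powr (- Complex x t)) = G t" for t
      unfolding G_def A_def a_def using Z powr_line[of "real _" x t] by (intro sum.cong) auto
    have fA: "finite A" and A1: "A \<subseteq> {1..K}" using Z by (auto simp: A_def)
    have n1: "real n \<ge> 1" "real n \<ge> real Z" "real n \<le> real K" if "n \<in> A" for n using that Z by (auto simp: A_def)
    have Tp: "T powr p \<ge> 1" if "p \<ge> 0" for p using T that by (intro ge_one_powr_ge_zero) auto
    have KT: "real K powr p \<le> T powr q" if "p \<ge> 0" "(1 + \<delta> / 16) * p \<le> q" for p q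
    proof -
      have "real K powr p \<le> (T powr (1 + \<delta> / 16)) powr p" using K that by (intro powr_mono2) auto
      also have "\<dots> = T powr ((1 + \<delta> / 16) * p)" by (simp add: powr_powr)
      also have "\<dots> \<le> T powr q" using T that by (intro powr_mono) auto
      finally show ?thesis .
    qed
    have an: "norm (a n) \<le> dcount n * real n powr (- (1 / 2 + \<delta> / 2))" if "n \<in> A" for n
    proof -
      have "norm (a n) = \<bar>c n\<bar> * real n powr (-x)" unfolding a_def norm_of_real by (simp add: abs_mult)
      also have "\<dots> \<le> dcount n * real n powr (- (1 / 2 + \<delta> / 2))"
        using n1[OF that] x c by (intro mult_mono powr_mono) (auto simp: dcount_nonneg)
      finally show ?thesis .
    qed
    have an2: "norm (a n) ^ 2 \<le> dcount n ^ 2 * real n powr (- (1 + \<delta>))" if "n \<in> A" for n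
    proof -
      have "norm (a n) ^ 2 \<le> (dcount n * real n powr (- (1 / 2 + \<delta> / 2))) ^ 2"
        using an[OF that] by (intro power_mono) auto
      also have "\<dots> = dcount n ^ 2 * real n powr (- (1 + \<delta>))"
        by (simp add: power_mult_distrib power2_eq_square powr_add[symmetric])
      finally show ?thesis .
    qed
    have S2: "(\<Sum>n\<in>A. norm (a n) ^ 2) \<le> real Z powr (- \<delta> / 4) * C2"
    proof -
      have "(\<Sum>n\<in>A. norm (a n) ^ 2) \<le> (\<Sum>n\<in>A. real Z powr (- \<delta> / 4) * (dcount n ^ 2 * real n powr (- (1 + \<delta> / 8))))"
      proof (intro sum_mono)
        fix n assume n: "n \<in> A"
        have "real n powr (- (1 + \<delta>)) \<le> real n powr (- \<delta> / 4 + - (1 + \<delta> / 8))"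
          using n1[OF n] \<delta> by (intro powr_mono) auto
        also have "\<dots> = real n powr (- \<delta> / 4) * real n powr (- (1 + \<delta> / 8))" by (rule powr_add)
        also have "\<dots> \<le> real Z powr (- \<delta> / 4) * real n powr (- (1 + \<delta> / 8))"
          using n1[OF n] \<delta> Z by (intro mult_right_mono powr_mono2') auto
        finally show "norm (a n) ^ 2 \<le> real Z powr (- \<delta> / 4) * (dcount n ^ 2 * real n powr (- (1 + \<delta> / 8)))"
          using order_trans[OF an2[OF n] mult_left_mono] by (fastforce simp: mult_ac)
      qed
      also have "\<dots> \<le> real Z powr (- \<delta> / 4) * C2" unfolding sum_distrib_left[symmetric]
        by (intro mult_left_mono C2 fA) auto
      finally show ?thesis .
    qed
    have S1: "(\<Sum>n\<in>A. norm (a n)) ^ 2 \<le> T powr (1 - \<delta> / 4) * C2 ^ 2"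
    proof -
      have "(\<Sum>n\<in>A. norm (a n)) \<le> (\<Sum>n\<in>A. T powr (1 / 2 - \<delta> / 8) * (dcount n ^ 2 * real n powr (- (1 + \<delta> / 8))))"
      proof (intro sum_mono)
        fix n assume n: "n \<in> A"
        have d: "dcount n \<le> dcount n ^ 2" using dcount_ge_1[of n] n1[OF n] by (simp add: power2_eq_square)
        have "real n powr (- (1 / 2 + \<delta> / 2)) = real n powr (1 / 2 - 3 / 8 * \<delta> + - (1 + \<delta> / 8))" by simp
        also have "\<dots> = real n powr (1 / 2 - 3 / 8 * \<delta>) * real n powr (- (1 + \<delta> / 8))" by (rule powr_add)
        also have "\<dots> \<le> real K powr (1 / 2 - 3 / 8 * \<delta>) * real n powr (- (1 + \<delta> / 8))"
          using n1[OF n] \<delta> by (intro mult_right_mono powr_mono2) auto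
        also have "real K powr (1 / 2 - 3 / 8 * \<delta>) \<le> T powr (1 / 2 - \<delta> / 8)"
          using \<delta> by (intro KT) (auto simp: algebra_simps intro: add_nonneg_nonneg)
        finally have "dcount n * real n powr (- (1 / 2 + \<delta> / 2)) \<le> dcount n ^ 2 * (T powr (1 / 2 - \<delta> / 8) * real n powr (- (1 + \<delta> / 8)))"
          using d by (intro mult_mono) (auto simp: mult_right_mono)
        then show "norm (a n) \<le> T powr (1 / 2 - \<delta> / 8) * (dcount n ^ 2 * real n powr (- (1 + \<delta> / 8)))"
          using an[OF n] by (simp add: mult_ac)
      qed
      also have "\<dots> \<le> T powr (1 / 2 - \<delta> / 8) * C2" unfolding sum_distrib_left[symmetric]
        by (intro mult_left_mono C2 fA) auto
      finally have "(\<Sum>n\<in>A. norm (a n)) ^ 2 \<le> (T powr (1 / 2 - \<delta> / 8) * C2) ^ 2"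
        by (intro power_mono sum_nonneg) auto
      also have "\<dots> = T powr (1 - \<delta> / 4) * C2 ^ 2"
        by (simp add: power_mult_distrib power2_eq_square powr_add[symmetric])
      finally show ?thesis .
    qed
    have S3: "(\<Sum>n\<in>A. norm (a n) ^ 2 * real n) \<le> T powr (1 - \<delta> / 2) * C2"
    proof -
      have "(\<Sum>n\<in>A. norm (a n) ^ 2 * real n) \<le> (\<Sum>n\<in>A. T powr (1 - \<delta> / 2) * (dcount n ^ 2 * real n powr (- (1 + \<delta> / 8))))"
      proof (intro sum_mono)
        fix n assume n: "n \<in> A"
        have "real n powr (- (1 + \<delta>)) * real n = real n powr (- (1 + \<delta>)) * real n powr 1" using n1[OF n] by simp
        also have "\<dots> = real n powr (1 - 7 / 8 * \<delta> + - (1 + \<delta> / 8))" unfolding powr_add[symmetric] by simp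
        also have "\<dots> = real n powr (1 - 7 / 8 * \<delta>) * real n powr (- (1 + \<delta> / 8))" by (rule powr_add)
        also have "\<dots> \<le> real K powr (1 - 7 / 8 * \<delta>) * real n powr (- (1 + \<delta> / 8))"
          using n1[OF n] \<delta> by (intro mult_right_mono powr_mono2) auto
        also have "real K powr (1 - 7 / 8 * \<delta>) \<le> T powr (1 - \<delta> / 2)"
          using \<delta> by (intro KT) (auto simp: algebra_simps intro: add_nonneg_nonneg)
        finally have *: "real n powr (- (1 + \<delta>)) * real n \<le> T powr (1 - \<delta> / 2) * real n powr (- (1 + \<delta> / 8))"
          by (simp add: mult_right_mono)
        have "norm (a n) ^ 2 * real n \<le> dcount n ^ 2 * (real n powr (- (1 + \<delta>)) * real n)"
          using mult_right_mono[OF an2[OF n], of "real n"] by (simp add: mult.assoc)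
        also have "\<dots> \<le> dcount n ^ 2 * (T powr (1 - \<delta> / 2) * real n powr (- (1 + \<delta> / 8)))"
          by (intro mult_left_mono *) auto
        finally show "norm (a n) ^ 2 * real n \<le> T powr (1 - \<delta> / 2) * (dcount n ^ 2 * real n powr (- (1 + \<delta> / 8)))"
          by (simp add: mult_ac)
      qed
      also have "\<dots> \<le> T powr (1 - \<delta> / 2) * C2" unfolding sum_distrib_left[symmetric]
        by (intro mult_left_mono C2 fA) auto
      finally show ?thesis .
    qed
    have lnK: "1 + ln (real K) \<le> 1 + 2 * ln T"
    proof (cases "K = 0")
      case False
      then have "ln (real K) \<le> ln (T powr (1 + \<delta> / 16))" using K T by (subst ln_le_cancel_iff) auto
      also have "\<dots> \<le> 2 * ln T" using T \<delta> by (auto simp: ln_powr intro!: mult_right_mono)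
      finally show ?thesis by simp
    qed (use T in auto)
    have lnK0: "0 \<le> ln (real K)" by (cases "K = 0") auto
    have Tq: "T powr (1 - q) = T * T powr (- q)" for q using powr_add[of T 1 "- q"] T by simp
    have ZT: "T powr (- \<delta> / 4) \<le> real Z powr (- \<delta> / 4)" using Z \<delta> T by (intro powr_mono2') auto
    have "integral {T/4..4*T} (\<lambda>t. norm (G t) ^ 2) \<le> (4 * T - T / 4) * (\<Sum>n\<in>A. norm (a n) ^ 2) + 2 * (\<Sum>n\<in>A. norm (a n)) ^ 2
       + 4 * (1 + ln (real K)) * (\<Sum>n\<in>A. norm (a n) ^ 2 * real n)"
      unfolding G_def using T by (intro mean_value_bound[OF A1, of _ _ _ 0]) auto
    also have "\<dots> \<le> (4 * T - T / 4) * (real Z powr (- \<delta> / 4) * C2) + 2 * (T powr (1 - \<delta> / 4) * C2 ^ 2)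
       + 4 * (1 + 2 * ln T) * (T powr (1 - \<delta> / 2) * C2)"
      using T lnK lnK0 S1 S2 S3 by (intro add_mono mult_mono) (auto intro!: sum_nonneg add_nonneg_nonneg)
    also have "2 * (T powr (1 - \<delta> / 4) * C2 ^ 2) = 2 * T * (T powr (- \<delta> / 4) * C2 ^ 2)"
      by (simp add: Tq)
    also have "4 * (1 + 2 * ln T) * (T powr (1 - \<delta> / 2) * C2) = 4 * T * C2 * ((1 + 2 * ln T) * T powr (- \<delta> / 2))"
      by (simp add: Tq)
    also have "(4 * T - T / 4) * (real Z powr (- \<delta> / 4) * C2) + 2 * T * (T powr (- \<delta> / 4) * C2 ^ 2)
       + 4 * T * C2 * ((1 + 2 * ln T) * T powr (- \<delta> / 2))
      \<le> (4 * T - T / 4) * (real Z powr (- \<delta> / 4) * C2) + (4 * T - T / 4) * (real Z powr (- \<delta> / 4) * C2 ^ 2)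
       + 4 * T * C2 * (C3 * real Z powr (- \<delta> / 4))"
    proof (intro add_mono order_refl)
      show "2 * T * (T powr (- \<delta> / 4) * C2 ^ 2) \<le> (4 * T - T / 4) * (real Z powr (- \<delta> / 4) * C2 ^ 2)"
        using T ZT by (intro mult_mono) auto
      have "(1 + 2 * ln T) * T powr (- \<delta> / 2) \<le> C3 * real Z powr (- \<delta> / 4)"
        using order_trans[OF C3[OF T] mult_left_mono[OF ZT, of C3]] C30 by simp
      then show "4 * T * C2 * ((1 + 2 * ln T) * T powr (- \<delta> / 2)) \<le> 4 * T * C2 * (C3 * real Z powr (- \<delta> / 4))"
        using T C20 by (intro mult_left_mono) auto
    qed
    also have "\<dots> \<le> (4 * T - T / 4) * (E * real Z powr (- \<delta> / 4))"
    proof -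
      have "4 * T * C2 * (C3 * real Z powr (- \<delta> / 4)) \<le> (4 * T - T / 4) * 2 * C2 * (C3 * real Z powr (- \<delta> / 4))"
        using T C20 C30 by (intro mult_right_mono) auto
      moreover have "0 \<le> (4 * T - T / 4) * real Z powr (- \<delta> / 4)" using T by auto
      ultimately show ?thesis unfolding E_def by (simp add: algebra_simps)
    qed
    finally have I2: "integral {T/4..4*T} (\<lambda>t. norm (G t) ^ 2) \<le> (4 * T - T / 4) * (E * real Z powr (- \<delta> / 4))" .
    have "integral {T/4..4*T} (\<lambda>t. norm (G t)) \<le> (4 * T - T / 4) * sqrt (E * real Z powr (- \<delta> / 4))"
    proof (rule integral_norm_le_sqrt[OF _ _ I2])
      show "continuous_on {T/4..4*T} G" unfolding G_def cis_conv_exp by (intro continuous_intros)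
    qed (use T E0 Z in auto)
    also have "sqrt (E * real Z powr (- \<delta> / 4)) = sqrt E * real Z powr (- \<delta> / 8)"
      using Z by (simp add: real_sqrt_mult powr_half_sqrt[symmetric] powr_powr)
    also have "(4 * T - T / 4) * (sqrt E * real Z powr (- \<delta> / 8)) \<le> 4 * T * (sqrt E * real Z powr (- \<delta> / 8))"
      using T E0 by (intro mult_right_mono) auto
    finally show "integral {T/4..4*T} (\<lambda>t. norm (\<Sum>n\<in>{Z..K}. of_real (c n) * of_nat n powr (- Complex x t))) \<le> 4 * sqrt E * T * real Z powr (- \<delta> / 8)"
      unfolding G by (simp add: mult_ac)
  qed
qed

text \<open>The coefficients (n + v) powr (- (x + 1)) with n > N are so small that the average over
  the interval is O(T powr (- 1 - \<delta> / 4)). The extra T powr (- 1) compensates the factor |s|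
  in front of the Euler-Maclaurin terms. The bound \<open>T ^ 8\<close> keeps the logarithm of the
  length O(ln T).\<close>

lemma mean_zeta_term_le:
  fixes \<delta> :: real assumes \<delta>: "0 < \<delta>" "\<delta> < 1 / 2"
  obtains E T0 where "E > 0" "T0 \<ge> 4" "\<And>T N N2 x v. T \<ge> T0 \<Longrightarrow> T \<le> real (Suc N) \<Longrightarrow> real N2 \<le> T ^ 8 \<Longrightarrow> 1 / 2 + \<delta> / 2 \<le> x \<Longrightarrow> v \<ge> 0 \<Longrightarrow>
     integral {T/4..4*T} (\<lambda>t. norm (\<Sum>n\<in>{Suc N..N2}. of_real ((real n + v) powr (- (x + 1))) * cis (- t * ln (real n + v))))
       \<le> E * T powr (- \<delta> / 4)"
proof -
  define C6 where "C6 = (\<Sum>n. real n powr (- (1 + \<delta> / 4)))"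
  have C6: "(\<Sum>n\<in>A. real n powr (- (1 + \<delta> / 4))) \<le> C6" if "finite A" for A
    unfolding C6_def using that \<delta> by (intro sum_nat_powr_le) auto
  have C60: "C6 \<ge> 0" using C6[of "{}"] by simp
  have "eventually (\<lambda>T. (1 + 8 * ln T) * T powr (- \<delta> / 4) \<le> 1) at_top"
    using \<delta> by real_asymp
  then obtain T1 where T1: "\<And>T. T \<ge> T1 \<Longrightarrow> (1 + 8 * ln T) * T powr (- \<delta> / 4) \<le> 1"
    by (auto simp: eventually_at_top_linorder)
  define E where "E = 4 * C6 + 2 * C6 ^ 2 + 4 * C6 + 1"
  have E0: "E > 0" unfolding E_def using C60 by (intro add_nonneg_pos add_nonneg_nonneg) auto
  show ?thesis
  proof (rule that[of "4 * sqrt E" "max 4 T1"])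
    show "4 * sqrt E > 0" using E0 by simp
    fix T x v :: real and N N2 :: nat
    assume T: "T \<ge> max 4 T1" and N: "T \<le> real (Suc N)" and N2: "real N2 \<le> T ^ 8" and x: "1 / 2 + \<delta> / 2 \<le> x" and v: "v \<ge> 0"
    define A where "A = {Suc N..N2}"
    define a where "a = (\<lambda>n. complex_of_real ((real n + v) powr (- (x + 1))))"
    define G where "G = (\<lambda>t. \<Sum>n\<in>A. a n * cis (- t * ln (real n + v)))"
    have fA: "finite A" and A1: "A \<subseteq> {1..N2}" by (auto simp: A_def)
    have n1: "real n \<ge> 1" "T \<le> real n" if "n \<in> A" for n using that N T by (auto simp: A_def)
    have T4: "T \<ge> 4" using T by simp
    have key: "(real n + v) powr (- p) \<le> T powr (- q) * real n powr (- (1 + \<delta> / 4))"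
      if "n \<in> A" "q \<ge> 0" "q + 1 + \<delta> / 4 \<le> p" for n p q
    proof -
      have "(real n + v) powr (- p) \<le> real n powr (- p)"
        using n1[OF that(1)] v that \<delta> by (intro powr_mono2') auto
      also have "\<dots> \<le> real n powr (- q + - (1 + \<delta> / 4))"
        using n1[OF that(1)] that by (intro powr_mono) auto
      also have "\<dots> = real n powr (- q) * real n powr (- (1 + \<delta> / 4))" by (rule powr_add)
      also have "\<dots> \<le> T powr (- q) * real n powr (- (1 + \<delta> / 4))"
        using n1[OF that(1)] T4 that by (intro mult_right_mono powr_mono2') auto
      finally show ?thesis .
    qed
    have sums: "(\<Sum>n\<in>A. (real n + v) powr (- p)) \<le> T powr (- q) * C6" if "q \<ge> 0" "q + 1 + \<delta> / 4 \<le> p" for p q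
    proof -
      have "(\<Sum>n\<in>A. (real n + v) powr (- p)) \<le> (\<Sum>n\<in>A. T powr (- q) * real n powr (- (1 + \<delta> / 4)))"
        using that by (intro sum_mono key) auto
      also have "\<dots> \<le> T powr (- q) * C6" unfolding sum_distrib_left[symmetric]
        by (intro mult_left_mono C6 fA) auto
      finally show ?thesis .
    qed
    have na: "norm (a n) = (real n + v) powr (- (x + 1))" for n unfolding a_def norm_of_real by simp
    have na2: "norm (a n) ^ 2 = (real n + v) powr (- (2 * x + 2))" for n
      unfolding na power2_eq_square powr_add[symmetric] by (simp add: algebra_simps)
    have S2: "(\<Sum>n\<in>A. norm (a n) ^ 2) \<le> T powr (- (2 + \<delta> / 2)) * C6"
      unfolding na2 using x \<delta> by (intro sums) auto
    have "(\<Sum>n\<in>A. norm (a n)) \<le> T powr (- (1 / 2 + \<delta> / 4)) * C6"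
      unfolding na using x \<delta> by (intro sums) auto
    then have "(\<Sum>n\<in>A. norm (a n)) ^ 2 \<le> (T powr (- (1 / 2 + \<delta> / 4)) * C6) ^ 2"
      by (intro power_mono sum_nonneg) auto
    also have "\<dots> = T powr (- (1 + \<delta> / 2)) * C6 ^ 2"
      by (simp add: power_mult_distrib power2_eq_square powr_add[symmetric])
    finally have S1: "(\<Sum>n\<in>A. norm (a n)) ^ 2 \<le> T powr (- (1 + \<delta> / 2)) * C6 ^ 2" .
    have "(\<Sum>n\<in>A. norm (a n) ^ 2 * (real n + v)) = (\<Sum>n\<in>A. (real n + v) powr (- (2 * x + 1)))"
    proof (intro sum.cong refl)
      fix n assume "n \<in> A"
      then have "real n + v > 0" using n1 v by fastforce
      then have "norm (a n) ^ 2 * (real n + v) = (real n + v) powr (- (2 * x + 2)) * (real n + v) powr 1" by (simp add: na2)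
      also have "\<dots> = (real n + v) powr (- (2 * x + 2) + 1)" by (rule powr_add[symmetric])
      also have "- (2 * x + 2) + 1 = - (2 * x + 1)" by simp
      finally show "norm (a n) ^ 2 * (real n + v) = (real n + v) powr (- (2 * x + 1))" .
    qed
    also have "\<dots> \<le> T powr (- (1 + 3 / 4 * \<delta>)) * C6" using x \<delta> by (intro sums) auto
    finally have S3: "(\<Sum>n\<in>A. norm (a n) ^ 2 * (real n + v)) \<le> T powr (- (1 + 3 / 4 * \<delta>)) * C6" .
    have lnK: "1 + ln (real N2) \<le> 1 + 8 * ln T"
    proof (cases "N2 = 0")
      case False
      then have "ln (real N2) \<le> ln (T ^ 8)" using N2 T4 by (subst ln_le_cancel_iff) auto
      also have "\<dots> = 8 * ln T" using T4 by (simp add: ln_realpow)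
      finally show ?thesis by simp
    qed (use T4 in auto)
    have lnK0: "0 \<le> ln (real N2)" by (cases "N2 = 0") auto
    have "integral {T/4..4*T} (\<lambda>t. norm (G t) ^ 2) \<le> (4 * T - T / 4) * (\<Sum>n\<in>A. norm (a n) ^ 2) + 2 * (\<Sum>n\<in>A. norm (a n)) ^ 2
       + 4 * (1 + ln (real N2)) * (\<Sum>n\<in>A. norm (a n) ^ 2 * (real n + v))"
      unfolding G_def using T4 v by (intro mean_value_bound[OF A1, of _ _ _ v]) auto
    also have "\<dots> \<le> (4 * T) * (T powr (- (2 + \<delta> / 2)) * C6) + 2 * (T powr (- (1 + \<delta> / 2)) * C6 ^ 2)
       + 4 * (1 + 8 * ln T) * (T powr (- (1 + 3 / 4 * \<delta>)) * C6)"
      using T4 lnK lnK0 S1 S2 S3 v by (intro add_mono mult_mono) (auto intro!: sum_nonneg add_nonneg_nonneg)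
    also have "(4 * T) * (T powr (- (2 + \<delta> / 2)) * C6) = 4 * C6 * (T powr 1 * T powr (- (2 + \<delta> / 2)))" using T4 by simp
    also have "T powr 1 * T powr (- (2 + \<delta> / 2)) = T powr (- (1 + \<delta> / 2))" unfolding powr_add[symmetric] by simp
    also have "4 * (1 + 8 * ln T) * (T powr (- (1 + 3 / 4 * \<delta>)) * C6) = ((1 + 8 * ln T) * T powr (- \<delta> / 4)) * (4 * C6 * T powr (- (1 + \<delta> / 2)))"
    proof -
      have "- (1 + 3 / 4 * \<delta>) = - \<delta> / 4 + - (1 + \<delta> / 2)" by simp
      then have "T powr (- (1 + 3 / 4 * \<delta>)) = T powr (- \<delta> / 4) * T powr (- (1 + \<delta> / 2))" by (simp only: powr_add)
      then show ?thesis by (simp only: mult_ac)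
    qed
    also have "\<dots> \<le> 1 * (4 * C6 * T powr (- (1 + \<delta> / 2)))"
      using T T1[of T] C60 by (intro mult_right_mono) auto
    also have "4 * C6 * T powr (- (1 + \<delta> / 2)) + 2 * (T powr (- (1 + \<delta> / 2)) * C6 ^ 2) + 1 * (4 * C6 * T powr (- (1 + \<delta> / 2)))
       \<le> T powr (- (1 + \<delta> / 2)) * E" unfolding E_def by (simp add: algebra_simps)
    also have "- (1 + \<delta> / 2) = 1 + - (2 + \<delta> / 2)" by simp
    also have "T powr (1 + - (2 + \<delta> / 2)) * E = T * (T powr (- (2 + \<delta> / 2)) * E)" unfolding powr_add using T4 by simp
    also have "\<dots> \<le> (4 * T - T / 4) * (T powr (- (2 + \<delta> / 2)) * E)"
      using T4 E0 by (intro mult_right_mono) auto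
    finally have I2: "integral {T/4..4*T} (\<lambda>t. norm (G t) ^ 2) \<le> (4 * T - T / 4) * (T powr (- (2 + \<delta> / 2)) * E)" by simp
    have "integral {T/4..4*T} (\<lambda>t. norm (G t)) \<le> (4 * T - T / 4) * sqrt (T powr (- (2 + \<delta> / 2)) * E)"
    proof (rule integral_norm_le_sqrt[OF _ _ I2])
      show "continuous_on {T/4..4*T} G" unfolding G_def cis_conv_exp by (intro continuous_intros)
    qed (use T4 E0 in auto)
    also have "sqrt (T powr (- (2 + \<delta> / 2)) * E) = sqrt E * T powr (- 1 + - \<delta> / 4)"
    proof -
      have "sqrt (T powr (- (2 + \<delta> / 2))) = T powr (- (2 + \<delta> / 2) * (1 / 2))"
        unfolding powr_powr[symmetric] by (rule powr_half_sqrt[symmetric]) simp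
      also have "- (2 + \<delta> / 2) * (1 / 2) = - 1 + - \<delta> / 4" by simp
      finally show ?thesis unfolding real_sqrt_mult by (simp only: mult.commute)
    qed
    also have "(4 * T - T / 4) * (sqrt E * T powr (- 1 + - \<delta> / 4)) \<le> 4 * T * (sqrt E * T powr (- 1 + - \<delta> / 4))"
      using T4 E0 by (intro mult_right_mono) auto
    also have "\<dots> = 4 * sqrt E * T powr (- \<delta> / 4)" unfolding powr_add using T4 by (simp add: powr_minus field_simps)
    finally show "integral {T/4..4*T} (\<lambda>t. norm (\<Sum>n\<in>{Suc N..N2}. of_real ((real n + v) powr (- (x + 1))) * cis (- t * ln (real n + v))))
       \<le> 4 * sqrt E * T powr (- \<delta> / 4)" unfolding G_def a_def A_def .
  qed simp
qed

lemma norm_sum_zeta_term_le: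
  fixes x t :: real
  assumes "Complex x t \<noteq> 1"
  shows "norm (\<Sum>n\<in>{N..<N2}. zeta_term n (Complex x t)) \<le> norm (Complex x t) *
    integral {0..1} (\<lambda>v. norm (\<Sum>n\<in>{Suc N..N2}. of_real ((real n + v) powr (- (x + 1))) * cis (- t * ln (real n + v))))"
proof -
  let ?s = "Complex x t"
  let ?W = "\<lambda>v. \<Sum>n\<in>{Suc N..N2}. complex_of_real ((real n + v) powr (- (x + 1))) * cis (- t * ln (real n + v))"
  let ?f = "\<lambda>v. \<Sum>n\<in>{N..<N2}. ?s * (of_real (1 - v) * of_real (real (Suc n) + v) powr (- ?s - 1))"
  have f: "(?f has_integral (\<Sum>n\<in>{N..<N2}. zeta_term n ?s)) {0..1}"
    by (intro has_integral_sum zeta_term_integral assms) auto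
  have fW: "?f v = ?s * (of_real (1 - v) * ?W v)" if "v \<in> {0..1}" for v
  proof -
    have "- ?s - 1 = - Complex (x + 1) t" by (simp add: complex_eq_iff)
    then have "?f v = (\<Sum>n\<in>{N..<N2}. ?s * (of_real (1 - v) * (of_real ((real (Suc n) + v) powr (- (x + 1))) * cis (- t * ln (real (Suc n) + v)))))"
    proof (intro sum.cong refl)
      fix n assume "- ?s - 1 = - Complex (x + 1) t"
      moreover have "complex_of_real (real (Suc n) + v) powr (- Complex (x + 1) t)
         = of_real ((real (Suc n) + v) powr (- (x + 1))) * cis (- t * ln (real (Suc n) + v))"
        by (rule powr_line) (use that in simp)
      ultimately show "?s * (of_real (1 - v) * of_real (real (Suc n) + v) powr (- ?s - 1))
        = ?s * (of_real (1 - v) * (of_real ((real (Suc n) + v) powr (- (x + 1))) * cis (- t * ln (real (Suc n) + v))))"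
        by (simp only:)
    qed
    also have "\<dots> = (\<Sum>n\<in>{Suc N..N2}. ?s * (of_real (1 - v) * (of_real ((real n + v) powr (- (x + 1))) * cis (- t * ln (real n + v)))))"
      by (rule sum.reindex_bij_witness[of _ "\<lambda>n. n - 1" Suc]) auto
    finally show ?thesis by (simp only: sum_distrib_left)
  qed
  have "norm (integral {0..1} ?f) \<le> integral {0..1} (\<lambda>v. norm ?s * norm (?W v))"
  proof (rule integral_norm_bound_integral)
    show "?f integrable_on {0..1}" using f by blast
    have "continuous_on {0..1} ?W" unfolding cis_conv_exp by (intro continuous_intros) (auto simp: add_nonneg_eq_0_iff)
    then show "(\<lambda>v. norm ?s * norm (?W v)) integrable_on {0..1}"
      by (intro integrable_continuous_interval continuous_on_mult_left continuous_on_norm)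
    fix v :: real assume v: "v \<in> {0..1}"
    have "norm (?f v) = norm ?s * (\<bar>1 - v\<bar> * norm (?W v))" unfolding fW[OF v] norm_mult norm_of_real ..
    also have "\<dots> \<le> norm ?s * (1 * norm (?W v))" using v by (intro mult_left_mono mult_right_mono) auto
    finally show "norm (?f v) \<le> norm ?s * norm (?W v)" by simp
  qed
  also have "integral {0..1} ?f = (\<Sum>n\<in>{N..<N2}. zeta_term n ?s)" using f by (rule integral_unique)
  finally show ?thesis by simp
qed

lemma norm_dser_le:
  assumes "\<And>n. \<bar>D n\<bar> \<le> 1" "Re s \<ge> 0"
  shows "norm (dser D X s) \<le> real X"
proof -
  have "norm (dser D X s) \<le> (\<Sum>n\<in>{1..X}. 1)"
    unfolding dser_def
  proof (intro sum_norm_le)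
    fix n assume n: "n \<in> {1..X}"
    have "norm (complex_of_nat n powr (-s)) = real n powr (- Re s)"
      using n by (simp add: norm_powr_real_powr)
    also have "\<dots> \<le> real n powr 0" using n assms by (intro powr_mono) auto
    finally show "norm (of_real (D n) * of_nat n powr (-s)) \<le> 1"
      using n assms(1)[of n] by (auto simp: norm_mult intro: mult_le_one)
  qed
  then show ?thesis by simp
qed

lemma continuous_on_zeta_line: "x > 0 \<Longrightarrow> 0 < a \<Longrightarrow> continuous_on {a..b} (\<lambda>t. zeta (Complex x t))"
proof -
  assume "x > 0" "0 < a"
  then show ?thesis
    by (intro continuous_on_compose2[OF holomorphic_on_imp_continuous_on[OF zeta_holomorphic], of _ "\<lambda>t. Complex x t"])
       (auto simp: Complex_eq complex_eq_iff intro!: continuous_intros)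
qed

lemma continuous_on_dser: "continuous_on A (dser D X)"
  unfolding dser_def by (intro continuous_intros) auto

text \<open>The coefficient at n only involves divisors of n, so cutting zeta at
  \<open>N \<ge> Z\<close> does not disturb the vanishing below \<open>Z\<close>. The coefficient at
  1 is set to 0 in \<open>c\<close>; it accounts for the subtracted 1.\<close>

lemma zeta_mul_dser_decomp:
  assumes D: "\<And>n. \<bar>D n\<bar> \<le> 1" "D 1 = 1" "\<And>n. n > X \<Longrightarrow> D n = 0"
    and Z: "1 \<le> Z" "Z \<le> N" and van: "\<And>n. 1 < n \<Longrightarrow> n < Z \<Longrightarrow> dconv (\<lambda>_. 1) D n = 0"
  obtains c where "\<And>n. \<bar>c n\<bar> \<le> dcount n"
    "\<And>s. (\<Sum>n=1..N. of_nat n powr (-s)) * dser D X s - 1 = (\<Sum>n\<in>{Z..N * X}. of_real (c n) * of_nat n powr (-s))"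
proof -
  define o1 where "o1 = (\<lambda>n. if n \<le> N then 1 else (0::real))"
  define c where "c = (\<lambda>n. if n = 1 then 0 else dconv o1 D n)"
  have X1: "X \<ge> 1" using D(2) D(3)[of 1] by (cases "X = 0") auto
  have K: "N * X \<ge> 1" using X1 Z by (simp add: Suc_le_eq)
  show ?thesis
  proof (rule that[of c])
    show "\<bar>c n\<bar> \<le> dcount n" for n
      using abs_dconv_le_dcount[of o1 D n] D(1) by (auto simp: c_def o1_def dcount_nonneg)
    fix s
    have "(\<Sum>n=1..N. of_nat n powr (-s)) = dser o1 N s" by (simp add: dser_def o1_def)
    then have "(\<Sum>n=1..N. of_nat n powr (-s)) * dser D X s = dser (dconv o1 D) (N * X) s"
      by (simp only:) (rule dser_mult, auto simp: o1_def D(3))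
    also have "\<dots> = (\<Sum>n\<in>{1..N*X}. of_real (c n) * of_nat n powr (-s) + (if n = 1 then 1 else 0))"
      unfolding dser_def using D(2) Z by (intro sum.cong) (auto simp: c_def o1_def)
    also have "\<dots> = (\<Sum>n\<in>{1..N*X}. of_real (c n) * of_nat n powr (-s)) + 1"
      using K by (simp add: sum.distrib)
    also have "(\<Sum>n\<in>{1..N*X}. of_real (c n) * of_nat n powr (-s)) = (\<Sum>n\<in>{Z..N*X}. of_real (c n) * of_nat n powr (-s))"
    proof (rule sum.mono_neutral_right)
      show "\<forall>n\<in>{1..N*X} - {Z..N*X}. of_real (c n) * of_nat n powr (-s) = 0"
      proof
        fix n assume n: "n \<in> {1..N*X} - {Z..N*X}"
        have "c n = 0"
        proof (cases "n = 1")
          case False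
          then have n': "1 < n" "n < Z" using n by auto
          have "dconv o1 D n = dconv (\<lambda>_. 1) D n"
            using n' Z by (intro dconv_cong) (auto simp: o1_def dest!: dvd_imp_le)
          then show ?thesis using van[OF n'] False by (simp add: c_def)
        qed (simp add: c_def)
        then show "of_real (c n) * of_nat n powr (-s) = (0::complex)" by simp
      qed
    qed (use Z in auto)
    finally show "(\<Sum>n=1..N. of_nat n powr (-s)) * dser D X s - 1 = (\<Sum>n\<in>{Z..N * X}. of_real (c n) * of_nat n powr (-s))"
      by simp
  qed
qed

text \<open>Zeta is replaced by its partial sum up to T. The product of this with the mollifier
  contributes the tail from Z on; the boundary term, the Euler-Maclaurin terms up to
  \<open>N2\<close> and the rest all save at least T powr (- \<delta> / 4) and lose at most a factor
  X <= T powr (\<delta> / 32) for the mollifier. As Z <= T, the first contribution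
  dominates.\<close>

lemma mollified_zeta_mean:
  fixes \<delta> :: real assumes \<delta>: "0 < \<delta>" "\<delta> < 1 / 2"
  obtains C T0 where "C > 0" "T0 \<ge> 4" "\<And>T D X Z x. T \<ge> T0 \<Longrightarrow> (\<And>n. \<bar>D n\<bar> \<le> 1) \<Longrightarrow> D 1 = 1 \<Longrightarrow> (\<And>n. n > X \<Longrightarrow> D n = 0) \<Longrightarrow>
     real X \<le> T powr (\<delta> / 32) \<Longrightarrow> 1 \<le> Z \<Longrightarrow> real Z \<le> T \<Longrightarrow> (\<And>n. 1 < n \<Longrightarrow> n < Z \<Longrightarrow> dconv (\<lambda>_. 1) D n = 0) \<Longrightarrow>
     1 / 2 + \<delta> / 2 \<le> x \<Longrightarrow> x \<le> 4 \<Longrightarrow>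
     integral {T/4..4*T} (\<lambda>t. norm (zeta (Complex x t) * dser D X (Complex x t) - 1)) \<le> C * T * real Z powr (- \<delta> / 8)"
proof -
  obtain C1 where C1: "C1 > 0" "\<And>T Z K c x. T \<ge> 4 \<Longrightarrow> 1 \<le> Z \<Longrightarrow> real Z \<le> T \<Longrightarrow> real K \<le> T powr (1 + \<delta> / 16) \<Longrightarrow>
     1 / 2 + \<delta> / 2 \<le> x \<Longrightarrow> (\<And>n. \<bar>c n\<bar> \<le> dcount n) \<Longrightarrow>
     integral {T/4..4*T} (\<lambda>t. norm (\<Sum>n\<in>{Z..K}. of_real (c n) * of_nat n powr (- Complex x t))) \<le> C1 * T * real Z powr (- \<delta> / 8)"
    by (rule mean_tail_le[OF \<delta>]) (blast intro: that)
  obtain E T0 where E: "E > 0" "T0 \<ge> 4" "\<And>T N N2 x v. T \<ge> T0 \<Longrightarrow> T \<le> real (Suc N) \<Longrightarrow> real N2 \<le> T ^ 8 \<Longrightarrow> 1 / 2 + \<delta> / 2 \<le> x \<Longrightarrow> v \<ge> 0 \<Longrightarrow>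
     integral {T/4..4*T} (\<lambda>t. norm (\<Sum>n\<in>{Suc N..N2}. of_real ((real n + v) powr (- (x + 1))) * cis (- t * ln (real n + v))))
       \<le> E * T powr (- \<delta> / 4)"
    by (rule mean_zeta_term_le[OF \<delta>]) (blast intro: that)
  define C5 where "C5 = (\<Sum>n. real n powr (- (5 / 4)))"
  have C50: "C5 \<ge> 0" unfolding C5_def by (intro suminf_nonneg summable_nat_powr) auto
  show ?thesis
  proof (rule that[of "C1 + 32 + 8 * E + 128 * C5" T0])
    show "C1 + 32 + 8 * E + 128 * C5 > 0" using C1(1) E(1) C50 by linarith
    show "T0 \<ge> 4" by fact
    fix T x :: real and X Z :: nat and D :: "nat \<Rightarrow> real"
    assume T0: "T \<ge> T0" and D: "\<And>n. \<bar>D n\<bar> \<le> 1" "D 1 = 1" "\<And>n. n > X \<Longrightarrow> D n = 0"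
      and X: "real X \<le> T powr (\<delta> / 32)" and Z: "1 \<le> Z" "real Z \<le> T"
      and van: "\<And>n. 1 < n \<Longrightarrow> n < Z \<Longrightarrow> dconv (\<lambda>_. 1) D n = 0" and x: "1 / 2 + \<delta> / 2 \<le> x" "x \<le> 4"
    have T: "T \<ge> 4" using T0 E(2) by linarith
    define N where "N = nat \<lfloor>T\<rfloor>"
    have N: "real N \<le> T" "T \<le> real (Suc N)" "T / 2 \<le> real N" "Z \<le> N" "N \<ge> 1"
      using T Z by (auto simp: N_def le_nat_iff le_floor_iff) linarith+
    \<comment> \<open>The eighth power turns the saving N2 powr (- 1 / 4) into N powr (- 2), which
      beats |s| = O(T).\<close>
    define N2 where "N2 = N ^ 8"
    have N2: "N \<le> N2" "N2 > 0" "real N2 \<le> T ^ 8"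
    proof -
      show "N \<le> N2" unfolding N2_def using N(5) by (intro self_le_power) auto
      then show "N2 > 0" using N(5) by linarith
      show "real N2 \<le> T ^ 8" unfolding N2_def of_nat_power using N(1) by (intro power_mono) auto
    qed
    obtain c where c: "\<And>n. \<bar>c n\<bar> \<le> dcount n"
      "\<And>s. (\<Sum>n=1..N. of_nat n powr (-s)) * dser D X s - 1 = (\<Sum>n\<in>{Z..N * X}. of_real (c n) * of_nat n powr (-s))"
      by (rule zeta_mul_dser_decomp[OF D Z(1) N(4) van]) auto
    define G where "G = (\<lambda>t. \<Sum>n\<in>{Z..N * X}. of_real (c n) * of_nat n powr (- Complex x t))"
    define W where "W = (\<lambda>t v. \<Sum>n\<in>{Suc N..N2}. complex_of_real ((real n + v) powr (- (x + 1))) * cis (- t * ln (real n + v)))"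
    define H where "H = (\<lambda>t. integral {0..1} (\<lambda>v. norm (W t v)))"
    have cW: "continuous_on (cbox (T/4, 0) (4*T, 1)) (\<lambda>(t, v). norm (W t v))"
      unfolding W_def cis_conv_exp case_prod_unfold
      by (intro continuous_intros) (auto simp: cbox_Pair_eq add_pos_nonneg)
    have cH: "continuous_on {T/4..4*T} H"
      unfolding H_def box_real[symmetric]
      by (rule integral_continuous_on_param) (use cW in \<open>simp add: cbox_Pair_eq\<close>)
    have cG: "continuous_on {T/4..4*T} G"
      unfolding G_def
    proof (intro continuous_on_sum continuous_on_mult continuous_on_const)
      fix n assume "n \<in> {Z..N * X}"
      then show "continuous_on {T/4..4*T} (\<lambda>t. of_nat n powr (- Complex x t))"
        using Z by (intro continuous_on_powr_complex continuous_intros isCont_Complex_line) (auto simp: Complex_eq intro!: continuous_intros)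
    qed
    have pt: "norm (zeta (Complex x t) * dser D X (Complex x t) - 1)
       \<le> norm (G t) + (real X * (8 / sqrt T) + (8 * T * real X) * H t + real X * (32 * C5 / T))"
      if t: "t \<in> {T/4..4*T}" for t
    proof -
      define s where "s = Complex x t"
      have t4: "T / 4 \<le> t" "t \<le> 4 * T" using t by auto
      have s: "Re s > 1 / 2" "s \<noteq> 1" using x t4 T \<delta> by (auto simp: s_def complex_eq_iff)
      have ns: "norm s \<le> 8 * T" using cmod_le[of s] x t4 T \<delta> by (simp add: s_def)
      define M where "M = dser D X s"
      have M: "norm M \<le> real X" unfolding M_def by (rule norm_dser_le[OF D(1)]) (use s in auto)
      define S where "S = (\<Sum>n=1..N. of_nat n powr (-s))"
      define E2 where "E2 = of_nat (Suc N) powr (1 - s) / (1 - s)"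
      define Zt where "Zt = (\<Sum>n\<in>{N..<N2}. zeta_term n s)"
      have E2: "norm E2 \<le> 8 / sqrt T"
      proof -
        have "norm (complex_of_nat (Suc N) powr (1 - s)) = real (Suc N) powr (1 - x)"
          using norm_powr_real_powr[of "of_nat (Suc N)" "1 - s"] by (simp add: s_def)
        also have "\<dots> \<le> real (Suc N) powr (1 / 2)" using x \<delta> by (intro powr_mono) auto
        also have "\<dots> \<le> (4 * T) powr (1 / 2)" using N T by (intro powr_mono2) auto
        also have "\<dots> = 2 * sqrt T" using T by (simp add: powr_half_sqrt real_sqrt_mult)
        finally have 1: "norm (complex_of_nat (Suc N) powr (1 - s)) \<le> 2 * sqrt T" .
        have "T / 4 \<le> norm (1 - s)" using abs_Im_le_cmod[of "1 - s"] t4 T by (simp add: s_def)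
        then have "norm E2 \<le> 2 * sqrt T / (T / 4)" unfolding E2_def norm_divide using 1 T by (intro frac_le) auto
        also have "\<dots> = 8 / sqrt T" using T real_sqrt_mult_self[of T] by (simp add: field_simps)
        finally show ?thesis .
      qed
      have Zt: "norm Zt \<le> 8 * T * H t"
      proof -
        have "norm Zt \<le> norm s * H t"
          unfolding Zt_def H_def W_def s_def by (rule norm_sum_zeta_term_le) (use s in \<open>simp add: s_def\<close>)
        also have "\<dots> \<le> 8 * T * H t" unfolding H_def
          using ns by (intro mult_right_mono Henstock_Kurzweil_Integration.integral_nonneg)
            (auto intro!: integrable_continuous_interval continuous_intros simp: W_def cis_conv_exp)
        finally show ?thesis .
      qed
      have R: "norm (zeta s - (S - E2 + Zt)) \<le> 32 * C5 / T"
      proof -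
        have "norm (zeta s - (S - E2 + Zt)) \<le> norm s * (real N2 powr (- 1 / 4) * C5)"
          unfolding S_def E2_def Zt_def C5_def by (rule zeta_partial_sum[OF s N2(1,2)])
        also have "real N2 powr (- 1 / 4) = real N powr (- 2)"
        proof -
          have "real N2 = real N powr 8" using N(5) by (simp add: N2_def powr_realpow flip: powr_numeral)
          then have "real N2 powr (- 1 / 4) = real N powr (8 * (- 1 / 4))" by (simp only: powr_powr)
          then show ?thesis by simp
        qed
        also have "\<dots> \<le> (T / 2) powr (- 2)" using N T by (intro powr_mono2') auto
        also have "(T / 2) powr (- 2) = 4 / T ^ 2" using T by (simp add: powr_minus powr_numeral field_simps)
        also have "norm s * (4 / T ^ 2 * C5) \<le> 8 * T * (4 / T ^ 2 * C5)"
          using ns C50 by (intro mult_right_mono) auto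
        also have "\<dots> = 32 * C5 / T" using T by (simp add: power2_eq_square)
        finally show ?thesis using C50 by (simp add: mult_left_mono mult_right_mono)
      qed
      have GS: "S * M - 1 = G t" unfolding S_def M_def G_def s_def by (rule c(2))
      have "zeta s * M - 1 = G t - M * E2 + M * Zt + M * (zeta s - (S - E2 + Zt))"
        unfolding GS[symmetric] by (simp add: algebra_simps)
      also have "norm \<dots> \<le> norm (G t) + norm M * norm E2 + norm M * norm Zt + norm M * norm (zeta s - (S - E2 + Zt))"
        unfolding norm_mult[symmetric]
        by (meson add_mono norm_triangle_ineq norm_triangle_ineq4 order_refl order_trans)
      also have "\<dots> \<le> norm (G t) + real X * (8 / sqrt T) + real X * (8 * T * H t) + real X * (32 * C5 / T)"
        using M E2 Zt R T C50 by (intro add_mono mult_mono order_refl) auto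
      finally show ?thesis unfolding s_def M_def by (simp add: mult_ac)
    qed
    have cI: "(\<lambda>t. norm (G t)) integrable_on {T/4..4*T}" "H integrable_on {T/4..4*T}"
      by (intro integrable_continuous_interval continuous_intros cG cH)+
    have "integral {T/4..4*T} (\<lambda>t. norm (zeta (Complex x t) * dser D X (Complex x t) - 1))
      \<le> integral {T/4..4*T} (\<lambda>t. norm (G t) + (real X * (8 / sqrt T) + (8 * T * real X) * H t + real X * (32 * C5 / T)))"
    proof (rule integral_le)
      have "continuous_on {T/4..4*T} (\<lambda>t. dser D X (Complex x t))"
        by (rule continuous_on_compose2[OF continuous_on_dser, of _ "\<lambda>t. Complex x t" UNIV]) (auto simp: Complex_eq intro!: continuous_intros)
      then show "(\<lambda>t. norm (zeta (Complex x t) * dser D X (Complex x t) - 1)) integrable_on {T/4..4*T}"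
        using x T \<delta> by (intro integrable_continuous_interval continuous_intros continuous_on_zeta_line) auto
      show "(\<lambda>t. norm (G t) + (real X * (8 / sqrt T) + (8 * T * real X) * H t + real X * (32 * C5 / T))) integrable_on {T/4..4*T}"
        by (intro integrable_continuous_interval continuous_intros cG cH)
    qed (rule pt)
    also have "\<dots> = integral {T/4..4*T} (\<lambda>t. norm (G t)) + ((4 * T - T / 4) * (real X * (8 / sqrt T))
         + 8 * T * real X * integral {T/4..4*T} H + (4 * T - T / 4) * (real X * (32 * C5 / T)))"
    proof (rule integral_unique, intro has_integral_add has_integral_mult_right integrable_integral cI)
      show c: "((\<lambda>t. k) has_integral (4 * T - T / 4) * k) {T/4..4*T}" for k
        using has_integral_const_real[of k "T/4" "4*T"] T by simp
      show "((\<lambda>t. real X * (32 * C5 / T)) has_integral (4 * T - T / 4) * (real X * (32 * C5 / T))) {T/4..4*T}" by (rule c)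
    qed
    also have "\<dots> \<le> C1 * T * real Z powr (- \<delta> / 8) + (4 * T * (real X * (8 / sqrt T))
         + 8 * T * real X * (E * T powr (- \<delta> / 4)) + 4 * T * (real X * (32 * C5 / T)))"
    proof (intro add_mono mult_left_mono mult_right_mono)
      have "real (N * X) \<le> T * T powr (\<delta> / 32)" unfolding of_nat_mult using N X T by (intro mult_mono) auto
      also have "\<dots> = T powr (1 + \<delta> / 32)" using T by (simp add: powr_add)
      also have "\<dots> \<le> T powr (1 + \<delta> / 16)" using T \<delta> by (intro powr_mono) auto
      finally show "integral {T/4..4*T} (\<lambda>t. norm (G t)) \<le> C1 * T * real Z powr (- \<delta> / 8)"
        unfolding G_def by (intro C1(2) T Z c(1) x)
      have "integral {T/4..4*T} H = integral (cbox (T/4) (4*T)) (\<lambda>t. integral (cbox 0 1) (\<lambda>v. norm (W t v)))"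
        by (simp add: H_def)
      also have "\<dots> = integral (cbox 0 1) (\<lambda>v. integral (cbox (T/4) (4*T)) (\<lambda>t. norm (W t v)))"
        by (rule integral_swap_continuous[OF cW])
      also have "\<dots> \<le> integral (cbox 0 1) (\<lambda>v::real. E * T powr (- \<delta> / 4))"
      proof (rule integral_le)
        have "continuous_on (cbox 0 1) (\<lambda>v. integral (cbox (T/4) (4*T)) (\<lambda>t. norm (W t v)))"
        proof (rule integral_continuous_on_param)
          have "continuous_on (cbox (0::real) 1 \<times> cbox (T/4) (4*T)) ((\<lambda>(t, v). norm (W t v)) \<circ> prod.swap)"
            by (intro continuous_on_compose continuous_on_swap continuous_on_subset[OF cW]) (auto simp: cbox_Pair_eq)
          then show "continuous_on (cbox (0::real) 1 \<times> cbox (T/4) (4*T)) (\<lambda>(v, t). norm (W t v))"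
            by (simp add: o_def case_prod_unfold)
        qed
        then show "(\<lambda>v. integral (cbox (T/4) (4*T)) (\<lambda>t. norm (W t v))) integrable_on cbox 0 1"
          by (rule integrable_continuous)
        show "integral (cbox (T/4) (4*T)) (\<lambda>t. norm (W t v)) \<le> E * T powr (- \<delta> / 4)" if "v \<in> cbox 0 1" for v
          unfolding W_def using E(3)[OF T0 N(2) N2(3) x(1), of v] that by simp
      qed auto
      also have "\<dots> = E * T powr (- \<delta> / 4)" by simp
      finally show "integral {T/4..4*T} H \<le> E * T powr (- \<delta> / 4)" .
    qed (use T C50 in auto)
    also have "\<dots> \<le> C1 * T * real Z powr (- \<delta> / 8) + (32 * (T * real Z powr (- \<delta> / 8))
         + 8 * E * (T * real Z powr (- \<delta> / 8)) + 128 * C5 * (T * real Z powr (- \<delta> / 8)))"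
    proof (intro add_mono order_refl)
      have XT: "real X * T powr (- p) \<le> real Z powr (- \<delta> / 8)" if "p \<ge> \<delta> / 4" for p
      proof -
        have "real X * T powr (- p) \<le> T powr (\<delta> / 32) * T powr (- p)" using X by (intro mult_right_mono) auto
        also have "\<dots> = T powr (\<delta> / 32 + - p)" by (rule powr_add[symmetric])
        also have "\<dots> \<le> T powr (- \<delta> / 8)" using T that \<delta> by (intro powr_mono) auto
        also have "\<dots> \<le> real Z powr (- \<delta> / 8)" using Z \<delta> by (intro powr_mono2') auto
        finally show ?thesis .
      qed
      have "T powr (- (1 / 2)) = 1 / sqrt T"
        unfolding powr_minus_divide using T by (subst powr_half_sqrt) auto
      then have "4 * T * (real X * (8 / sqrt T)) = 32 * T * (real X * T powr (- (1 / 2)))" by simp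
      also have "\<dots> \<le> 32 * T * real Z powr (- \<delta> / 8)" using T \<delta> by (intro mult_left_mono XT) auto
      finally show "4 * T * (real X * (8 / sqrt T)) \<le> 32 * (T * real Z powr (- \<delta> / 8))" by simp
      have "8 * E * T * (real X * T powr (- (\<delta> / 4))) \<le> 8 * E * T * real Z powr (- \<delta> / 8)"
        using T E(1) by (intro mult_left_mono XT) auto
      then show "8 * T * real X * (E * T powr (- \<delta> / 4)) \<le> 8 * E * (T * real Z powr (- \<delta> / 8))"
        by (simp add: mult_ac)
      have "128 * C5 * T * (real X * T powr (- 1)) \<le> 128 * C5 * T * real Z powr (- \<delta> / 8)"
        using T C50 \<delta> by (intro mult_left_mono XT) auto
      moreover have "T powr (- 1) = 1 / T" using T by (simp add: powr_minus_divide)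
      ultimately show "4 * T * (real X * (32 * C5 / T)) \<le> 128 * C5 * (T * real Z powr (- \<delta> / 8))"
        using T by (simp add: mult_ac)
    qed
    also have "\<dots> = (C1 + 32 + 8 * E + 128 * C5) * T * real Z powr (- \<delta> / 8)" by (simp add: algebra_simps)
    finally show "integral {T/4..4*T} (\<lambda>t. norm (zeta (Complex x t) * dser D X (Complex x t) - 1))
       \<le> (C1 + 32 + 8 * E + 128 * C5) * T * real Z powr (- \<delta> / 8)" .
  qed
qed

text \<open>The sides of the rectangle \<open>[w, 4] \<times> [-1, 1]\<close>, which is translated vertically.\<close>

definition rect_sides :: "real \<Rightarrow> nat \<Rightarrow> complex \<times> complex" where
  "rect_sides w k = (if k = 0 then (Complex w (-1), Complex 4 (-1)) else if k = 1 then (Complex 4 (-1), Complex 4 1)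
     else if k = 2 then (Complex 4 1, Complex w 1) else (Complex w 1, Complex w (-1)))"

definition side_point :: "real \<Rightarrow> nat \<Rightarrow> real \<Rightarrow> complex" where
  "side_point w k x = linepath (fst (rect_sides w k)) (snd (rect_sides w k)) x"

definition side_len :: "real \<Rightarrow> nat \<Rightarrow> real" where
  "side_len w k = norm (snd (rect_sides w k) - fst (rect_sides w k))"

text \<open>The arc length integral of |f| along the boundary of the rectangle shifted up by
  \<open>y\<close>.\<close>

definition rect_mean :: "real \<Rightarrow> (complex \<Rightarrow> complex) \<Rightarrow> real \<Rightarrow> real" where
  "rect_mean w f y = (\<Sum>k<4. side_len w k * integral {0..1} (\<lambda>x. norm (f (side_point w k x + \<i> * of_real y))))"

lemma integral_norm_nonneg: "0 \<le> integral S (\<lambda>x. norm (f x))"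
  by (cases "(\<lambda>x. norm (f x)) integrable_on S")
     (auto simp: not_integrable_integral intro: Henstock_Kurzweil_Integration.integral_nonneg)

lemma linepath_translate: "linepath (a + c) (b + c) x = linepath a b x + (c::complex)"
  by (simp add: linepath_def algebra_simps)

lemma side_point_cases:
  assumes "w \<le> 4" "x \<in> {0..1}"
  shows "Re (side_point w k x) \<in> {w..4}" "Im (side_point w k x) \<in> {-1..1}"
    "Re (side_point w k x) = w \<or> Re (side_point w k x) = 4 \<or> \<bar>Im (side_point w k x)\<bar> = 1"
proof -
  have c: "(1 - x) * w + x * 4 \<in> {w..4}" "(1 - x) * 4 + x * w \<in> {w..4}"
    using assms mult_left_mono[of w 4 x] mult_left_mono[of w 4 "1 - x"] by (auto simp: algebra_simps)
  show "Re (side_point w k x) \<in> {w..4}" "Im (side_point w k x) \<in> {-1..1}"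
    "Re (side_point w k x) = w \<or> Re (side_point w k x) = 4 \<or> \<bar>Im (side_point w k x)\<bar> = 1"
    using assms c by (auto simp: side_point_def rect_sides_def linepath_def algebra_simps)
qed

lemma sum_side_len: "w \<le> 4 \<Longrightarrow> (\<Sum>k<4. side_len w k) = 2 * (4 - w) + 4"
  by (simp add: side_len_def rect_sides_def numeral_eq_Suc norm_complex_def real_sqrt_abs2 power2_eq_square)

lemma continuous_on_side_point: "continuous_on A (side_point w k)"
  unfolding side_point_def linepath_def by (intro continuous_intros)

lemma norm_contour_integral_linepath_le:
  assumes g: "continuous_on (closed_segment a b) g"
    and h: "continuous_on {0..1} h" "\<And>x. x \<in> {0..1} \<Longrightarrow> norm (g (linepath a b x)) \<le> h x"
  shows "norm (contour_integral (linepath a b) g) \<le> norm (b - a) * integral {0..1} h"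
proof -
  have "(g has_contour_integral contour_integral (linepath a b) g) (linepath a b)"
    by (intro has_contour_integral_integral contour_integrable_continuous_linepath g)
  then have i: "((\<lambda>x. g (linepath a b x) * (b - a)) has_integral contour_integral (linepath a b) g) {0..1}"
    by (simp add: has_contour_integral_linepath)
  have "norm (integral {0..1} (\<lambda>x. g (linepath a b x) * (b - a))) \<le> integral {0..1} (\<lambda>x. norm (b - a) * h x)"
  proof (rule integral_norm_bound_integral)
    show "(\<lambda>x. g (linepath a b x) * (b - a)) integrable_on {0..1}" using i by blast
    show "(\<lambda>x. norm (b - a) * h x) integrable_on {0..1}"
      by (intro integrable_continuous_interval continuous_intros h(1))
    show "norm (g (linepath a b x) * (b - a)) \<le> norm (b - a) * h x" if "x \<in> {0..1}" for x
      unfolding norm_mult mult.commute[of _ "norm (b - a)"] by (intro mult_left_mono h(2) that norm_ge_zero)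
  qed
  then show ?thesis using integral_unique[OF i] by simp
qed

text \<open>Cauchy's integral formula: the point keeps distance at least \<open>d\<close> from the
  vertical sides by its abscissa and distance 1 >= d from the horizontal ones, so the kernel is at
  most 1 / d.\<close>

lemma norm_le_rect_mean:
  assumes f: "f holomorphic_on {z. Re z > 0} \<inter> {z. Im z > 0}" and w: "0 < w" "w \<le> 4" and d: "0 < d" "d \<le> 1"
    and x: "x \<in> {w + d..4 - d}" and y: "y > 1"
  shows "2 * pi * d * norm (f (Complex x y)) \<le> rect_mean w f y"
proof -
  let ?U = "{z. Re z > 0} \<inter> {z. Im z > 0}"
  define z where "z = Complex x y"
  define a1 where "a1 = Complex w (-1) + \<i> * of_real y"
  define a2 where "a2 = Complex 4 (-1) + \<i> * of_real y"
  define a3 where "a3 = Complex 4 1 + \<i> * of_real y"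
  define a4 where "a4 = Complex w 1 + \<i> * of_real y"
  define g where "g = (\<lambda>u. f u / (u - z))"
  define p where "p = rectpath a1 a3"
  have re: "Complex (Re a3) (Im a1) = a2" "Complex (Re a1) (Im a3) = a4"
    by (auto simp: a1_def a2_def a3_def a4_def complex_eq_iff)
  have cU: "convex ?U" by (intro convex_Int convex_halfspace_Re_gt convex_halfspace_Im_gt)
  have oU: "open ?U" by (intro open_Int open_halfspace_Re_gt open_halfspace_Im_gt)
  have zb: "z \<in> box a1 a3" using x y d w by (auto simp: z_def a1_def a3_def in_box_complex_iff)
  have pim: "path_image p \<subseteq> cbox a1 a3 - box a1 a3" unfolding p_def
    by (rule path_image_rectpath_cbox_minus_box[THEN equalityD1]) (use w in \<open>auto simp: a1_def a3_def\<close>)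
  have cbU: "cbox a1 a3 \<subseteq> ?U" using w y by (auto simp: a1_def a3_def in_cbox_complex_iff)
  have zU: "z \<in> ?U" using x y w d by (auto simp: z_def)
  have "(g has_contour_integral (2 * pi * \<i> * winding_number p z * f z)) p"
    unfolding g_def
  proof (rule Cauchy_integral_formula_convex_simple[OF cU f])
    show "z \<in> interior ?U" using zU by (simp only: interior_open[OF oU])
    show "path_image p \<subseteq> ?U - {z}" using pim cbU zb by blast
  qed (auto simp: p_def)
  moreover have "winding_number p z = 1" unfolding p_def by (rule winding_number_rectpath[OF zb])
  ultimately have ci_eq: "contour_integral p g = 2 * pi * \<i> * f z" by (simp add: contour_integral_unique)
  have side: "continuous_on (closed_segment (fst (rect_sides w k) + \<i> * of_real y) (snd (rect_sides w k) + \<i> * of_real y)) g \<and>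
     norm (contour_integral (linepath (fst (rect_sides w k) + \<i> * of_real y) (snd (rect_sides w k) + \<i> * of_real y)) g)
      \<le> side_len w k * integral {0..1} (\<lambda>x. norm (f (side_point w k x + \<i> * of_real y)) / d)" for k
  proof -
    let ?a = "fst (rect_sides w k) + \<i> * of_real y" and ?b = "snd (rect_sides w k) + \<i> * of_real y"
    have lp: "linepath ?a ?b t = side_point w k t + \<i> * of_real y" for t
      by (simp add: linepath_translate side_point_def)
    have far: "d \<le> norm (side_point w k t + \<i> * of_real y - z)" "side_point w k t + \<i> * of_real y \<in> ?U" if t: "t \<in> {0..1}" for t
    proof -
      let ?q = "side_point w k t + \<i> * of_real y - z"
      have "d \<le> max \<bar>Re ?q\<bar> \<bar>Im ?q\<bar>"
        using side_point_cases(3)[OF w(2) t, of k] x d by (auto simp: z_def)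
      then show "d \<le> norm ?q" using abs_Re_le_cmod[of ?q] abs_Im_le_cmod[of ?q] by linarith
      show "side_point w k t + \<i> * of_real y \<in> ?U"
        using side_point_cases(1,2)[OF w(2) t, of k] w y by auto
    qed
    have seg: "\<exists>t\<in>{0..1}. u = side_point w k t + \<i> * of_real y" if "u \<in> closed_segment ?a ?b" for u
      using that unfolding linepath_image_01[symmetric] lp by auto
    have cg: "continuous_on (closed_segment ?a ?b) g"
      unfolding g_def
    proof (intro continuous_intros ballI)
      show "continuous_on (closed_segment ?a ?b) f"
        by (rule continuous_on_subset[OF holomorphic_on_imp_continuous_on[OF f]]) (use seg far(2) in blast)
      fix u assume "u \<in> closed_segment ?a ?b"
      then obtain t where "t \<in> {0..1}" "u = side_point w k t + \<i> * of_real y" using seg by blast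
      then show "u - z \<noteq> 0" using far(1)[of t] d by auto
    qed
    have "continuous_on {0..1} (\<lambda>x. f (side_point w k x + \<i> * of_real y))"
      by (rule continuous_on_compose2[OF holomorphic_on_imp_continuous_on[OF f]])
         (use far(2) in \<open>auto intro!: continuous_intros continuous_on_side_point\<close>)
    then have "norm (contour_integral (linepath ?a ?b) g) \<le> norm (?b - ?a) * integral {0..1} (\<lambda>x. norm (f (side_point w k x + \<i> * of_real y)) / d)"
    proof (intro norm_contour_integral_linepath_le[OF cg])
      show "norm (g (linepath ?a ?b x)) \<le> norm (f (side_point w k x + \<i> * of_real y)) / d" if "x \<in> {0..1}" for x
        unfolding lp g_def norm_divide using far(1)[OF that] d by (intro frac_le) auto
    qed (use d in \<open>auto intro!: continuous_intros\<close>)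
    then show ?thesis using cg by (simp add: side_len_def)
  qed
  have s4: "fst (rect_sides w 0) + \<i> * of_real y = a1" "snd (rect_sides w 0) + \<i> * of_real y = a2"
    "fst (rect_sides w 1) + \<i> * of_real y = a2" "snd (rect_sides w 1) + \<i> * of_real y = a3"
    "fst (rect_sides w 2) + \<i> * of_real y = a3" "snd (rect_sides w 2) + \<i> * of_real y = a4"
    "fst (rect_sides w 3) + \<i> * of_real y = a4" "snd (rect_sides w 3) + \<i> * of_real y = a1"
    by (auto simp: rect_sides_def a1_def a2_def a3_def a4_def)
  note sides = side[of 0, unfolded s4] side[of 1, unfolded s4] side[of 2, unfolded s4] side[of 3, unfolded s4]
  have ci: "g contour_integrable_on linepath a1 a2" "g contour_integrable_on linepath a2 a3"
     "g contour_integrable_on linepath a3 a4" "g contour_integrable_on linepath a4 a1"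
    using sides by (auto intro: contour_integrable_continuous_linepath)
  have eq: "contour_integral p g = contour_integral (linepath a1 a2) g + (contour_integral (linepath a2 a3) g +
      (contour_integral (linepath a3 a4) g + contour_integral (linepath a4 a1) g))"
    unfolding p_def rectpath_def Let_def re using ci by (simp add: contour_integral_join)
  have n4: "norm (a + (b + (c + e))) \<le> norm a + (norm b + (norm c + norm e))" for a b c e :: complex
    using norm_triangle_ineq[of a "b + (c + e)"] norm_triangle_ineq[of b "c + e"] norm_triangle_ineq[of c e] by linarith
  have "norm (contour_integral p g) \<le> norm (contour_integral (linepath a1 a2) g) + (norm (contour_integral (linepath a2 a3) g) +
      (norm (contour_integral (linepath a3 a4) g) + norm (contour_integral (linepath a4 a1) g)))"
    unfolding eq by (rule n4)
  also have "\<dots> \<le> (\<Sum>k<4. side_len w k * integral {0..1} (\<lambda>x. norm (f (side_point w k x + \<i> * of_real y)) / d))"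
  proof -
    have s4: "(\<Sum>k<4. F k) = F 0 + (F 1 + (F 2 + F 3))" for F :: "nat \<Rightarrow> real"
      by (simp add: eval_nat_numeral)
    show ?thesis unfolding s4 using sides by (intro add_mono) blast+
  qed
  also have "\<dots> = rect_mean w f y / d"
    by (simp add: rect_mean_def sum_divide_distrib)
  finally have "norm (contour_integral p g) \<le> rect_mean w f y / d" .
  moreover have "norm (2 * pi * \<i> * f z) = 2 * pi * norm (f z)" by (simp add: norm_mult)
  ultimately show ?thesis using ci_eq d by (simp add: z_def field_simps)
qed

text \<open>By Fubini: as y varies, each fixed boundary point runs along a vertical segment
  contained in [a - 1, b + 1], where \<open>B\<close> applies. The boundary has length 2 (4 - w) + 4
  <= 12.\<close>

lemma integral_rect_mean_le:
  assumes f: "continuous_on ({z. Re z > 0} \<inter> {z. Im z > 0}) f" and w: "0 < w" "w \<le> 4" and ab: "1 < a" "a \<le> b"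
    and B: "\<And>x. x \<in> {w..4} \<Longrightarrow> integral {a - 1..b + 1} (\<lambda>t. norm (f (Complex x t))) \<le> B"
  shows "continuous_on {a..b} (rect_mean w f)" "integral {a..b} (rect_mean w f) \<le> 12 * B"
proof -
  let ?U = "{z. Re z > 0} \<inter> {z. Im z > 0}"
  have c2: "continuous_on (cbox (a, 0) (b, 1)) (\<lambda>(y, x). norm (f (side_point w k x + \<i> * of_real y)))" for k
    unfolding case_prod_unfold
  proof (intro continuous_on_norm continuous_on_compose2[OF f])
    show "continuous_on (cbox (a, 0) (b, 1)) (\<lambda>q. side_point w k (snd q) + \<i> * of_real (fst q))"
      by (intro continuous_intros continuous_on_compose2[OF continuous_on_side_point[of UNIV]]) auto
    show "(\<lambda>q. side_point w k (snd q) + \<i> * of_real (fst q)) ` cbox (a, 0) (b, 1) \<subseteq> ?U"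
    proof (rule image_subsetI)
      fix q assume "q \<in> cbox (a, 0::real) (b, 1)"
      then have "snd q \<in> {0..1}" "fst q \<ge> a" by (auto simp: cbox_Pair_eq)
      from side_point_cases[OF w(2) this(1), of k] this(2)
      show "side_point w k (snd q) + \<i> * of_real (fst q) \<in> ?U" using w ab by auto
    qed

  qed
  have c1: "continuous_on {a..b} (\<lambda>y. integral {0..1} (\<lambda>x. norm (f (side_point w k x + \<i> * of_real y))))" for k
    unfolding box_real[symmetric]
    by (rule integral_continuous_on_param) (use c2 in \<open>simp add: cbox_Pair_eq\<close>)
  show cr: "continuous_on {a..b} (rect_mean w f)"
    unfolding rect_mean_def[abs_def] by (intro continuous_intros c1)
  have "integral {a..b} (\<lambda>y. integral {0..1} (\<lambda>x. norm (f (side_point w k x + \<i> * of_real y)))) \<le> B" for k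
  proof -
    have "integral {a..b} (\<lambda>y. integral {0..1} (\<lambda>x. norm (f (side_point w k x + \<i> * of_real y))))
      = integral (cbox 0 1) (\<lambda>x. integral (cbox a b) (\<lambda>y. norm (f (side_point w k x + \<i> * of_real y))))"
      using integral_swap_continuous[OF c2] by simp
    also have "\<dots> \<le> integral (cbox 0 1) (\<lambda>x::real. B)"
    proof (rule integral_le)
      have "continuous_on (cbox 0 1) (\<lambda>x. integral (cbox a b) (\<lambda>y. norm (f (side_point w k x + \<i> * of_real y))))"
      proof (rule integral_continuous_on_param)
        have "continuous_on (cbox (0::real) 1 \<times> cbox a b) ((\<lambda>(y, x). norm (f (side_point w k x + \<i> * of_real y))) \<circ> prod.swap)"
          by (intro continuous_on_compose continuous_on_swap continuous_on_subset[OF c2]) (auto simp: cbox_Pair_eq)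
        then show "continuous_on (cbox (0::real) 1 \<times> cbox a b) (\<lambda>(x, y). norm (f (side_point w k x + \<i> * of_real y)))"
          by (simp add: o_def case_prod_unfold)
      qed
      then show "(\<lambda>x. integral (cbox a b) (\<lambda>y. norm (f (side_point w k x + \<i> * of_real y)))) integrable_on cbox 0 1"
        by (rule integrable_continuous)
      fix x assume "x \<in> cbox (0::real) 1"
      then have x: "x \<in> {0..1}" by simp
      note sp = side_point_cases(1,2)[OF w(2) x, of k]
      define r c where "r = Re (side_point w k x)" and "c = Im (side_point w k x)"
      have e: "side_point w k x + \<i> * of_real y = Complex r (y + c)" for y by (simp add: r_def c_def complex_eq_iff)
      have cont: "continuous_on {a - 1..b + 1} (\<lambda>t. norm (f (Complex r t)))"
        by (intro continuous_on_norm continuous_on_compose2[OF f, of _ "\<lambda>t. Complex r t"])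
           (use sp w ab in \<open>auto simp: Complex_eq r_def intro!: continuous_intros\<close>)
      have "((\<lambda>t. norm (f (Complex r t))) has_integral integral {a + c..b + c} (\<lambda>t. norm (f (Complex r t)))) (cbox (a + c) (b + c))"
        using sp by (simp add: c_def, intro integrable_integral integrable_continuous_interval continuous_on_subset[OF cont]) (auto simp: c_def)
      from has_integral_affinity[OF this, of 1 c]
      have "((\<lambda>t. norm (f (Complex r (t + c)))) has_integral integral {a + c..b + c} (\<lambda>t. norm (f (Complex r t)))) {a..b}"
        by simp
      then have "integral (cbox a b) (\<lambda>y. norm (f (side_point w k x + \<i> * of_real y))) = integral {a + c..b + c} (\<lambda>t. norm (f (Complex r t)))"
        unfolding e by (simp add: integral_unique)
      also have "\<dots> \<le> integral {a - 1..b + 1} (\<lambda>t. norm (f (Complex r t)))"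
        using sp by (intro integral_subset_le integrable_continuous_interval continuous_on_subset[OF cont]) (auto simp: c_def)
      also have "\<dots> \<le> B" by (rule B) (use sp in \<open>simp add: r_def\<close>)
      finally show "integral (cbox a b) (\<lambda>y. norm (f (side_point w k x + \<i> * of_real y))) \<le> B" .
    qed auto
    finally show ?thesis by simp
  qed
  note le = this
  have B0: "0 \<le> B" using order_trans[OF integral_norm_nonneg B[of w]] w by simp
  have "integral {a..b} (rect_mean w f)
     = (\<Sum>k<4. side_len w k * integral {a..b} (\<lambda>y. integral {0..1} (\<lambda>x. norm (f (side_point w k x + \<i> * of_real y)))))"
    unfolding rect_mean_def[abs_def]
    by (subst integral_sum) (auto intro!: integrable_continuous_interval continuous_intros c1)
  also have "\<dots> \<le> (\<Sum>k<4. side_len w k * B)"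
    by (intro sum_mono mult_left_mono le) (auto simp: side_len_def)
  also have "\<dots> = (2 * (4 - w) + 4) * B" unfolding sum_distrib_right[symmetric] using sum_side_len[OF w(2)] by simp
  also have "\<dots> \<le> 12 * B" using w B0 by (intro mult_right_mono) auto
  finally show "integral {a..b} (rect_mean w f) \<le> 12 * B" .
qed

text \<open>Cauchy's formula on a vertically translated rectangle, averaged over the translations, and
  Markov's inequality.\<close>

lemma exceptional_ordinates:
  assumes f: "f holomorphic_on {z. Re z > 0} \<inter> {z. Im z > 0}" and w: "0 < w" "w \<le> 4" and d: "0 < d" "d \<le> 1" and ab: "1 < a" "a \<le> b"
    and B: "\<And>x. x \<in> {w..4} \<Longrightarrow> integral {a - 1..b + 1} (\<lambda>t. norm (f (Complex x t))) \<le> B" and \<eta>: "\<eta> > 0"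
  obtains E where "E \<in> sets borel" "E \<subseteq> {a..b}" "measure lborel E \<le> 2 * B / (d * \<eta>)"
    "\<And>x y. y \<in> {a..b} - E \<Longrightarrow> x \<in> {w + d..4 - d} \<Longrightarrow> norm (f (Complex x y)) \<le> \<eta>"
proof -
  note cf = holomorphic_on_imp_continuous_on[OF f]
  note R = integral_rect_mean_le[OF cf w ab B]
  \<comment> \<open>The constant 6 stands for a lower bound of 2 pi, so that outside
    \<open>E\<close> the Cauchy bound gives at most \<eta>; Markov's inequality with 12 B then gives
    2 B / (d \<eta>).\<close>
  define E where "E = {y \<in> {a..b}. 6 * d * \<eta> \<le> rect_mean w f y}"
  have "closed E" unfolding E_def
    using continuous_on_closed_Collect_le[OF continuous_on_const R(1)] by auto
  then have Em: "E \<in> sets borel" by simp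
  have Ef: "emeasure lborel E < \<infinity>"
  proof -
    have "emeasure lborel E \<le> emeasure lborel {a..b}" by (rule emeasure_mono) (auto simp: E_def)
    also have "\<dots> < \<infinity>" using ab by simp
    finally show ?thesis .
  qed
  have rm0: "0 \<le> rect_mean w f y" for y
    unfolding rect_mean_def side_len_def
    by (intro sum_nonneg mult_nonneg_nonneg integral_norm_nonneg norm_ge_zero)
  show ?thesis
  proof (rule that[of E])
    show "E \<in> sets borel" by fact
    show "E \<subseteq> {a..b}" by (auto simp: E_def)
    have si: "set_integrable lborel {a..b} (rect_mean w f)"
      by (rule borel_integrable_atLeastAtMost') (rule R(1))
    have "6 * d * \<eta> * measure lborel E = (LINT y:E|lborel. 6 * d * \<eta>)"
      using Ef by (simp add: set_integral_const Em)
    also have "\<dots> \<le> (LINT y:{a..b}|lborel. rect_mean w f y)"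
      unfolding set_lebesgue_integral_def
    proof (rule integral_mono)
      show "integrable lborel (\<lambda>x. indicat_real E x *\<^sub>R (6 * d * \<eta>))"
        using Em Ef by (intro integrable_scaleR_left) auto
      show "integrable lborel (\<lambda>x. indicat_real {a..b} x *\<^sub>R rect_mean w f x)"
        using si by (simp add: set_integrable_def)
      show "indicat_real E x *\<^sub>R (6 * d * \<eta>) \<le> indicat_real {a..b} x *\<^sub>R rect_mean w f x" for x
        using rm0[of x] by (auto simp: E_def indicator_def)
    qed
    also have "\<dots> = integral {a..b} (rect_mean w f)" by (rule set_borel_integral_eq_integral(2)[OF si])
    also have "\<dots> \<le> 12 * B" by (rule R(2))
    finally show "measure lborel E \<le> 2 * B / (d * \<eta>)" using d \<eta> by (simp add: field_simps)
    fix x y assume y: "y \<in> {a..b} - E" and x: "x \<in> {w + d..4 - d}"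
    have "6 * d * norm (f (Complex x y)) \<le> 2 * pi * d * norm (f (Complex x y))"
      using pi_gt3 d by (intro mult_right_mono) auto
    also have "\<dots> \<le> rect_mean w f y"
      by (rule norm_le_rect_mean[OF f w d x]) (use y ab in auto)
    also have "\<dots> \<le> 6 * d * \<eta>" using y by (auto simp: E_def)
    finally show "norm (f (Complex x y)) \<le> \<eta>" using d by simp
  qed
qed

section \<open>Sums over primes\<close>

lemma prod_primes_dvd:
  fixes A :: "nat set"
  assumes "finite A" "\<And>p. p \<in> A \<Longrightarrow> prime p" "\<And>p. p \<in> A \<Longrightarrow> p dvd n"
  shows "\<Prod>A dvd n"
  using assms
proof (induction A rule: finite_induct)
  case (insert p A)
  have "coprime p (\<Prod>A)"
    using insert by (intro prod_coprime_right primes_coprime) auto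
  then show ?case using insert by (simp add: divides_mult)
qed simp

text \<open>Chebyshev's argument: with n = 2^k, all primes in (n, 2n] divide the binomial
  coefficient of 2n over n, which is at most 4^n, and each of them exceeds 2^k.\<close>

lemma card_primes_dyadic:
  "real k * real (card {p. prime p \<and> p \<in> {2 ^ k<..2 ^ Suc k :: nat}}) \<le> 2 * 2 ^ k"
proof -
  define n :: nat where "n = 2 ^ k"
  define P where "P = {p. prime p \<and> p \<in> {2 ^ k<..2 ^ Suc k :: nat}}"
  have fP: "finite P" by (rule finite_subset[of _ "{..2 ^ Suc k}"]) (auto simp: P_def)
  have "p dvd (2 * n choose n)" if "p \<in> P" for p
  proof -
    have p: "prime p" "n < p" "p \<le> 2 * n" using that by (auto simp: P_def n_def)
    have "fact n * fact n * (2 * n choose n) = (fact (2 * n) :: nat)"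
      using binomial_fact_lemma[of n "2 * n"] by simp
    moreover have "p dvd fact (2 * n)" "\<not> p dvd fact n" using p by (auto simp: prime_dvd_fact_iff)
    ultimately show ?thesis using p(1) by (metis prime_dvd_mult_iff)
  qed
  then have "\<Prod>P dvd (2 * n choose n)" using fP by (intro prod_primes_dvd) (auto simp: P_def)
  then have "\<Prod>P \<le> (2 * n choose n)" by (rule dvd_imp_le) simp
  also have "\<dots> \<le> 2 ^ (2 * n)" by (rule binomial_le_pow2)
  finally have 1: "\<Prod>P \<le> 2 ^ (2 * n)" .
  have "2 ^ (k * card P) = (\<Prod>p\<in>P. (2::nat) ^ k)" by (simp add: power_mult)
  also have "\<dots> \<le> \<Prod>P" by (rule prod_mono) (auto simp: P_def)
  finally have "(2::nat) ^ (k * card P) \<le> 2 ^ (2 * n)" using 1 by linarith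
  then have "k * card P \<le> 2 * n" by (simp add: power_increasing_iff)
  then have "real (k * card P) \<le> real (2 * n)" by (rule of_nat_mono)
  then show ?thesis by (simp add: P_def n_def)
qed

text \<open>The bound for the logarithm of the exponential moment belonging to a single prime with a
  coefficient of size (L / p) powr \<sigma>; see \<open>hmin_powr\<close>.\<close>

definition prime_wt :: "real \<Rightarrow> real \<Rightarrow> nat \<Rightarrow> real" where
  "prime_wt \<sigma> L p = min ((L / real p) powr \<sigma>) ((L / real p) powr (2 * \<sigma>))"

text \<open>The primes in the dyadic interval \<open>(2\<^sup>k, 2\<^sup>k\<^sup>+\<^sup>1]\<close> number at most \<open>2\<^sup>k\<^sup>+\<^sup>1 / k\<close>; with \<open>L\<close> in
  \<open>[2\<^sup>m, 2\<^sup>m\<^sup>+\<^sup>1)\<close> the contribution of this interval decays geometrically in \<open>\<bar>m - k\<bar>\<close>.\<close>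

lemma sum_prime_wt_le:
  assumes \<sigma>: "1 / 2 < \<sigma>" "\<sigma> < 1"
  obtains C where "C > 0" "\<And>L A. L \<ge> 2 \<Longrightarrow> finite A \<Longrightarrow> (\<And>p. p \<in> A \<Longrightarrow> prime p) \<Longrightarrow> (\<Sum>p\<in>A. prime_wt \<sigma> L p) \<le> C * L / ln L"
proof -
  \<comment> \<open>The ratios of decay for dyadic intervals below and above L. The first is less
    than 1 because \<sigma> < 1, the second because \<sigma> > 1 / 2.\<close>
  define q1 q2 where "q1 = 2 powr (\<sigma> - 1)" and "q2 = 2 powr (1 - 2 * \<sigma>)"
  have q: "0 < q1" "q1 < 1" "0 < q2" "q2 < 1" using \<sigma> powr_less_mono[of _ 0 2] by (auto simp: q1_def q2_def)
  have s1: "summable (\<lambda>j. real (Suc j) * q1 ^ j)"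
    using geometric_deriv_sums[of q1] q by (auto simp: sums_iff)
  have s2: "summable (\<lambda>i. q2 ^ i)" using q by (intro summable_geometric) auto
  define S1 S2 where "S1 = (\<Sum>j. real (Suc j) * q1 ^ j)" and "S2 = (\<Sum>i. q2 ^ i)"
  have S1: "(\<Sum>j\<in>J. real (Suc j) * q1 ^ j) \<le> S1" if "finite J" for J
    unfolding S1_def using q that by (intro sum_le_suminf s1) auto
  have S2: "(\<Sum>j\<in>J. q2 ^ j) \<le> S2" if "finite J" for J
    unfolding S2_def using q that by (intro sum_le_suminf s2) auto
  have S0: "S1 \<ge> 0" "S2 \<ge> 0" using S1[of "{}"] S2[of "{}"] by auto
  define C where "C = 1 / (1 - \<sigma>) + 2 * (4 * S1 + 8 * S2)"
  show ?thesis
  proof (rule that[of C])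
    show "C > 0" unfolding C_def using \<sigma> S0 by (intro add_pos_nonneg) auto
    fix L :: real and A :: "nat set"
    assume L: "L \<ge> 2" and A: "finite A" "\<And>p. p \<in> A \<Longrightarrow> prime p"
    define m where "m = nat \<lfloor>log 2 L\<rfloor>"
    have lg: "log 2 L \<ge> 1" using L by (simp add: le_log_iff)
    have m: "m \<ge> 1" "real m \<le> log 2 L" "log 2 L < real m + 1" using lg by (auto simp: m_def) linarith+
    have Lm: "2 ^ m \<le> L" "L < 2 ^ Suc m"
    proof -
      have "2 powr real m \<le> L" using m(2) L by (simp add: le_log_iff)
      then show "2 ^ m \<le> L" by (simp add: powr_realpow)
      have "L < 2 powr (real m + 1)" using m(3) L by (simp add: log_less_iff)
      then show "L < 2 ^ Suc m" by (simp add: powr_add powr_realpow)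
    qed
    have lnm: "ln L \<le> 2 * real m"
    proof -
      have "ln L = log 2 L * ln 2" using L by (simp add: log_def)
      also have "\<dots> \<le> (real m + 1) * 1" using m ln2_le_25_over_36 lg by (intro mult_mono) auto
      finally show ?thesis using m by simp
    qed
    define P where "P = (\<lambda>k. {p. prime p \<and> p \<in> {2 ^ k<..2 ^ Suc k :: nat}})"
    have fP: "finite (P k)" for k by (rule finite_subset[of _ "{..2 ^ Suc k}"]) (auto simp: P_def)
    define g where "g = (\<lambda>k. if k \<le> m then (4 * 2 ^ m / real m) * (real (Suc (m - k)) * q1 ^ (m - k))
        else (8 * 2 ^ m / real m) * q2 ^ (k - m))"
    have blk: "(\<Sum>p\<in>P k. prime_wt \<sigma> L p) \<le> g k" if k: "k \<ge> 1" for k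
    proof -
      define x where "x = (2::real) powr (real m + 1 - real k)"
      have x: "L / real p \<le> x" "0 \<le> L / real p" if "p \<in> P k" for p
      proof -
        have "real (2 ^ k) \<le> real p" using that by (intro of_nat_mono) (auto simp: P_def)
        then have "L / real p \<le> 2 ^ Suc m / 2 ^ k" using Lm L by (intro frac_le) auto
        also have "\<dots> = x" unfolding x_def by (simp add: powr_diff powr_add powr_realpow)
        finally show "L / real p \<le> x" "0 \<le> L / real p" using L by auto
      qed
      have cP: "real (card (P k)) \<le> 2 * 2 ^ k / real k"
        using card_primes_dyadic[of k] k by (simp add: P_def field_simps)
      show ?thesis
      proof (cases "k \<le> m")
        case True
        define j where "j = m - k"
        have j: "k = m - j" "j < m" using True k by (auto simp: j_def)
        have xp: "x powr \<sigma> \<le> 2 * 2 powr (\<sigma> * real j)"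
        proof -
          have "x powr \<sigma> = 2 powr (\<sigma> * real j + \<sigma>)" unfolding x_def powr_powr using j by (simp add: algebra_simps of_nat_diff)
          also have "\<dots> = 2 powr (\<sigma> * real j) * 2 powr \<sigma>" by (rule powr_add)
          also have "\<dots> \<le> 2 powr (\<sigma> * real j) * 2 powr 1" using \<sigma> by (intro mult_left_mono powr_mono) auto
          finally show ?thesis by (simp add: mult.commute)
        qed
        have "(\<Sum>p\<in>P k. prime_wt \<sigma> L p) \<le> (\<Sum>p\<in>P k. 2 * 2 powr (\<sigma> * real j))"
        proof (intro sum_mono)
          fix p assume "p \<in> P k"
          then have "(L / real p) powr \<sigma> \<le> x powr \<sigma>" using x \<sigma> by (intro powr_mono2) auto
          then show "prime_wt \<sigma> L p \<le> 2 * 2 powr (\<sigma> * real j)" using xp by (simp add: prime_wt_def)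
        qed
        also have "\<dots> = real (card (P k)) * (2 * 2 powr (\<sigma> * real j))" by simp
        also have "\<dots> \<le> 2 * 2 ^ k / real k * (2 * 2 powr (\<sigma> * real j))" by (intro mult_right_mono cP) auto
        also have "\<dots> = 4 * (2 ^ k * 2 powr (\<sigma> * real j)) * (1 / real k)" by simp
        also have "2 ^ k * 2 powr (\<sigma> * real j) = 2 ^ m * q1 ^ j"
        proof -
          have "(2::real) ^ k = 2 powr (real m - real j)" using j by (simp add: powr_realpow[symmetric] of_nat_diff)
          moreover have "q1 ^ j = 2 powr ((\<sigma> - 1) * real j)" by (simp add: q1_def powr_realpow[symmetric] powr_powr)
          moreover have "(2::real) ^ m = 2 powr real m" by (simp add: powr_realpow)
          ultimately show ?thesis by (simp add: powr_add[symmetric] algebra_simps)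
        qed
        \<comment> \<open>For small k the prime density 1 / k is worse than the desired 1 / m. The
          linear factor of the series \<open>S1\<close> pays for this.\<close>
        also have "1 / real k \<le> real (Suc j) / real m"
        proof -
          have "m \<le> Suc j * k"
          proof -
            obtain i where i: "m = j + Suc i" using j by (metis less_imp_Suc_add add_Suc_right)
            then have "k = Suc i" using j by simp
            then show ?thesis using i by (simp add: algebra_simps)
          qed
          then have "real m \<le> real (Suc j * k)" by (rule of_nat_mono)
          then show ?thesis using k m by (simp add: field_simps)
        qed
        finally have "(\<Sum>p\<in>P k. prime_wt \<sigma> L p) \<le> 4 * (2 ^ m * q1 ^ j) * (real (Suc j) / real m)"
          using q by (simp add: mult_left_mono del: of_nat_Suc)
        also have "\<dots> = g k" unfolding g_def j_def using True by (simp add: mult_ac del: of_nat_Suc)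
        finally show ?thesis .
      next
        case False
        define i where "i = k - m"
        have i: "k = m + i" "i \<ge> 1" using False by (auto simp: i_def)
        have xp: "x powr (2 * \<sigma>) \<le> 4 * 2 powr (- 2 * \<sigma> * real i)"
        proof -
          have "x powr (2 * \<sigma>) = 2 powr (- 2 * \<sigma> * real i + 2 * \<sigma>)" unfolding x_def powr_powr using i by (simp add: algebra_simps)
          also have "\<dots> = 2 powr (- 2 * \<sigma> * real i) * 2 powr (2 * \<sigma>)" by (rule powr_add)
          also have "\<dots> \<le> 2 powr (- 2 * \<sigma> * real i) * 2 powr 2" using \<sigma> by (intro mult_left_mono powr_mono) auto
          finally show ?thesis by (simp add: mult.commute)
        qed
        have "(\<Sum>p\<in>P k. prime_wt \<sigma> L p) \<le> (\<Sum>p\<in>P k. 4 * 2 powr (- 2 * \<sigma> * real i))"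
        proof (intro sum_mono)
          fix p assume "p \<in> P k"
          then have "(L / real p) powr (2 * \<sigma>) \<le> x powr (2 * \<sigma>)" using x \<sigma> by (intro powr_mono2) auto
          then show "prime_wt \<sigma> L p \<le> 4 * 2 powr (- 2 * \<sigma> * real i)" using xp by (simp add: prime_wt_def)
        qed
        also have "\<dots> = real (card (P k)) * (4 * 2 powr (- 2 * \<sigma> * real i))" by simp
        also have "\<dots> \<le> 2 * 2 ^ k / real k * (4 * 2 powr (- 2 * \<sigma> * real i))" by (intro mult_right_mono cP) auto
        also have "\<dots> = 8 * (2 ^ k * 2 powr (- 2 * \<sigma> * real i)) * (1 / real k)" by simp
        also have "2 ^ k * 2 powr (- 2 * \<sigma> * real i) = 2 ^ m * q2 ^ i"
        proof -
          have "(2::real) ^ k = 2 powr (real m + real i)" using i by (simp add: powr_realpow[symmetric])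
          moreover have "q2 ^ i = 2 powr ((1 - 2 * \<sigma>) * real i)" by (simp add: q2_def powr_realpow[symmetric] powr_powr)
          moreover have "(2::real) ^ m = 2 powr real m" by (simp add: powr_realpow)
          ultimately show ?thesis by (simp add: powr_add[symmetric] algebra_simps)
        qed
        also have "1 / real k \<le> 1 / real m" using i m by (intro divide_left_mono) auto
        finally show ?thesis using q False by (simp add: g_def i_def mult_left_mono)
      qed
    qed
    obtain N where N: "A \<subseteq> {..2 ^ Suc N}"
    proof -
      obtain M where M: "\<And>p. p \<in> A \<Longrightarrow> p \<le> M" using A(1) unfolding finite_nat_set_iff_bounded_le by blast
      have "M \<le> 2 ^ Suc M" using less_exp[of "Suc M"] by linarith
      then show ?thesis using M that[of M] by (meson atMost_iff order_trans subsetI)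
    qed
    have sub: "A \<subseteq> {2} \<union> (\<Union>k\<in>{1..N}. P k)"
    proof
      fix p assume p: "p \<in> A"
      define k where "k = (LEAST k. p \<le> 2 ^ Suc k)"
      have k: "p \<le> 2 ^ Suc k" "k \<le> N"
        using LeastI[of "\<lambda>k. p \<le> 2 ^ Suc k" N] Least_le[of "\<lambda>k. p \<le> 2 ^ Suc k" N] N p unfolding k_def by auto
      show "p \<in> {2} \<union> (\<Union>k\<in>{1..N}. P k)"
      proof (cases "k = 0")
        case True
        then show ?thesis using k A(2)[OF p] prime_ge_2_nat[of p] by simp
      next
        case False
        then obtain l where l: "k = Suc l" by (cases k) auto
        have "\<not> p \<le> 2 ^ Suc l" using not_less_Least[of l "\<lambda>k. p \<le> 2 ^ Suc k"] l unfolding k_def by simp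
        then have "p \<in> P k" using k A(2)[OF p] l by (simp add: P_def)
        then show ?thesis using k False by auto
      qed
    qed
    have wt0: "0 \<le> prime_wt \<sigma> L p" for p by (simp add: prime_wt_def)
    have "(\<Sum>p\<in>A. prime_wt \<sigma> L p) \<le> (\<Sum>p\<in>{2} \<union> (\<Union>k\<in>{1..N}. P k). prime_wt \<sigma> L p)"
      by (intro sum_mono2 sub) (auto simp: fP wt0)
    also have "\<dots> \<le> (\<Sum>p\<in>{2}. prime_wt \<sigma> L p) + (\<Sum>p\<in>(\<Union>k\<in>{1..N}. P k). prime_wt \<sigma> L p)"
      by (subst sum_Un) (auto simp: fP wt0 sum_nonneg)
    finally have f1: "(\<Sum>p\<in>A. prime_wt \<sigma> L p) \<le> (\<Sum>p\<in>{2}. prime_wt \<sigma> L p) + (\<Sum>p\<in>(\<Union>k\<in>{1..N}. P k). prime_wt \<sigma> L p)" .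
    have "(\<Sum>p\<in>(\<Union>k\<in>{1..N}. P k). prime_wt \<sigma> L p) \<le> (\<Sum>k\<in>{1..N}. \<Sum>p\<in>P k. prime_wt \<sigma> L p)"
    proof -
      have U: "(\<Union>k\<in>{1..N}. P k) = snd ` (SIGMA k:{1..N}. P k)" by force
      have "(\<Sum>p\<in>snd ` (SIGMA k:{1..N}. P k). prime_wt \<sigma> L p) \<le> (\<Sum>x\<in>(SIGMA k:{1..N}. P k). prime_wt \<sigma> L (snd x))"
        by (rule sum_image_le[unfolded o_def]) (auto simp: fP wt0)
      also have "\<dots> = (\<Sum>k\<in>{1..N}. \<Sum>p\<in>P k. prime_wt \<sigma> L p)"
        by (subst sum.Sigma) (auto simp: fP case_prod_unfold)
      finally show ?thesis unfolding U .
    qed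
    also have "\<dots> \<le> (\<Sum>k\<in>{1..N}. g k)" by (intro sum_mono blk) auto
    also have "\<dots> \<le> (\<Sum>k\<in>{1..m} \<union> {m<..m + N}. g k)"
      using q by (intro sum_mono2) (auto simp: g_def)
    also have "\<dots> = (\<Sum>k\<in>{1..m}. g k) + (\<Sum>k\<in>{m<..m + N}. g k)" by (rule sum.union_disjoint) auto
    finally have f2: "(\<Sum>p\<in>(\<Union>k\<in>{1..N}. P k). prime_wt \<sigma> L p) \<le> (\<Sum>k\<in>{1..m}. g k) + (\<Sum>k\<in>{m<..m + N}. g k)" .
    have "(\<Sum>k\<in>{1..m}. g k) = (\<Sum>j\<in>{..<m}. (4 * 2 ^ m / real m) * (real (Suc j) * q1 ^ j))"
      by (rule sum.reindex_bij_witness[of _ "\<lambda>j. m - j" "\<lambda>k. m - k"]) (auto simp: g_def)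
    also have "\<dots> \<le> (4 * 2 ^ m / real m) * S1" unfolding sum_distrib_left[symmetric] by (intro mult_left_mono S1) auto
    finally have f3: "(\<Sum>k\<in>{1..m}. g k) \<le> (4 * 2 ^ m / real m) * S1" .
    have "(\<Sum>k\<in>{m<..m + N}. g k) = (\<Sum>i\<in>{1..N}. (8 * 2 ^ m / real m) * q2 ^ i)"
      by (rule sum.reindex_bij_witness[of _ "\<lambda>i. m + i" "\<lambda>k. k - m"]) (auto simp: g_def)
    also have "\<dots> \<le> (8 * 2 ^ m / real m) * S2" unfolding sum_distrib_left[symmetric] by (intro mult_left_mono S2) auto
    finally have f4: "(\<Sum>k\<in>{m<..m + N}. g k) \<le> (8 * 2 ^ m / real m) * S2" .
    \<comment> \<open>The prime 2 lies in the dyadic interval with k = 0, where the bound with 1 / k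
      says nothing.\<close>
    have f5: "(\<Sum>p\<in>{2}. prime_wt \<sigma> L p) \<le> 1 / (1 - \<sigma>) * L / ln L"
    proof -
      have "(\<Sum>p\<in>{2}. prime_wt \<sigma> L p) \<le> (L / 2) powr \<sigma>" by (simp add: prime_wt_def)
      also have "\<dots> \<le> L powr \<sigma>" using L \<sigma> by (intro powr_mono2) auto
      also have "\<dots> \<le> 1 / (1 - \<sigma>) * L / ln L"
      proof -
        have "ln L \<le> L powr (1 - \<sigma>) / (1 - \<sigma>)" using L \<sigma> by (intro ln_powr_bound) auto
        then have "L powr \<sigma> * ln L \<le> L powr \<sigma> * (L powr (1 - \<sigma>) / (1 - \<sigma>))" by (intro mult_left_mono) auto
        also have "\<dots> = L / (1 - \<sigma>)" using L by (simp add: powr_add[symmetric])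
        finally have "L powr \<sigma> * ln L \<le> L / (1 - \<sigma>)" .
        moreover have "0 < ln L" using L by simp
        ultimately have "L powr \<sigma> \<le> L / (1 - \<sigma>) / ln L" by (subst pos_le_divide_eq)
        then show ?thesis by simp
      qed
      finally show ?thesis .
    qed
    have f6: "4 * 2 ^ m / real m * S1 + 8 * 2 ^ m / real m * S2 = (2 ^ m / real m) * (4 * S1 + 8 * S2)"
      by (simp add: distrib_left mult_ac)
    have "2 ^ m / real m \<le> 2 * L / ln L"
    proof -
      have "2 ^ m / real m \<le> L / (ln L / 2)" using Lm L lnm m by (intro frac_le) auto
      also have "\<dots> = 2 * L / ln L" by simp
      finally show ?thesis .
    qed
    then have f7: "2 ^ m / real m * (4 * S1 + 8 * S2) \<le> 2 * L / ln L * (4 * S1 + 8 * S2)"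
      using S0 by (intro mult_right_mono) auto
    have "1 / (1 - \<sigma>) * L / ln L + 2 * L / ln L * (4 * S1 + 8 * S2) = C * L / ln L"
      unfolding C_def by (simp add: add_divide_distrib distrib_right distrib_left mult_ac)
    then show "(\<Sum>p\<in>A. prime_wt \<sigma> L p) \<le> C * L / ln L" using f1 f2 f3 f4 f5 f6 f7 by linarith
  qed
qed

text \<open>The geometric series over the exponents k >= 2 gives p powr (- 2 w) / (1 - p powr (-
  w)); the denominator is replaced by its value at 2 and the sum over primes by the sum over all
  integers.\<close>

definition nonprime_const :: "real \<Rightarrow> real" where
  "nonprime_const w = (\<Sum>n. real n powr (- 2 * w)) / (1 - 2 powr (-w))"

lemma nonprime_const_nonneg: "w > 1 / 2 \<Longrightarrow> 0 \<le> nonprime_const w"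
  unfolding nonprime_const_def using powr_less_mono[of "-w" 0 2] summable_nat_powr[of "2 * w"]
  by (intro divide_nonneg_nonneg suminf_nonneg) auto

lemma sum_nonprime_lam_le:
  assumes w: "w > 1 / 2" and A: "finite A" "\<And>n. n \<in> A \<Longrightarrow> \<not> prime n"
  shows "(\<Sum>n\<in>A. lam n * real n powr (-w)) \<le> nonprime_const w"
proof -
  have q: "2 powr (-w) < 1" using powr_less_mono[of "-w" 0 2] w by simp
  obtain N where N: "\<And>n. n \<in> A \<Longrightarrow> n < N" using A(1) unfolding finite_nat_set_iff_bounded by blast
  let ?I = "{2..N} \<times> {2..N}" and ?f = "\<lambda>(p, k). p ^ k :: nat"
  have sub: "{n \<in> A. lam n \<noteq> 0} \<subseteq> ?f ` ?I"
  proof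
    fix n assume "n \<in> {n \<in> A. lam n \<noteq> 0}"
    then have n: "n \<in> A" "primepow n" by (auto simp: lam_def mangoldt_def split: if_splits)
    then obtain p k where pk: "prime p" "k > 0" "n = p ^ k" by (auto simp: primepow_def)
    have "k \<noteq> 1" using pk A(2)[OF n(1)] by auto
    then have k2: "k \<ge> 2" using pk by auto
    have p2: "p \<ge> 2" using pk prime_ge_2_nat by auto
    have "p \<le> p ^ k" "k < p ^ k"
      using pk p2 self_le_power[of p k] less_le_trans[OF less_exp[of k] power_mono[OF p2]] by auto
    then show "n \<in> ?f ` ?I" using pk k2 p2 N[OF n(1)] by (auto intro!: image_eqI[of _ _ "(p, k)"])
  qed
  have "(\<Sum>n\<in>A. lam n * real n powr (-w)) = (\<Sum>n\<in>{n \<in> A. lam n \<noteq> 0}. lam n * real n powr (-w))"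
    using A by (intro sum.mono_neutral_right) auto
  also have "\<dots> \<le> (\<Sum>n\<in>{n \<in> A. lam n \<noteq> 0}. real n powr (-w))"
    using lam_le_1 by (intro sum_mono) (auto intro: mult_left_le_one_le lam_nonneg)
  also have "\<dots> \<le> (\<Sum>n\<in>?f ` ?I. real n powr (-w))" by (intro sum_mono2 sub) auto
  also have "\<dots> \<le> (\<Sum>x\<in>?I. real (?f x) powr (-w))"
    by (rule sum_image_le[of ?I "\<lambda>n. real n powr (-w)" ?f, unfolded o_def]) auto
  also have "\<dots> = (\<Sum>p\<in>{2..N}. \<Sum>k\<in>{2..N}. (real p powr (-w)) ^ k)"
    unfolding sum.cartesian_product
    by (intro sum.cong) (auto simp: powr_realpow[symmetric] powr_powr mult.commute)
  also have "\<dots> \<le> (\<Sum>p\<in>{2..N}. real p powr (- 2 * w) / (1 - 2 powr (-w)))"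
  proof (intro sum_mono)
    fix p assume p: "p \<in> {2..N}"
    define r where "r = real p powr (-w)"
    have r: "0 < r" "r \<le> 2 powr (-w)" using p w by (auto simp: r_def intro!: powr_mono2')
    then have r1: "r < 1" using q by linarith
    have "(\<Sum>k\<in>{2..N}. r ^ k) \<le> r ^ 2 / (1 - r)"
    proof -
      have pe: "r * (r * r ^ (a - 2)) = r ^ a" if "2 \<le> a" for a
        using le_add_diff_inverse[OF that] power_add[of r 2 "a - 2"] by (simp add: power2_eq_square mult.assoc)
      have "(\<Sum>k\<in>{2..N}. r ^ k) = (\<Sum>k<N - 1. r ^ 2 * r ^ k)"
        by (rule sum.reindex_bij_witness[of _ "\<lambda>k. k + 2" "\<lambda>k. k - 2"]) (auto simp: power2_eq_square mult.assoc pe)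
      also have "\<dots> = r ^ 2 * ((1 - r ^ (N - 1)) / (1 - r))" using r1 by (simp add: sum_distrib_left[symmetric] sum_gp_strict)
      also have "\<dots> \<le> r ^ 2 * (1 / (1 - r))" using r r1 by (intro mult_left_mono divide_right_mono) auto
      finally show ?thesis by simp
    qed
    also have "\<dots> \<le> r ^ 2 / (1 - 2 powr (-w))" using r q by (intro divide_left_mono) auto
    also have "r ^ 2 = real p powr (- 2 * w)" by (simp add: r_def power2_eq_square powr_add[symmetric])
    finally show "(\<Sum>k\<in>{2..N}. (real p powr (-w)) ^ k) \<le> real p powr (- 2 * w) / (1 - 2 powr (-w))" by (simp add: r_def)
  qed
  also have "\<dots> = (\<Sum>p\<in>{2..N}. real p powr (- (2 * w))) / (1 - 2 powr (-w))" by (simp add: sum_divide_distrib)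
  also have "\<dots> \<le> nonprime_const w"
    unfolding nonprime_const_def using q w sum_nat_powr_le[of "2 * w" "{2..N}"] by (intro divide_right_mono) auto
  finally show ?thesis .
qed

text \<open>Rankin's trick: lowering the exponent from \<open>w\<close> to \<open>w'\<close>
  extracts a power of the starting point and leaves a sum that still converges.\<close>

lemma sum_nonprime_lam_tail_le:
  assumes w: "w' > 1 / 2" "w' \<le> w" and A: "finite A" "\<And>n. n \<in> A \<Longrightarrow> \<not> prime n" "\<And>n. n \<in> A \<Longrightarrow> Y \<le> real n" and Y: "Y > 0"
  shows "(\<Sum>n\<in>A. lam n * real n powr (-w)) \<le> Y powr (w' - w) * nonprime_const w'"
proof -
  have "(\<Sum>n\<in>A. lam n * real n powr (-w)) \<le> (\<Sum>n\<in>A. Y powr (w' - w) * (lam n * real n powr (-w')))"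
  proof (intro sum_mono)
    fix n assume n: "n \<in> A"
    have "real n powr (-w) = real n powr (w' - w) * real n powr (-w')" by (simp add: powr_add[symmetric])
    also have "\<dots> \<le> Y powr (w' - w) * real n powr (-w')"
      using A(3)[OF n] w Y by (intro mult_right_mono powr_mono2') auto
    finally show "lam n * real n powr (-w) \<le> Y powr (w' - w) * (lam n * real n powr (-w'))"
      using mult_left_mono[OF _ lam_nonneg] by (fastforce simp: mult_ac)
  qed
  also have "\<dots> \<le> Y powr (w' - w) * nonprime_const w'"
    unfolding sum_distrib_left[symmetric] by (intro mult_left_mono sum_nonprime_lam_le w A) auto
  finally show ?thesis .
qed

lemma sum_nat_powr_tail_le:
  assumes "w' > 1" "w' \<le> w" "finite A" "\<And>n. n \<in> A \<Longrightarrow> Y \<le> real n" "Y > 0"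
  shows "(\<Sum>n\<in>A. real n powr (-w)) \<le> Y powr (w' - w) * (\<Sum>n. real n powr (-w'))"
proof -
  have "(\<Sum>n\<in>A. real n powr (-w)) \<le> (\<Sum>n\<in>A. Y powr (w' - w) * real n powr (-w'))"
  proof (intro sum_mono)
    fix n assume n: "n \<in> A"
    have "real n powr (-w) = real n powr (w' - w) * real n powr (-w')" by (simp add: powr_add[symmetric])
    also have "\<dots> \<le> Y powr (w' - w) * real n powr (-w')"
      using assms(4)[OF n] assms by (intro mult_right_mono powr_mono2') auto
    finally show "real n powr (-w) \<le> Y powr (w' - w) * real n powr (-w')" .
  qed
  also have "\<dots> \<le> Y powr (w' - w) * (\<Sum>n. real n powr (-w'))"
    unfolding sum_distrib_left[symmetric] by (intro mult_left_mono sum_nat_powr_le assms) auto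
  finally show ?thesis .
qed

section \<open>Trigonometric polynomials in completely multiplicative functions\<close>

text \<open>The common properties of n powr (- i t), see \<open>nit\<close>, and of the random
  completely multiplicative function, see \<open>chi\<close>. Polynomial expressions are expanded
  once for all such \<open>h\<close> and then evaluated on both sides of the comparison.\<close>

definition cmult :: "(nat \<Rightarrow> complex) \<Rightarrow> bool" where
  "cmult h \<longleftrightarrow> h 1 = 1 \<and> (\<forall>n>0. norm (h n) = 1) \<and> (\<forall>m>0. \<forall>n>0. h (m * n) = h m * h n)"

text \<open>A list serves as a formal sum, so that like terms need not be collected when polynomials
  are multiplied.\<close>

definition tsum :: "(complex \<times> nat \<times> nat) list \<Rightarrow> (nat \<Rightarrow> complex) \<Rightarrow> complex" where
  "tsum xs h = (\<Sum>(c, m, n)\<leftarrow>xs. c * h m * cnj (h n))"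

definition tnorm :: "(complex \<times> nat \<times> nat) list \<Rightarrow> real" where
  "tnorm xs = (\<Sum>(c, m, n)\<leftarrow>xs. norm c)"

text \<open>\<open>L\<close> is the length and \<open>B\<close> bounds the sum of the absolute
  coefficients; the error of transference is of order \<open>B * L\<close>. The function need agree
  with a polynomial on multiplicative arguments only, as products are merged by
  multiplicativity.\<close>

definition tpoly :: "real \<Rightarrow> real \<Rightarrow> ((nat \<Rightarrow> complex) \<Rightarrow> complex) \<Rightarrow> bool" where
  "tpoly L B Q \<longleftrightarrow> (\<exists>xs. (\<forall>(c, m, n)\<in>set xs. 0 < m \<and> 0 < n \<and> real m \<le> L \<and> real n \<le> L) \<and> tnorm xs \<le> B \<and>
     (\<forall>h. cmult h \<longrightarrow> Q h = tsum xs h))"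

lemma tsum_Nil [simp]: "tsum [] h = 0" and tsum_Cons [simp]: "tsum (x # xs) h = fst x * h (fst (snd x)) * cnj (h (snd (snd x))) + tsum xs h"
  and tnorm_Nil [simp]: "tnorm [] = 0" and tnorm_Cons [simp]: "tnorm (x # xs) = norm (fst x) + tnorm xs"
  by (auto simp: tsum_def tnorm_def case_prod_unfold)

lemma tsum_append [simp]: "tsum (xs @ ys) h = tsum xs h + tsum ys h"
  and tnorm_append [simp]: "tnorm (xs @ ys) = tnorm xs + tnorm ys"
  by (auto simp: tsum_def tnorm_def)

lemma tnorm_nonneg: "0 \<le> tnorm xs"
  by (induction xs) auto

lemma tpoly_nonneg: "tpoly L B Q \<Longrightarrow> 0 \<le> B"
  unfolding tpoly_def using tnorm_nonneg order_trans by blast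

lemma tpoly_mono: "tpoly L B Q \<Longrightarrow> L \<le> L' \<Longrightarrow> B \<le> B' \<Longrightarrow> tpoly L' B' Q"
  unfolding tpoly_def by (fastforce intro: order_trans)

lemma tpoly_const: "1 \<le> L \<Longrightarrow> tpoly L (norm c) (\<lambda>_. c)"
  unfolding tpoly_def by (intro exI[of _ "[(c, 1, 1)]"]) (auto simp: cmult_def)

lemma tpoly_char: "0 < n \<Longrightarrow> real n \<le> L \<Longrightarrow> tpoly L 1 (\<lambda>h. h n)"
  unfolding tpoly_def by (intro exI[of _ "[(1, n, 1)]"]) (auto simp: cmult_def)

lemma tpoly_add: "tpoly L B1 Q1 \<Longrightarrow> tpoly L B2 Q2 \<Longrightarrow> tpoly L (B1 + B2) (\<lambda>h. Q1 h + Q2 h)"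
  unfolding tpoly_def
proof (elim exE conjE)
  fix xs ys
  assume "\<forall>(c, m, n)\<in>set xs. 0 < m \<and> 0 < n \<and> real m \<le> L \<and> real n \<le> L" "tnorm xs \<le> B1" "\<forall>h. cmult h \<longrightarrow> Q1 h = tsum xs h"
    "\<forall>(c, m, n)\<in>set ys. 0 < m \<and> 0 < n \<and> real m \<le> L \<and> real n \<le> L" "tnorm ys \<le> B2" "\<forall>h. cmult h \<longrightarrow> Q2 h = tsum ys h"
  then show "\<exists>zs. (\<forall>(c, m, n)\<in>set zs. 0 < m \<and> 0 < n \<and> real m \<le> L \<and> real n \<le> L) \<and> tnorm zs \<le> B1 + B2 \<and>
     (\<forall>h. cmult h \<longrightarrow> Q1 h + Q2 h = tsum zs h)"
    by (intro exI[of _ "xs @ ys"]) auto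
qed

lemma tpoly_cnj: "tpoly L B Q \<Longrightarrow> tpoly L B (\<lambda>h. cnj (Q h))"
  unfolding tpoly_def
proof (elim exE conjE)
  fix xs
  assume *: "\<forall>(c, m, n)\<in>set xs. 0 < m \<and> 0 < n \<and> real m \<le> L \<and> real n \<le> L" "tnorm xs \<le> B" "\<forall>h. cmult h \<longrightarrow> Q h = tsum xs h"
  let ?ys = "map (\<lambda>(c, m, n). (cnj c, n, m)) xs"
  have "tsum ?ys h = cnj (tsum xs h)" for h by (induction xs) (auto simp: mult_ac)
  moreover have "tnorm ?ys = tnorm xs" by (induction xs) auto
  ultimately show "\<exists>zs. (\<forall>(c, m, n)\<in>set zs. 0 < m \<and> 0 < n \<and> real m \<le> L \<and> real n \<le> L) \<and> tnorm zs \<le> B \<and>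
     (\<forall>h. cmult h \<longrightarrow> cnj (Q h) = tsum zs h)"
    using * by (intro exI[of _ ?ys]) auto
qed

definition tmul :: "(complex \<times> nat \<times> nat) list \<Rightarrow> (complex \<times> nat \<times> nat) list \<Rightarrow> (complex \<times> nat \<times> nat) list" where
  "tmul xs ys = concat (map (\<lambda>(c, m, n). map (\<lambda>(c', m', n'). (c * c', m * m', n * n')) ys) xs)"

lemma tnorm_tmul: "tnorm (tmul xs ys) = tnorm xs * tnorm ys"
proof -
  have "tnorm (map (\<lambda>(c', m', n'). (c * c', m * m', n * n')) ys) = norm c * tnorm ys" for c m n
    by (induction ys) (auto simp: norm_mult algebra_simps)
  then show ?thesis unfolding tmul_def by (induction xs) (auto simp: algebra_simps)
qed

lemma tsum_tmul:
  assumes "cmult h" "\<forall>(c, m, n)\<in>set xs. 0 < m \<and> 0 < n" "\<forall>(c, m, n)\<in>set ys. 0 < m \<and> 0 < n"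
  shows "tsum (tmul xs ys) h = tsum xs h * tsum ys h"
proof -
  have "tsum (map (\<lambda>(c', m', n'). (c * c', m * m', n * n')) ys) h = c * h m * cnj (h n) * tsum ys h" if "0 < m" "0 < n" for c m n
    using assms(3)
  proof (induction ys)
    case (Cons y ys)
    then have "h (m * fst (snd y)) = h m * h (fst (snd y))" "h (n * snd (snd y)) = h n * h (snd (snd y))"
      using assms(1) that by (auto simp: cmult_def)
    with Cons show ?case by (auto simp: algebra_simps)
  qed simp
  then show ?thesis unfolding tmul_def using assms(2) by (induction xs) (auto simp: algebra_simps)
qed

lemma tpoly_mult:
  assumes "tpoly L1 B1 Q1" "tpoly L2 B2 Q2" shows "tpoly (L1 * L2) (B1 * B2) (\<lambda>h. Q1 h * Q2 h)"
proof -
  obtain xs where xs: "\<forall>(c, m, n)\<in>set xs. 0 < m \<and> 0 < n \<and> real m \<le> L1 \<and> real n \<le> L1" "tnorm xs \<le> B1" "\<And>h. cmult h \<Longrightarrow> Q1 h = tsum xs h"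
    using assms(1) unfolding tpoly_def by auto
  obtain ys where ys: "\<forall>(c, m, n)\<in>set ys. 0 < m \<and> 0 < n \<and> real m \<le> L2 \<and> real n \<le> L2" "tnorm ys \<le> B2" "\<And>h. cmult h \<Longrightarrow> Q2 h = tsum ys h"
    using assms(2) unfolding tpoly_def by auto
  show ?thesis unfolding tpoly_def
  proof (intro exI[of _ "tmul xs ys"] conjI allI impI)
    show "\<forall>(c, m, n)\<in>set (tmul xs ys). 0 < m \<and> 0 < n \<and> real m \<le> L1 * L2 \<and> real n \<le> L1 * L2"
    proof
      fix z assume "z \<in> set (tmul xs ys)"
      then obtain x y where xy: "x \<in> set xs" "y \<in> set ys" "z = (fst x * fst y, fst (snd x) * fst (snd y), snd (snd x) * snd (snd y))"
        by (auto simp: tmul_def case_prod_unfold)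
      from bspec[OF xs(1) xy(1)] bspec[OF ys(1) xy(2)]
      show "case z of (c, m, n) \<Rightarrow> 0 < m \<and> 0 < n \<and> real m \<le> L1 * L2 \<and> real n \<le> L1 * L2"
        unfolding xy(3) by (auto simp: case_prod_unfold intro!: mult_mono)
    qed
    show "tnorm (tmul xs ys) \<le> B1 * B2"
      unfolding tnorm_tmul using xs(2) ys(2) tnorm_nonneg[of xs] tnorm_nonneg[of ys] by (intro mult_mono) auto
    show "Q1 h * Q2 h = tsum (tmul xs ys) h" if "cmult h" for h
      using xs ys that by (subst tsum_tmul) (auto simp: case_prod_unfold)
  qed
qed

lemma tpoly_cmult: "tpoly L B Q \<Longrightarrow> tpoly L (norm c * B) (\<lambda>h. c * Q h)"
  using tpoly_mult[OF tpoly_const[of 1 c], of L B Q] by simp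

lemma tpoly_sum:
  assumes "finite S" "\<And>i. i \<in> S \<Longrightarrow> tpoly L (B i) (Q i)"
  shows "tpoly L (\<Sum>i\<in>S. B i) (\<lambda>h. \<Sum>i\<in>S. Q i h)"
  using assms
proof (induction S rule: finite_induct)
  case empty
  show ?case unfolding tpoly_def by (intro exI[of _ "[]"]) auto
qed (auto intro: tpoly_add)

lemma tpoly_prod:
  assumes "finite S" "\<And>i. i \<in> S \<Longrightarrow> tpoly (L i) (B i) (Q i)"
  shows "tpoly (\<Prod>i\<in>S. L i) (\<Prod>i\<in>S. B i) (\<lambda>h. \<Prod>i\<in>S. Q i h)"
  using assms
proof (induction S rule: finite_induct)
  case empty
  show ?case using tpoly_const[of 1 1] by simp
qed (auto intro: tpoly_mult)

lemma tpoly_power: "tpoly L B Q \<Longrightarrow> tpoly (L ^ k) (B ^ k) (\<lambda>h. Q h ^ k)"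
  using tpoly_prod[of "{..<k}" "\<lambda>_. L" "\<lambda>_. B" "\<lambda>_. Q"] by simp

lemma tpoly_Re: "tpoly L B Q \<Longrightarrow> tpoly L B (\<lambda>h. of_real (Re (Q h)))"
proof -
  assume Q: "tpoly L B Q"
  have "tpoly L (norm (1/2::complex) * (B + B)) (\<lambda>h. (1/2) * (Q h + cnj (Q h)))"
    by (intro tpoly_cmult tpoly_add tpoly_cnj Q)
  moreover have "(1/2) * (z + cnj z) = of_real (Re z)" for z by (simp add: complex_eq_iff)
  ultimately show ?thesis by simp
qed

text \<open>The coefficient sum is estimated crudely through 1 / j! <= 1 <= (k choose j). This is
  good enough because coefficient sums only have to stay below a small power of T.\<close>

lemma tpoly_trunc_exp:
  assumes "tpoly L B Q" "1 \<le> L"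
  shows "tpoly (L ^ k) ((1 + B) ^ k) (\<lambda>h. \<Sum>j<k. Q h ^ j / fact j)"
proof -
  have B: "0 \<le> B" using assms(1) by (rule tpoly_nonneg)
  have "tpoly (L ^ k) (\<Sum>j<k. norm (1 / fact j :: complex) * B ^ j) (\<lambda>h. \<Sum>j<k. (1 / fact j) * Q h ^ j)"
  proof (intro tpoly_sum tpoly_cmult)
    show "tpoly (L ^ k) (B ^ j) (\<lambda>h. Q h ^ j)" if "j \<in> {..<k}" for j
      by (rule tpoly_mono[OF tpoly_power[OF assms(1)]]) (use that assms(2) in \<open>auto intro: power_increasing\<close>)
  qed simp
  moreover have "(\<Sum>j<k. norm (1 / fact j :: complex) * B ^ j) \<le> (1 + B) ^ k"
  proof -
    have "(\<Sum>j<k. norm (1 / fact j :: complex) * B ^ j) \<le> (\<Sum>j\<le>k. real (k choose j) * B ^ j)"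
    proof (rule order_trans[OF sum_mono sum_mono2])
      show "norm (1 / fact j :: complex) * B ^ j \<le> real (k choose j) * B ^ j" if "j \<in> {..<k}" for j
      proof (intro mult_right_mono)
        have "1 \<le> real (k choose j)" using that by (simp add: Suc_le_eq)
        moreover have "norm (1 / fact j :: complex) \<le> 1" by (simp add: norm_divide)
        ultimately show "norm (1 / fact j :: complex) \<le> real (k choose j)" by linarith
      qed (use B in auto)
    qed (use B in auto)
    also have "\<dots> = (1 + B) ^ k" using binomial_ring[of B 1 k] by (simp add: add.commute)
    finally show ?thesis .
  qed
  ultimately show ?thesis by (auto intro: tpoly_mono)
qed

definition nit :: "real \<Rightarrow> nat \<Rightarrow> complex" where
  "nit t n = cis (- t * ln (real n))"

lemma cmult_nit: "cmult (nit t)"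
  by (auto simp: cmult_def nit_def ln_mult cis_mult algebra_simps)

lemma powr_nit: "0 < n \<Longrightarrow> of_nat n powr (- (s + \<i> * of_real t)) = of_nat n powr (-s) * nit t n"
proof -
  assume n: "0 < n"
  have "of_nat n powr (- (s + \<i> * of_real t)) = of_nat n powr (-s) * of_nat n powr (- (\<i> * of_real t))"
    by (simp add: powr_add[symmetric])
  also have "complex_of_nat n powr (- (\<i> * of_real t)) = nit t n"
    using n powr_line[of "real n" 0 t] by (simp add: nit_def Complex_eq)
  finally show ?thesis .
qed

lemma int_nit:
  assumes ab: "a \<le> b" and mn: "0 < m" "0 < n" "real m \<le> L" "real n \<le> L"
  obtains I where "((\<lambda>t. nit t m * cnj (nit t n)) has_integral I) {a..b}"
    "norm (I - of_real (b - a) * (if m = n then 1 else 0)) \<le> 2 * L"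
proof -
  have e: "nit t m * cnj (nit t n) = cis ((ln (real n) - ln (real m)) * t)" for t
    by (simp add: nit_def cis_cnj cis_mult algebra_simps)
  show ?thesis
  proof (cases "m = n")
    case True
    show ?thesis
    proof (rule that[of "of_real (b - a)"])
      show "((\<lambda>t. nit t m * cnj (nit t n)) has_integral of_real (b - a)) {a..b}"
      proof -
        have "nit t m * cnj (nit t n) = 1" for t unfolding e using True by simp
        then show ?thesis using has_integral_const_real[of "1::complex" a b] ab by (simp add: scaleR_conv_of_real)
      qed
    qed (use True mn in auto)
  next
    case False
    then have "ln (real n) - ln (real m) \<noteq> 0" using mn by simp
    from cis_integral_bound[OF this ab] obtain I where
      I: "((\<lambda>t. cis ((ln (real n) - ln (real m)) * t)) has_integral I) {a..b}" "norm I \<le> 2 / \<bar>ln (real n) - ln (real m)\<bar>" by blast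
    have "1 / \<bar>ln (real n) - ln (real m)\<bar> \<le> 1 + min (real n) (real m) / \<bar>real n - real m\<bar>"
      using mn False by (intro inverse_ln_diff_le) auto
    also have "\<dots> \<le> 1 + min (real n) (real m) / 1"
      using mn False by (intro add_left_mono divide_left_mono) auto
    also have "\<dots> \<le> L" using mn False by auto
    finally have "norm I \<le> 2 * L" using I(2) by simp
    then show ?thesis using I(1) False by (intro that[of I]) (auto simp: e)
  qed
qed

lemma int_tsum_nit:
  assumes ab: "a \<le> b" and xs: "\<forall>(c, m, n)\<in>set xs. 0 < m \<and> 0 < n \<and> real m \<le> L \<and> real n \<le> L"
  shows "\<exists>I. ((\<lambda>t. tsum xs (nit t)) has_integral I) {a..b} \<and>
    norm (I - of_real (b - a) * (\<Sum>(c, m, n)\<leftarrow>xs. if m = n then c else 0)) \<le> 2 * tnorm xs * L"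
  using xs
proof (induction xs)
  case Nil
  then show ?case by (intro exI[of _ 0]) (auto simp: tsum_def)
next
  case (Cons x xs)
  obtain c m n where x: "x = (c, m, n)" by (cases x)
  obtain I where I: "((\<lambda>t. tsum xs (nit t)) has_integral I) {a..b}"
    "norm (I - of_real (b - a) * (\<Sum>(c, m, n)\<leftarrow>xs. if m = n then c else 0)) \<le> 2 * tnorm xs * L"
    using Cons by auto
  obtain I1 where I1: "((\<lambda>t. nit t m * cnj (nit t n)) has_integral I1) {a..b}"
    "norm (I1 - of_real (b - a) * (if m = n then 1 else 0)) \<le> 2 * L"
    using int_nit[OF ab, of m n L] Cons.prems x by auto
  have "((\<lambda>t. c * (nit t m * cnj (nit t n)) + tsum xs (nit t)) has_integral c * I1 + I) {a..b}"
    by (intro has_integral_add has_integral_mult_right I(1) I1(1))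
  moreover have "norm ((c * I1 + I) - of_real (b - a) * (\<Sum>(c, m, n)\<leftarrow>x # xs. if m = n then c else 0)) \<le> 2 * tnorm (x # xs) * L"
  proof -
    have "(c * I1 + I) - of_real (b - a) * (\<Sum>(c, m, n)\<leftarrow>x # xs. if m = n then c else 0)
      = c * (I1 - of_real (b - a) * (if m = n then 1 else 0)) + (I - of_real (b - a) * (\<Sum>(c, m, n)\<leftarrow>xs. if m = n then c else 0))"
      by (simp add: x algebra_simps)
    also have "norm \<dots> \<le> norm c * norm (I1 - of_real (b - a) * (if m = n then 1 else 0)) + norm (I - of_real (b - a) * (\<Sum>(c, m, n)\<leftarrow>xs. if m = n then c else 0))"
      unfolding norm_mult[symmetric] by (rule norm_triangle_ineq)
    also have "\<dots> \<le> norm c * (2 * L) + 2 * tnorm xs * L"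
      by (intro add_mono mult_left_mono I1 I) auto
    finally show ?thesis by (simp add: x algebra_simps)
  qed
  ultimately show ?case by (auto simp: x mult.assoc)
qed

section \<open>The random model\<close>

lemma cis_measurable: "cis \<in> borel_measurable (uniform_measure lborel A)"
proof -
  have "cis \<in> borel_measurable borel"
    unfolding cis_conv_exp[abs_def] by (intro borel_measurable_continuous_onI continuous_intros)
  then show ?thesis using measurable_cong_sets[of "uniform_measure lborel A" borel borel borel] by simp
qed

lemma borel_measurable_cnj: "f \<in> borel_measurable M \<Longrightarrow> (\<lambda>x. cnj (f x)) \<in> borel_measurable M"
  by (rule measurable_compose[OF _ borel_measurable_continuous_onI]) (auto intro: continuous_intros)

lemma unit_circle_integral_cis:
  fixes k :: int
  shows "integrable (uniform_measure lborel {0..2 * pi}) (\<lambda>\<theta>. cis (of_int k * \<theta>))"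
    "(LINT \<theta>|uniform_measure lborel {0..2 * pi}. cis (of_int k * \<theta>)) = (if k = 0 then 1 else 0)"
proof -
  have um: "uniform_measure lborel {0..2 * pi} = density lborel (\<lambda>x. ennreal (indicator {0..2 * pi} x / (2 * pi)))"
    unfolding uniform_measure_def
    by (intro arg_cong[of _ _ "density lborel"] ext)
       (auto simp: divide_ennreal ennreal_indicator[symmetric] indicator_def simp flip: ennreal_1)
  have m: "(\<lambda>\<theta>. cis (of_int k * \<theta>)) \<in> borel_measurable borel"
    unfolding cis_conv_exp by (intro borel_measurable_continuous_onI continuous_intros)
  have c: "continuous_on {0..2 * pi} (\<lambda>\<theta>. cis (of_int k * \<theta>))"
    unfolding cis_conv_exp by (intro continuous_intros)
  have si: "set_integrable lborel {0..2 * pi} (\<lambda>\<theta>. cis (of_int k * \<theta>))"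
    by (rule borel_integrable_atLeastAtMost'[OF c])
  have pr: "prob_space (uniform_measure lborel {0..2 * pi})" by (intro prob_space_uniform_measure) auto
  interpret pr: prob_space "uniform_measure lborel {0..2 * pi}" by (rule pr)
  show "integrable (uniform_measure lborel {0..2 * pi}) (\<lambda>\<theta>. cis (of_int k * \<theta>))"
    by (intro pr.integrable_const_bound[of _ 1]) (use m in auto)
  have "(LINT \<theta>|uniform_measure lborel {0..2 * pi}. cis (of_int k * \<theta>))
     = (LINT \<theta>|lborel. (indicator {0..2 * pi} \<theta> / (2 * pi)) *\<^sub>R cis (of_int k * \<theta>))"
    unfolding um using m by (subst integral_density) auto
  also have "\<dots> = (LINT \<theta>|lborel. (1 / (2 * pi)) *\<^sub>R (indicator {0..2 * pi} \<theta> *\<^sub>R cis (of_int k * \<theta>)))"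
    by (intro Bochner_Integration.integral_cong) auto
  also have "\<dots> = (1 / (2 * pi)) *\<^sub>R (LINT \<theta>:{0..2 * pi}|lborel. cis (of_int k * \<theta>))"
    unfolding set_lebesgue_integral_def by (rule integral_scaleR_right)
  also have "(LINT \<theta>:{0..2 * pi}|lborel. cis (of_int k * \<theta>)) = integral {0..2 * pi} (\<lambda>\<theta>. cis (of_int k * \<theta>))"
    by (rule set_borel_integral_eq_integral(2)[OF si])
  also have "(1 / (2 * pi)) *\<^sub>R \<dots> = (if k = 0 then 1 else 0)"
  proof (cases "k = 0")
    case True
    then show ?thesis by (simp add: scaleR_conv_of_real)
  next
    case False
    define F where "F = (\<lambda>t. cis (of_int k * t) / (\<i> * of_int k))"
    have "((\<lambda>t. cis (of_int k * t)) has_integral F (2 * pi) - F 0) {0..2 * pi}"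
    proof (rule fundamental_theorem_of_calculus)
      fix t show "(F has_vector_derivative cis (of_int k * t)) (at t within {0..2 * pi})"
        unfolding F_def cis_conv_exp using False
        by (auto intro!: derivative_eq_intros has_vector_derivative_real_field simp: field_simps)
    qed simp
    moreover have "cis (of_int k * (2 * pi)) = 1" using cis_multiple_2pi[of "of_int k"] by (simp add: mult_ac)
    ultimately show ?thesis using False by (simp add: F_def integral_unique)
  qed
  finally show "(LINT \<theta>|uniform_measure lborel {0..2 * pi}. cis (of_int k * \<theta>)) = (if k = 0 then 1 else 0)" .
qed

text \<open>The completely multiplicative extension of values prescribed at the primes.\<close>

definition chi :: "(nat \<Rightarrow> complex) \<Rightarrow> nat \<Rightarrow> complex" where
  "chi x n = (\<Prod>p\<in>prime_factors n. x p ^ multiplicity p n)"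

lemma chi_superset:
  assumes "finite S" "prime_factors n \<subseteq> S" "\<And>p. p \<in> S \<Longrightarrow> prime p" "n > 0"
  shows "chi x n = (\<Prod>p\<in>S. x p ^ multiplicity p n)"
  unfolding chi_def
proof (rule prod.mono_neutral_left)
  show "\<forall>p\<in>S - prime_factors n. x p ^ multiplicity p n = 1"
  proof
    fix p assume p: "p \<in> S - prime_factors n"
    then have "\<not> p dvd n" using assms(3)[of p] assms(4) by (auto simp: prime_factors_dvd)
    then show "x p ^ multiplicity p n = 1" by (simp add: not_dvd_imp_multiplicity_0)
  qed
qed (use assms in auto)

lemma chi_prime: "prime p \<Longrightarrow> chi x p = x p"
  by (simp add: chi_def prime_prime_factors)

lemma chi_prime_power: "prime p \<Longrightarrow> k > 0 \<Longrightarrow> chi x (p ^ k) = x p ^ k"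
  by (simp add: chi_def prime_factors_power prime_prime_factors)

lemma cmult_chi:
  assumes "\<And>p. prime p \<Longrightarrow> norm (x p) = 1" shows "cmult (chi x)"
  unfolding cmult_def
proof (intro conjI allI impI)
  show "chi x 1 = 1" by (simp add: chi_def)
  show "norm (chi x n) = 1" if "n > 0" for n
    unfolding chi_def prod_norm[symmetric] norm_power
    by (intro prod.neutral) (auto simp: assms in_prime_factors_imp_prime)
  show "chi x (m * n) = chi x m * chi x n" if mn: "m > 0" "n > 0" for m n
  proof -
    define S where "S = prime_factors m \<union> prime_factors n"
    have S: "finite S" "\<And>p. p \<in> S \<Longrightarrow> prime p" by (auto simp: S_def)
    have "chi x (m * n) = (\<Prod>p\<in>S. x p ^ multiplicity p (m * n))"
      using S mn by (intro chi_superset) (auto simp: S_def prime_factors_product)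
    also have "\<dots> = (\<Prod>p\<in>S. x p ^ multiplicity p m * x p ^ multiplicity p n)"
      using S mn by (intro prod.cong) (auto simp: prime_elem_multiplicity_mult_distrib power_add)
    also have "\<dots> = chi x m * chi x n"
    proof -
      have "chi x m = (\<Prod>p\<in>S. x p ^ multiplicity p m)" "chi x n = (\<Prod>p\<in>S. x p ^ multiplicity p n)"
        by (rule chi_superset[OF S(1) _ S(2)]; use mn in \<open>auto simp: S_def\<close>)+
      then show ?thesis by (simp add: prod.distrib)
    qed
    finally show ?thesis .
  qed
qed

locale rmodel =
  fixes M :: "'a measure" and X :: "nat \<Rightarrow> 'a \<Rightarrow> complex"
  assumes rm: "random_model M X"

sublocale rmodel \<subseteq> prob_space M
  using rm by (simp add: random_model_def)

context rmodel
begin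

lemma indep_X: "indep_vars (\<lambda>_. borel) X {p. prime p}"
  using rm by (simp add: random_model_def)

lemma X_measurable: "prime p \<Longrightarrow> X p \<in> borel_measurable M"
  using indep_X by (auto simp: indep_vars_def)

lemma X_distr: "prime p \<Longrightarrow> distr M borel (X p) = unit_circle_measure"
  using rm by (simp add: random_model_def)

lemma norm_X: "AE \<omega> in M. \<forall>p. prime p \<longrightarrow> norm (X p \<omega>) = 1"
proof (subst AE_all_countable, intro allI)
  fix p
  show "AE \<omega> in M. prime p \<longrightarrow> norm (X p \<omega>) = 1"
  proof (cases "prime p")
    case True
    have "AE z in unit_circle_measure. norm z = 1"
      unfolding unit_circle_measure_def by (subst AE_distr_iff) (auto intro: cis_measurable)
    then have "AE z in distr M borel (X p). norm z = 1" unfolding X_distr[OF True] .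
    then show ?thesis by (subst (asm) AE_distr_iff) (auto intro: X_measurable True)
  qed simp
qed

lemma cmult_X: "AE \<omega> in M. cmult (chi (\<lambda>p. X p \<omega>))"
  using norm_X by eventually_elim (auto intro: cmult_chi)

lemma expectation_X:
  assumes "prime p" "f \<in> borel_measurable borel"
  shows "expectation (\<lambda>\<omega>. f (X p \<omega>)) = (LINT \<theta>|uniform_measure lborel {0..2 * pi}. f (cis \<theta>) :: complex)"
proof -
  have "expectation (\<lambda>\<omega>. f (X p \<omega>)) = (LINT z|distr M borel (X p). f z)"
    using assms X_measurable by (intro integral_distr[symmetric]) auto
  also have "\<dots> = (LINT \<theta>|uniform_measure lborel {0..2 * pi}. f (cis \<theta>))"
    unfolding X_distr[OF assms(1)] unit_circle_measure_def
    using assms(2) by (intro integral_distr cis_measurable)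
  finally show ?thesis .
qed

lemma expectation_X_powers:
  assumes "prime p"
  shows "expectation (\<lambda>\<omega>. X p \<omega> ^ a * cnj (X p \<omega>) ^ b) = (if a = b then 1 else 0)"
proof -
  have "cis \<theta> ^ a * cnj (cis \<theta>) ^ b = cis (of_int (int a - int b) * \<theta>)" for \<theta>
    by (simp add: cis_cnj Complex.DeMoivre cis_mult algebra_simps)
  moreover have "(\<lambda>z::complex. z ^ a * cnj z ^ b) \<in> borel_measurable borel"
    by (intro borel_measurable_continuous_onI continuous_intros)
  ultimately show ?thesis
    using expectation_X[OF assms, of "\<lambda>z. z ^ a * cnj z ^ b"] unit_circle_integral_cis(2)[of "int a - int b"] by simp
qed

lemma chi_X_measurable: "(\<lambda>\<omega>. chi (\<lambda>p. X p \<omega>) n) \<in> borel_measurable M"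
  unfolding chi_def by (intro borel_measurable_prod borel_measurable_power X_measurable) auto

text \<open>Orthogonality: by independence the expectation factors over the primes, and a prime
  occurring in m and n with different multiplicities contributes a factor 0.\<close>

lemma expectation_chi:
  assumes mn: "0 < m" "0 < n"
  shows "expectation (\<lambda>\<omega>. chi (\<lambda>p. X p \<omega>) m * cnj (chi (\<lambda>p. X p \<omega>) n)) = (if m = n then 1 else 0)"
proof -
  define S where "S = prime_factors m \<union> prime_factors n"
  have S: "finite S" "\<And>p. p \<in> S \<Longrightarrow> prime p" by (auto simp: S_def)
  define Y where "Y = (\<lambda>p \<omega>. X p \<omega> ^ multiplicity p m * cnj (X p \<omega>) ^ multiplicity p n)"
  have e: "chi (\<lambda>p. X p \<omega>) m * cnj (chi (\<lambda>p. X p \<omega>) n) = (\<Prod>p\<in>S. Y p \<omega>)" for \<omega>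
  proof -
    have "chi x m = (\<Prod>p\<in>S. x p ^ multiplicity p m)" "chi x n = (\<Prod>p\<in>S. x p ^ multiplicity p n)" for x
      by (rule chi_superset[OF S(1) _ S(2)]; use mn in \<open>auto simp: S_def\<close>)+
    then show ?thesis by (simp add: Y_def prod.distrib)
  qed
  have ind: "indep_vars (\<lambda>_. borel) Y S"
    unfolding Y_def
  proof (rule indep_vars_compose2[where Y = "\<lambda>p z. z ^ multiplicity p m * cnj z ^ multiplicity p n"])
    show "indep_vars (\<lambda>_. borel) X S" by (rule indep_vars_subset[OF indep_X]) (use S in auto)
  qed (auto intro!: borel_measurable_continuous_onI continuous_intros)
  have int: "integrable M (Y p)" if "p \<in> S" for p
  proof (rule integrable_const_bound[of _ 1])
    show "AE \<omega> in M. norm (Y p \<omega>) \<le> 1"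
      using norm_X by eventually_elim (use S that in \<open>auto simp: Y_def norm_mult norm_power\<close>)
    show "Y p \<in> borel_measurable M" using ind that by (auto simp: indep_vars_def)
  qed
  have "expectation (\<lambda>\<omega>. \<Prod>p\<in>S. Y p \<omega>) = (\<Prod>p\<in>S. expectation (Y p))"
    by (rule indep_vars_lebesgue_integral[OF S(1) ind int])
  also have "\<dots> = (\<Prod>p\<in>S. if multiplicity p m = multiplicity p n then 1 else 0)"
    using S by (intro prod.cong) (auto simp: Y_def expectation_X_powers)
  also have "\<dots> = (if m = n then 1 else 0)"
  proof (cases "m = n")
    case False
    obtain p where p: "prime p" "multiplicity p m \<noteq> multiplicity p n"
      using False mn multiplicity_eq_nat[of m n] by auto
    then have "p \<in> S" using mn unfolding S_def
      by (auto simp: prime_factors_dvd) (metis not_dvd_imp_multiplicity_0)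
    then show ?thesis using False p S(1) by (auto simp: prod_zero_iff)
  qed simp
  finally show ?thesis by (simp add: e)
qed

lemma tsum_X:
  assumes "\<forall>(c, m, n)\<in>set xs. 0 < m \<and> 0 < n"
  shows "integrable M (\<lambda>\<omega>. tsum xs (chi (\<lambda>p. X p \<omega>))) \<and>
    expectation (\<lambda>\<omega>. tsum xs (chi (\<lambda>p. X p \<omega>))) = (\<Sum>(c, m, n)\<leftarrow>xs. if m = n then c else 0)"
  using assms
proof (induction xs)
  case (Cons x xs)
  obtain c m n where x: "x = (c, m, n)" by (cases x)
  then have mn: "0 < m" "0 < n" using Cons.prems by auto
  have i: "integrable M (\<lambda>\<omega>. chi (\<lambda>p. X p \<omega>) m * cnj (chi (\<lambda>p. X p \<omega>) n))"
  proof (rule integrable_const_bound[of _ 1])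
    show "AE \<omega> in M. norm (chi (\<lambda>p. X p \<omega>) m * cnj (chi (\<lambda>p. X p \<omega>) n)) \<le> 1"
      using cmult_X by eventually_elim (use mn in \<open>auto simp: cmult_def norm_mult\<close>)
  qed (intro borel_measurable_times borel_measurable_cnj chi_X_measurable)
  show ?case using Cons i by (simp add: x mult.assoc expectation_chi[OF mn])
qed simp

text \<open>Distinct \<open>m, n \<le> L\<close> have \<open>\<bar>ln (m / n)\<bar> \<ge> 1 / L\<close>, so that every off-diagonal term has an integral of
  size \<open>O(L)\<close>, whatever the interval.\<close>

lemma tpoly_transference:
  assumes Q: "tpoly L B Q" and L: "0 \<le> L" and ab: "a \<le> b"
    and m: "(\<lambda>\<omega>. Q (chi (\<lambda>p. X p \<omega>))) \<in> borel_measurable M"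
  shows "(\<lambda>t. Q (nit t)) integrable_on {a..b}" "integrable M (\<lambda>\<omega>. Q (chi (\<lambda>p. X p \<omega>)))"
    "norm (integral {a..b} (\<lambda>t. Q (nit t)) - of_real (b - a) * expectation (\<lambda>\<omega>. Q (chi (\<lambda>p. X p \<omega>)))) \<le> 2 * B * L"
proof -
  obtain xs where xs: "\<forall>(c, m, n)\<in>set xs. 0 < m \<and> 0 < n \<and> real m \<le> L \<and> real n \<le> L" "tnorm xs \<le> B" "\<And>h. cmult h \<Longrightarrow> Q h = tsum xs h"
    using Q unfolding tpoly_def by auto
  obtain I where I: "((\<lambda>t. tsum xs (nit t)) has_integral I) {a..b}"
    "norm (I - of_real (b - a) * (\<Sum>(c, m, n)\<leftarrow>xs. if m = n then c else 0)) \<le> 2 * tnorm xs * L"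
    using int_tsum_nit[OF ab xs(1)] by blast
  have Qn: "(\<lambda>t. Q (nit t)) = (\<lambda>t. tsum xs (nit t))" using xs(3) cmult_nit by auto
  show "(\<lambda>t. Q (nit t)) integrable_on {a..b}" unfolding Qn using I(1) by blast
  have tX: "integrable M (\<lambda>\<omega>. tsum xs (chi (\<lambda>p. X p \<omega>)))"
    "expectation (\<lambda>\<omega>. tsum xs (chi (\<lambda>p. X p \<omega>))) = (\<Sum>(c, m, n)\<leftarrow>xs. if m = n then c else 0)"
    using tsum_X[of xs] xs(1) by fastforce+
  have ae: "AE \<omega> in M. Q (chi (\<lambda>p. X p \<omega>)) = tsum xs (chi (\<lambda>p. X p \<omega>))"
    using cmult_X by eventually_elim (rule xs(3))
  have tm: "(\<lambda>\<omega>. tsum xs (chi (\<lambda>p. X p \<omega>))) \<in> borel_measurable M"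
    using tX(1) by (rule borel_measurable_integrable)
  show "integrable M (\<lambda>\<omega>. Q (chi (\<lambda>p. X p \<omega>)))"
    using integrable_cong_AE[OF m tm ae] tX(1) by simp
  have "norm (I - of_real (b - a) * (\<Sum>(c, m, n)\<leftarrow>xs. if m = n then c else 0)) \<le> 2 * B * L"
    by (rule order_trans[OF I(2)]) (use xs(2) L in \<open>auto intro!: mult_right_mono\<close>)
  then show "norm (integral {a..b} (\<lambda>t. Q (nit t)) - of_real (b - a) * expectation (\<lambda>\<omega>. Q (chi (\<lambda>p. X p \<omega>)))) \<le> 2 * B * L"
    unfolding integral_cong_AE[OF m tm ae] tX(2) Qn integral_unique[OF I(1)] .
qed

end

section \<open>Exponential moments of block sums in the random model\<close>

definition hmin :: "real \<Rightarrow> real" where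
  "hmin x = min x (x ^ 2)"

lemma exp_le_quadratic:
  assumes "\<bar>y\<bar> \<le> (1::real)" shows "exp y \<le> 1 + y + y ^ 2"
proof (cases "y \<ge> 0")
  case True
  then show ?thesis using assms exp_bound[of y] by simp
next
  case False
  define x where "x = - y"
  have x: "0 < x" "x \<le> 1" using False assms by (auto simp: x_def)
  have "exp y = 1 / exp x" by (simp add: x_def exp_minus divide_inverse)
  also have "\<dots> \<le> 1 / (1 + x)" using x by (intro divide_left_mono) auto
  also have "\<dots> \<le> 1 - x + x ^ 2"
  proof -
    have "1 \<le> (1 - x + x ^ 2) * (1 + x)" using x by (simp add: algebra_simps power2_eq_square power3_eq_cube[symmetric])
    then show ?thesis using x by (simp add: pos_divide_le_eq)
  qed
  finally show ?thesis by (simp add: x_def)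
qed

lemma power_div_fact_le_exp: "0 \<le> x \<Longrightarrow> x ^ k / fact k \<le> exp (x::real)"
proof -
  assume x: "0 \<le> x"
  have s: "summable (\<lambda>n. x ^ n / fact n)" using summable_exp[of x] by (simp add: field_simps)
  have "(\<Sum>n\<in>{k}. x ^ n / fact n) \<le> (\<Sum>n. x ^ n / fact n)"
    using x by (intro sum_le_suminf s) auto
  then show ?thesis by (simp add: exp_def scaleR_conv_of_real divide_inverse mult.commute)
qed

text \<open>With b n = n powr (- s) this is part of the series of log zeta: at s + i t for
  \<open>h = nit t\<close>, and in the random model for \<open>h = chi\<close> of the random values.
  Linear combinations over the points s j only change \<open>b\<close>.\<close>

definition Gsum :: "nat set \<Rightarrow> (nat \<Rightarrow> complex) \<Rightarrow> (nat \<Rightarrow> complex) \<Rightarrow> complex" where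
  "Gsum B b h = (\<Sum>n\<in>B. of_real (lam n) * b n * h n)"

lemma tpoly_Gsum:
  assumes "finite B" "\<And>n. n \<in> B \<Longrightarrow> 0 < n \<and> real n \<le> L"
  shows "tpoly L (\<Sum>n\<in>B. norm (b n)) (Gsum B b)"
proof -
  have "tpoly L (\<Sum>n\<in>B. norm (of_real (lam n) * b n) * 1) (\<lambda>h. \<Sum>n\<in>B. (of_real (lam n) * b n) * h n)"
    using assms by (intro tpoly_sum tpoly_cmult tpoly_char) auto
  then have "tpoly L (\<Sum>n\<in>B. norm (of_real (lam n) * b n) * 1) (Gsum B b)" by (simp add: Gsum_def[abs_def])
  moreover have "(\<Sum>n\<in>B. norm (of_real (lam n) * b n) * 1) \<le> (\<Sum>n\<in>B. norm (b n))"
    using lam_le_1 lam_nonneg by (intro sum_mono) (auto simp: norm_mult intro: mult_left_le_one_le)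
  ultimately show ?thesis by (auto intro: tpoly_mono)
qed

text \<open>The primes carry the randomness of a block, the higher prime powers are bounded trivially by \<open>D\<close>.\<close>

lemma exp_Re_Gsum_le:
  assumes B: "finite B" "0 \<notin> B" and h: "cmult h" and D: "(\<Sum>n\<in>{n\<in>B. \<not> prime n}. lam n * norm (b n)) \<le> D" and r: "r \<ge> 0"
  defines "a \<equiv> (\<Sum>p\<in>{n\<in>B. prime n}. Re (of_real r * b p * h p))"
  shows "exp (r * \<bar>Re (Gsum B b h)\<bar>) \<le> exp (r * D) * (exp a + exp (- a))"
proof -
  have "Gsum B b h = (\<Sum>n\<in>{n\<in>B. prime n}. of_real (lam n) * b n * h n) + (\<Sum>n\<in>{n\<in>B. \<not> prime n}. of_real (lam n) * b n * h n)"
    unfolding Gsum_def using B by (subst sum.union_disjoint[symmetric]) (auto intro: sum.cong)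
  also have "(\<Sum>n\<in>{n\<in>B. prime n}. of_real (lam n) * b n * h n) = (\<Sum>n\<in>{n\<in>B. prime n}. b n * h n)"
  proof (intro sum.cong refl)
    fix p assume "p \<in> {n \<in> B. prime n}"
    then have p: "prime p" by simp
    then have "lam p = 1" using prime_gt_1_nat[OF p] mangoldt_primepow[OF p, of 1] by (simp add: lam_def)
    then show "of_real (lam p) * b p * h p = b p * h p" by simp
  qed
  finally have G: "Gsum B b h = (\<Sum>n\<in>{n\<in>B. prime n}. b n * h n) + (\<Sum>n\<in>{n\<in>B. \<not> prime n}. of_real (lam n) * b n * h n)" .
  have "norm (\<Sum>n\<in>{n\<in>B. \<not> prime n}. of_real (lam n) * b n * h n) \<le> (\<Sum>n\<in>{n\<in>B. \<not> prime n}. lam n * norm (b n))"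
  proof (intro sum_norm_le)
    fix n assume "n \<in> {n \<in> B. \<not> prime n}"
    then have "n > 0" using B by (auto intro: Nat.gr0I)
    then have "norm (h n) = 1" using h by (simp add: cmult_def)
    then show "norm (of_real (lam n) * b n * h n) \<le> lam n * norm (b n)" by (simp add: norm_mult lam_nonneg)
  qed
  also have "\<dots> \<le> D" by (rule D)
  finally have n: "\<bar>Re (\<Sum>n\<in>{n\<in>B. \<not> prime n}. of_real (lam n) * b n * h n)\<bar> \<le> D"
    using abs_Re_le_cmod order_trans by blast
  have "a = r * Re (\<Sum>n\<in>{n\<in>B. prime n}. b n * h n)"
    unfolding a_def Re_sum sum_distrib_left by (intro sum.cong) (auto simp: algebra_simps)
  then have "\<bar>a\<bar> = r * \<bar>Re (\<Sum>n\<in>{n\<in>B. prime n}. b n * h n)\<bar>" using r by (simp add: abs_mult)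
  moreover have "\<bar>Re (Gsum B b h)\<bar> \<le> \<bar>Re (\<Sum>n\<in>{n\<in>B. prime n}. b n * h n)\<bar> + D" using n unfolding G by simp
  then have "r * \<bar>Re (Gsum B b h)\<bar> \<le> r * (\<bar>Re (\<Sum>n\<in>{n\<in>B. prime n}. b n * h n)\<bar> + D)" using r by (rule mult_left_mono)
  ultimately have "r * \<bar>Re (Gsum B b h)\<bar> \<le> r * D + \<bar>a\<bar>" by (simp add: algebra_simps)
  then have "exp (r * \<bar>Re (Gsum B b h)\<bar>) \<le> exp (r * D) * exp \<bar>a\<bar>" by (simp add: exp_add[symmetric])
  also have "\<dots> \<le> exp (r * D) * (exp a + exp (- a))" by (intro mult_left_mono) (auto simp: abs_if)
  finally show ?thesis .
qed

context rmodel
begin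

lemma Gsum_measurable: "(\<lambda>\<omega>. Gsum B b (chi (\<lambda>p. X p \<omega>))) \<in> borel_measurable M"
  unfolding Gsum_def by (intro borel_measurable_sum borel_measurable_times chi_X_measurable borel_measurable_const)

text \<open>The trivial bound |\<beta>| for the exponent is always available. For |\<beta>| <= 1 the
  mean zero of X p removes the linear term of the exponential, and only the square remains.\<close>

lemma expectation_exp_Re:
  assumes p: "prime p"
  shows "integrable M (\<lambda>\<omega>. exp (Re (\<beta> * X p \<omega>)))" "expectation (\<lambda>\<omega>. exp (Re (\<beta> * X p \<omega>))) \<le> exp (hmin (norm \<beta>))"
proof -
  note m[measurable] = X_measurable[OF p]
  have b: "AE \<omega> in M. \<bar>Re (\<beta> * X p \<omega>)\<bar> \<le> norm \<beta>"
    using norm_X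
  proof eventually_elim
    case (elim \<omega>)
    then have "norm (\<beta> * X p \<omega>) = norm \<beta>" using p by (simp add: norm_mult)
    then show ?case using abs_Re_le_cmod[of "\<beta> * X p \<omega>"] by simp
  qed
  show i: "integrable M (\<lambda>\<omega>. exp (Re (\<beta> * X p \<omega>)))"
    by (rule integrable_const_bound[of _ "exp (norm \<beta>)"]) (use b in \<open>eventually_elim, auto\<close>, measurable)
  have iX: "integrable M (\<lambda>\<omega>. \<beta> * X p \<omega>)"
  proof (rule integrable_const_bound[of _ "norm \<beta>"])
    show "AE \<omega> in M. norm (\<beta> * X p \<omega>) \<le> norm \<beta>"
      using norm_X by eventually_elim (use p in \<open>auto simp: norm_mult\<close>)
  qed measurable
  have E0: "expectation (\<lambda>\<omega>. Re (\<beta> * X p \<omega>)) = 0"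
    using expectation_X_powers[OF p, of 1 0] unfolding integral_Re[OF iX] by simp
  show "expectation (\<lambda>\<omega>. exp (Re (\<beta> * X p \<omega>))) \<le> exp (hmin (norm \<beta>))"
  proof (cases "norm \<beta> \<le> 1")
    case True
    have iR: "integrable M (\<lambda>\<omega>. Re (\<beta> * X p \<omega>))" using iX by (rule integrable_Re)
    have "expectation (\<lambda>\<omega>. exp (Re (\<beta> * X p \<omega>))) \<le> expectation (\<lambda>\<omega>. (1 + norm \<beta> ^ 2) + Re (\<beta> * X p \<omega>))"
    proof (rule integral_mono_AE[OF i])
      show "integrable M (\<lambda>\<omega>. (1 + norm \<beta> ^ 2) + Re (\<beta> * X p \<omega>))" using iR by (intro Bochner_Integration.integrable_add) auto
      show "AE \<omega> in M. exp (Re (\<beta> * X p \<omega>)) \<le> (1 + norm \<beta> ^ 2) + Re (\<beta> * X p \<omega>)"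
        using b
      proof eventually_elim
        case (elim \<omega>)
        have "exp (Re (\<beta> * X p \<omega>)) \<le> 1 + Re (\<beta> * X p \<omega>) + Re (\<beta> * X p \<omega>) ^ 2"
          using elim True by (intro exp_le_quadratic) linarith
        moreover have "Re (\<beta> * X p \<omega>) ^ 2 \<le> norm \<beta> ^ 2" using elim by (rule abs_le_square_iff[THEN iffD1, OF order_trans]) simp
        ultimately show ?case by linarith
      qed
    qed
    also have "\<dots> = 1 + norm \<beta> ^ 2 + expectation (\<lambda>\<omega>. Re (\<beta> * X p \<omega>))"
      using iR by (subst Bochner_Integration.integral_add) (auto simp: prob_space)
    also have "\<dots> \<le> exp (norm \<beta> ^ 2)" using E0 exp_ge_add_one_self[of "norm \<beta> ^ 2"] by simp
    also have "norm \<beta> ^ 2 = hmin (norm \<beta>)" using True power_decreasing[of 1 2 "norm \<beta>"] by (simp add: hmin_def)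
    finally show ?thesis .
  next
    case False
    have "expectation (\<lambda>\<omega>. exp (Re (\<beta> * X p \<omega>))) \<le> expectation (\<lambda>\<omega>. exp (norm \<beta>))"
    proof (rule integral_mono_AE[OF i])
      show "AE \<omega> in M. exp (Re (\<beta> * X p \<omega>)) \<le> exp (norm \<beta>)" using b by eventually_elim auto
    qed simp
    also have "\<dots> = exp (hmin (norm \<beta>))" using False mult_left_mono[of 1 "norm \<beta>" "norm \<beta>"]
      by (simp add: hmin_def prob_space power2_eq_square)
    finally show ?thesis .
  qed
qed

lemma expectation_exp_sum:
  assumes A: "finite A" "\<forall>p\<in>A. prime p"
  shows "integrable M (\<lambda>\<omega>. exp (\<Sum>p\<in>A. Re (\<beta> p * X p \<omega>)))"
    "expectation (\<lambda>\<omega>. exp (\<Sum>p\<in>A. Re (\<beta> p * X p \<omega>))) \<le> exp (\<Sum>p\<in>A. hmin (norm (\<beta> p)))"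
proof -
  have ind: "indep_vars (\<lambda>_. borel) (\<lambda>p \<omega>. exp (Re (\<beta> p * X p \<omega>))) A"
  proof (rule indep_vars_compose2[where Y = "\<lambda>p z. exp (Re (\<beta> p * z))"])
    show "indep_vars (\<lambda>_. borel) X A" by (rule indep_vars_subset[OF indep_X]) (use A in auto)
  qed (auto intro!: borel_measurable_continuous_onI continuous_intros)
  have e: "exp (\<Sum>p\<in>A. Re (\<beta> p * X p \<omega>)) = (\<Prod>p\<in>A. exp (Re (\<beta> p * X p \<omega>)))" for \<omega>
    using A(1) by (rule exp_sum)
  note int = expectation_exp_Re[OF bspec[OF A(2)]]
  show "integrable M (\<lambda>\<omega>. exp (\<Sum>p\<in>A. Re (\<beta> p * X p \<omega>)))"
    unfolding e by (rule indep_vars_integrable[OF A(1) ind int(1)])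
  have "expectation (\<lambda>\<omega>. exp (\<Sum>p\<in>A. Re (\<beta> p * X p \<omega>))) = (\<Prod>p\<in>A. expectation (\<lambda>\<omega>. exp (Re (\<beta> p * X p \<omega>))))"
    unfolding e by (rule indep_vars_lebesgue_integral[OF A(1) ind int(1)])
  also have "\<dots> \<le> (\<Prod>p\<in>A. exp (hmin (norm (\<beta> p))))"
    by (intro prod_mono conjI int(2)) (auto intro!: Bochner_Integration.integral_nonneg)
  also have "\<dots> = exp (\<Sum>p\<in>A. hmin (norm (\<beta> p)))" using A(1) by (rule exp_sum[symmetric])
  finally show "expectation (\<lambda>\<omega>. exp (\<Sum>p\<in>A. Re (\<beta> p * X p \<omega>))) \<le> exp (\<Sum>p\<in>A. hmin (norm (\<beta> p)))" .
qed

text \<open>The sum of both signs majorises the exponential of |a| while each summand still factors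
  over the primes.\<close>

lemma expectation_exp_sum_two_sided:
  fixes \<beta> :: "nat \<Rightarrow> complex"
  assumes A: "finite A" "\<forall>p\<in>A. prime p"
  defines "a \<equiv> \<lambda>\<omega>. \<Sum>p\<in>A. Re (\<beta> p * X p \<omega>)"
  shows "integrable M (\<lambda>\<omega>. exp (a \<omega>) + exp (- a \<omega>))"
    "expectation (\<lambda>\<omega>. exp (a \<omega>) + exp (- a \<omega>)) \<le> 2 * exp (\<Sum>p\<in>A. hmin (norm (\<beta> p)))"
proof -
  have m: "- a \<omega> = (\<Sum>p\<in>A. Re (- \<beta> p * X p \<omega>))" for \<omega>
    unfolding a_def sum_negf[symmetric] by (intro sum.cong) auto
  note i1 = expectation_exp_sum[OF A, of \<beta>] and i2 = expectation_exp_sum[OF A, of "\<lambda>p. - \<beta> p"]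
  show "integrable M (\<lambda>\<omega>. exp (a \<omega>) + exp (- a \<omega>))"
    unfolding m unfolding a_def using i1(1) i2(1) by (rule Bochner_Integration.integrable_add)
  have "expectation (\<lambda>\<omega>. exp (a \<omega>) + exp (- a \<omega>)) = expectation (\<lambda>\<omega>. exp (a \<omega>)) + expectation (\<lambda>\<omega>. exp (- a \<omega>))"
    unfolding m unfolding a_def using i1(1) i2(1) by (rule Bochner_Integration.integral_add)
  also have "\<dots> \<le> 2 * exp (\<Sum>p\<in>A. hmin (norm (\<beta> p)))"
    using i1(2) i2(2) unfolding m unfolding a_def by simp
  finally show "expectation (\<lambda>\<omega>. exp (a \<omega>) + exp (- a \<omega>)) \<le> 2 * exp (\<Sum>p\<in>A. hmin (norm (\<beta> p)))" .
qed

text \<open>The blocks depend on disjoint sets of primes, so functions of different blocks are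
  independent and the expectation of the product factors.\<close>

lemma expectation_block_prod:
  fixes \<beta> :: "nat \<Rightarrow> nat \<Rightarrow> complex"
  assumes A: "\<forall>i<N. finite (A i)" "\<forall>i<N. \<forall>p\<in>A i. prime p" "disjoint_family_on A {..<N}"
    and c: "\<forall>i<N. 0 \<le> c i"
  defines "a \<equiv> \<lambda>i \<omega>. \<Sum>p\<in>A i. Re (\<beta> i p * X p \<omega>)"
  shows "integrable M (\<lambda>\<omega>. \<Prod>i<N. 1 + c i * (exp (a i \<omega>) + exp (- a i \<omega>)))"
    "expectation (\<lambda>\<omega>. \<Prod>i<N. 1 + c i * (exp (a i \<omega>) + exp (- a i \<omega>))) \<le> (\<Prod>i<N. 1 + 2 * c i * exp (\<Sum>p\<in>A i. hmin (norm (\<beta> i p))))"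
proof -
  define Y where "Y = (\<lambda>i x. 1 + c i * (exp (\<Sum>p\<in>A i. Re (\<beta> i p * x p)) + exp (- (\<Sum>p\<in>A i. Re (\<beta> i p * x p)))))"
  define Z where "Z = (\<lambda>i \<omega>. 1 + c i * (exp (a i \<omega>) + exp (- a i \<omega>)))"
  have YZ: "(\<lambda>i \<omega>. Y i (restrict (\<lambda>p. X p \<omega>) (A i))) = Z"
    unfolding Y_def Z_def a_def by (intro ext) (simp cong: sum.cong)
  have ind: "indep_vars (\<lambda>_. borel) Z {..<N}"
    unfolding YZ[symmetric]
  proof (rule indep_vars_compose2[where Y = Y])
    show "indep_vars (\<lambda>j. PiM (A j) (\<lambda>_. borel)) (\<lambda>j \<omega>. restrict (\<lambda>i. X i \<omega>) (A j)) {..<N}"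
      by (rule indep_vars_restrict[OF indep_X]) (use A in auto)
    fix i assume "i \<in> {..<N}"
    have [measurable]: "(\<lambda>x. x p) \<in> borel_measurable (PiM (A i) (\<lambda>_. borel :: complex measure))" if "p \<in> A i" for p
      using that by (rule measurable_component_singleton)
    show "Y i \<in> borel_measurable (PiM (A i) (\<lambda>_. borel))"
      unfolding Y_def by measurable
  qed
  have int: "integrable M (Z i)" "expectation (Z i) \<le> 1 + 2 * c i * exp (\<Sum>p\<in>A i. hmin (norm (\<beta> i p)))" "0 \<le> expectation (Z i)" if i: "i < N" for i
  proof -
    have t: "integrable M (\<lambda>\<omega>. exp (a i \<omega>) + exp (- a i \<omega>))"
      "expectation (\<lambda>\<omega>. exp (a i \<omega>) + exp (- a i \<omega>)) \<le> 2 * exp (\<Sum>p\<in>A i. hmin (norm (\<beta> i p)))"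
      unfolding a_def by (rule expectation_exp_sum_two_sided[OF A(1)[rule_format, OF i] A(2)[THEN spec, THEN mp, OF i]])+
    show "integrable M (Z i)" unfolding Z_def by (intro Bochner_Integration.integrable_add[OF integrable_const integrable_mult_right] t(1))
    have "expectation (Z i) = 1 + c i * expectation (\<lambda>\<omega>. exp (a i \<omega>) + exp (- a i \<omega>))"
      unfolding Z_def Bochner_Integration.integral_add[OF integrable_const integrable_mult_right[OF t(1)]] integral_mult_right_zero
      by (simp add: prob_space)
    also have "\<dots> \<le> 1 + c i * (2 * exp (\<Sum>p\<in>A i. hmin (norm (\<beta> i p))))"
      using c[rule_format, OF i] by (intro add_left_mono mult_left_mono t(2)) auto
    finally show "expectation (Z i) \<le> 1 + 2 * c i * exp (\<Sum>p\<in>A i. hmin (norm (\<beta> i p)))" by (simp add: mult_ac)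
    show "0 \<le> expectation (Z i)" unfolding Z_def using c[rule_format, OF i] by (intro Bochner_Integration.integral_nonneg add_nonneg_nonneg mult_nonneg_nonneg) auto
  qed
  show "integrable M (\<lambda>\<omega>. \<Prod>i<N. 1 + c i * (exp (a i \<omega>) + exp (- a i \<omega>)))"
    using indep_vars_integrable[OF _ ind int(1)] by (simp add: Z_def)
  have "expectation (\<lambda>\<omega>. \<Prod>i<N. Z i \<omega>) = (\<Prod>i<N. expectation (Z i))"
    by (rule indep_vars_lebesgue_integral[OF _ ind int(1)]) auto
  also have "\<dots> \<le> (\<Prod>i<N. 1 + 2 * c i * exp (\<Sum>p\<in>A i. hmin (norm (\<beta> i p))))"
    by (intro prod_mono conjI int(2,3)) auto
  finally show "expectation (\<lambda>\<omega>. \<Prod>i<N. 1 + c i * (exp (a i \<omega>) + exp (- a i \<omega>))) \<le> (\<Prod>i<N. 1 + 2 * c i * exp (\<Sum>p\<in>A i. hmin (norm (\<beta> i p))))"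
    by (simp add: Z_def)
qed

text \<open>From x^k / k! <= r powr (- k) * exp (r x): the free parameter \<open>r i\<close> trades
  the gain against the size of the exponential moment, block by block. The left side is the form
  taken by the truncation error of the characteristic function.\<close>

lemma expectation_prod_moments:
  fixes N :: nat
  assumes B: "\<And>i. i < N \<Longrightarrow> finite (B i)" "\<And>i. i < N \<Longrightarrow> 0 \<notin> B i" "disjoint_family_on B {..<N}"
    and D: "\<And>i. i < N \<Longrightarrow> (\<Sum>n\<in>{n\<in>B i. \<not> prime n}. lam n * norm (b i n)) \<le> D i" and r: "\<And>i. i < N \<Longrightarrow> r i > 0"
  shows "expectation (\<lambda>\<omega>. \<Prod>i<N. 1 + \<bar>Re (Gsum (B i) (b i) (chi (\<lambda>p. X p \<omega>)))\<bar> ^ k i / fact (k i))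
    \<le> (\<Prod>i<N. 1 + 2 * (exp (r i * D i) / r i ^ k i) * exp (\<Sum>p\<in>{n\<in>B i. prime n}. hmin (r i * norm (b i p))))"
proof -
  define A where "A = (\<lambda>i. {n\<in>B i. prime n})"
  define \<beta> where "\<beta> = (\<lambda>i p. of_real (r i) * b i p)"
  define c where "c = (\<lambda>i. exp (r i * D i) / r i ^ k i)"
  have c0: "\<forall>i<N. 0 \<le> c i" using r by (auto simp: c_def less_imp_le)
  have hb: "hmin (norm (\<beta> i p)) = hmin (r i * norm (b i p))" if "i < N" for i p
    using r[OF that] by (simp add: \<beta>_def norm_mult)
  have Ab: "\<forall>i<N. finite (A i)" "\<forall>i<N. \<forall>p\<in>A i. prime p" "disjoint_family_on A {..<N}"
    using B(1) apply (auto simp: A_def)[2]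
    using B(3) unfolding A_def disjoint_family_on_def by blast
  let ?a = "\<lambda>i \<omega>. \<Sum>p\<in>A i. Re (\<beta> i p * X p \<omega>)"
  note bp = expectation_block_prod[OF Ab c0, where \<beta> = \<beta>]
  have pt: "AE \<omega> in M. (\<Prod>i<N. 1 + \<bar>Re (Gsum (B i) (b i) (chi (\<lambda>p. X p \<omega>)))\<bar> ^ k i / fact (k i))
       \<le> (\<Prod>i<N. 1 + c i * (exp (?a i \<omega>) + exp (- ?a i \<omega>)))"
    using cmult_X
  proof eventually_elim
    case (elim \<omega>)
    show ?case
    proof (intro prod_mono conjI)
      fix i assume "i \<in> {..<N}"
      then have i: "i < N" by simp
      let ?g = "\<bar>Re (Gsum (B i) (b i) (chi (\<lambda>p. X p \<omega>)))\<bar>"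
      have "r i ^ k i * (?g ^ k i / fact (k i)) = (r i * ?g) ^ k i / fact (k i)" by (simp add: power_mult_distrib)
      also have "\<dots> \<le> exp (r i * ?g)" using r[OF i] by (intro power_div_fact_le_exp) auto
      also have "\<dots> \<le> exp (r i * D i) * (exp (?a i \<omega>) + exp (- ?a i \<omega>))"
      proof -
        have "?a i \<omega> = (\<Sum>p\<in>{n\<in>B i. prime n}. Re (of_real (r i) * b i p * chi (\<lambda>p. X p \<omega>) p))"
          unfolding A_def \<beta>_def by (intro sum.cong) (auto simp: chi_prime)
        then show ?thesis
          using exp_Re_Gsum_le[OF B(1)[OF i] B(2)[OF i] elim D[OF i], of "r i"] r[OF i] by simp
      qed
      finally have "?g ^ k i / fact (k i) \<le> c i * (exp (?a i \<omega>) + exp (- ?a i \<omega>))"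
        using r[OF i] by (simp add: c_def field_simps)
      then show "1 + ?g ^ k i / fact (k i) \<le> 1 + c i * (exp (?a i \<omega>) + exp (- ?a i \<omega>))" by simp
      show "0 \<le> 1 + ?g ^ k i / fact (k i)" by simp
    qed
  qed
  have "expectation (\<lambda>\<omega>. \<Prod>i<N. 1 + \<bar>Re (Gsum (B i) (b i) (chi (\<lambda>p. X p \<omega>)))\<bar> ^ k i / fact (k i))
    \<le> expectation (\<lambda>\<omega>. \<Prod>i<N. 1 + c i * (exp (?a i \<omega>) + exp (- ?a i \<omega>)))"
  proof (rule integral_mono_AE[OF _ bp(1) pt])
    have m: "(\<lambda>\<omega>. \<Prod>i<N. 1 + \<bar>Re (Gsum (B i) (b i) (chi (\<lambda>p. X p \<omega>)))\<bar> ^ k i / fact (k i)) \<in> borel_measurable M"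
    proof -
      note [measurable] = Gsum_measurable
      show ?thesis by measurable
    qed
    show "integrable M (\<lambda>\<omega>. \<Prod>i<N. 1 + \<bar>Re (Gsum (B i) (b i) (chi (\<lambda>p. X p \<omega>)))\<bar> ^ k i / fact (k i))"
    proof (rule Bochner_Integration.integrable_bound[OF bp(1) m])
      show "AE \<omega> in M. norm (\<Prod>i<N. 1 + \<bar>Re (Gsum (B i) (b i) (chi (\<lambda>p. X p \<omega>)))\<bar> ^ k i / fact (k i))
        \<le> norm (\<Prod>i<N. 1 + c i * (exp (?a i \<omega>) + exp (- ?a i \<omega>)))"
        using pt
      proof eventually_elim
        case (elim \<omega>)
        have "0 \<le> (\<Prod>i<N. 1 + \<bar>Re (Gsum (B i) (b i) (chi (\<lambda>p. X p \<omega>)))\<bar> ^ k i / fact (k i))" by (intro prod_nonneg) auto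
        then show ?case using elim by simp
      qed
    qed
  qed
  also have "\<dots> \<le> (\<Prod>i<N. 1 + 2 * c i * exp (\<Sum>p\<in>A i. hmin (norm (\<beta> i p))))" by (rule bp(2))
  also have "\<dots> = (\<Prod>i<N. 1 + 2 * (exp (r i * D i) / r i ^ k i) * exp (\<Sum>p\<in>{n\<in>B i. prime n}. hmin (r i * norm (b i p))))"
    by (intro prod.cong refl) (simp add: c_def A_def hb)
  finally show ?thesis .
qed

text \<open>Here the modulus is needed and not only the real part. |G| is at most |Re G| + |Im G|,
  and 2 x y <= x^2 + y^2 separates the two exponentials at the price of doubling \<open>r\<close>.
  The imaginary part of G is the real part for the coefficients - i b.\<close>

lemma expectation_moment:
  assumes B: "finite B" "0 \<notin> B"
    and D: "(\<Sum>n\<in>{n\<in>B. \<not> prime n}. lam n * norm (b n)) \<le> D" and r: "r > 0"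
  shows "integrable M (\<lambda>\<omega>. norm (Gsum B b (chi (\<lambda>p. X p \<omega>))) ^ k / fact k)"
    "expectation (\<lambda>\<omega>. norm (Gsum B b (chi (\<lambda>p. X p \<omega>))) ^ k / fact k)
    \<le> 2 * (exp (2 * r * D) / r ^ k) * exp (\<Sum>p\<in>{n\<in>B. prime n}. hmin (2 * r * norm (b p)))"
proof -
  define A where "A = {n\<in>B. prime n}"
  have A: "finite A" "\<forall>p\<in>A. prime p" using B by (auto simp: A_def)
  define \<beta>1 \<beta>2 where "\<beta>1 = (\<lambda>p. of_real (2 * r) * b p)" and "\<beta>2 = (\<lambda>p. of_real (2 * r) * (- \<i> * b p))"
  let ?a1 = "\<lambda>\<omega>. \<Sum>p\<in>A. Re (\<beta>1 p * X p \<omega>)" and ?a2 = "\<lambda>\<omega>. \<Sum>p\<in>A. Re (\<beta>2 p * X p \<omega>)"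
  note t1 = expectation_exp_sum_two_sided[OF A, of \<beta>1] and t2 = expectation_exp_sum_two_sided[OF A, of \<beta>2]
  let ?G = "\<lambda>\<omega>. Gsum B b (chi (\<lambda>p. X p \<omega>))"
  define c where "c = exp (2 * r * D) / r ^ k / 2"
  define W where "W = (\<lambda>\<omega>. c * ((exp (?a1 \<omega>) + exp (- ?a1 \<omega>)) + (exp (?a2 \<omega>) + exp (- ?a2 \<omega>))))"
  have iW: "integrable M W" unfolding W_def
    by (rule integrable_mult_right) (rule Bochner_Integration.integrable_add[OF t1(1) t2(1)])
  have pt: "AE \<omega> in M. norm (?G \<omega>) ^ k / fact k \<le> W \<omega>"
    using cmult_X
  proof eventually_elim
    case (elim \<omega>)
    let ?h = "chi (\<lambda>p. X p \<omega>)"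
    have iG: "Gsum B (\<lambda>n. - \<i> * b n) ?h = - \<i> * Gsum B b ?h"
      unfolding Gsum_def sum_distrib_left by (intro sum.cong) (auto simp: algebra_simps)
    have "r ^ k * (norm (?G \<omega>) ^ k / fact k) = (r * norm (?G \<omega>)) ^ k / fact k" by (simp add: power_mult_distrib)
    also have "\<dots> \<le> exp (r * norm (?G \<omega>))" using r by (intro power_div_fact_le_exp) auto
    also have "\<dots> \<le> exp (r * \<bar>Re (?G \<omega>)\<bar> + r * \<bar>Im (?G \<omega>)\<bar>)"
      using r cmod_le[of "?G \<omega>"] by (simp add: distrib_left[symmetric])
    also have "\<dots> \<le> (exp (2 * r * \<bar>Re (?G \<omega>)\<bar>) + exp (2 * r * \<bar>Im (?G \<omega>)\<bar>)) / 2"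
      using sum_squares_bound[of "exp (r * \<bar>Re (?G \<omega>)\<bar>)" "exp (r * \<bar>Im (?G \<omega>)\<bar>)"]
      by (simp add: exp_add exp_double[symmetric] mult.assoc)
    also have "\<dots> \<le> (exp (2 * r * D) * (exp (?a1 \<omega>) + exp (- ?a1 \<omega>)) + exp (2 * r * D) * (exp (?a2 \<omega>) + exp (- ?a2 \<omega>))) / 2"
    proof (intro divide_right_mono add_mono)
      have a1: "?a1 \<omega> = (\<Sum>p\<in>{n\<in>B. prime n}. Re (of_real (2 * r) * b p * ?h p))"
        unfolding A_def \<beta>1_def by (intro sum.cong) (auto simp: chi_prime)
      show "exp (2 * r * \<bar>Re (?G \<omega>)\<bar>) \<le> exp (2 * r * D) * (exp (?a1 \<omega>) + exp (- ?a1 \<omega>))"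
        unfolding a1 using exp_Re_Gsum_le[OF B elim D, of "2 * r"] r by simp
      have a2: "?a2 \<omega> = (\<Sum>p\<in>{n\<in>B. prime n}. Re (of_real (2 * r) * (- \<i> * b p) * ?h p))"
        unfolding A_def \<beta>2_def by (intro sum.cong) (auto simp: chi_prime)
      have D2: "(\<Sum>n\<in>{n\<in>B. \<not> prime n}. lam n * norm (- \<i> * b n)) \<le> D" using D by (simp add: norm_mult)
      have "\<bar>Im (?G \<omega>)\<bar> = \<bar>Re (Gsum B (\<lambda>n. - \<i> * b n) ?h)\<bar>" unfolding iG by simp
      then show "exp (2 * r * \<bar>Im (?G \<omega>)\<bar>) \<le> exp (2 * r * D) * (exp (?a2 \<omega>) + exp (- ?a2 \<omega>))"
        unfolding a2 using exp_Re_Gsum_le[OF B elim D2, of "2 * r"] r by simp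
    qed simp
    also have "\<dots> = r ^ k * W \<omega>" using r by (simp add: W_def c_def field_simps)
    finally have "r ^ k * (norm (?G \<omega>) ^ k / fact k) \<le> r ^ k * W \<omega>" .
    then show ?case by (rule mult_left_le_imp_le) (use r in simp)
  qed
  show i: "integrable M (\<lambda>\<omega>. norm (?G \<omega>) ^ k / fact k)"
  proof (rule Bochner_Integration.integrable_bound[OF iW])
    show "(\<lambda>\<omega>. norm (?G \<omega>) ^ k / fact k) \<in> borel_measurable M"
      using Gsum_measurable[of B b] by measurable
    show "AE \<omega> in M. norm (norm (?G \<omega>) ^ k / fact k) \<le> norm (W \<omega>)"
      using pt by eventually_elim (simp add: order_trans[OF _ abs_ge_self])
  qed
  have hb: "hmin (norm (\<beta>1 p)) = hmin (2 * r * norm (b p))" "hmin (norm (\<beta>2 p)) = hmin (2 * r * norm (b p))" for p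
    using r by (simp_all add: \<beta>1_def \<beta>2_def norm_mult)
  have "expectation (\<lambda>\<omega>. norm (?G \<omega>) ^ k / fact k) \<le> expectation W"
    by (rule integral_mono_AE[OF i iW pt])
  also have "\<dots> = c * (expectation (\<lambda>\<omega>. exp (?a1 \<omega>) + exp (- ?a1 \<omega>)) + expectation (\<lambda>\<omega>. exp (?a2 \<omega>) + exp (- ?a2 \<omega>)))"
    unfolding W_def integral_mult_right_zero Bochner_Integration.integral_add[OF t1(1) t2(1)] ..
  also have "\<dots> \<le> c * (2 * exp (\<Sum>p\<in>A. hmin (norm (\<beta>1 p))) + 2 * exp (\<Sum>p\<in>A. hmin (norm (\<beta>2 p))))"
    using r by (intro mult_left_mono add_mono t1(2) t2(2)) (auto simp: c_def)
  also have "\<dots> = 2 * (exp (2 * r * D) / r ^ k) * exp (\<Sum>p\<in>{n\<in>B. prime n}. hmin (2 * r * norm (b p)))"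
    by (simp add: c_def A_def hb)
  finally show "expectation (\<lambda>\<omega>. norm (?G \<omega>) ^ k / fact k)
    \<le> 2 * (exp (2 * r * D) / r ^ k) * exp (\<Sum>p\<in>{n\<in>B. prime n}. hmin (2 * r * norm (b p)))" .
qed

end

section \<open>The blocks of the Dirichlet polynomial\<close>

text \<open>The sum of the two bounds obtained in \<open>block_sums_le\<close>, uniform in the block
  and in T.\<close>

definition blk_const :: "real \<Rightarrow> real" where
  "blk_const \<delta> = 2 * nonprime_const (1 / 2 + \<delta> / 4) + 4 * (\<Sum>n. real n powr (- (1 + \<delta> / 2)))"

text \<open>\<open>len\<close>, \<open>cK\<close> and \<open>NcK\<close> are the inequalities
  between T and the constants that hold for large T; collecting them here confines the asymptotics
  to \<open>eventually_scales\<close>. \<open>len\<close> bounds the rounding losses in the length,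
  \<open>cK\<close> keeps exp (20 c K) below a small power of T, and \<open>NcK\<close> lets exp (c
  K) absorb the number of blocks. The constant c makes the main part 6 c A L of the logarithm of the
  length equal to \<epsilon> / 2 * L.\<close>

locale scales =
  fixes \<sigma> T :: real
  fixes \<delta> A \<epsilon> c L l K :: real
  defines \<delta>_def: "\<delta> \<equiv> \<sigma> - 1 / 2" and A_def: "A \<equiv> 100 / \<delta>" and \<epsilon>_def: "\<epsilon> \<equiv> \<delta> / 64" and c_def: "c \<equiv> \<epsilon> / (12 * A)"
    and L_def: "L \<equiv> ln T" and l_def: "l \<equiv> ln L" and K_def: "K \<equiv> L / l"
  assumes \<sigma>: "1 / 2 < \<sigma>" "\<sigma> < 1" and T4: "T \<ge> 4" and l1: "l \<ge> 1" and lK: "l \<le> K"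
    and len: "2 * A * l + (8 * A + 2 * c * A) * K \<le> \<epsilon> / 2 * L"
    and cK: "20 * c * K \<le> L / 4"
    and NcK: "(2 * l + 3) * (2 * exp 4) \<le> exp (c * K)"
begin

lemma \<delta>: "0 < \<delta>" "\<delta> < 1 / 2" and A: "A > 200" and \<epsilon>: "0 < \<epsilon>" "\<epsilon> < 1 / 128" and c: "0 < c" "6 * c * A = \<epsilon> / 2" "c < 1"
proof -
  show d: "0 < \<delta>" "\<delta> < 1 / 2" using \<sigma> by (auto simp: \<delta>_def)
  show A: "A > 200" using d by (simp add: A_def field_simps)
  show e: "0 < \<epsilon>" "\<epsilon> < 1 / 128" using d by (auto simp: \<epsilon>_def)
  show "0 < c" "6 * c * A = \<epsilon> / 2" using A e by (auto simp: c_def)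
  have "c \<le> \<epsilon> / 1" unfolding c_def using A e by (intro divide_left_mono) auto
  then show "c < 1" using e by simp
qed

lemma L: "L > 0" "L = l * K" "exp l = L" "exp L = T" "K > 0" "K \<le> L" "L \<ge> 1"
proof -
  show L0: "L > 0" using T4 by (simp add: L_def)
  show "L = l * K" using l1 by (simp add: K_def)
  show "exp l = L" using L0 by (simp add: l_def)
  show "exp L = T" using T4 by (simp add: L_def)
  show K: "K > 0" using L0 l1 by (simp add: K_def)
  show "K \<le> L" using K l1 \<open>L = l * K\<close> mult_right_mono[of 1 l K] by simp
  show "L \<ge> 1" using \<open>exp l = L\<close> l1 exp_ge_add_one_self[of l] by linarith
qed

text \<open>Chosen so that the last block ends between exp (A K) and exp (2 A K).\<close>

definition I :: nat where "I = (LEAST i. K \<le> l * 2 ^ i)"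

definition Yr :: "nat \<Rightarrow> real" where "Yr i = exp (A * l * 2 ^ i)"

definition Yb :: "nat \<Rightarrow> nat" where "Yb i = nat \<lfloor>Yr i\<rfloor>"

definition blk :: "nat \<Rightarrow> nat set" where
  "blk i = {n. 2 \<le> n \<and> real n \<le> Yr i \<and> (i = 0 \<or> Yr (i - 1) < real n)}"

text \<open>Even, so that the kk-th power of a real number equals that of its absolute value, and
  the kk-th power of a modulus is a polynomial in the number and its conjugate.\<close>

definition kk :: "nat \<Rightarrow> nat" where
  "kk i = 2 * nat \<lceil>c * K / (if i = 0 then 1 else 2 ^ i * l)\<rceil>"

lemma I_ge: "K \<le> l * 2 ^ I"
proof -
  obtain m :: nat where "K < real m" using reals_Archimedean2 by blast
  also have "real m \<le> 2 ^ m" using less_exp[of m] by (metis less_imp_le of_nat_le_iff of_nat_numeral of_nat_power)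
  also have "\<dots> \<le> l * 2 ^ m" using l1 mult_right_mono[of 1 l "2 ^ m"] by simp
  finally have "K \<le> l * 2 ^ m" by simp
  then show ?thesis unfolding I_def by (rule LeastI)
qed

lemma I_le: "l * 2 ^ I \<le> 2 * K" "real I \<le> 1 + 2 * l"
proof -
  have *: "l * 2 ^ j < K" if "I = Suc j" for j
    using not_less_Least[of j "\<lambda>i. K \<le> l * 2 ^ i"] that by (simp add: I_def)
  show "l * 2 ^ I \<le> 2 * K"
  proof (cases I)
    case 0
    then show ?thesis using lK L by simp
  next
    case (Suc j)
    then show ?thesis using *[OF Suc] by simp
  qed
  moreover have "1 * 2 ^ I \<le> l * 2 ^ I" using l1 by (intro mult_right_mono) auto
  ultimately have "2 ^ I \<le> 2 * K" by linarith
  also have "\<dots> \<le> 2 * exp l" using L by simp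
  finally have "ln (2 ^ I) \<le> ln (2 * exp l)" by (subst ln_le_cancel_iff) auto
  then have "real I * ln 2 \<le> ln 2 + l" by (simp add: ln_realpow ln_mult)
  moreover have "2 / 3 \<le> ln (2::real)" by (rule ln2_ge_two_thirds)
  moreover have "real I * (2 / 3) \<le> real I * ln 2" using ln2_ge_two_thirds by (intro mult_left_mono) auto
  moreover have "ln 2 \<le> (2/3) + (1/36 :: real)" using ln2_le_25_over_36 by simp
  ultimately show "real I \<le> 1 + 2 * l" using l1 by linarith
qed

lemma Yr_ge: "Yr i \<ge> 2" "Yr i > 0"
proof -
  have "1 * 1 * 1 \<le> A * l * 2 ^ i" using A l1 by (intro mult_mono) auto
  then have "1 + 1 \<le> Yr i" unfolding Yr_def using exp_ge_add_one_self[of "A * l * 2 ^ i"] by linarith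
  then show "Yr i \<ge> 2" "Yr i > 0" by auto
qed

lemma Yr_mono: "i \<le> j \<Longrightarrow> Yr i \<le> Yr j"
  unfolding Yr_def using A l1 by (auto intro!: mult_left_mono power_increasing)

lemma Yb: "real (Yb i) \<le> Yr i" "Yr i < real (Suc (Yb i))" "Yb i \<ge> 2"
  using Yr_ge[of i] by (auto simp: Yb_def le_nat_iff le_floor_iff) linarith

lemma blk_subset: "blk i \<subseteq> {2..Yb i}" "finite (blk i)" "0 \<notin> blk i" "Suc 0 \<notin> blk i"
proof -
  show s: "blk i \<subseteq> {2..Yb i}" using Yr_ge[of i] by (auto simp: blk_def Yb_def le_nat_iff le_floor_iff)
  show "finite (blk i)" by (rule finite_subset[OF s]) simp
  show "0 \<notin> blk i" "Suc 0 \<notin> blk i" by (auto simp: blk_def)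
qed

lemma blk_disjoint: "disjoint_family_on blk S"
proof -
  have "n \<notin> blk j" if n: "n \<in> blk i" and ij: "i < j" for n i j
  proof
    assume "n \<in> blk j"
    then have "Yr (j - 1) < real n" using ij by (auto simp: blk_def)
    moreover have "Yr i \<le> Yr (j - 1)" using ij by (intro Yr_mono) auto
    ultimately show False using n by (auto simp: blk_def)
  qed
  then show ?thesis unfolding disjoint_family_on_def by (metis disjoint_iff linorder_neqE_nat)
qed

lemma blk_Union: "(\<Union>i<Suc m. blk i) = {n. 2 \<le> n \<and> real n \<le> Yr m}"
proof (induction m)
  case (Suc m)
  have "(\<Union>i<Suc (Suc m). blk i) = (\<Union>i<Suc m. blk i) \<union> blk (Suc m)" by (auto simp: less_Suc_eq)
  also have "\<dots> = {n. 2 \<le> n \<and> real n \<le> Yr (Suc m)}"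
    unfolding Suc using Yr_mono[of m "Suc m"] by (auto simp: blk_def)
  finally show ?case .
qed (auto simp: blk_def)

lemma kk_even: "even (kk i)" and kk_pos: "kk i > 0"
proof -
  show "even (kk i)" by (simp add: kk_def)
  have "0 < c * K / (if i = 0 then 1 else 2 ^ i * l)" using c L l1 by auto
  then show "kk i > 0" by (simp add: kk_def)
qed

lemma kk_ge0: "2 * c * K \<le> real (kk 0)" and kk_ge: "i \<ge> 1 \<Longrightarrow> 2 * c * K \<le> real (kk i) * (2 ^ i * l)"
proof -
  show "2 * c * K \<le> real (kk 0)" 
  proof -
    have "c * K \<le> real (nat \<lceil>c * K\<rceil>)" by linarith
    then show ?thesis by (simp add: kk_def)
  qed
  assume i: "i \<ge> 1"
  have p: "2 ^ i * l > 0" using l1 by simp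
  have "c * K / (2 ^ i * l) \<le> real (nat \<lceil>c * K / (2 ^ i * l)\<rceil>)" by linarith
  then have "c * K \<le> real (nat \<lceil>c * K / (2 ^ i * l)\<rceil>) * (2 ^ i * l)" using p by (simp only: pos_divide_le_eq)
  then show "2 * c * K \<le> real (kk i) * (2 ^ i * l)" using i l1 by (simp add: kk_def)
qed

lemma kk_le0: "real (kk 0) \<le> 2 * c * K + 2" and kk_le: "i \<ge> 1 \<Longrightarrow> real (kk i) * (2 ^ i * l) \<le> 2 * c * K + 2 * (2 ^ i * l)"
proof -
  have p0: "0 < c * K" using c L by simp
  have *: "real (nat \<lceil>x\<rceil>) \<le> x + 1" if "x > 0" for x :: real using that by linarith
  show "real (kk 0) \<le> 2 * c * K + 2" using *[OF p0] by (simp add: kk_def)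
  assume i: "i \<ge> 1"
  have p: "2 ^ i * l > 0" using l1 by simp
  have "real (nat \<lceil>c * K / (2 ^ i * l)\<rceil>) * (2 ^ i * l) \<le> (c * K / (2 ^ i * l) + 1) * (2 ^ i * l)"
    using p p0 by (intro mult_right_mono *) auto
  also have "\<dots> = c * K + 2 ^ i * l" using p l1 by (simp add: distrib_right)
  finally show "real (kk i) * (2 ^ i * l) \<le> 2 * c * K + 2 * (2 ^ i * l)" using i l1 by (simp add: kk_def)
qed

lemma kk_le': "real (kk i) \<le> 2 * c * K + 2"
proof (cases "i = 0")
  case False
  define p where "p = 2 ^ i * l"
  have p: "p \<ge> 1" using l1 mult_mono[of 1 "2 ^ i" 1 l] by (simp add: p_def)
  have "real (kk i) * p \<le> 2 * c * K + 2 * p" using kk_le[of i] False by (simp add: p_def)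
  also have "\<dots> \<le> (2 * c * K) * p + 2 * p" using p c L mult_left_mono[of 1 p "2 * c * K"] by simp
  also have "\<dots> = (2 * c * K + 2) * p" by (simp add: distrib_right)
  finally show ?thesis using p by simp
qed (use kk_le0 in simp)

definition X :: real where "X = (\<Prod>i<Suc I. Yr i ^ kk i)"

text \<open>In the exponent, block 0 contributes 2 c A l K and each of the at most 1 + 2 l later
  blocks contributes 2 c A K, together 6 c A l K = \<epsilon> / 2 * L up to lower order. Rounding
  the degrees up costs 2 A l 2^i in block i, a geometric sum of size O(A K); this and the remaining
  terms are what \<open>len\<close> controls.\<close>

lemma X_le: "X \<le> T powr \<epsilon>" "X \<ge> 1"
proof -
  have "X = exp (\<Sum>i<Suc I. real (kk i) * (A * l * 2 ^ i))"
    unfolding X_def Yr_def by (simp add: exp_sum exp_of_nat_mult del: prod.lessThan_Suc sum.lessThan_Suc)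
  also have "(\<Sum>i<Suc I. real (kk i) * (A * l * 2 ^ i)) = real (kk 0) * (A * l) + (\<Sum>i\<in>{1..I}. real (kk i) * (A * l * 2 ^ i))"
    by (simp add: sum.lessThan_Suc_shift sum.atLeast_Suc_atMost[of 1] lessThan_Suc_atMost atLeast0AtMost[symmetric] sum.atLeast_Suc_atMost del: sum.lessThan_Suc)
  also have "\<dots> \<le> (2 * c * K + 2) * (A * l) + (\<Sum>i\<in>{1..I}. 2 * c * A * K + 2 * A * l * 2 ^ i)"
  proof (intro add_mono mult_right_mono kk_le0 sum_mono)
    fix i assume "i \<in> {1..I}"
    then have "A * (real (kk i) * (2 ^ i * l)) \<le> A * (2 * c * K + 2 * (2 ^ i * l))"
      using A by (intro mult_left_mono kk_le) auto
    then show "real (kk i) * (A * l * 2 ^ i) \<le> 2 * c * A * K + 2 * A * l * 2 ^ i" by (simp add: algebra_simps)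
  qed (use A l1 in auto)
  also have "(\<Sum>i\<in>{1..I}. 2 * c * A * K + 2 * A * l * 2 ^ i) = real I * (2 * c * A * K) + 2 * A * l * (\<Sum>i\<in>{1..I}. 2 ^ i)"
    by (simp add: sum.distrib sum_distrib_left)
  also have "\<dots> \<le> (1 + 2 * l) * (2 * c * A * K) + 2 * A * l * (2 * 2 ^ I)"
  proof (intro add_mono mult_right_mono mult_left_mono I_le)
    have "(\<Sum>i\<in>{1..n}. 2 ^ i) \<le> (2 * 2 ^ n :: real)" for n by (induction n) auto
    then show "(\<Sum>i\<in>{1..I}. 2 ^ i) \<le> (2 * 2 ^ I :: real)" .
  qed (use A c L l1 in auto)
  also have "2 * A * l * (2 * 2 ^ I) = 4 * A * (l * 2 ^ I)" by simp
  also have "\<dots> \<le> 4 * A * (2 * K)" using A by (intro mult_left_mono I_le) auto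
  also have "(2 * c * K + 2) * (A * l) + ((1 + 2 * l) * (2 * c * A * K) + 4 * A * (2 * K))
     = 6 * c * A * (l * K) + (2 * A * l + (8 * A + 2 * c * A) * K)" by (simp add: algebra_simps)
  also have "\<dots> \<le> \<epsilon> / 2 * L + \<epsilon> / 2 * L" 
  proof -
    have "6 * c * A * (l * K) = \<epsilon> / 2 * L" by (simp only: c(2) L(2)[symmetric])
    then show ?thesis using len by linarith
  qed
  also have "exp (\<epsilon> / 2 * L + \<epsilon> / 2 * L) = T powr \<epsilon>" using T4 by (simp add: powr_def L_def)
  finally show "X \<le> T powr \<epsilon>" by simp
  show "X \<ge> 1" unfolding X_def using Yr_ge by (intro prod_ge_1 one_le_power) (auto intro: order_trans[of 1 2])
qed

lemma Yr_pow_le_X: "i < Suc I \<Longrightarrow> Yr i ^ kk i \<le> X"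
proof -
  assume i: "i < Suc I"
  have "X = Yr i ^ kk i * (\<Prod>j\<in>{..<Suc I} - {i}. Yr j ^ kk j)"
    unfolding X_def using i by (subst prod.remove[of _ i]) auto
  moreover have "1 \<le> (\<Prod>j\<in>{..<Suc I} - {i}. Yr j ^ kk j)"
    using Yr_ge by (intro prod_ge_1 one_le_power) (auto intro: order_trans[of 1 2])
  ultimately show ?thesis using Yr_ge(2)[of i] mult_left_mono[of 1 _ "Yr i ^ kk i"] by simp
qed

text \<open>The coefficients of zeta times the mollifier will vanish strictly between 1 and
  \<open>Z\<close>. The choice exp (c K) is admissible because block 0 has degree at least 2 c K and
  starts at 2.\<close>

definition Z :: nat where "Z = nat \<lfloor>exp (c * K)\<rfloor>"

lemma Z: "1 \<le> Z" "real Z \<le> exp (c * K)" "exp (c * K) / 2 \<le> real Z" "real Z \<le> T"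
proof -
  have e: "exp (c * K) \<ge> 1" using c L by simp
  show 1: "1 \<le> Z" "real Z \<le> exp (c * K)" using e by (auto simp: Z_def le_nat_iff le_floor_iff)
  have "exp (c * K) < real Z + 1" unfolding Z_def using e by linarith
  then show "exp (c * K) / 2 \<le> real Z" using 1(1) by linarith
  have "c * K \<le> L" using c L cK by linarith
  then have "exp (c * K) \<le> T" using L(4) exp_le_cancel_iff[of "c * K" L] by simp
  then show "real Z \<le> T" using 1(2) by linarith
qed

text \<open>The parameter of the exponential moment in block i >= 1: it balances the degree, so that
  every such block gains exp (20 c K).\<close>

definition rr :: "nat \<Rightarrow> real" where "rr i = exp (10 * l * 2 ^ i)"

lemma rr_pow: "1 \<le> i \<Longrightarrow> 1 / rr i ^ kk i \<le> exp (- 20 * c * K)"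
proof -
  assume i: "1 \<le> i"
  have "20 * c * K \<le> real (kk i) * (10 * l * 2 ^ i)" using kk_ge[OF i] by (simp add: algebra_simps)
  then have "exp (- (real (kk i) * (10 * l * 2 ^ i))) \<le> exp (- 20 * c * K)" by simp
  then show ?thesis by (simp add: rr_def exp_of_nat_mult[symmetric] exp_minus divide_inverse)
qed

abbreviation C3 :: real where "C3 \<equiv> blk_const \<delta>"

lemma C3_ge: "0 \<le> C3" "2 * nonprime_const (1 / 2 + \<delta> / 4) \<le> C3" "4 * (\<Sum>n. real n powr (- (1 + \<delta> / 2))) \<le> C3"
  using nonprime_const_nonneg[of "1 / 2 + \<delta> / 4"] \<delta> suminf_nonneg[OF summable_nat_powr[of "1 + \<delta> / 2"]]
  by (auto simp: blk_const_def)

text \<open>This is where A = 100 / \<delta> is used. The integers of block i exceed exp (A / 2 * l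
  * 2^i), so Rankin's trick yields exp (- 25 l 2^i) for the primes against R^2, of order exp (22 l
  2^i), and exp (- 25/2 l 2^i) for the higher powers against R. The 11 in the bound for R, compared
  with the 10 in \<open>rr\<close>, leaves room for coefficients as large as L = exp l.\<close>

lemma block_sums_le:
  assumes i: "1 \<le> i" and R: "0 \<le> R" "R \<le> 2 * exp (11 * l * 2 ^ i)"
  shows "R * (\<Sum>n\<in>{n\<in>blk i. \<not> prime n}. lam n * real n powr (- (1 / 2 + \<delta> / 2))) \<le> C3"
    "(\<Sum>p\<in>{n\<in>blk i. prime n}. hmin (R * real p powr (- (1 / 2 + \<delta> / 2)))) \<le> C3"
proof -
  have Y: "Yr (i - 1) \<le> real n" if "n \<in> blk i" for n using that i by (auto simp: blk_def)
  have Ye: "Yr (i - 1) powr (- q) = exp (- (q * A / 2) * l * 2 ^ i)" for q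
  proof -
    have "(2::real) ^ i = 2 * 2 ^ (i - 1)" using i by (cases i) auto
    then show ?thesis by (simp add: Yr_def powr_def algebra_simps)
  qed
  have "(\<Sum>n\<in>{n\<in>blk i. \<not> prime n}. lam n * real n powr (- (1 / 2 + \<delta> / 2)))
     \<le> Yr (i - 1) powr ((1 / 2 + \<delta> / 4) - (1 / 2 + \<delta> / 2)) * nonprime_const (1 / 2 + \<delta> / 4)"
    using \<delta> blk_subset[of i] Y Yr_ge by (intro sum_nonprime_lam_tail_le) auto
  also have "(1 / 2 + \<delta> / 4) - (1 / 2 + \<delta> / 2) = - (\<delta> / 4)" by simp
  also have "Yr (i - 1) powr (- (\<delta> / 4)) = exp (- (25 / 2) * l * 2 ^ i)" unfolding Ye using \<delta> by (simp add: A_def)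
  finally have 1: "(\<Sum>n\<in>{n\<in>blk i. \<not> prime n}. lam n * real n powr (- (1 / 2 + \<delta> / 2))) \<le> exp (- (25 / 2) * l * 2 ^ i) * nonprime_const (1 / 2 + \<delta> / 4)" .
  have np: "0 \<le> nonprime_const (1 / 2 + \<delta> / 4)" using \<delta> by (intro nonprime_const_nonneg) auto
  have "R * (\<Sum>n\<in>{n\<in>blk i. \<not> prime n}. lam n * real n powr (- (1 / 2 + \<delta> / 2)))
     \<le> (2 * exp (11 * l * 2 ^ i)) * (exp (- (25 / 2) * l * 2 ^ i) * nonprime_const (1 / 2 + \<delta> / 4))"
    using R 1 by (intro mult_mono) (auto intro!: sum_nonneg lam_nonneg mult_nonneg_nonneg)
  also have "\<dots> = 2 * exp (- (3 / 2) * l * 2 ^ i) * nonprime_const (1 / 2 + \<delta> / 4)"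
    by (simp add: exp_add[symmetric] algebra_simps)
  also have "\<dots> \<le> 2 * 1 * nonprime_const (1 / 2 + \<delta> / 4)" using l1 np by (intro mult_mono) auto
  also have "\<dots> \<le> C3" using C3_ge by simp
  finally show "R * (\<Sum>n\<in>{n\<in>blk i. \<not> prime n}. lam n * real n powr (- (1 / 2 + \<delta> / 2))) \<le> C3" .
  have "(\<Sum>p\<in>{n\<in>blk i. prime n}. hmin (R * real p powr (- (1 / 2 + \<delta> / 2)))) \<le> (\<Sum>p\<in>{n\<in>blk i. prime n}. R ^ 2 * real p powr (- (1 + \<delta>)))"
  proof (intro sum_mono)
    fix p
    have "hmin (R * real p powr (- (1 / 2 + \<delta> / 2))) \<le> (R * real p powr (- (1 / 2 + \<delta> / 2))) ^ 2"
      by (simp add: hmin_def)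
    also have "\<dots> = R ^ 2 * real p powr (- (1 + \<delta>))"
      by (simp add: power_mult_distrib power2_eq_square powr_add[symmetric])
    finally show "hmin (R * real p powr (- (1 / 2 + \<delta> / 2))) \<le> R ^ 2 * real p powr (- (1 + \<delta>))" .
  qed
  also have "\<dots> = R ^ 2 * (\<Sum>p\<in>{n\<in>blk i. prime n}. real p powr (- (1 + \<delta>)))" by (simp add: sum_distrib_left)
  also have "\<dots> \<le> (2 * exp (11 * l * 2 ^ i)) ^ 2 * (Yr (i - 1) powr ((1 + \<delta> / 2) - (1 + \<delta>)) * (\<Sum>n. real n powr (- (1 + \<delta> / 2))))"
    using R \<delta> blk_subset[of i] Y Yr_ge by (intro mult_mono power_mono sum_nat_powr_tail_le) (auto intro!: sum_nonneg)
  also have "(1 + \<delta> / 2) - (1 + \<delta>) = - (\<delta> / 2)" by simp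
  also have "Yr (i - 1) powr (- (\<delta> / 2)) = exp (- 25 * l * 2 ^ i)" unfolding Ye using \<delta> by (simp add: A_def)
  also have "(2 * exp (11 * l * 2 ^ i)) ^ 2 * (exp (- 25 * l * 2 ^ i) * (\<Sum>n. real n powr (- (1 + \<delta> / 2))))
     = 4 * exp (- 3 * l * 2 ^ i) * (\<Sum>n. real n powr (- (1 + \<delta> / 2)))"
    by (simp add: power2_eq_square exp_add[symmetric] algebra_simps)
  also have "\<dots> \<le> 4 * 1 * (\<Sum>n. real n powr (- (1 + \<delta> / 2)))"
    using l1 \<delta> by (intro mult_right_mono mult_left_mono suminf_nonneg summable_nat_powr) auto
  also have "\<dots> \<le> C3" using C3_ge by simp
  finally show "(\<Sum>p\<in>{n\<in>blk i. prime n}. hmin (R * real p powr (- (1 / 2 + \<delta> / 2)))) \<le> C3" .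
qed

definition Pb :: "nat \<Rightarrow> complex \<Rightarrow> complex" where
  "Pb i s = Gsum (blk i) (\<lambda>n. of_nat n powr (- s)) (\<lambda>_. 1)"

definition P :: "complex \<Rightarrow> complex" where "P s = (\<Sum>i<Suc I. Pb i s)"

lemma P_eq: "P s = (\<Sum>n\<in>{n. 2 \<le> n \<and> real n \<le> Yr I}. of_real (lam n) * of_nat n powr (- s))"
  unfolding P_def Pb_def Gsum_def blk_Union[symmetric]
  using blk_disjoint[of "{..<Suc I}"] blk_subset(2)
  by (subst sum.UNION_disjoint) (auto simp: disjoint_family_on_def)

lemma Pb_nit: "Pb i (s + \<i> * of_real t) = Gsum (blk i) (\<lambda>n. of_nat n powr (- s)) (nit t)"
  unfolding Pb_def Gsum_def using blk_subset(3)[of i]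
  by (intro sum.cong refl) (metis (no_types, lifting) Nat.neq0_conv mult.assoc mult.right_neutral powr_nit)

end

lemma eventually_scales:
  assumes "1 / 2 < \<sigma>" "\<sigma> < 1" shows "eventually (\<lambda>T. scales \<sigma> T) at_top"
proof -
  define \<delta> where "\<delta> = \<sigma> - 1 / 2"
  define A where "A = 100 / \<delta>"
  define \<epsilon> where "\<epsilon> = \<delta> / 64"
  define c where "c = \<epsilon> / (12 * A)"
  have p: "\<delta> > 0" "A > 0" "\<epsilon> > 0" "c > 0" using assms by (auto simp: \<delta>_def A_def \<epsilon>_def c_def)
  have 1: "eventually (\<lambda>T::real. T \<ge> 4) at_top" by (rule eventually_ge_at_top)
  have 2: "eventually (\<lambda>T::real. ln (ln T) \<ge> 1) at_top" by real_asymp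
  have 3: "eventually (\<lambda>T::real. ln (ln T) \<le> ln T / ln (ln T)) at_top" by real_asymp
  have 4: "eventually (\<lambda>T::real. 2 * A * ln (ln T) + (8 * A + 2 * c * A) * (ln T / ln (ln T)) \<le> \<epsilon> / 2 * ln T) at_top"
  proof -
    have "((\<lambda>T::real. (2 * A * ln (ln T) + (8 * A + 2 * c * A) * (ln T / ln (ln T))) / ln T) \<longlongrightarrow> 0) at_top"
      by real_asymp
    then have "eventually (\<lambda>T::real. (2 * A * ln (ln T) + (8 * A + 2 * c * A) * (ln T / ln (ln T))) / ln T < \<epsilon> / 2) at_top"
      using p by (intro order_tendstoD) auto
    moreover have "eventually (\<lambda>T::real. ln T > 0) at_top" by real_asymp
    ultimately show ?thesis by eventually_elim (simp add: pos_divide_less_eq)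
  qed
  have 5: "eventually (\<lambda>T::real. 20 * c * (ln T / ln (ln T)) \<le> ln T / 4) at_top"
  proof -
    have "((\<lambda>T::real. 20 * c / ln (ln T)) \<longlongrightarrow> 0) at_top" by real_asymp
    then have "eventually (\<lambda>T::real. 20 * c / ln (ln T) < 1 / 4) at_top"
      by (intro order_tendstoD) auto
    moreover have "eventually (\<lambda>T::real. ln T > 0) at_top" by real_asymp
    ultimately show ?thesis
    proof eventually_elim
      case (elim T)
      have "20 * c * (ln T / ln (ln T)) = (20 * c / ln (ln T)) * ln T" by simp
      also have "\<dots> \<le> 1 / 4 * ln T" using elim by (intro mult_right_mono) auto
      finally show ?case by simp
    qed
  qed
  have 6: "eventually (\<lambda>T::real. (2 * ln (ln T) + 3) * (2 * exp 4) \<le> exp (c * (ln T / ln (ln T)))) at_top"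
    using p by real_asymp
  show ?thesis using 1 2 3 4 5 6
    by eventually_elim (unfold_locales, use assms in \<open>auto simp: \<delta>_def A_def \<epsilon>_def c_def\<close>)
qed

section \<open>Approximation of the logarithm of zeta\<close>

text \<open>The conclusion of \<open>mollified_zeta_mean\<close> at a single T, in a form that can
  be passed to the locale as a hypothesis.\<close>

definition moll_bound :: "real \<Rightarrow> real \<Rightarrow> real \<Rightarrow> bool" where
  "moll_bound \<delta> C T \<longleftrightarrow> (\<forall>D X Z x. (\<forall>n. \<bar>D n\<bar> \<le> 1) \<longrightarrow> D 1 = 1 \<longrightarrow> (\<forall>n>X. D n = 0) \<longrightarrow>
     real X \<le> T powr (\<delta> / 32) \<longrightarrow> 1 \<le> Z \<longrightarrow> real Z \<le> T \<longrightarrow> (\<forall>n>1. n < Z \<longrightarrow> dconv (\<lambda>_. 1) D n = 0) \<longrightarrow>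
     1 / 2 + \<delta> / 2 \<le> x \<longrightarrow> x \<le> 4 \<longrightarrow>
     integral {T/4..4*T} (\<lambda>t. norm (zeta (Complex x t) * dser D X (Complex x t) - 1)) \<le> C * T * real Z powr (- \<delta> / 8))"

lemma moll_bound_exists:
  assumes "0 < \<delta>" "\<delta> < 1 / 2" obtains C T0 where "C > 0" "\<And>T. T \<ge> T0 \<Longrightarrow> moll_bound \<delta> C T"
proof -
  obtain C T0 where C: "C > 0" "T0 \<ge> 4" "\<And>T D X Z x. T \<ge> T0 \<Longrightarrow> (\<And>n. \<bar>D n\<bar> \<le> 1) \<Longrightarrow> D 1 = 1 \<Longrightarrow> (\<And>n. n > X \<Longrightarrow> D n = 0) \<Longrightarrow>
     real X \<le> T powr (\<delta> / 32) \<Longrightarrow> 1 \<le> Z \<Longrightarrow> real Z \<le> T \<Longrightarrow> (\<And>n. 1 < n \<Longrightarrow> n < Z \<Longrightarrow> dconv (\<lambda>_. 1) D n = 0) \<Longrightarrow>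
     1 / 2 + \<delta> / 2 \<le> x \<Longrightarrow> x \<le> 4 \<Longrightarrow>
     integral {T/4..4*T} (\<lambda>t. norm (zeta (Complex x t) * dser D X (Complex x t) - 1)) \<le> C * T * real Z powr (- \<delta> / 8)"
    by (rule mollified_zeta_mean[OF assms]) (blast intro: that)
  show ?thesis by (rule that[OF C(1), of T0]) (unfold moll_bound_def, intro allI impI C(3), auto)
qed

lemma dser_holomorphic: "dser D N holomorphic_on S"
proof -
  have "(\<lambda>s. \<Sum>n\<in>{1..N}. of_real (D n) * of_nat n powr (-s)) holomorphic_on S"
    by (intro holomorphic_intros) auto
  then show ?thesis by (simp add: dser_def[abs_def])
qed

lemma norm_prod_sub_1_le:
  fixes z :: "nat \<Rightarrow> complex"
  assumes "(\<Sum>i\<in>S. norm (z i)) \<le> 1" shows "norm ((\<Prod>i\<in>S. 1 + z i) - 1) \<le> 2 * (\<Sum>i\<in>S. norm (z i))"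
proof (cases "finite S")
  case True
  define x where "x = (\<Sum>i\<in>S. norm (z i))"
  have x: "0 \<le> x" "x \<le> 1" using assms by (auto simp: x_def intro: sum_nonneg)
  have "norm ((\<Prod>i\<in>S. 1 + z i) - 1) \<le> (\<Prod>i\<in>S. 1 + norm (z i)) - 1" by (rule norm_prod_minus1_le_prod_minus1)
  also have "(\<Prod>i\<in>S. 1 + norm (z i)) \<le> (\<Prod>i\<in>S. exp (norm (z i)))" by (intro prod_mono) auto
  also have "\<dots> = exp x" unfolding x_def using True by (rule exp_sum[symmetric])
  also have "exp x - 1 \<le> 2 * x"
  proof -
    have "exp x \<le> 1 + x + x ^ 2" using x by (intro exp_bound) auto
    moreover have "x ^ 2 \<le> x" using x by (simp add: power2_eq_square mult_left_le)
    ultimately show ?thesis by linarith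
  qed
  finally show ?thesis by (simp add: x_def)
qed simp

text \<open>The first exponential bounds the moments of block 0, the second those of the later
  blocks; the final summand 2 pays for the error of transference in
  \<open>moment_step\<close>.\<close>

definition mom_const :: "real \<Rightarrow> real" where
  "mom_const \<delta> = 8 * (exp (2 * exp 10 * nonprime_const (1 / 2 + \<delta> / 2) + (2 * exp 10) ^ 2 * (\<Sum>n. real n powr (- (1 + \<delta>)))) + exp (2 * blk_const \<delta>)) + 2"

context scales
begin

definition Dm :: "nat \<Rightarrow> real" where
  "Dm = dmoll (\<lambda>i n. if n \<in> blk i then - lam n else 0) kk (Suc I)"

definition Xn :: nat where "Xn = (\<Prod>i<Suc I. Yb i ^ kk i)"

lemma Xn_le: "real Xn \<le> X" "real Xn \<le> T powr (\<delta> / 32)"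
proof -
  show 1: "real Xn \<le> X" unfolding Xn_def X_def of_nat_prod of_nat_power
    by (intro prod_mono conjI power_mono Yb) auto
  have "T powr \<epsilon> \<le> T powr (\<delta> / 32)" using T4 \<delta> by (intro powr_mono) (auto simp: \<epsilon>_def)
  then have "X \<le> T powr (\<delta> / 32)" using X_le(1) by linarith
  then show "real Xn \<le> T powr (\<delta> / 32)" using 1 by linarith
qed

lemma sum_blk_lam:
  assumes "2 \<le> n" "real n \<le> Yr I"
  shows "(\<Sum>i<Suc I. ln (real n) * (if n \<in> blk i then lam n else 0)) = mangoldt n"
proof -
  obtain j where j: "j < Suc I" "n \<in> blk j" using blk_Union[of I] assms by blast
  have "(\<Sum>i<Suc I. ln (real n) * (if n \<in> blk i then lam n else 0)) = (\<Sum>i\<in>{j}. ln (real n) * (if n \<in> blk i then lam n else 0))"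
  proof (intro sum.mono_neutral_right ballI)
    fix i assume "i \<in> {..<Suc I} - {j}"
    then have "n \<notin> blk i" using blk_disjoint[of UNIV] j unfolding disjoint_family_on_def by blast
    then show "ln (real n) * (if n \<in> blk i then lam n else 0) = 0" by simp
  qed (use j in auto)
  then show ?thesis using j by (simp add: ln_lam)
qed

lemma Dm_le: "\<bar>Dm n\<bar> \<le> 1"
proof (cases "n = 0")
  case False
  have "\<bar>Dm n\<bar> \<le> dmoll (\<lambda>i n. if n \<in> blk i then lam n else 0) kk (Suc I) n"
    unfolding Dm_def by (intro abs_dmoll_le) (auto simp: lam_nonneg)
  also have "\<dots> \<le> 1"
  proof (rule dmoll_le_1)
    fix m :: nat assume "m > 0"
    show "(\<Sum>i<Suc I. ln (real m) * (if m \<in> blk i then lam m else 0)) \<le> mangoldt m"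
    proof (cases "2 \<le> m \<and> real m \<le> Yr I")
      case True
      then show ?thesis using sum_blk_lam by simp
    next
      case False
      then have "\<forall>i<Suc I. m \<notin> blk i" using blk_Union[of I] by blast
      then have "(\<Sum>i<Suc I. ln (real m) * (if m \<in> blk i then lam m else 0)) = 0" by (intro sum.neutral) auto
      then show ?thesis by (simp add: mangoldt_nonneg)
    qed
  qed (use False blk_subset in \<open>auto simp: lam_nonneg\<close>)
  finally show ?thesis .
qed (simp add: Dm_def)

lemma Dm_1: "Dm 1 = 1"
  unfolding Dm_def by (rule dmoll_1) (use kk_pos blk_subset in auto)

lemma Dm_0: "n > Xn \<Longrightarrow> Dm n = 0"
  unfolding Dm_def Xn_def
  by (rule dmoll_eq_0_above[of Yb]) (use Yb(3) blk_subset(1) in \<open>fastforce intro: less_le_trans[of 0 2]\<close>)+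

lemma exp_cK_le_Yr: "exp (c * K) \<le> Yr I"
proof -
  have "c * K \<le> 1 * K" using c L by (intro mult_right_mono) auto
  also have "1 * K \<le> A * (l * 2 ^ I)" using A I_ge L by (intro mult_mono) auto
  finally show ?thesis by (simp add: Yr_def mult.assoc)
qed

text \<open>The elements of block i are at least \<open>Suc (Yb (i - 1))\<close>, or 2 if i = 0, and
  these numbers raised to the power \<open>kk i\<close> reach exp (c K). The narrowest case is block
  0, where 2 ^ kk 0 is at least exp (2 c K ln 2).\<close>

lemma Dm_van: assumes "1 < n" "n < Z" shows "dconv (\<lambda>_. 1) Dm n = 0"
  unfolding Dm_def
proof (rule dconv_one_dmoll_eq_0[of "\<lambda>i. if i = 0 then 2 else Suc (Yb (i - 1))" _ _ Z])
  fix i m assume "m < (if i = 0 then 2 else Suc (Yb (i - 1)))"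
  moreover have "real m \<le> Yr (i - 1)" if "m \<le> Yb (i - 1)" using Yb(1)[of "i - 1"] that by linarith
  ultimately have "m \<notin> blk i" by (auto simp: blk_def split: if_splits)
  then show "(if m \<in> blk i then - lam m else 0) = 0" by simp
next
  fix i assume "i < Suc I"
  have "exp (c * K) \<le> real ((if i = 0 then 2 else Suc (Yb (i - 1))) ^ kk i)"
  proof (cases "i = 0")
    case True
    have "c * K \<le> real (kk 0) * ln 2"
    proof -
      have "0 < c * K" using c L by simp
      moreover have "(2 * c * K) * (2 / 3) \<le> real (kk 0) * ln 2"
        using kk_ge0 ln2_ge_two_thirds c L by (intro mult_mono) auto
      ultimately show ?thesis by linarith
    qed
    then have "exp (c * K) \<le> exp (real (kk 0) * ln 2)" by simp
    also have "\<dots> = 2 ^ kk 0" by (simp add: exp_of_nat_mult)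
    finally show ?thesis using True by simp
  next
    case False
    have "(2::real) ^ i = 2 * 2 ^ (i - 1)" using False by (cases i) auto
    then have "2 * c * K \<le> real (kk i) * (2 * 2 ^ (i - 1) * l)" using kk_ge[of i] False by simp
    then have "A * (c * K) \<le> A * (real (kk i) * (2 ^ (i - 1) * l))" using A by (intro mult_left_mono) auto
    moreover have "1 * (c * K) \<le> A * (c * K)" using A c L by (intro mult_right_mono) auto
    ultimately have "exp (c * K) \<le> exp (real (kk i) * (A * l * 2 ^ (i - 1)))" by (simp add: mult_ac)
    also have "\<dots> = Yr (i - 1) ^ kk i" by (simp add: Yr_def exp_of_nat_mult)
    also have "\<dots> \<le> real (Suc (Yb (i - 1))) ^ kk i"
      using Yb(2)[of "i - 1"] Yr_ge(2)[of "i - 1"] by (intro power_mono) auto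
    finally show ?thesis using False by simp
  qed
  then show "Z \<le> (if i = 0 then 2 else Suc (Yb (i - 1))) ^ kk i"
    using Z(2) by (metis of_nat_le_iff order_trans)
next
  fix m assume m: "0 < m" "m < Z"
  show "(\<Sum>i<Suc I. ln (real m) * (if m \<in> blk i then - lam m else 0)) = - mangoldt m"
  proof (cases "m = 1")
    case True
    then show ?thesis using blk_subset(4) by (simp add: sum.neutral)
  next
    case False
    have "real m < real Z" using m by simp
    then have "real m \<le> Yr I" using Z(2) exp_cK_le_Yr by linarith
    then have "(\<Sum>i<Suc I. ln (real m) * (if m \<in> blk i then lam m else 0)) = mangoldt m"
      using m False by (intro sum_blk_lam) auto
    moreover have "(\<Sum>i<Suc I. ln (real m) * (if m \<in> blk i then - lam m else 0))
       = - (\<Sum>i<Suc I. ln (real m) * (if m \<in> blk i then lam m else 0))"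
      unfolding sum_negf[symmetric] by (intro sum.cong) auto
    ultimately show ?thesis by (simp only:)
  qed
qed (use kk_pos assms in auto)

lemma dser_Dm: "dser Dm Xn s = (\<Prod>i<Suc I. \<Sum>j<kk i. (- Pb i s) ^ j / fact j)"
proof -
  have "dser (\<lambda>n. if n \<in> blk i then - lam n else 0) (Yb i) s = - Pb i s" for i
  proof -
    have "dser (\<lambda>n. if n \<in> blk i then - lam n else 0) (Yb i) s = (\<Sum>n\<in>blk i. of_real (- lam n) * of_nat n powr (-s))"
      unfolding dser_def using blk_subset(1)[of i] by (intro sum.mono_neutral_cong_right) auto
    then show ?thesis by (simp add: Pb_def Gsum_def sum_negf)
  qed
  then show ?thesis unfolding Dm_def Xn_def
    by (subst dser_dmoll) (use Yb(3) blk_subset(1) in \<open>fastforce intro: less_le_trans[of 0 2]\<close>)+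
qed

lemma Pb_holomorphic: "Pb i holomorphic_on S"
proof -
  have "(\<lambda>s. \<Sum>n\<in>blk i. of_real (lam n) * of_nat n powr (-s) * 1) holomorphic_on S"
    using blk_subset(3)[of i] by (intro holomorphic_intros)
  then show ?thesis by (simp add: Pb_def[abs_def] Gsum_def)
qed

lemma tpoly_Gsum_blk:
  assumes "\<And>n. n \<in> blk i \<Longrightarrow> norm (b n) \<le> \<beta>" "\<beta> \<ge> 0"
  shows "tpoly (Yr i) (\<beta> * Yr i) (Gsum (blk i) b)"
proof -
  have "(\<Sum>n\<in>blk i. norm (b n)) \<le> (\<Sum>n\<in>{2..Yb i}. \<beta>)"
    using assms blk_subset[of i] by (intro order_trans[OF sum_mono sum_mono2]) auto
  also have "\<dots> \<le> \<beta> * real (Yb i)" using assms(2) by (auto intro!: mult_left_mono simp: mult.commute)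
  also have "\<dots> \<le> \<beta> * Yr i" using assms(2) Yb(1) by (rule mult_left_mono[rotated])
  finally show ?thesis
    by (intro tpoly_mono[OF tpoly_Gsum[OF blk_subset(2), of i "Yr i" b]]) (auto simp: blk_def)
qed

text \<open>The coefficients carry no factor L powr \<sigma> here. In block 0 the parameter r = exp
  10 therefore gives a bounded exponential moment and, with degree at least 2 c K, a gain of exp (20
  c K), the same as \<open>rr\<close> gives in the later blocks.\<close>

lemma moment_bound:
  assumes rm: "random_model M Xr" and i: "i < Suc I" and b: "\<And>n. n \<in> blk i \<Longrightarrow> norm (b n) = real n powr (-x)" and x: "1 / 2 + \<delta> / 2 \<le> x"
  shows "integral\<^sup>L M (\<lambda>\<omega>. norm (Gsum (blk i) b (chi (\<lambda>p. Xr p \<omega>))) ^ kk i / fact (kk i)) \<le> (mom_const \<delta> - 2) / 4 * exp (- 20 * c * K)"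
proof -
  interpret R: rmodel M Xr by unfold_locales (rule rm)
  let ?w = "1 / 2 + \<delta> / 2"
  have bw: "norm (b n) \<le> real n powr (- ?w)" if "n \<in> blk i" for n
    using b[OF that] x that by (auto simp: blk_def intro!: powr_mono)
  define D where "D = (\<Sum>n\<in>{n\<in>blk i. \<not> prime n}. lam n * real n powr (- ?w))"
  have D: "(\<Sum>n\<in>{n\<in>blk i. \<not> prime n}. lam n * norm (b n)) \<le> D"
    unfolding D_def using bw by (intro sum_mono mult_left_mono lam_nonneg) auto
  have hm: "hmin x \<le> hmin y" if "0 \<le> x" "x \<le> y" for x y
    unfolding hmin_def using that by (intro min.mono power_mono) auto
  show ?thesis
  proof (cases "i = 0")
    case True
    define r where "r = exp (10::real)"
    have r: "r > 0" by (simp add: r_def)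
    have D0: "D \<le> nonprime_const ?w" unfolding D_def using \<delta> blk_subset[of i] by (intro sum_nonprime_lam_le) auto
    have S0: "(\<Sum>p\<in>{n\<in>blk i. prime n}. hmin (2 * r * norm (b p))) \<le> (2 * r) ^ 2 * (\<Sum>n. real n powr (- (1 + \<delta>)))"
    proof -
      have "(\<Sum>p\<in>{n\<in>blk i. prime n}. hmin (2 * r * norm (b p))) \<le> (\<Sum>p\<in>{n\<in>blk i. prime n}. (2 * r) ^ 2 * real p powr (- (1 + \<delta>)))"
      proof (intro sum_mono)
        fix p assume "p \<in> {n\<in>blk i. prime n}"
        then have p: "norm (b p) \<le> real p powr (- ?w)" using bw by auto
        have "hmin (2 * r * norm (b p)) \<le> (2 * r * norm (b p)) ^ 2" by (simp add: hmin_def)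
        also have "\<dots> \<le> (2 * r * real p powr (- ?w)) ^ 2" using p r by (intro power_mono mult_left_mono) auto
        also have "\<dots> = (2 * r) ^ 2 * real p powr (- (1 + \<delta>))"
          by (simp add: power_mult_distrib power2_eq_square powr_add[symmetric])
        finally show "hmin (2 * r * norm (b p)) \<le> (2 * r) ^ 2 * real p powr (- (1 + \<delta>))" .
      qed
      also have "\<dots> \<le> (2 * r) ^ 2 * (\<Sum>n. real n powr (- (1 + \<delta>)))"
        unfolding sum_distrib_left[symmetric] using \<delta> blk_subset[of i] by (intro mult_left_mono sum_nat_powr_le) auto
      finally show ?thesis .
    qed
    have rk: "1 / r ^ kk i \<le> exp (- 20 * c * K)"
    proof -
      have "20 * c * K \<le> real (kk 0) * 10" using kk_ge0 by linarith
      then have "exp (- (real (kk 0) * 10)) \<le> exp (- 20 * c * K)" by simp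
      then show ?thesis using True by (simp add: r_def exp_of_nat_mult[symmetric] exp_minus divide_inverse)
    qed
    have "integral\<^sup>L M (\<lambda>\<omega>. norm (Gsum (blk i) b (chi (\<lambda>p. Xr p \<omega>))) ^ kk i / fact (kk i))
      \<le> 2 * (exp (2 * r * D) / r ^ kk i) * exp (\<Sum>p\<in>{n\<in>blk i. prime n}. hmin (2 * r * norm (b p)))"
      by (rule R.expectation_moment(2)[OF blk_subset(2,3) D r])
    also have "\<dots> = 2 * exp (2 * r * D + (\<Sum>p\<in>{n\<in>blk i. prime n}. hmin (2 * r * norm (b p)))) * (1 / r ^ kk i)"
      by (simp add: exp_add)
    also have "\<dots> \<le> 2 * exp (2 * exp 10 * nonprime_const ?w + (2 * exp 10) ^ 2 * (\<Sum>n. real n powr (- (1 + \<delta>)))) * exp (- 20 * c * K)"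
      using D0 S0 rk r by (intro mult_mono) (auto simp: r_def intro!: add_mono)
    also have "\<dots> \<le> (mom_const \<delta> - 2) / 4 * exp (- 20 * c * K)"
      by (intro mult_right_mono) (auto simp: mom_const_def)
    finally show ?thesis .
  next
    case False
    define r where "r = rr i"
    have r: "r > 0" by (simp add: r_def rr_def)
    have "10 * l * 2 ^ i \<le> 11 * l * 2 ^ i" using l1 by auto
    then have R: "2 * r \<le> 2 * exp (11 * l * 2 ^ i)" by (simp add: r_def rr_def)
    have D1: "2 * r * D \<le> C3" unfolding D_def using block_sums_le(1)[of i "2 * r"] False R r by simp
    have "(\<Sum>p\<in>{n\<in>blk i. prime n}. hmin (2 * r * norm (b p))) \<le> (\<Sum>p\<in>{n\<in>blk i. prime n}. hmin (2 * r * real p powr (- ?w)))"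
      using bw r by (intro sum_mono hm) auto
    also have "\<dots> \<le> C3" using block_sums_le(2)[of i "2 * r"] False R r by simp
    finally have S1: "(\<Sum>p\<in>{n\<in>blk i. prime n}. hmin (2 * r * norm (b p))) \<le> C3" .
    have "integral\<^sup>L M (\<lambda>\<omega>. norm (Gsum (blk i) b (chi (\<lambda>p. Xr p \<omega>))) ^ kk i / fact (kk i))
      \<le> 2 * (exp (2 * r * D) / r ^ kk i) * exp (\<Sum>p\<in>{n\<in>blk i. prime n}. hmin (2 * r * norm (b p)))"
      by (rule R.expectation_moment(2)[OF blk_subset(2,3) D r])
    also have "\<dots> = 2 * exp (2 * r * D + (\<Sum>p\<in>{n\<in>blk i. prime n}. hmin (2 * r * norm (b p)))) * (1 / r ^ kk i)"
      by (simp add: exp_add)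
    also have "\<dots> \<le> 2 * exp (2 * C3) * exp (- 20 * c * K)"
      using D1 S1 rr_pow[of i] False r by (intro mult_mono) (auto simp: r_def)
    also have "\<dots> \<le> (mom_const \<delta> - 2) / 4 * exp (- 20 * c * K)"
      by (intro mult_right_mono) (auto simp: mom_const_def)
    finally show ?thesis .
  qed
qed

lemma X_pow_small: "2 * X ^ 2 \<le> T * exp (- 20 * c * K) * 2"
proof -
  have "X ^ 2 \<le> (T powr \<epsilon>) ^ 2" using X_le by (intro power_mono) auto
  also have "\<dots> = T powr (2 * \<epsilon>)" by (simp add: power2_eq_square powr_add[symmetric])
  also have "\<dots> \<le> T powr (3 / 4)" using T4 \<epsilon> by (intro powr_mono) auto
  also have "\<dots> = exp (3 / 4 * L)" using T4 by (simp add: powr_def L_def)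
  also have "\<dots> \<le> exp (L + - 20 * c * K)" using cK by simp
  also have "\<dots> = T * exp (- 20 * c * K)" unfolding exp_add using L(4) by simp
  finally show ?thesis by simp
qed

text \<open>The random model acts as a device for high moments on vertical lines: since
  \<open>kk i\<close> is even, |Pb|^kk is a trigonometric polynomial of length at most X, so its
  integral is the expectation times the length of the interval up to 2 X^2.\<close>

lemma moment_step:
  assumes rm: "random_model M Xr" and i: "i < Suc I" and x: "1 / 2 + \<delta> / 2 \<le> x"
  shows "integral {T/4..4*T} (\<lambda>t. norm (Pb i (Complex x t) ^ kk i / fact (kk i))) \<le> mom_const \<delta> * T * exp (- 20 * c * K)"
proof -
  interpret R: rmodel M Xr by unfold_locales (rule rm)
  define b where "b = (\<lambda>n. complex_of_nat n powr (- of_real x))"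
  have nb: "norm (b n) = real n powr (-x)" if "n \<in> blk i" for n
    using that by (simp add: b_def norm_powr_real_powr blk_def)
  have nb1: "norm (b n) \<le> 1" if "n \<in> blk i" for n
  proof -
    have "real n powr (-x) \<le> real n powr 0" using that x \<delta> by (intro powr_mono) (auto simp: blk_def)
    then show ?thesis using nb[OF that] that by (simp add: blk_def)
  qed
  define G where "G = Gsum (blk i) b"
  obtain m where m: "kk i = 2 * m" using kk_even[of i] by blast
  define Q where "Q = (\<lambda>h. complex_of_real (1 / fact (kk i)) * (G h * cnj (G h)) ^ m)"
  have Qn: "Q h = of_real (norm (G h) ^ kk i / fact (kk i))" for h
  proof -
    have "G h * cnj (G h) = of_real (norm (G h) ^ 2)" by (rule complex_norm_square[symmetric])
    then have "(G h * cnj (G h)) ^ m = of_real (norm (G h) ^ kk i)"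
      by (simp add: m power_mult del: of_real_power flip: of_real_power)
    then show ?thesis by (simp add: Q_def)
  qed
  have tG: "tpoly (Yr i) (1 * Yr i) G" unfolding G_def using nb1 by (intro tpoly_Gsum_blk) auto
  have "tpoly ((Yr i * Yr i) ^ m) (norm (complex_of_real (1 / fact (kk i))) * (1 * Yr i * (1 * Yr i)) ^ m) Q"
    unfolding Q_def by (intro tpoly_cmult tpoly_power tpoly_mult tpoly_cnj tG)
  moreover have "(Yr i * Yr i) ^ m = Yr i ^ kk i" by (simp add: m power_mult power2_eq_square)
  moreover have "norm (complex_of_real (1 / fact (kk i))) * (1 * Yr i * (1 * Yr i)) ^ m \<le> 1 * Yr i ^ kk i"
  proof (rule mult_mono)
    show "(1 * Yr i * (1 * Yr i)) ^ m \<le> Yr i ^ kk i" by (simp add: m power_mult power2_eq_square)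
    show "norm (complex_of_real (1 / fact (kk i))) \<le> 1" unfolding norm_of_real by simp
  qed (use Yr_ge(2)[of i] in auto)
  ultimately have tQ: "tpoly X X Q" using Yr_pow_le_X[OF i] by (auto intro: tpoly_mono)
  have Qm: "(\<lambda>\<omega>. Q (chi (\<lambda>p. Xr p \<omega>))) \<in> borel_measurable M"
    unfolding Q_def G_def by (intro borel_measurable_times borel_measurable_power borel_measurable_cnj R.Gsum_measurable) auto
  have ab: "T / 4 \<le> 4 * T" using T4 by simp
  note tr = R.tpoly_transference[OF tQ _ ab Qm]
  have X0: "0 \<le> X" using X_le by linarith
  have pn: "Pb i (Complex x t) = G (nit t)" for t
    using Pb_nit[of i "of_real x" t] by (simp add: G_def b_def Complex_eq)
  define J where "J = integral {T/4..4*T} (\<lambda>t. norm (Pb i (Complex x t) ^ kk i / fact (kk i)))"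
  have Jn: "norm (Pb i (Complex x t) ^ kk i / fact (kk i)) = norm (G (nit t)) ^ kk i / fact (kk i)" for t
    unfolding pn by (simp add: norm_divide norm_power)
  have "continuous_on {T/4..4*T} (\<lambda>t. norm (Pb i (Complex x t) ^ kk i / fact (kk i)))"
    by (intro continuous_intros continuous_on_compose2[OF holomorphic_on_imp_continuous_on[OF Pb_holomorphic[of i UNIV]], of _ "\<lambda>t. Complex x t"])
       (auto simp: Complex_eq intro!: continuous_intros)
  then have "((\<lambda>t. norm (G (nit t)) ^ kk i / fact (kk i)) has_integral J) {T/4..4*T}"
    unfolding J_def Jn by (intro integrable_integral integrable_continuous_interval)
  from has_integral_of_real[OF this, where 'b = complex]
  have iQ: "integral {T/4..4*T} (\<lambda>t. Q (nit t)) = of_real J"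
    unfolding Qn by (intro integral_unique) simp
  define E where "E = integral\<^sup>L M (\<lambda>\<omega>. norm (G (chi (\<lambda>p. Xr p \<omega>))) ^ kk i / fact (kk i))"
  have eQ: "integral\<^sup>L M (\<lambda>\<omega>. Q (chi (\<lambda>p. Xr p \<omega>))) = of_real E"
    unfolding Qn E_def by (rule integral_complex_of_real)
  have "\<bar>J - (4 * T - T / 4) * E\<bar> = norm (complex_of_real (J - (4 * T - T / 4) * E))" by (simp only: norm_of_real)
  also have "\<dots> = norm (of_real J - of_real (4 * T - T / 4) * complex_of_real E)" by simp
  also have "\<dots> \<le> 2 * X * X" using tr(3)[OF X0] unfolding iQ eQ .
  finally have "J \<le> (4 * T - T / 4) * E + 2 * X ^ 2" by (simp add: power2_eq_square abs_le_iff)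
  also have "\<dots> \<le> 4 * T * ((mom_const \<delta> - 2) / 4 * exp (- 20 * c * K)) + T * exp (- 20 * c * K) * 2"
  proof (rule add_mono, rule mult_mono)
    show "E \<le> (mom_const \<delta> - 2) / 4 * exp (- 20 * c * K)"
      unfolding E_def G_def by (rule moment_bound[OF rm i nb x])
    show "0 \<le> E" unfolding E_def by (intro Bochner_Integration.integral_nonneg) auto
    show "2 * X ^ 2 \<le> T * exp (- 20 * c * K) * 2" by (rule X_pow_small)
  qed (use T4 in auto)
  also have "\<dots> = mom_const \<delta> * T * exp (- 20 * c * K)" by (simp add: field_simps)
  finally show ?thesis by (simp add: J_def)
qed

end

context scales
begin

text \<open>Up to a factor 2 this bounds Z powr (- \<delta> / 16), half of the saving for mollified
  zeta. The other half goes into the measure of the exceptional set.\<close>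

definition qq :: real where "qq = exp (- (c * \<delta> / 16 * K))"

lemma qq: "0 < qq" "exp (- 5 * c * K) \<le> qq" "exp (- 9 * c * K) \<le> qq" "real Z powr (- \<delta> / 16) \<le> 2 * qq" "exp (- 100 * K) \<le> qq"
proof -
  have p: "0 < c * K" using c L by simp
  have d: "c * K * (\<delta> / 16) \<le> c * K * 1" using p \<delta> by (intro mult_left_mono) auto
  show "0 < qq" by (simp add: qq_def)
  show "exp (- 5 * c * K) \<le> qq" "exp (- 9 * c * K) \<le> qq" unfolding qq_def using d p by (simp_all add: algebra_simps)
  have "c * K \<le> K" using c L mult_right_mono[of c 1 K] by simp
  then have "c * \<delta> / 16 * K \<le> 100 * K" using d L by (simp add: algebra_simps)
  then show "exp (- 100 * K) \<le> qq" unfolding qq_def by simp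
  have "real Z powr (- \<delta> / 16) \<le> (exp (c * K) / 2) powr (- \<delta> / 16)"
    using Z(3) \<delta> by (intro powr_mono2') auto
  also have "\<dots> = exp (c * K) powr (- \<delta> / 16) / 2 powr (- \<delta> / 16)" by (rule powr_divide)
  also have "\<dots> \<le> exp (c * K) powr (- \<delta> / 16) / (1 / 2)"
  proof (intro divide_left_mono)
    have "2 powr (- 1) \<le> (2::real) powr (- \<delta> / 16)" using \<delta> by (intro powr_mono) auto
    then show "1 / 2 \<le> (2::real) powr (- \<delta> / 16)" by (simp add: powr_minus)
  qed auto
  also have "exp (c * K) powr (- \<delta> / 16) = qq" by (simp add: qq_def powr_def algebra_simps)
  finally show "real Z powr (- \<delta> / 16) \<le> 2 * qq" by simp
qed

lemma N_le: "real (Suc I) * (2 * exp 4) \<le> exp (c * K)"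
proof -
  have "real (Suc I) \<le> 2 * l + 3" using I_le(2) by simp
  then have "real (Suc I) * (2 * exp 4) \<le> (2 * l + 3) * (2 * exp 4)" by (intro mult_right_mono) auto
  then show ?thesis using NcK by linarith
qed

text \<open>Smallness of w^k / k! forces |w| <= k, since otherwise it would be at least k^k / k! >=
  1. This controls exp |w|, which enters once through the remainder and once through the factor exp
  w.\<close>

lemma trunc_quotient:
  fixes w :: complex
  assumes d: "norm (w ^ k / fact k) \<le> e" "e < 1" "k > 0"
  shows "norm ((\<Sum>j<k. (- w) ^ j / fact j) * exp w - 1) \<le> e * exp (2 * real k)"
proof -
  have wk: "norm w \<le> real k"
  proof (rule ccontr)
    assume "\<not> ?thesis"
    then have "real k ^ k \<le> norm w ^ k" by (intro power_mono) auto
    moreover have "fact k \<le> real k ^ k" using fact_le_power[of k, where 'a = real] by simp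
    ultimately have "1 \<le> norm w ^ k / fact k" by (simp add: le_divide_eq)
    moreover have "norm w ^ k / fact k = norm (w ^ k / fact k)" by (simp add: norm_divide norm_power)
    ultimately show False using d(1,2) by linarith
  qed
  have "norm (exp (- w) - (\<Sum>j<k. (- w) ^ j / fact j)) \<le> norm (- w) ^ k / fact k * exp (norm (- w))"
    by (rule norm_exp_sub_trunc_le)
  also have "norm (- w) ^ k / fact k = norm (w ^ k / fact k)" by (simp add: norm_divide norm_power)
  also have "norm (w ^ k / fact k) * exp (norm (- w)) \<le> e * exp (norm (- w))" by (intro mult_right_mono d(1)) simp
  finally have 1: "norm ((\<Sum>j<k. (- w) ^ j / fact j) - exp (- w)) \<le> e * exp (norm w)" by (simp add: norm_minus_commute)
  have e0: "0 \<le> e" using d(1) norm_ge_zero order_trans by blast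
  have "(\<Sum>j<k. (- w) ^ j / fact j) * exp w - 1 = ((\<Sum>j<k. (- w) ^ j / fact j) - exp (- w)) * exp w"
    by (simp add: left_diff_distrib exp_minus)
  also have "norm \<dots> \<le> (e * exp (norm w)) * exp (norm w)"
    unfolding norm_mult using 1 norm_exp[of w] e0 by (intro mult_mono) auto
  also have "\<dots> = e * exp (2 * norm w)" by (simp add: mult_exp_exp)
  also have "\<dots> \<le> e * exp (2 * real k)" using wk e0 by (intro mult_left_mono) auto
  finally show ?thesis .
qed

text \<open>In each block the error exp (- 10 c K) is multiplied by exp (2 kk i), at most exp (4 c K
  + 4), which leaves exp (- 6 c K); the number of blocks and the constants cost another exp (c
  K).\<close>

lemma mollifier_times_exp:
  assumes d: "\<And>i. i < Suc I \<Longrightarrow> norm (Pb i s ^ kk i / fact (kk i)) \<le> exp (- 10 * c * K)"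
  shows "norm (dser Dm Xn s * exp (P s) - 1) \<le> exp (- 5 * c * K)"
proof -
  have p: "0 < c * K" using c L by simp
  define z where "z = (\<lambda>i. (\<Sum>j<kk i. (- Pb i s) ^ j / fact j) * exp (Pb i s) - 1)"
  have eq: "dser Dm Xn s * exp (P s) = (\<Prod>i<Suc I. 1 + z i)"
    unfolding dser_Dm P_def by (simp add: z_def exp_sum prod.distrib del: prod.lessThan_Suc sum.lessThan_Suc)
  have zi: "norm (z i) \<le> exp 4 * exp (- 6 * c * K)" if "i < Suc I" for i
  proof -
    have "norm (z i) \<le> exp (- 10 * c * K) * exp (2 * real (kk i))"
      unfolding z_def using p by (intro trunc_quotient d that kk_pos) (auto simp: mult.commute[of K])
    also have "\<dots> \<le> exp (4 + - 6 * c * K)" unfolding exp_add[symmetric] exp_le_cancel_iff using kk_le'[of i] by linarith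
    finally show ?thesis by (simp only: exp_add)
  qed
  have s: "2 * (\<Sum>i<Suc I. norm (z i)) \<le> exp (- 5 * c * K)"
  proof -
    have "2 * (\<Sum>i<Suc I. norm (z i)) \<le> 2 * (\<Sum>i<Suc I. exp 4 * exp (- 6 * c * K))"
      using zi by (intro mult_left_mono sum_mono) auto
    also have "\<dots> = (real (Suc I) * (2 * exp 4)) * exp (- 6 * c * K)" by simp
    also have "\<dots> \<le> exp (c * K) * exp (- 6 * c * K)" by (intro mult_right_mono N_le) auto
    also have "\<dots> = exp (- 5 * c * K)" by (simp add: exp_add[symmetric])
    finally show ?thesis .
  qed
  moreover have "exp (- 5 * c * K) \<le> 1" using p by (simp add: mult.commute[of K])
  ultimately have "(\<Sum>i<Suc I. norm (z i)) \<le> 1"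
    using sum_nonneg[of "{..<Suc I}" "\<lambda>i. norm (z i)"] by linarith
  from norm_prod_sub_1_le[OF this] have "norm ((\<Prod>i<Suc I. 1 + z i) - 1) \<le> 2 * (\<Sum>i<Suc I. norm (z i))" by blast
  then show ?thesis unfolding eq using s by (rule order_trans)
qed

text \<open>The saving is Yr I powr (- 1 / 2), where Yr I is at least exp (A K) and A exceeds
  200.\<close>

lemma Lser_tail:
  assumes "Re s \<ge> 2"
  shows "norm (Lser s - P s) \<le> (\<Sum>n. real n powr (- (3 / 2))) * exp (- 100 * K)"
proof -
  let ?t = "\<lambda>n. of_real (lam n) * complex_of_nat n powr (-s)"
  define m where "m = Suc (Yb I)"
  have "P s = (\<Sum>n<m. ?t n)"
    unfolding P_eq
  proof (rule sum.mono_neutral_left)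
    show "{n. 2 \<le> n \<and> real n \<le> Yr I} \<subseteq> {..<m}" using Yb(2)[of I] unfolding m_def by auto
    show "\<forall>n\<in>{..<m} - {n. 2 \<le> n \<and> real n \<le> Yr I}. ?t n = 0"
    proof
      fix n assume n: "n \<in> {..<m} - {n. 2 \<le> n \<and> real n \<le> Yr I}"
      then have "real n \<le> Yr I" using Yb(1)[of I] by (auto simp: m_def less_Suc_eq_le intro: order_trans[of _ "real (Yb I)"])
      then have "n = 0 \<or> n = 1" using n by auto
      then show "?t n = 0" by auto
    qed
  qed simp
  moreover have ss: "?t sums Lser s" using assms by (intro Lser_sums) auto
  ultimately have "Lser s - P s = (\<Sum>n. ?t (n + m))"
    using suminf_minus_initial_segment[of ?t m] by (simp add: sums_iff)
  have s32: "summable (\<lambda>n. real (n + m) powr (- (3 / 2)))"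
    using summable_nat_powr[of "3 / 2"] by (subst summable_iff_shift) auto
  have "norm (\<Sum>n. ?t (n + m)) \<le> (\<Sum>n. exp (- 100 * K) * real (n + m) powr (- (3 / 2)))"
  proof (rule norm_suminf_le)
    fix n
    have nm: "Yr I \<le> real (n + m)" using Yb(2)[of I] by (simp add: m_def)
    have "norm (?t (n + m)) \<le> real (n + m) powr (- 2)" using assms by (intro norm_Lser_term_le)
    also have "\<dots> = real (n + m) powr (- (1 / 2)) * real (n + m) powr (- (3 / 2))" unfolding powr_add[symmetric] by simp
    also have "\<dots> \<le> Yr I powr (- (1 / 2)) * real (n + m) powr (- (3 / 2))"
      using nm Yr_ge[of I] by (intro mult_right_mono powr_mono2') auto
    also have "Yr I powr (- (1 / 2)) \<le> exp (- 100 * K)"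
    proof -
      have "200 * K \<le> A * (l * 2 ^ I)" using A I_ge L by (intro mult_mono) auto
      then show ?thesis by (simp add: Yr_def powr_def algebra_simps)
    qed
    finally show "norm (?t (n + m)) \<le> exp (- 100 * K) * real (n + m) powr (- (3 / 2))" by (simp add: mult_right_mono)
  qed (intro summable_mult s32)
  also have "\<dots> = exp (- 100 * K) * (\<Sum>n. real (n + m) powr (- (3 / 2)))" by (rule suminf_mult[OF s32])
  also have "\<dots> \<le> exp (- 100 * K) * (\<Sum>n. real n powr (- (3 / 2)))"
    using suminf_minus_initial_segment[OF summable_nat_powr[of "3/2"], of m]
    by (intro mult_left_mono) (auto intro: sum_nonneg)
  finally show ?thesis using \<open>Lser s - P s = _\<close> by (simp add: mult.commute)
qed

text \<open>Ordinates are excluded where mollified zeta is not close to 1 or where some block power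
  Pb^k / k! is not small. For the others both hold along the whole segment from \<sigma> to 3, and
  zeta times exp (- P) stays close to 1 there. Beyond abscissa 2 the Dirichlet series is compared
  directly.\<close>

lemma log_zeta_near_P:
  assumes rm: "random_model M Xr" and mb: "moll_bound \<delta> C1 T" "C1 > 0"
    and q8: "qq < 1 / 8" and tl: "(\<Sum>n. real n powr (- (3 / 2))) * exp (- 100 * K) < 1"
  obtains E where "E \<in> sets borel" "E \<subseteq> {T/2..3*T}" "measure lborel E \<le> 4 / \<delta> * (2 * C1 + mom_const \<delta>) * T * qq"
    "\<And>x y. y \<in> {T/2..3*T} - E \<Longrightarrow> \<sigma> \<le> x \<Longrightarrow> norm (log_zeta (Complex x y) - P (Complex x y)) \<le> (8 + (\<Sum>n. real n powr (- (3 / 2)))) * qq"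
proof -
  \<comment> \<open>The left side of the rectangle lies halfway between the critical line and
    \<sigma>, which leaves distance d = \<delta> / 2 for Cauchy's formula.\<close>
  let ?w = "1 / 2 + \<delta> / 2" and ?U = "{z. Re z > 0} \<inter> {z. Im z > 0}"
  have p: "0 < c * K" using c L by simp
  have w: "0 < ?w" "?w \<le> 4" "0 < \<delta> / 2" "\<delta> / 2 \<le> 1" "1 < T / 2" "T / 2 \<le> 3 * T" using \<delta> T4 by auto
  have sub: "integral {T / 2 - 1..3 * T + 1} (\<lambda>t. norm (f (Complex x t))) \<le> integral {T/4..4*T} (\<lambda>t. norm (f (Complex x t)))"
    if f: "f holomorphic_on ?U" and x: "x \<in> {?w..4}" for f x
  proof -
    have c: "continuous_on {T/4..4*T} (\<lambda>t. norm (f (Complex x t)))"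
      by (intro continuous_intros continuous_on_compose2[OF holomorphic_on_imp_continuous_on[OF f], of _ "\<lambda>t. Complex x t"])
         (use x \<delta> T4 in \<open>auto simp: Complex_eq intro!: continuous_intros\<close>)
    show ?thesis
      using T4 by (intro integral_subset_le integrable_continuous_interval continuous_on_subset[OF c] c) auto
  qed
  define f where "f = (\<lambda>z. zeta z * dser Dm Xn z - 1)"
  have fh: "f holomorphic_on ?U" unfolding f_def
    by (intro holomorphic_intros dser_holomorphic holomorphic_on_subset[OF zeta_holomorphic]) (auto simp: complex_eq_iff)
  have fB: "integral {T / 2 - 1..3 * T + 1} (\<lambda>t. norm (f (Complex x t))) \<le> C1 * T * real Z powr (- \<delta> / 8)" if x: "x \<in> {?w..4}" for x
  proof (rule order_trans[OF sub[OF fh x]])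
    show "integral {T/4..4*T} (\<lambda>t. norm (f (Complex x t))) \<le> C1 * T * real Z powr (- \<delta> / 8)"
      unfolding f_def
      by (rule mb(1)[unfolded moll_bound_def, rule_format])
         (use Dm_le Dm_1 Dm_0 Xn_le(2) Z Dm_van x in auto)
  qed
  have \<eta>: "0 < real Z powr (- \<delta> / 16)" using Z(1) by simp
  obtain E0 where E0: "E0 \<in> sets borel" "E0 \<subseteq> {T/2..3*T}" "measure lborel E0 \<le> 2 * (C1 * T * real Z powr (- \<delta> / 8)) / (\<delta> / 2 * real Z powr (- \<delta> / 16))"
    "\<And>x y. y \<in> {T/2..3*T} - E0 \<Longrightarrow> x \<in> {?w + \<delta> / 2..4 - \<delta> / 2} \<Longrightarrow> norm (f (Complex x y)) \<le> real Z powr (- \<delta> / 16)"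
    using exceptional_ordinates[OF fh w fB \<eta>] by metis
  \<comment> \<open>The square root of the mean bound exp (- 20 c K), so that Markov's inequality
    gives an equally small exceptional set.\<close>
  define e10 where "e10 = exp (- 10 * c * K)"
  have "\<exists>E. E \<in> sets borel \<and> E \<subseteq> {T/2..3*T} \<and> measure lborel E \<le> 2 * (mom_const \<delta> * T * exp (- 20 * c * K)) / (\<delta> / 2 * e10) \<and>
     (\<forall>x y. y \<in> {T/2..3*T} - E \<longrightarrow> x \<in> {?w + \<delta> / 2..4 - \<delta> / 2} \<longrightarrow> norm (Pb i (Complex x y) ^ kk i / fact (kk i)) \<le> e10)"
    if i: "i < Suc I" for i
  proof -
    have gh: "(\<lambda>z. Pb i z ^ kk i / fact (kk i)) holomorphic_on ?U" by (intro holomorphic_intros Pb_holomorphic) auto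
    have gB: "integral {T / 2 - 1..3 * T + 1} (\<lambda>t. norm (Pb i (Complex x t) ^ kk i / fact (kk i))) \<le> mom_const \<delta> * T * exp (- 20 * c * K)"
      if x: "x \<in> {?w..4}" for x
      by (rule order_trans[OF sub[OF gh x] moment_step[OF rm i]]) (use x in auto)
    have e: "0 < e10" by (simp add: e10_def)
    show ?thesis using exceptional_ordinates[OF gh w gB e] by metis
  qed
  then obtain F where F: "\<And>i. i < Suc I \<Longrightarrow> F i \<in> sets borel" "\<And>i. i < Suc I \<Longrightarrow> F i \<subseteq> {T/2..3*T}"
    "\<And>i. i < Suc I \<Longrightarrow> measure lborel (F i) \<le> 2 * (mom_const \<delta> * T * exp (- 20 * c * K)) / (\<delta> / 2 * e10)"
    "\<And>i x y. i < Suc I \<Longrightarrow> y \<in> {T/2..3*T} - F i \<Longrightarrow> x \<in> {?w + \<delta> / 2..4 - \<delta> / 2} \<Longrightarrow> norm (Pb i (Complex x y) ^ kk i / fact (kk i)) \<le> e10"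
    by metis
  define E where "E = E0 \<union> (\<Union>i<Suc I. F i)"
  have fin: "emeasure lborel S \<noteq> \<infinity>" if "S \<subseteq> {T/2..3*T}" "S \<in> sets borel" for S
  proof -
    have "emeasure lborel S \<le> emeasure lborel {T/2..3*T}" using that by (intro emeasure_mono) auto
    also have "\<dots> < \<infinity>" using w by simp
    finally show ?thesis by simp
  qed
  have UF: "(\<Union>i<Suc I. F i) \<in> sets borel" using F(1) by (intro sets.finite_UN) auto
  show ?thesis
  proof (rule that[of E])
    show "E \<in> sets borel" unfolding E_def using E0(1) UF by (rule sets.Un)
    show "E \<subseteq> {T/2..3*T}" unfolding E_def using E0(2) F(2) by blast
    have "measure lborel E \<le> measure lborel E0 + measure lborel (\<Union>i<Suc I. F i)"
      unfolding E_def using E0(1) UF by (intro measure_Un_le) auto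
    also have "measure lborel (\<Union>i<Suc I. F i) \<le> (\<Sum>i<Suc I. measure lborel (F i))"
      using F(1) by (intro measure_UNION_le) auto
    also have "\<dots> \<le> (\<Sum>i<Suc I. 2 * (mom_const \<delta> * T * exp (- 20 * c * K)) / (\<delta> / 2 * e10))"
      using F(3) by (intro sum_mono) auto
    also have "\<dots> = 4 / \<delta> * mom_const \<delta> * T * (real (Suc I) * (exp (- 20 * c * K) / e10))" by (simp add: field_simps)
    also have "exp (- 20 * c * K) / e10 = exp (- 10 * c * K)" unfolding e10_def exp_diff[symmetric] by simp
    also have "4 / \<delta> * mom_const \<delta> * T * (real (Suc I) * exp (- 10 * c * K)) \<le> 4 / \<delta> * mom_const \<delta> * T * qq"
    proof (intro mult_left_mono)
      have "real (Suc I) * 1 \<le> real (Suc I) * (2 * exp 4)" by (intro mult_left_mono) (auto intro: order_trans[of 1 2])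
      also have "\<dots> \<le> exp (c * K)" by (rule N_le)
      finally have "real (Suc I) * exp (- 10 * c * K) \<le> exp (c * K) * exp (- 10 * c * K)" by (intro mult_right_mono) auto
      also have "\<dots> = exp (- 9 * c * K)" by (simp add: exp_add[symmetric])
      finally show "real (Suc I) * exp (- 10 * c * K) \<le> qq" using qq(3) by linarith
      show "0 \<le> 4 / \<delta> * mom_const \<delta> * T" using \<delta> T4 by (simp add: mom_const_def)
    qed
    also have "measure lborel E0 \<le> 4 / \<delta> * (2 * C1) * T * qq"
    proof -
      have "real Z powr (- \<delta> / 8) = real Z powr (- \<delta> / 16) * real Z powr (- \<delta> / 16)" unfolding powr_add[symmetric] by simp
      then have "2 * (C1 * T * real Z powr (- \<delta> / 8)) / (\<delta> / 2 * real Z powr (- \<delta> / 16)) = 4 / \<delta> * C1 * T * real Z powr (- \<delta> / 16)"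
        using \<eta> by (simp add: field_simps)
      also have "\<dots> \<le> 4 / \<delta> * C1 * T * (2 * qq)" using qq(4) \<delta> T4 mb(2) by (intro mult_left_mono) auto
      finally show ?thesis using E0(3) by simp
    qed
    finally show "measure lborel E \<le> 4 / \<delta> * (2 * C1 + mom_const \<delta>) * T * qq" by (simp add: algebra_simps)
  next
    fix x0 y assume y: "y \<in> {T/2..3*T} - E" and x0: "\<sigma> \<le> x0"
    define S where "S = (\<Sum>n. real n powr (- (3 / 2)))"
    have S0: "0 \<le> S" unfolding S_def by (intro suminf_nonneg summable_nat_powr) auto
    show "norm (log_zeta (Complex x0 y) - P (Complex x0 y)) \<le> (8 + (\<Sum>n. real n powr (- (3 / 2)))) * qq"
    proof (cases "x0 \<le> 2")
      case False
      then have "norm (log_zeta (Complex x0 y) - P (Complex x0 y)) \<le> S * exp (- 100 * K)"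
        unfolding S_def using Lser_tail[of "Complex x0 y"] by (simp add: log_zeta_eq_Lser)
      also have "\<dots> \<le> S * qq" using S0 qq(5) by (rule mult_left_mono[rotated])
      finally show ?thesis unfolding S_def[symmetric] using qq(1) by (simp add: distrib_right)
    next
      case True
      have y0: "y > 0" using y T4 by auto
      have "norm (log_zeta (Complex x0 y) - P (Complex x0 y)) \<le> 2 * (4 * qq)"
      proof (rule log_zeta_approx_of_quotient[OF True, where P = "\<lambda>x. P (Complex x y)"])
        have "P holomorphic_on UNIV" unfolding P_def[abs_def] by (intro holomorphic_intros Pb_holomorphic)
        then show "continuous_on {x0..3} (\<lambda>x. P (Complex x y))"
          by (intro continuous_on_compose2[OF holomorphic_on_imp_continuous_on isCont_Complex_line]) auto
        show "continuous_on {x0..3} (\<lambda>x. zeta (Complex x y))"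
          by (rule continuous_on_compose2[OF holomorphic_on_imp_continuous_on[OF zeta_holomorphic] isCont_Complex_line])
             (use y0 x0 \<sigma> in \<open>auto simp: complex_eq_iff\<close>)
        show "4 * qq < 1 / 2" using q8 by simp
        show "norm (Lser (Complex 3 y) - P (Complex 3 y)) < 1" using Lser_tail[of "Complex 3 y"] tl by simp
        fix x assume x: "x \<in> {x0..3}"
        define s where "s = Complex x y"
        have "?w + \<delta> / 2 = \<sigma>" by (simp add: \<delta>_def field_simps)
        then have xr: "x \<in> {?w + \<delta> / 2..4 - \<delta> / 2}" using x x0 \<delta> by auto
        have f1: "norm (zeta s * dser Dm Xn s - 1) \<le> 2 * qq"
          using E0(4)[OF _ xr, of y] y qq(4) by (auto simp: E_def f_def s_def)
        have "norm (Pb i s ^ kk i / fact (kk i)) \<le> exp (- 10 * c * K)" if "i < Suc I" for i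
          using F(4)[OF that _ xr, of y] y that by (auto simp: E_def e10_def s_def)
        from mollifier_times_exp[of s, OF this] have m1: "norm (dser Dm Xn s * exp (P s) - 1) \<le> qq"
          using qq(2) by linarith
        define m where "m = dser Dm Xn s * exp (P s)"
        have mn: "1 / 2 \<le> norm m" using norm_triangle_ineq2[of 1 "1 - m"] m1 q8 by (simp add: m_def norm_minus_commute)
        then have m0: "m \<noteq> 0" by auto
        \<comment> \<open>Zeta times exp (- P) is the quotient of zeta times mollifier by m =
          mollifier times exp P, both of which are close to 1.\<close>
        have "zeta s * exp (- P s) - 1 = ((zeta s * dser Dm Xn s - 1) - (m - 1)) / m"
          using m0 by (simp add: m_def field_simps exp_minus)
        also have "norm \<dots> \<le> (2 * qq + qq) / norm m"
          unfolding norm_divide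
        proof (intro divide_right_mono)
          show "norm ((zeta s * dser Dm Xn s - 1) - (m - 1)) \<le> 2 * qq + qq"
            using norm_triangle_ineq4[of "zeta s * dser Dm Xn s - 1" "m - 1"] f1 m1 unfolding m_def by linarith
        qed simp
        also have "\<dots> \<le> (2 * qq + qq) / (3 / 4)"
        proof (intro divide_left_mono)
          show "3 / 4 \<le> norm m" using norm_triangle_ineq2[of 1 "1 - m"] m1 q8 by (simp add: m_def norm_minus_commute)
        qed (use qq(1) mn in auto)
        also have "\<dots> = 4 * qq" by simp
        finally show "norm (zeta (Complex x y) * exp (- P (Complex x y)) - 1) \<le> 4 * qq" by (simp add: s_def)
      qed
      also have "\<dots> \<le> (8 + S) * qq" using S0 qq(1) by (simp add: distrib_right)
      finally show ?thesis by (simp add: S_def)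
    qed
  qed
qed

end

section \<open>Almost sure convergence of the random Euler product and its approximation in
  mean\<close>

lemma nn_integral_AE_limit_le:
  fixes f :: "nat \<Rightarrow> 'a \<Rightarrow> real"
  assumes m: "\<And>n. f n \<in> borel_measurable M"
    and lim: "AE x in M. (\<lambda>n. f n x) \<longlonglongrightarrow> g x"
    and B: "eventually (\<lambda>n. (\<integral>\<^sup>+x. ennreal (f n x) \<partial>M) \<le> B) sequentially"
  shows "(\<integral>\<^sup>+x. ennreal (g x) \<partial>M) \<le> B"
proof -
  have "AE x in M. ennreal (g x) = liminf (\<lambda>n. ennreal (f n x))"
    using lim
  proof eventually_elim
    case (elim x)
    then have "(\<lambda>n. ennreal (f n x)) \<longlonglongrightarrow> ennreal (g x)" by (rule tendsto_ennrealI)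
    from lim_imp_Liminf[OF _ this] show ?case by simp
  qed
  then have "(\<integral>\<^sup>+x. ennreal (g x) \<partial>M) = (\<integral>\<^sup>+x. liminf (\<lambda>n. ennreal (f n x)) \<partial>M)"
    by (rule nn_integral_cong_AE)
  also have "\<dots> \<le> liminf (\<lambda>n. \<integral>\<^sup>+x. ennreal (f n x) \<partial>M)" using m by (intro nn_integral_liminf) auto
  also have "\<dots> \<le> limsup (\<lambda>n. \<integral>\<^sup>+x. ennreal (f n x) \<partial>M)" by (rule Liminf_le_Limsup) simp
  also have "\<dots> \<le> B" using B by (rule Limsup_bounded)
  finally show ?thesis .
qed

lemma AE_summable_of_nn_integral_le:
  fixes f :: "nat \<Rightarrow> 'a \<Rightarrow> real"
  assumes m: "\<And>n. f n \<in> borel_measurable M" and nn: "\<And>n x. 0 \<le> f n x"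
    and B: "\<And>n. (\<integral>\<^sup>+x. ennreal (f n x) \<partial>M) \<le> ennreal (g n)" and g: "\<And>n. 0 \<le> g n" "summable g"
  shows "AE x in M. summable (\<lambda>n. f n x)"
proof -
  have "(\<integral>\<^sup>+x. (\<Sum>n. ennreal (f n x)) \<partial>M) = (\<Sum>n. \<integral>\<^sup>+x. ennreal (f n x) \<partial>M)"
    using m by (intro nn_integral_suminf) auto
  also have "\<dots> \<le> (\<Sum>n. ennreal (g n))" using B by (intro suminf_le) auto
  also have "\<dots> = ennreal (suminf g)" using g by (intro suminf_ennreal2) auto
  finally have "(\<integral>\<^sup>+x. (\<Sum>n. ennreal (f n x)) \<partial>M) < \<infinity>" by (rule le_less_trans) simp
  then have "AE x in M. (\<Sum>n. ennreal (f n x)) \<noteq> \<infinity>" using m by (intro nn_integral_PInf_AE) auto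
  then show ?thesis by eventually_elim (use nn in \<open>auto intro: summable_suminf_not_top\<close>)
qed

lemma lam_prime_power: "prime p \<Longrightarrow> k > 0 \<Longrightarrow> lam (p ^ k) = 1 / real k"
  using prime_gt_1_nat[of p] by (simp add: lam_def mangoldt_def aprimedivisor_prime_power ln_realpow)

lemma norm_nat_powr_le: "n > 0 \<Longrightarrow> w \<le> Re s \<Longrightarrow> norm (of_nat n powr (-s)) \<le> real n powr (-w)"
  by (subst norm_powr_real_powr) (auto intro!: powr_mono)

lemma Gsum_primes:
  assumes "\<And>p. p \<in> A \<Longrightarrow> prime p" shows "Gsum A b (chi x) = (\<Sum>p\<in>A. b p * x p)"
  unfolding Gsum_def by (intro sum.cong refl) (use assms lam_prime_power[of _ 1] in \<open>simp add: chi_prime\<close>)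

lemma Gsum_prime_powers:
  assumes fP: "finite P" "\<And>p. p \<in> P \<Longrightarrow> prime p"
  shows "Gsum ((\<lambda>(p, k). p ^ k) ` (P \<times> {1..K})) (\<lambda>n. of_nat n powr (-s)) (chi x)
    = (\<Sum>p\<in>P. \<Sum>k=1..K. (x p * of_nat p powr (-s)) ^ k / of_nat k)"
proof -
  have inj: "inj_on (\<lambda>(p, k). p ^ k) (P \<times> {1..K})"
  proof (rule inj_onI, clarsimp)
    fix p k q m assume *: "p \<in> P" "q \<in> P" "Suc 0 \<le> k" "Suc 0 \<le> m" "p ^ k = q ^ m"
    then have "prime p" "prime q" using fP by auto
    then have "p = q" using * by (metis prime_dvd_power_nat primes_dvd_imp_eq dvd_power less_eq_Suc_le)
    then show "p = q \<and> k = m" using * \<open>prime q\<close> prime_gt_1_nat[of q] power_inject_exp[of q k m] by auto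
  qed
  have "Gsum ((\<lambda>(p, k). p ^ k) ` (P \<times> {1..K})) (\<lambda>n. of_nat n powr (-s)) (chi x)
    = (\<Sum>(p, k)\<in>P \<times> {1..K}. of_real (lam (p ^ k)) * of_nat (p ^ k) powr (-s) * chi x (p ^ k))"
    unfolding Gsum_def by (subst sum.reindex[OF inj]) (simp add: case_prod_unfold)
  also have "\<dots> = (\<Sum>(p, k)\<in>P \<times> {1..K}. (x p * of_nat p powr (-s)) ^ k / of_nat k)"
  proof (intro sum.cong refl, clarify)
    fix p k assume *: "p \<in> P" "k \<in> {1..K}"
    then have p: "prime p" "k > 0" using fP by auto
    have "complex_of_nat (p ^ k) powr (-s) = (of_nat p powr (-s)) ^ k"
    proof -
      have p0: "p > 0" using prime_gt_0_nat[OF p(1)] .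
      then have "Ln (of_nat (p ^ k)) = of_nat k * of_real (ln (real p))"
        using Ln_of_nat[of "p ^ k"] by (simp add: ln_realpow)
      then have "complex_of_nat (p ^ k) powr (-s) = exp (of_nat k * (- s * of_real (ln (real p))))"
        using p0 by (simp add: powr_def mult_ac)
      also have "\<dots> = (of_nat p powr (-s)) ^ k"
        unfolding exp_of_nat_mult using p0 by (simp add: powr_def Ln_of_nat)
      finally show ?thesis .
    qed
    then show "of_real (lam (p ^ k)) * of_nat (p ^ k) powr (-s) * chi x (p ^ k) = (x p * of_nat p powr (-s)) ^ k / of_nat k"
      using p by (simp add: lam_prime_power chi_prime_power power_mult_distrib)
  qed
  also have "\<dots> = (\<Sum>p\<in>P. \<Sum>k=1..K. (x p * of_nat p powr (-s)) ^ k / of_nat k)"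
    by (simp add: sum.cartesian_product)
  finally show ?thesis .
qed

lemma neg_Ln_sums:
  assumes "norm z < 1" shows "(\<lambda>K. \<Sum>k=1..K. z ^ k / of_nat k) \<longlonglongrightarrow> - Ln (1 - z)"
proof -
  have "(\<lambda>n. - (- (z ^ n) / of_nat n)) sums - Ln (1 - z)"
    using sums_minus[OF Ln_series'[of "-z"]] assms by simp
  then have "(\<lambda>K. \<Sum>k<Suc K. z ^ k / of_nat k) \<longlonglongrightarrow> - Ln (1 - z)"
    unfolding sums_def by (intro LIMSEQ_Suc) (simp add: sum_negf)
  moreover have "(\<Sum>k<Suc K. z ^ k / of_nat k) = (\<Sum>k=1..K. z ^ k / of_nat k)" for K
    by (subst sum.lessThan_Suc_shift) (simp add: sum.atLeast1_atMost_eq)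
  ultimately show ?thesis by simp
qed

lemma prime_powr_less:
  assumes "1 / 2 < w" "n \<ge> 2" shows "real n powr (-w) \<le> 3 / 4"
proof -
  have "real n powr (-w) \<le> real n powr (- (1 / 2))" using assms by (intro powr_mono) auto
  also have "\<dots> \<le> 2 powr (- (1 / 2))" using assms by (intro powr_mono2') auto
  also have "\<dots> \<le> 3 / 4"
  proof -
    have "4 / 3 \<le> sqrt 2" by (rule real_le_rsqrt) (simp add: power2_eq_square)
    then show ?thesis by (simp add: powr_minus powr_half_sqrt divide_simps)
  qed
  finally show ?thesis .
qed

text \<open>Expanding the logarithms produces all powers of primes below N. Those up to Y make up
  the sum over \<open>{2..Y}\<close>, the primes between Y and N are split off because they are not
  small in absolute value, and only higher prime powers beyond Y remain. For finiteness the
  exponents are first cut at K, which tends to infinity; K >= Y already captures every prime power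
  up to Y.\<close>

lemma euler_partial_log_approx:
  assumes x: "\<And>p. prime p \<Longrightarrow> norm (x p) = 1" and d: "\<delta> > 0" "1 / 2 + \<delta> \<le> Re s" and N: "1 \<le> Y" "Y < N"
  shows "norm (- (\<Sum>p<N. if prime p then Ln (1 - x p * of_nat p powr (-s)) else 0)
      - (Gsum {2..Y} (\<lambda>n. of_nat n powr (-s)) (chi x) + Gsum {p. prime p \<and> Y < p \<and> p < N} (\<lambda>n. of_nat n powr (-s)) (chi x)))
    \<le> nonprime_const (1 / 2 + \<delta> / 2) * real Y powr (- \<delta> / 2)" (is "norm (?R - (?G Y + ?T)) \<le> ?B")
proof -
  define P where "P = {p. prime p \<and> p < N}"
  have P: "finite P" "\<And>p. p \<in> P \<Longrightarrow> prime p" by (auto simp: P_def)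
  let ?b = "\<lambda>n. complex_of_nat n powr (-s)"
  define S where "S = (\<lambda>K. (\<lambda>(p, k). p ^ k) ` (P \<times> {1..K::nat}))"
  have fS: "finite (S K)" for K using P by (auto simp: S_def)
  have mem: "n \<in> S K \<longleftrightarrow> (\<exists>p\<in>P. \<exists>k\<in>{1..K}. n = p ^ k)" for n K
    unfolding S_def by fastforce
  have "(\<lambda>K. Gsum (S K) ?b (chi x)) \<longlonglongrightarrow> (\<Sum>p\<in>P. - Ln (1 - x p * ?b p))"
  proof -
    have *: "Gsum (S K) ?b (chi x) = (\<Sum>p\<in>P. \<Sum>k=1..K. (x p * ?b p) ^ k / of_nat k)" for K
      unfolding S_def by (rule Gsum_prime_powers) (use P in auto)
    show ?thesis unfolding *
  proof (intro tendsto_sum neg_Ln_sums)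
    fix p assume "p \<in> P"
    then have p: "prime p" by (rule P)
    then have "norm (x p * ?b p) \<le> real p powr (- (1 / 2 + \<delta>))"
      using x d norm_nat_powr_le[of p "1/2+\<delta>" s] prime_gt_0_nat by (simp add: norm_mult)
    also have "\<dots> \<le> 3 / 4" using p prime_ge_2_nat d by (intro prime_powr_less) auto
    finally show "norm (x p * ?b p) < 1" by simp
  qed
  qed
  moreover have "?R = (\<Sum>p\<in>P. - Ln (1 - x p * ?b p))"
    unfolding sum_negf P_def by (subst sum.inter_filter[symmetric]) (auto intro: sum.cong)
  ultimately have "(\<lambda>K. norm (Gsum (S K) ?b (chi x) - (?G Y + ?T))) \<longlonglongrightarrow> norm (?R - (?G Y + ?T))"
    by (intro tendsto_intros) simp
  moreover have "norm (Gsum (S K) ?b (chi x) - (?G Y + ?T)) \<le> ?B" if K: "K \<ge> Y" for K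
  proof -
    define E where "E = {n\<in>S K. Y < n \<and> \<not> prime n}"
    let ?t = "\<lambda>n. of_real (lam n) * ?b n * chi x n"
    have K1: "K \<ge> 1" using K N by simp
    have "?G Y = sum ?t {n\<in>{2..Y}. lam n \<noteq> 0}" unfolding Gsum_def by (intro sum.mono_neutral_right) auto
    also have "{n\<in>{2..Y}. lam n \<noteq> 0} = {n\<in>S K. n \<le> Y}"
    proof (intro equalityI subsetI)
      fix n assume n: "n \<in> {n\<in>{2..Y}. lam n \<noteq> 0}"
      then have "mangoldt n \<noteq> (0::real)" by (auto simp: lam_def)
      then obtain p k where pk: "prime p" "k > 0" "n = p ^ k"
        unfolding mangoldt_def primepow_def by (auto split: if_splits)
      have "p \<le> n" using pk self_le_power[of p k] prime_ge_1_nat[of p] by auto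
      moreover have "k < 2 ^ k" by simp
      then have "k < p ^ k" using power_mono[OF prime_ge_2_nat[OF pk(1)], of k] by linarith
      ultimately have "p \<in> P" "k \<in> {1..K}" using pk n N K by (auto simp: P_def)
      then have "n \<in> S K" using pk(3) unfolding mem by blast
      then show "n \<in> {n\<in>S K. n \<le> Y}" using n by simp
    next
      fix n assume n: "n \<in> {n\<in>S K. n \<le> Y}"
      then obtain p k where "p \<in> P" "k \<in> {1..K}" and n': "n = p ^ k" unfolding mem by blast
      then have pk: "prime p" "k > 0" "n = p ^ k" using P(2) by auto
      then have "n \<ge> 2" using self_le_power[of p k] prime_ge_2_nat[of p] by linarith
      then show "n \<in> {n\<in>{2..Y}. lam n \<noteq> 0}" using n pk lam_prime_power[of p k] by auto
    qed
    finally have 1: "?G Y = sum ?t {n\<in>S K. n \<le> Y}" .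
    have "{p. prime p \<and> Y < p \<and> p < N} = {n\<in>S K. Y < n \<and> prime n}"
    proof (intro equalityI subsetI)
      fix n assume n: "n \<in> {p. prime p \<and> Y < p \<and> p < N}"
      then have "n \<in> P" "1 \<in> {1..K}" "n = n ^ 1" using K1 by (auto simp: P_def)
      then have "n \<in> S K" unfolding mem by blast
      then show "n \<in> {n\<in>S K. Y < n \<and> prime n}" using n by simp
    next
      fix n assume n: "n \<in> {n\<in>S K. Y < n \<and> prime n}"
      then obtain p k where "p \<in> P" "k \<in> {1..K}" and n': "n = p ^ k" unfolding mem by blast
      then have pk: "p \<in> P" "k > 0" "n = p ^ k" by auto
      then have "k = 1" using n prime_power_iff by blast
      then show "n \<in> {p. prime p \<and> Y < p \<and> p < N}" using n pk by (auto simp: P_def)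
    qed
    then have 2: "?T = sum ?t {n\<in>S K. Y < n \<and> prime n}" by (simp add: Gsum_def)
    have "S K = {n\<in>S K. n \<le> Y} \<union> {n\<in>S K. Y < n \<and> prime n} \<union> E" by (auto simp: E_def)
    then have "Gsum (S K) ?b (chi x) = sum ?t ({n\<in>S K. n \<le> Y} \<union> {n\<in>S K. Y < n \<and> prime n} \<union> E)"
      unfolding Gsum_def by (rule arg_cong)
    also have "\<dots> = ?G Y + ?T + sum ?t E"
      unfolding 1 2 using fS[of K] by (subst sum.union_disjoint, auto simp: E_def)+
    finally have "norm (Gsum (S K) ?b (chi x) - (?G Y + ?T)) = norm (sum ?t E)" by simp
    also have "\<dots> \<le> (\<Sum>n\<in>E. lam n * real n powr (- (1 / 2 + \<delta>)))"
    proof (rule sum_norm_le)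
      fix n assume "n \<in> E"
      then have n: "n > 0" by (auto simp: E_def)
      have "cmult (chi x)" using x by (rule cmult_chi)
      then have "norm (chi x n) = 1" using n unfolding cmult_def by blast
      then show "norm (?t n) \<le> lam n * real n powr (- (1 / 2 + \<delta>))"
        using lam_nonneg[of n] norm_nat_powr_le[OF n d(2)] by (simp add: norm_mult mult_left_mono)
    qed
    also have "\<dots> \<le> real Y powr (1 / 2 + \<delta> / 2 - (1 / 2 + \<delta>)) * nonprime_const (1 / 2 + \<delta> / 2)"
      using d N fS[of K] by (intro sum_nonprime_lam_tail_le) (auto simp: E_def)
    also have "\<dots> = ?B" by (simp add: field_simps)
    finally show ?thesis .
  qed
  ultimately show ?thesis by (intro LIMSEQ_le_const2) blast+
qed

context rmodel
begin

text \<open>The parameter r = Y powr (\<delta> / 2) is chosen so that r^2 times the sum of p powr (-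
  (1 + 2 \<delta>)) over p >= Y stays bounded; the k-th moment then inherits the decay r powr (-
  k).\<close>

lemma prime_sum_moment:
  assumes d: "\<delta> > 0" "1 / 2 + \<delta> \<le> Re s" and A: "finite A" "\<And>p. p \<in> A \<Longrightarrow> prime p" "\<And>p. p \<in> A \<Longrightarrow> Y \<le> real p" and Y: "1 \<le> Y"
  shows "(\<integral>\<^sup>+\<omega>. ennreal (norm (Gsum A (\<lambda>n. of_nat n powr (-s)) (chi (\<lambda>p. X p \<omega>))) ^ k) \<partial>M)
    \<le> ennreal (2 * fact k * exp (4 * (\<Sum>n. real n powr - (1 + \<delta>))) * (Y powr (- \<delta> / 2)) ^ k)"
proof -
  let ?b = "\<lambda>n. complex_of_nat n powr (-s)" and ?S = "\<Sum>n. real n powr - (1 + \<delta>)"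
  let ?G = "\<lambda>\<omega>. Gsum A ?b (chi (\<lambda>p. X p \<omega>))"
  define r where "r = Y powr (\<delta> / 2)"
  have r: "r > 0" using Y by (simp add: r_def)
  have A0: "0 \<notin> A" using A(2)[of 0] by auto
  have D: "(\<Sum>n\<in>{n\<in>A. \<not> prime n}. lam n * norm (?b n)) \<le> 0"
    using A(2) by (intro sum_nonpos) auto
  note m = expectation_moment[OF A(1) A0 D r, of k]
  have "(\<Sum>p\<in>{n\<in>A. prime n}. hmin (2 * r * norm (?b p))) \<le> (\<Sum>p\<in>{n\<in>A. prime n}. 4 * r\<^sup>2 * real p powr - (1 + 2 * \<delta>))"
  proof (rule sum_mono)
    fix p assume "p \<in> {n\<in>A. prime n}"
    then have "p > 0" using prime_gt_0_nat by auto
    from norm_nat_powr_le[OF this d(2)] have "norm (?b p) ^ 2 \<le> (real p powr - (1 / 2 + \<delta>)) ^ 2" by (intro power_mono) auto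
    also have "\<dots> = real p powr (- (1 / 2 + \<delta>) + - (1 / 2 + \<delta>))" by (simp only: power2_eq_square powr_add)
    also have "- (1 / 2 + \<delta>) + - (1 / 2 + \<delta>) = - (1 + 2 * \<delta>)" by simp
    finally have "4 * r\<^sup>2 * norm (?b p) ^ 2 \<le> 4 * r\<^sup>2 * real p powr - (1 + 2 * \<delta>)" by (intro mult_left_mono) auto
    moreover have "hmin (2 * r * norm (?b p)) \<le> (2 * r * norm (?b p)) ^ 2" by (simp add: hmin_def)
    ultimately show "hmin (2 * r * norm (?b p)) \<le> 4 * r\<^sup>2 * real p powr - (1 + 2 * \<delta>)" by (simp add: power_mult_distrib)
  qed
  also have "\<dots> = 4 * r\<^sup>2 * (\<Sum>p\<in>{n\<in>A. prime n}. real p powr - (1 + 2 * \<delta>))" by (simp add: sum_distrib_left)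
  also have "\<dots> \<le> 4 * r\<^sup>2 * (Y powr (1 + \<delta> - (1 + 2 * \<delta>)) * ?S)"
    using A d Y by (intro mult_left_mono sum_nat_powr_tail_le) auto
  also have "\<dots> = 4 * (r\<^sup>2 * Y powr (- \<delta>)) * ?S" by simp
  also have "r\<^sup>2 * Y powr (- \<delta>) = 1" using Y by (simp add: r_def power2_eq_square powr_add[symmetric])
  finally have h: "(\<Sum>p\<in>{n\<in>A. prime n}. hmin (2 * r * norm (?b p))) \<le> 4 * ?S" by simp
  have "(\<integral>\<^sup>+\<omega>. ennreal (norm (?G \<omega>) ^ k / fact k) \<partial>M) = ennreal (expectation (\<lambda>\<omega>. norm (?G \<omega>) ^ k / fact k))"
    using m(1) by (intro nn_integral_eq_integral) auto
  also have "\<dots> \<le> ennreal (2 * (exp (2 * r * 0) / r ^ k) * exp (4 * ?S))"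
  proof (rule ennreal_leI, rule order_trans[OF m(2)])
    show "2 * (exp (2 * r * 0) / r ^ k) * exp (\<Sum>p\<in>{n\<in>A. prime n}. hmin (2 * r * norm (?b p))) \<le> 2 * (exp (2 * r * 0) / r ^ k) * exp (4 * ?S)"
      using h r by (intro mult_left_mono) auto
  qed
  also have "exp (2 * r * 0) / r ^ k = (Y powr (- \<delta> / 2)) ^ k"
  proof -
    have "Y powr (- \<delta> / 2) = inverse r" unfolding r_def by (simp add: powr_minus[symmetric])
    then show ?thesis by (simp only: mult_zero_right exp_zero power_inverse inverse_eq_divide power_divide power_one)
  qed
  finally have le: "(\<integral>\<^sup>+\<omega>. ennreal (norm (?G \<omega>) ^ k / fact k) \<partial>M) \<le> ennreal (2 * (Y powr (- \<delta> / 2)) ^ k * exp (4 * ?S))" .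
  have "(\<integral>\<^sup>+\<omega>. ennreal (norm (?G \<omega>) ^ k) \<partial>M) = (\<integral>\<^sup>+\<omega>. ennreal (fact k) * ennreal (norm (?G \<omega>) ^ k / fact k) \<partial>M)"
    by (intro nn_integral_cong) (simp add: ennreal_mult[symmetric])
  also have "\<dots> = ennreal (fact k) * (\<integral>\<^sup>+\<omega>. ennreal (norm (?G \<omega>) ^ k / fact k) \<partial>M)"
    using m(1) by (intro nn_integral_cmult) auto
  also have "\<dots> \<le> ennreal (fact k) * ennreal (2 * (Y powr (- \<delta> / 2)) ^ k * exp (4 * ?S))" by (intro mult_left_mono le) auto
  also have "\<dots> = ennreal (2 * fact k * exp (4 * ?S) * (Y powr (- \<delta> / 2)) ^ k)"
    by (subst ennreal_mult[symmetric]) (simp_all add: mult_ac)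
  finally show ?thesis .
qed

end

context rmodel
begin

definition prime_partial :: "complex \<Rightarrow> nat \<Rightarrow> 'a \<Rightarrow> complex" where
  "prime_partial s N \<omega> = (\<Sum>p<N. if prime p then X p \<omega> * of_nat p powr (-s) else 0)"

lemma prime_partial_diff:
  assumes "m \<le> N"
  shows "prime_partial s N \<omega> - prime_partial s m \<omega> = Gsum {p. prime p \<and> m \<le> p \<and> p < N} (\<lambda>n. of_nat n powr (-s)) (chi (\<lambda>p. X p \<omega>))"
proof -
  have "prime_partial s N \<omega> - prime_partial s m \<omega> = (\<Sum>p\<in>{..<N} - {..<m}. if prime p then X p \<omega> * of_nat p powr (-s) else 0)"
    unfolding prime_partial_def using assms by (subst sum_diff) auto
  also have "\<dots> = (\<Sum>p\<in>{p\<in>{..<N} - {..<m}. prime p}. X p \<omega> * of_nat p powr (-s))"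
    by (subst sum.inter_filter) auto
  also have "{p\<in>{..<N} - {..<m}. prime p} = {p. prime p \<and> m \<le> p \<and> p < N}" by auto
  finally show ?thesis by (subst Gsum_primes) (auto simp: mult.commute)
qed

lemma prime_partial_measurable: "prime_partial s N \<in> borel_measurable M"
  unfolding prime_partial_def[abs_def]
proof (intro borel_measurable_sum)
  fix p show "(\<lambda>\<omega>. if prime p then X p \<omega> * of_nat p powr (-s) else 0) \<in> borel_measurable M"
    using X_measurable[of p] by (cases "prime p") auto
qed

lemma prime_partial_moment:
  assumes "\<delta> > 0" "1 / 2 + \<delta> \<le> Re s" "1 \<le> m" "m \<le> N"
  shows "(\<integral>\<^sup>+\<omega>. ennreal (norm (prime_partial s N \<omega> - prime_partial s m \<omega>) ^ k) \<partial>M)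
    \<le> ennreal (2 * fact k * exp (4 * (\<Sum>n. real n powr - (1 + \<delta>))) * (real m powr (- \<delta> / 2)) ^ k)"
  unfolding prime_partial_diff[OF assms(4)]
  by (rule prime_sum_moment) (use assms in auto)

text \<open>Moments alone suffice. First moments of the increments are summable along powers of 2
  and give a limit \<open>Ti\<close> there. A moment of sufficiently high order k makes the expected
  k-th power of the distance to \<open>Ti\<close> O(m powr (- 2)) for every m, which is summable
  over all m and forces convergence of the full sequence.\<close>

lemma prime_partial_convergent:
  assumes d: "\<delta> > 0" "1 / 2 + \<delta> \<le> Re s"
  shows "AE \<omega> in M. convergent (\<lambda>N. prime_partial s N \<omega>)"
proof -
  let ?T = "prime_partial s"
  define C where "C = (\<lambda>k::nat. 2 * fact k * exp (4 * (\<Sum>n. real n powr - (1 + \<delta>))))"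
  have C: "C k \<ge> 0" for k by (simp add: C_def)
  note meas [measurable] = prime_partial_measurable
  have "AE \<omega> in M. summable (\<lambda>j. norm (?T (2 ^ Suc j) \<omega> - ?T (2 ^ j) \<omega>))"
  proof (rule AE_summable_of_nn_integral_le[where g = "\<lambda>j. C 1 * (2 powr (- \<delta> / 2)) ^ j"])
    fix j
    have "real (2 ^ j) powr (- \<delta> / 2) = (2 powr (- \<delta> / 2)) ^ j"
      by (simp add: powr_realpow[symmetric] powr_powr mult.commute)
    then show "(\<integral>\<^sup>+\<omega>. ennreal (norm (?T (2 ^ Suc j) \<omega> - ?T (2 ^ j) \<omega>)) \<partial>M) \<le> ennreal (C 1 * (2 powr (- \<delta> / 2)) ^ j)"
      using prime_partial_moment[OF d, of "2 ^ j" "2 ^ Suc j" 1] by (simp add: C_def)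
    have "2 powr (- \<delta> / 2) < 2 powr 0" using d by (intro powr_less_mono) auto
    then show "summable (\<lambda>j. C 1 * (2 powr (- \<delta> / 2)) ^ j)" by (intro summable_mult summable_geometric) simp
  qed (use C in auto)
  then have sub: "AE \<omega> in M. (\<lambda>j. ?T (2 ^ j) \<omega>) \<longlonglongrightarrow> lim (\<lambda>j. ?T (2 ^ j) \<omega>)"
  proof eventually_elim
    case (elim \<omega>)
    then have "summable (\<lambda>j. ?T (2 ^ Suc j) \<omega> - ?T (2 ^ j) \<omega>)" by (rule summable_norm_cancel)
    then have "convergent (\<lambda>n. \<Sum>j<n. ?T (2 ^ Suc j) \<omega> - ?T (2 ^ j) \<omega>)" by (simp only: summable_iff_convergent)
    then have "convergent (\<lambda>n. ?T (2 ^ n) \<omega> - ?T (2 ^ 0) \<omega>)" by (simp only: sum_lessThan_telescope[of "\<lambda>n. ?T (2 ^ n) \<omega>"])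
    then have "convergent (\<lambda>n. (?T (2 ^ n) \<omega> - ?T (2 ^ 0) \<omega>) + ?T (2 ^ 0) \<omega>)" by (rule convergent_add[OF _ convergent_const])
    then show ?case by (simp add: convergent_LIMSEQ_iff)
  qed
  define Ti where "Ti = (\<lambda>\<omega>. lim (\<lambda>j. ?T (2 ^ j) \<omega>))"
  have [measurable]: "Ti \<in> borel_measurable M" unfolding Ti_def by measurable
  \<comment> \<open>Ensures k \<delta> / 2 >= 2, so that the bound of
    \<open>prime_partial_moment\<close> is summable over m.\<close>
  define k where "k = nat \<lceil>4 / \<delta>\<rceil>"
  have k: "real k * \<delta> \<ge> 4" "k > 0"
  proof -
    have "4 / \<delta> \<le> real k" "0 < 4 / \<delta>" using d unfolding k_def by (auto intro: real_nat_ceiling_ge)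
    moreover from this have "0 < real k" by linarith
    ultimately show "real k * \<delta> \<ge> 4" "k > 0" using d by (simp_all add: pos_divide_le_eq)
  qed
  have mom: "(\<integral>\<^sup>+\<omega>. ennreal (norm (?T (Suc m) \<omega> - Ti \<omega>) ^ k) \<partial>M) \<le> ennreal (C k * real (Suc m) powr -2)" for m
  proof (rule nn_integral_AE_limit_le[where f = "\<lambda>j \<omega>. norm (?T (Suc m) \<omega> - ?T (2 ^ j) \<omega>) ^ k"])
    show "AE \<omega> in M. (\<lambda>j. norm (?T (Suc m) \<omega> - ?T (2 ^ j) \<omega>) ^ k) \<longlonglongrightarrow> norm (?T (Suc m) \<omega> - Ti \<omega>) ^ k"
      using sub by eventually_elim (auto intro!: tendsto_intros simp: Ti_def)
    have "(real (Suc m) powr (- \<delta> / 2)) ^ k = real (Suc m) powr (of_nat k * (- \<delta> / 2))"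
      by (rule powr_power) simp
    also have "\<dots> \<le> real (Suc m) powr -2" using k by (intro powr_mono) auto
    finally have le: "C k * (real (Suc m) powr (- \<delta> / 2)) ^ k \<le> C k * real (Suc m) powr -2" using C by (intro mult_left_mono)
    show "\<forall>\<^sub>F j in sequentially. (\<integral>\<^sup>+\<omega>. ennreal (norm (?T (Suc m) \<omega> - ?T (2 ^ j) \<omega>) ^ k) \<partial>M) \<le> ennreal (C k * real (Suc m) powr -2)"
      using eventually_ge_at_top[of "Suc m"]
    proof eventually_elim
      case (elim j)
      then have "Suc m \<le> 2 ^ j" using less_exp[of j] by linarith
      from prime_partial_moment[OF d _ this, of k]
      have "(\<integral>\<^sup>+\<omega>. ennreal (norm (?T (Suc m) \<omega> - ?T (2 ^ j) \<omega>) ^ k) \<partial>M) \<le> ennreal (C k * (real (Suc m) powr (- \<delta> / 2)) ^ k)"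
        by (simp add: C_def norm_minus_commute)
      also have "\<dots> \<le> ennreal (C k * real (Suc m) powr -2)" by (rule ennreal_leI) (rule le)
      finally show ?case .
    qed
  qed measurable
  have "AE \<omega> in M. summable (\<lambda>m. norm (?T (Suc m) \<omega> - Ti \<omega>) ^ k)"
  proof (rule AE_summable_of_nn_integral_le[OF _ _ mom])
    have "summable (\<lambda>m. real m powr -2)" by (rule summable_nat_powr) simp
    then show "summable (\<lambda>m. C k * real (Suc m) powr -2)" by (intro summable_mult) (subst summable_Suc_iff[of "\<lambda>m. real m powr -2"])
  qed (use C in auto)
  then show ?thesis
  proof eventually_elim
    case (elim \<omega>)
    then have "(\<lambda>m. norm (?T (Suc m) \<omega> - Ti \<omega>) ^ k) \<longlonglongrightarrow> 0" by (rule summable_LIMSEQ_zero)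
    then have "(\<lambda>m. root k (norm (?T (Suc m) \<omega> - Ti \<omega>) ^ k)) \<longlonglongrightarrow> root k 0" by (rule tendsto_real_root)
    then have "(\<lambda>m. ?T (Suc m) \<omega> - Ti \<omega>) \<longlonglongrightarrow> 0"
      unfolding real_root_power_cancel[OF k(2) norm_ge_zero] real_root_zero by (rule tendsto_norm_zero_cancel)
    then have "(\<lambda>m. ?T (Suc m) \<omega>) \<longlonglongrightarrow> Ti \<omega>" by (simp add: LIM_zero_iff)
    then have "(\<lambda>m. ?T m \<omega>) \<longlonglongrightarrow> Ti \<omega>" by (rule LIMSEQ_imp_Suc)
    then show ?case by (rule convergentI)
  qed
qed

definition log_euler_partial :: "complex \<Rightarrow> nat \<Rightarrow> 'a \<Rightarrow> complex" where
  "log_euler_partial s N \<omega> = - (\<Sum>p<N. if prime p then Ln (1 - X p \<omega> * of_nat p powr (-s)) else 0)"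

lemma log_euler_term_measurable:
  "(\<lambda>\<omega>. if prime p then Ln (1 - X p \<omega> * of_nat p powr (-s)) else 0) \<in> borel_measurable M"
proof (cases "prime p")
  case True
  then have [measurable]: "X p \<in> borel_measurable M" by (rule X_measurable)
  show ?thesis by measurable
qed simp

lemma log_euler_partial_measurable: "log_euler_partial s N \<in> borel_measurable M"
  unfolding log_euler_partial_def[abs_def]
  by (intro borel_measurable_uminus borel_measurable_sum log_euler_term_measurable)

lemma log_zeta_rand_measurable: "log_zeta_rand X s \<in> borel_measurable M"
  unfolding log_zeta_rand_def[abs_def]
  by (intro borel_measurable_uminus borel_measurable_suminf log_euler_term_measurable)

text \<open>The difference between the logarithm of an Euler factor and its linear term is O(p powr
  (- (1 + 2 \<delta>))), hence absolutely summable. Only the linear terms need the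
  randomness.\<close>

lemma log_euler_partial_tendsto:
  assumes d: "\<delta> > 0" "1 / 2 + \<delta> \<le> Re s"
  shows "AE \<omega> in M. (\<lambda>N. log_euler_partial s N \<omega>) \<longlonglongrightarrow> log_zeta_rand X s \<omega>"
  using prime_partial_convergent[OF d] norm_X
proof eventually_elim
  case (elim \<omega>)
  define z where "z = (\<lambda>p. if prime p then X p \<omega> * of_nat p powr (-s) else 0)"
  have sz: "summable z" using elim(1) unfolding summable_iff_convergent z_def prime_partial_def .
  have "summable (\<lambda>p. Ln (1 + - z p) - - z p)"
  proof (rule summable_comparison_test')
    show "summable (\<lambda>p. 4 * real p powr - (1 + 2 * \<delta>))" using d by (intro summable_mult summable_nat_powr) auto
    fix p :: nat
    show "norm (Ln (1 + - z p) - - z p) \<le> 4 * real p powr - (1 + 2 * \<delta>)"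
    proof (cases "prime p")
      case True
      have n: "norm (z p) \<le> real p powr - (1 / 2 + \<delta>)"
        using True elim(2) norm_nat_powr_le[OF _ d(2), of p] prime_gt_0_nat by (simp add: z_def norm_mult)
      moreover have "real p powr - (1 / 2 + \<delta>) \<le> 3 / 4" using True prime_ge_2_nat d by (intro prime_powr_less) auto
      ultimately have n34: "norm (z p) \<le> 3 / 4" by linarith
      then have "norm (Ln (1 + - z p) - - z p) \<le> norm (- z p) ^ 2 / (1 - norm (- z p))" by (intro Ln_approx_linear) simp
      also have "\<dots> \<le> norm (z p) ^ 2 / (1 / 4)" using n34 by (simp only: norm_minus_cancel) (intro divide_left_mono, auto)
      also have "\<dots> \<le> 4 * (real p powr - (1 / 2 + \<delta>)) ^ 2" using n by (simp add: power_mono)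
      also have "(real p powr - (1 / 2 + \<delta>)) ^ 2 = real p powr (- (1 / 2 + \<delta>) + - (1 / 2 + \<delta>))"
        by (simp only: power2_eq_square powr_add)
      also have "- (1 / 2 + \<delta>) + - (1 / 2 + \<delta>) = - (1 + 2 * \<delta>)" by simp
      finally show ?thesis .
    qed (simp add: z_def)
  qed
  from summable_diff[OF this sz] have "summable (\<lambda>p. Ln (1 - z p))" by simp
  also have "(\<lambda>p. Ln (1 - z p)) = (\<lambda>p. if prime p then Ln (1 - X p \<omega> * of_nat p powr (-s)) else 0)"
    by (auto simp: z_def)
  finally show ?case unfolding log_euler_partial_def log_zeta_rand_def by (intro tendsto_minus summable_LIMSEQ)
qed

end

definition rand_const :: "real \<Rightarrow> real" where
  "rand_const \<delta> = nonprime_const (1 / 2 + \<delta> / 2) + 2 * exp (4 * (\<Sum>n. real n powr - (1 + \<delta>)))"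

context rmodel
begin

text \<open>A bound in mean for finite partial products, uniform in N, that passes to the limit by
  Fatou's lemma. The primes between Y and N are controlled by their first moment.\<close>

lemma log_zeta_rand_approx:
  assumes d: "\<delta> > 0" "1 / 2 + \<delta> \<le> Re s" and Y: "1 \<le> Y"
  shows "(\<integral>\<^sup>+\<omega>. ennreal (norm (log_zeta_rand X s \<omega> - Gsum {2..Y} (\<lambda>n. of_nat n powr (-s)) (chi (\<lambda>p. X p \<omega>)))) \<partial>M)
    \<le> ennreal (rand_const \<delta> * real Y powr (- \<delta> / 2))"
proof -
  let ?G = "\<lambda>A \<omega>. Gsum A (\<lambda>n. of_nat n powr (-s)) (chi (\<lambda>p. X p \<omega>))" and ?q = "real Y powr (- \<delta> / 2)"
  define P where "P = (\<lambda>N. {p. prime p \<and> Y < p \<and> p < N})"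
  note meas [measurable] = log_euler_partial_measurable Gsum_measurable
  show ?thesis
  proof (rule nn_integral_AE_limit_le[where f = "\<lambda>N \<omega>. norm (log_euler_partial s N \<omega> - ?G {2..Y} \<omega>)"])
    show "AE \<omega> in M. (\<lambda>N. norm (log_euler_partial s N \<omega> - ?G {2..Y} \<omega>)) \<longlonglongrightarrow> norm (log_zeta_rand X s \<omega> - ?G {2..Y} \<omega>)"
      using log_euler_partial_tendsto[OF d] by eventually_elim (intro tendsto_intros)
    show "\<forall>\<^sub>F N in sequentially. (\<integral>\<^sup>+\<omega>. ennreal (norm (log_euler_partial s N \<omega> - ?G {2..Y} \<omega>)) \<partial>M) \<le> ennreal (rand_const \<delta> * ?q)"
      using eventually_gt_at_top[of Y]
    proof eventually_elim
      case (elim N)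
      have "(\<integral>\<^sup>+\<omega>. ennreal (norm (log_euler_partial s N \<omega> - ?G {2..Y} \<omega>)) \<partial>M)
          \<le> (\<integral>\<^sup>+\<omega>. ennreal (nonprime_const (1 / 2 + \<delta> / 2) * ?q) + ennreal (norm (?G (P N) \<omega>)) \<partial>M)"
        using norm_X
      proof (intro nn_integral_mono_AE, eventually_elim)
        case (elim \<omega>)
        have "norm (log_euler_partial s N \<omega> - (?G {2..Y} \<omega> + ?G (P N) \<omega>)) \<le> nonprime_const (1 / 2 + \<delta> / 2) * ?q"
          unfolding log_euler_partial_def P_def using elim d Y \<open>Y < N\<close> by (intro euler_partial_log_approx) auto
        moreover have "norm (log_euler_partial s N \<omega> - ?G {2..Y} \<omega>)
            \<le> norm (log_euler_partial s N \<omega> - (?G {2..Y} \<omega> + ?G (P N) \<omega>)) + norm (?G (P N) \<omega>)"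
          by (rule order_trans[OF _ norm_triangle_ineq]) (simp add: algebra_simps)
        ultimately show ?case using d by (subst ennreal_plus[symmetric]) (auto intro!: ennreal_leI mult_nonneg_nonneg nonprime_const_nonneg)
      qed
      also have "\<dots> = ennreal (nonprime_const (1 / 2 + \<delta> / 2) * ?q) + (\<integral>\<^sup>+\<omega>. ennreal (norm (?G (P N) \<omega>) ^ 1) \<partial>M)"
        by (subst nn_integral_add) (auto simp: emeasure_space_1)
      also have "\<dots> \<le> ennreal (nonprime_const (1 / 2 + \<delta> / 2) * ?q) + ennreal (2 * fact 1 * exp (4 * (\<Sum>n. real n powr - (1 + \<delta>))) * ?q ^ 1)"
        using d Y by (intro add_left_mono prime_sum_moment) (auto simp: P_def)
      also have "\<dots> = ennreal (rand_const \<delta> * ?q)"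
        using d by (subst ennreal_plus[symmetric]) (auto simp: rand_const_def algebra_simps intro!: mult_nonneg_nonneg nonprime_const_nonneg)
      finally show ?case .
    qed
  qed measurable
qed

end

section \<open>Comparison of the characteristic functions\<close>

text \<open>Telescoping, where only the \<open>u i\<close> have norm at most 1. The
  \<open>v i\<close> may be as large as 1 + d i, which is why the error bound is a product and not a
  sum.\<close>

lemma norm_prod_diff_le:
  fixes u v :: "nat \<Rightarrow> complex"
  assumes "\<And>i. i < N \<Longrightarrow> norm (u i) \<le> 1" "\<And>i. i < N \<Longrightarrow> norm (u i - v i) \<le> d i"
  shows "norm ((\<Prod>i<N. u i) - (\<Prod>i<N. v i)) \<le> (\<Prod>i<N. 1 + d i) - 1"
  using assms
proof (induction N)
  case (Suc N)
  let ?U = "\<Prod>i<N. u i" and ?V = "\<Prod>i<N. v i" and ?D = "\<Prod>i<N. 1 + d i"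
  have IH: "norm (?U - ?V) \<le> ?D - 1" using Suc by simp
  have d: "norm (u N - v N) \<le> d N" "norm (u N) \<le> 1" using Suc.prems by auto
  have U: "norm ?U \<le> 1" unfolding prod_norm[symmetric] using Suc.prems by (intro prod_le_1) auto
  have v: "norm (v N) \<le> 1 + d N" using norm_triangle_ineq4[of "u N" "u N - v N"] d by simp
  have "?U * u N - ?V * v N = ?U * (u N - v N) + (?U - ?V) * v N" by (simp add: algebra_simps)
  then have "norm (?U * u N - ?V * v N) \<le> norm ?U * norm (u N - v N) + norm (?U - ?V) * norm (v N)"
    using norm_triangle_ineq[of "?U * (u N - v N)" "(?U - ?V) * v N"] by (simp add: norm_mult)
  also have "\<dots> \<le> 1 * d N + (?D - 1) * (1 + d N)"
    using U d v IH order_trans[OF norm_ge_zero IH] by (intro add_mono mult_mono) auto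
  finally show ?case by (simp add: algebra_simps)
qed simp

text \<open>On the imaginary axis the Taylor remainder has no exponential factor. As the degrees are
  even, the bound is polynomial in the x i without absolute values, so the truncation error itself
  has a majorant that can be transferred between the line and the model.\<close>

lemma trunc_exp_prod_approx:
  fixes x :: "nat \<Rightarrow> real"
  assumes k: "\<And>i. i < N \<Longrightarrow> even (k i) \<and> k i > 0"
  shows "norm (cis (\<Sum>i<N. x i) - (\<Prod>i<N. \<Sum>j<k i. (\<i> * of_real (x i)) ^ j / fact j))
    \<le> (\<Prod>i<N. 1 + x i ^ k i / fact (k i)) - 1"
proof -
  have "cis (\<Sum>i<N. x i) = (\<Prod>i<N. cis (x i))"
    by (induction N) (auto simp: cis_mult[symmetric])
  moreover have "norm (cis (x i) - (\<Sum>j<k i. (\<i> * of_real (x i)) ^ j / fact j)) \<le> x i ^ k i / fact (k i)" if i: "i < N" for i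
  proof -
    obtain m where m: "k i = Suc m" using k[OF i] gr0_implies_Suc by blast
    have "norm (iexp (x i) - (\<Sum>j\<le>m. (\<i> * of_real (x i)) ^ j / fact j)) \<le> \<bar>x i\<bar> ^ Suc m / fact (Suc m)"
      by (rule iexp_approx1)
    then show ?thesis using k[OF i] unfolding m cis_conv_exp lessThan_Suc_atMost by (simp only: power_even_abs)
  qed
  ultimately show ?thesis by (simp only:) (intro norm_prod_diff_le, auto)
qed

lemma hmin_mono: "0 \<le> x \<Longrightarrow> x \<le> y \<Longrightarrow> hmin x \<le> hmin y"
  unfolding hmin_def by (intro min.mono power_mono) auto

text \<open>Shrinking the coefficients by a factor a <= 1 shrinks the bound by at least a, also in
  the linear range. This makes the moment of block 0 proportional to \<open>c1\<close>.\<close>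

lemma hmin_mult_le: "0 \<le> a \<Longrightarrow> a \<le> 1 \<Longrightarrow> 0 \<le> x \<Longrightarrow> hmin (a * x) \<le> a * hmin x"
proof -
  assume a: "0 \<le> a" "a \<le> 1" "0 \<le> x"
  have "a\<^sup>2 \<le> a" using a by (simp add: power2_eq_square mult_left_le)
  then have "(a * x)\<^sup>2 \<le> a * x\<^sup>2" by (simp add: power_mult_distrib mult_right_mono)
  then show ?thesis using a unfolding hmin_def min_mult_distrib_left by auto
qed

lemma hmin_powr: "L > 0 \<Longrightarrow> p > 0 \<Longrightarrow> hmin (L powr \<sigma> * real p powr (-\<sigma>)) = prime_wt \<sigma> L p"
proof -
  assume "L > 0" "p > 0"
  then have "L powr \<sigma> * real p powr (-\<sigma>) = (L / real p) powr \<sigma>" by (simp add: powr_divide powr_minus_divide)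
  then show ?thesis unfolding hmin_def prime_wt_def by (simp add: power2_eq_square powr_add[symmetric])
qed

context scales
begin

text \<open>Here \<open>exp 1\<close> is the parameter \<open>r\<close> of the exponential moment: the gain \<open>exp (- kk 0)\<close> beats
  the moment, whose logarithm is \<open>O(c\<^sub>1 K)\<close>.\<close>

lemma zero_block_moment:
  assumes c1: "0 \<le> c1" "2 * exp 1 * c1 \<le> 1" "2 * exp 1 * c1 * (nonprime_const \<sigma> + CP) \<le> c"
    and CP: "\<And>A. finite A \<Longrightarrow> (\<And>p. p \<in> A \<Longrightarrow> prime p) \<Longrightarrow> (\<Sum>p\<in>A. prime_wt \<sigma> L p) \<le> CP * K"
    and b: "\<And>n. n \<ge> 1 \<Longrightarrow> norm (b n) \<le> 2 * c1 * L powr \<sigma> * real n powr (-\<sigma>)"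
    and LK: "L powr \<sigma> \<le> K"
  shows "2 * (exp (exp 1 * (\<Sum>n\<in>{n\<in>blk 0. \<not> prime n}. lam n * norm (b n))) / exp 1 ^ kk 0)
      * exp (\<Sum>p\<in>{n\<in>blk 0. prime n}. hmin (exp 1 * norm (b p))) \<le> 2 * exp (- c * K)"
proof -
  define a where "a = 2 * exp 1 * c1"
  have a: "0 \<le> a" "a \<le> 1" "a * (nonprime_const \<sigma> + CP) \<le> c" using c1 by (auto simp: a_def)
  have fin: "finite {n\<in>blk 0. \<not> prime n}" "finite {n\<in>blk 0. prime n}" using blk_subset(2)[of 0] by auto
  have b': "exp 1 * norm (b n) \<le> a * (L powr \<sigma> * real n powr (-\<sigma>))" if "n \<in> blk 0" for n
    using b[of n] that blk_subset(1)[of 0] mult_left_mono[OF b[of n], of "exp 1"] by (auto simp: a_def mult_ac)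
  have "exp 1 * (\<Sum>n\<in>{n\<in>blk 0. \<not> prime n}. lam n * norm (b n)) = (\<Sum>n\<in>{n\<in>blk 0. \<not> prime n}. lam n * (exp 1 * norm (b n)))"
    by (simp add: sum_distrib_left mult_ac)
  also have "\<dots> \<le> (\<Sum>n\<in>{n\<in>blk 0. \<not> prime n}. lam n * (a * (L powr \<sigma> * real n powr (-\<sigma>))))"
    using b' by (intro sum_mono mult_left_mono lam_nonneg) auto
  also have "\<dots> = a * L powr \<sigma> * (\<Sum>n\<in>{n\<in>blk 0. \<not> prime n}. lam n * real n powr (-\<sigma>))"
    by (simp add: sum_distrib_left mult_ac)
  also have "\<dots> \<le> a * K * nonprime_const \<sigma>"
    using \<sigma> a LK fin L by (intro mult_mono mult_nonneg_nonneg sum_nonprime_lam_le sum_nonneg lam_nonneg) auto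
  finally have 1: "exp 1 * (\<Sum>n\<in>{n\<in>blk 0. \<not> prime n}. lam n * norm (b n)) \<le> a * K * nonprime_const \<sigma>" .
  have "(\<Sum>p\<in>{n\<in>blk 0. prime n}. hmin (exp 1 * norm (b p))) \<le> (\<Sum>p\<in>{n\<in>blk 0. prime n}. a * prime_wt \<sigma> L p)"
  proof (rule sum_mono)
    fix p assume p: "p \<in> {n\<in>blk 0. prime n}"
    then have "p > 0" using prime_gt_0_nat by auto
    have "hmin (exp 1 * norm (b p)) \<le> hmin (a * (L powr \<sigma> * real p powr (-\<sigma>)))" using b' p by (intro hmin_mono) auto
    also have "\<dots> \<le> a * hmin (L powr \<sigma> * real p powr (-\<sigma>))" using a by (intro hmin_mult_le) auto
    finally show "hmin (exp 1 * norm (b p)) \<le> a * prime_wt \<sigma> L p" unfolding hmin_powr[OF L(1) \<open>p > 0\<close>] .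
  qed
  also have "\<dots> = a * (\<Sum>p\<in>{n\<in>blk 0. prime n}. prime_wt \<sigma> L p)" by (simp add: sum_distrib_left)
  also have "\<dots> \<le> a * (CP * K)" using a fin by (intro mult_left_mono CP) auto
  finally have 2: "(\<Sum>p\<in>{n\<in>blk 0. prime n}. hmin (exp 1 * norm (b p))) \<le> a * (CP * K)" .
  have "a * K * nonprime_const \<sigma> + a * (CP * K) = (a * (nonprime_const \<sigma> + CP)) * K" by (simp add: algebra_simps)
  also have "\<dots> \<le> c * K" using a L by (intro mult_right_mono) auto
  finally have 3: "a * K * nonprime_const \<sigma> + a * (CP * K) \<le> c * K" .
  have "exp 1 ^ kk 0 = exp (real (kk 0))" by (simp add: exp_of_nat_mult[symmetric])
  then have "2 * (exp (exp 1 * (\<Sum>n\<in>{n\<in>blk 0. \<not> prime n}. lam n * norm (b n))) / exp 1 ^ kk 0)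
      * exp (\<Sum>p\<in>{n\<in>blk 0. prime n}. hmin (exp 1 * norm (b p)))
    = 2 * exp (exp 1 * (\<Sum>n\<in>{n\<in>blk 0. \<not> prime n}. lam n * norm (b n)) - real (kk 0) + (\<Sum>p\<in>{n\<in>blk 0. prime n}. hmin (exp 1 * norm (b p))))"
    by (simp only: exp_add exp_diff)
  also have "\<dots> \<le> 2 * exp (- c * K)"
    using 1 2 3 kk_ge0 by (intro mult_left_mono) auto
  finally show ?thesis .
qed

text \<open>Beyond block 0 the coefficients may be bounded crudely with a factor L = exp l in place
  of L powr \<sigma>: it only raises exp (10 l 2^i) to at most exp (11 l 2^i), which
  \<open>block_sums_le\<close> admits.\<close>

lemma later_block_moment:
  assumes i: "1 \<le> i" and b: "\<And>n. n \<ge> 1 \<Longrightarrow> norm (b n) \<le> L * real n powr (-\<sigma>)"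
  shows "2 * (exp (rr i * (\<Sum>n\<in>{n\<in>blk i. \<not> prime n}. lam n * norm (b n))) / rr i ^ kk i)
      * exp (\<Sum>p\<in>{n\<in>blk i. prime n}. hmin (rr i * norm (b p))) \<le> 2 * exp (2 * C3) * exp (- 20 * c * K)"
proof -
  define R where "R = rr i * L"
  have R: "0 \<le> R" "R \<le> 2 * exp (11 * l * 2 ^ i)"
  proof -
    show "0 \<le> R" using L by (simp add: R_def rr_def)
    have "R = exp (10 * l * 2 ^ i + l)" unfolding R_def rr_def exp_add L(3) ..
    also have "\<dots> \<le> exp (11 * l * 2 ^ i)" using l1 mult_left_mono[of 1 "2 ^ i" l] by simp
    also have "\<dots> \<le> 2 * exp (11 * l * 2 ^ i)" by simp
    finally show "R \<le> 2 * exp (11 * l * 2 ^ i)" .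
  qed
  have rr: "rr i > 0" by (simp add: rr_def)
  have b': "rr i * norm (b n) \<le> R * real n powr (- (1 / 2 + \<delta> / 2))" if "n \<in> blk i" for n
  proof -
    have n: "n \<ge> 1" using that blk_subset(1)[of i] by auto
    have "norm (b n) \<le> L * real n powr (-\<sigma>)" by (rule b[OF n])
    also have "\<dots> \<le> L * real n powr (- (1 / 2 + \<delta> / 2))"
    proof (intro mult_left_mono powr_mono)
      show "- \<sigma> \<le> - (1 / 2 + \<delta> / 2)" using \<sigma> unfolding \<delta>_def by (simp add: field_simps)
    qed (use n L in auto)
    finally show ?thesis using rr by (simp add: R_def mult.assoc)
  qed
  have "rr i * (\<Sum>n\<in>{n\<in>blk i. \<not> prime n}. lam n * norm (b n)) = (\<Sum>n\<in>{n\<in>blk i. \<not> prime n}. lam n * (rr i * norm (b n)))"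
    by (simp add: sum_distrib_left mult_ac)
  also have "\<dots> \<le> (\<Sum>n\<in>{n\<in>blk i. \<not> prime n}. lam n * (R * real n powr (- (1 / 2 + \<delta> / 2))))"
    using b' by (intro sum_mono mult_left_mono lam_nonneg) auto
  also have "\<dots> = R * (\<Sum>n\<in>{n\<in>blk i. \<not> prime n}. lam n * real n powr (- (1 / 2 + \<delta> / 2)))"
    by (simp add: sum_distrib_left mult_ac)
  also have "\<dots> \<le> C3" by (rule block_sums_le[OF i R])
  finally have 1: "rr i * (\<Sum>n\<in>{n\<in>blk i. \<not> prime n}. lam n * norm (b n)) \<le> C3" .
  have "(\<Sum>p\<in>{n\<in>blk i. prime n}. hmin (rr i * norm (b p))) \<le> (\<Sum>p\<in>{n\<in>blk i. prime n}. hmin (R * real p powr (- (1 / 2 + \<delta> / 2))))"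
    using b' rr by (intro sum_mono hmin_mono) auto
  also have "\<dots> \<le> C3" by (rule block_sums_le[OF i R])
  finally have 2: "(\<Sum>p\<in>{n\<in>blk i. prime n}. hmin (rr i * norm (b p))) \<le> C3" .
  have "2 * (exp (rr i * (\<Sum>n\<in>{n\<in>blk i. \<not> prime n}. lam n * norm (b n))) / rr i ^ kk i)
      * exp (\<Sum>p\<in>{n\<in>blk i. prime n}. hmin (rr i * norm (b p)))
    = 2 * exp (rr i * (\<Sum>n\<in>{n\<in>blk i. \<not> prime n}. lam n * norm (b n)))
      * exp (\<Sum>p\<in>{n\<in>blk i. prime n}. hmin (rr i * norm (b p))) * (1 / rr i ^ kk i)" by simp
  also have "\<dots> \<le> 2 * exp C3 * exp C3 * exp (- 20 * c * K)"
    using 1 2 rr_pow[OF i] rr by (intro mult_mono) auto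
  also have "\<dots> = 2 * exp (2 * C3) * exp (- 20 * c * K)" by (simp add: exp_add[symmetric])
  finally show ?thesis .
qed

lemma Gsum_blocks: "Gsum {2..Yb I} b h = (\<Sum>i<Suc I. Gsum (blk i) b h)"
proof -
  have "{2..Yb I} = (\<Union>i<Suc I. blk i)"
    unfolding blk_Union using Yb(1,2)[of I] by (auto simp: less_Suc_eq_le)
  then show ?thesis
    unfolding Gsum_def using blk_subset(2) blk_disjoint[of "{..<Suc I}"]
    by (simp only:) (subst sum.UNION_disjoint, auto simp: disjoint_family_on_def simp del: lessThan_Suc)
qed

text \<open>Used to bound the coefficient sums of the truncated block exponentials by squares of
  their lengths.\<close>

lemma Yr_ge_L: "1 + L * Yr i \<le> Yr i ^ 2"
proof -
  have "L + 1 \<le> L * L"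
  proof -
    have "exp 1 \<le> L" using l1 unfolding L(3)[symmetric] by simp
    then have "2 \<le> L" using exp_ge_add_one_self[of 1] by linarith
    then have "2 * L \<le> L * L" by (intro mult_right_mono) auto
    then show ?thesis using \<open>2 \<le> L\<close> by linarith
  qed
  also have "\<dots> = exp (2 * l)" unfolding L(3)[symmetric] exp_add[symmetric] by simp
  also have "\<dots> \<le> Yr i"
  proof -
    have "2 * l \<le> A * l" using A l1 by (intro mult_right_mono) auto
    also have "\<dots> \<le> A * l * 2 ^ i" using A l1 mult_left_mono[of 1 "2 ^ i" "A * l"] by simp
    finally show ?thesis by (simp add: Yr_def)
  qed
  finally have "(L + 1) * Yr i \<le> Yr i * Yr i" using Yr_ge(2)[of i] by (intro mult_right_mono) auto
  moreover have "1 \<le> Yr i" using Yr_ge(1)[of i] by linarith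
  ultimately show ?thesis by (simp add: power2_eq_square algebra_simps)
qed

end

context scales
begin

text \<open>The expected majorant exceeds 1 by O(exp (- c K)) only. Block 0 supplies this rate; the
  later blocks have rate 20 c, of which a part absorbs their number. The product of the 1 + z i is
  linearised, which is legitimate as the z i add up to at most 1.\<close>

lemma block_moments:
  assumes rm: "random_model M Xr"
    and c1: "0 \<le> c1" "2 * exp 1 * c1 \<le> 1" "2 * exp 1 * c1 * (nonprime_const \<sigma> + CP) \<le> c"
    and CP: "\<And>A. finite A \<Longrightarrow> (\<And>p. p \<in> A \<Longrightarrow> prime p) \<Longrightarrow> (\<Sum>p\<in>A. prime_wt \<sigma> L p) \<le> CP * K"
    and b: "\<And>n. n \<ge> 1 \<Longrightarrow> norm (b n) \<le> 2 * c1 * L powr \<sigma> * real n powr (-\<sigma>)"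
    and LK: "L powr \<sigma> \<le> K" and bL: "2 * c1 * L powr \<sigma> \<le> L"
    and small: "(2 + exp (2 * C3)) * exp (- c * K) \<le> 1"
  shows "(LINT \<omega>|M. (\<Prod>i<Suc I. 1 + Re (Gsum (blk i) b (chi (\<lambda>p. Xr p \<omega>))) ^ kk i / fact (kk i)))
    \<le> 1 + 2 * (2 + exp (2 * C3)) * exp (- c * K)"
proof -
  interpret R: rmodel M Xr by unfold_locales (rule rm)
  define D where "D = (\<lambda>i. \<Sum>n\<in>{n\<in>blk i. \<not> prime n}. lam n * norm (b n))"
  define r where "r = (\<lambda>i. if i = 0 then exp 1 else rr i)"
  define z where "z = (\<lambda>i. 2 * (exp (r i * D i) / r i ^ kk i) * exp (\<Sum>p\<in>{n\<in>blk i. prime n}. hmin (r i * norm (b p))))"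
  have zs: "(\<Sum>i<Suc I. z i) \<le> (2 + exp (2 * C3)) * exp (- c * K)"
  proof -
    have "z 0 \<le> 2 * exp (- c * K)"
      using zero_block_moment[OF c1 CP b LK] by (simp add: z_def r_def D_def)
    moreover have "z (Suc i) \<le> 2 * exp (2 * C3) * exp (- 20 * c * K)" for i
    proof -
      have "norm (b n) \<le> L * real n powr (-\<sigma>)" if "n \<ge> 1" for n
        using b[OF that] mult_right_mono[OF bL, of "real n powr (-\<sigma>)"] by simp
      from later_block_moment[of "Suc i", OF _ this] show ?thesis by (simp add: z_def r_def D_def)
    qed
    then have "(\<Sum>i<I. z (Suc i)) \<le> (\<Sum>i<I. 2 * exp (2 * C3) * exp (- 20 * c * K))" by (intro sum_mono)
    moreover have "(\<Sum>i<I. 2 * exp (2 * C3) * exp (- 20 * c * K)) \<le> exp (2 * C3) * exp (- c * K)"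
    proof -
      have p: "0 < c * K" using c L by simp
      have "real I * 2 \<le> real (Suc I) * (2 * exp 4)" by (intro mult_mono) auto
      also have "\<dots> \<le> exp (c * K)" by (rule N_le)
      finally have "(real I * 2) * (exp (2 * C3) * exp (- 20 * c * K)) \<le> exp (c * K) * (exp (2 * C3) * exp (- 20 * c * K))"
        by (intro mult_right_mono) auto
      also have "\<dots> = exp (2 * C3) * exp (- 19 * (c * K))" by (simp add: exp_add[symmetric])
      also have "\<dots> \<le> exp (2 * C3) * exp (- c * K)" using p by (intro mult_left_mono) (auto simp: mult.commute[of K])
      finally show ?thesis by simp
    qed
    ultimately have "z 0 + (\<Sum>i<I. z (Suc i)) \<le> 2 * exp (- c * K) + exp (2 * C3) * exp (- c * K)" by linarith
    then show ?thesis unfolding sum.lessThan_Suc_shift by (simp only: distrib_right)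
  qed
  have "(LINT \<omega>|M. (\<Prod>i<Suc I. 1 + Re (Gsum (blk i) b (chi (\<lambda>p. Xr p \<omega>))) ^ kk i / fact (kk i)))
     = (LINT \<omega>|M. (\<Prod>i<Suc I. 1 + \<bar>Re (Gsum (blk i) b (chi (\<lambda>p. Xr p \<omega>)))\<bar> ^ kk i / fact (kk i)))"
    by (simp only: power_even_abs[OF kk_even])
  also have "\<dots> \<le> (\<Prod>i<Suc I. 1 + z i)"
    unfolding z_def
  proof (rule R.expectation_prod_moments)
    fix i show "0 < r i" by (simp add: r_def rr_def)
    show "(\<Sum>n\<in>{n\<in>blk i. \<not> prime n}. lam n * norm (b n)) \<le> D i" by (simp add: D_def)
  qed (use blk_subset blk_disjoint in auto)
  also have "\<dots> \<le> 1 + 2 * (\<Sum>i<Suc I. z i)"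
  proof -
    have z0: "0 \<le> z i" for i unfolding z_def by (intro mult_nonneg_nonneg divide_nonneg_nonneg) (auto simp: r_def rr_def)
    then have n: "norm (complex_of_real (z i)) = z i" for i by simp
    have "(\<Sum>i<Suc I. norm (complex_of_real (z i))) \<le> 1" unfolding n using small zs by linarith
    from norm_prod_sub_1_le[OF this]
    have "norm ((\<Prod>i<Suc I. 1 + complex_of_real (z i)) - 1) \<le> 2 * (\<Sum>i<Suc I. z i)" unfolding n .
    moreover have "(\<Prod>i<Suc I. 1 + complex_of_real (z i)) - 1 = of_real ((\<Prod>i<Suc I. 1 + z i) - 1)" by simp
    ultimately have "\<bar>(\<Prod>i<Suc I. 1 + z i) - 1\<bar> \<le> 2 * (\<Sum>i<Suc I. z i)" by (simp only: norm_of_real)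
    then show ?thesis by linarith
  qed
  also have "\<dots> \<le> 1 + 2 * (2 + exp (2 * C3)) * exp (- c * K)" using zs by linarith
  finally show ?thesis .
qed

lemma trunc_prod_tpoly:
  assumes b: "\<And>n. n \<ge> 1 \<Longrightarrow> norm (b n) \<le> L"
  shows "tpoly X (X\<^sup>2) (\<lambda>h. \<Prod>i<Suc I. \<Sum>j<kk i. (\<i> * of_real (Re (Gsum (blk i) b h))) ^ j / fact j)"
    "tpoly X (X\<^sup>2) (\<lambda>h. \<Prod>i<Suc I. 1 + of_real (Re (Gsum (blk i) b h)) ^ kk i / fact (kk i))"
proof -
  have g: "tpoly (Yr i) (L * Yr i) (\<lambda>h. of_real (Re (Gsum (blk i) b h)))" for i
    using b blk_subset(1)[of i] L by (intro tpoly_Re tpoly_Gsum_blk) auto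
  have Y1: "1 \<le> Yr i" for i using Yr_ge(1)[of i] by linarith
  have B: "(1 + L * Yr i) ^ kk i \<le> (Yr i ^ kk i)\<^sup>2" for i
  proof -
    have "(1 + L * Yr i) ^ kk i \<le> (Yr i ^ 2) ^ kk i" using L Y1[of i] by (intro power_mono Yr_ge_L) auto
    then show ?thesis by (simp add: power_mult[symmetric] mult.commute)
  qed
  have XX: "X\<^sup>2 = (\<Prod>i<Suc I. (Yr i ^ kk i)\<^sup>2)" unfolding X_def by (rule prod_power_distrib)
  have "tpoly (Yr i ^ kk i) ((Yr i ^ kk i)\<^sup>2) (\<lambda>h. \<Sum>j<kk i. (\<i> * of_real (Re (Gsum (blk i) b h))) ^ j / fact j)" for i
    using tpoly_trunc_exp[OF tpoly_cmult[OF g[of i], of \<i>] Y1, of "kk i"] by (rule tpoly_mono) (use B[of i] in auto)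
  then show "tpoly X (X\<^sup>2) (\<lambda>h. \<Prod>i<Suc I. \<Sum>j<kk i. (\<i> * of_real (Re (Gsum (blk i) b h))) ^ j / fact j)"
    unfolding XX unfolding X_def by (intro tpoly_prod) auto
  have "tpoly (Yr i ^ kk i) ((Yr i ^ kk i)\<^sup>2) (\<lambda>h. 1 + (1 / fact (kk i)) * of_real (Re (Gsum (blk i) b h)) ^ kk i)" for i
  proof (rule tpoly_mono[OF tpoly_add[OF tpoly_const tpoly_cmult[OF tpoly_power[OF g]]]])
    show "1 \<le> Yr i ^ kk i" using Y1 by (rule one_le_power)
    have a: "0 \<le> L * Yr i" using L Y1[of i] by simp
    have "norm (1 / fact (kk i) :: complex) * (L * Yr i) ^ kk i \<le> 1 * (L * Yr i) ^ kk i"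
      using a by (intro mult_right_mono) (auto simp: norm_divide fact_ge_1)
    moreover have "1 + (L * Yr i) ^ kk i \<le> (1 + L * Yr i) ^ kk i"
          proof -
      obtain m where m: "kk i = Suc m" using kk_pos[of i] gr0_implies_Suc by blast
      have "1 * 1 + L * Yr i * (L * Yr i) ^ m \<le> 1 * (1 + L * Yr i) ^ m + L * Yr i * (1 + L * Yr i) ^ m"
        using a by (intro add_mono mult_left_mono power_mono one_le_power) auto
      then show ?thesis unfolding m by (simp add: algebra_simps)
    qed
    ultimately show "norm (1::complex) + norm (1 / fact (kk i) :: complex) * (L * Yr i) ^ kk i \<le> (Yr i ^ kk i)\<^sup>2"
      using B[of i] by simp
  qed auto
  then have "tpoly (Yr i ^ kk i) ((Yr i ^ kk i)\<^sup>2) (\<lambda>h. 1 + of_real (Re (Gsum (blk i) b h)) ^ kk i / fact (kk i))" for i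
    by simp
  then show "tpoly X (X\<^sup>2) (\<lambda>h. \<Prod>i<Suc I. 1 + of_real (Re (Gsum (blk i) b h)) ^ kk i / fact (kk i))"
    unfolding XX unfolding X_def by (intro tpoly_prod) auto
qed

lemma X_cube_le: "X ^ 3 \<le> T * exp (- (K / 2))"
proof -
  have "X ^ 3 \<le> (T powr \<epsilon>) ^ 3" using X_le by (intro power_mono) auto
  also have "\<dots> = exp (3 * \<epsilon> * L)" using T4 by (simp add: powr_def exp_of_nat_mult[symmetric] L_def)
  also have "\<dots> \<le> exp (L + - (K / 2))"
  proof -
    have "3 * \<epsilon> * L \<le> 1 / 2 * L" using \<epsilon> L by (intro mult_right_mono) auto
    then have "3 * \<epsilon> * L \<le> L + - (K / 2)" using L(6) by linarith
    then show ?thesis by simp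
  qed
  also have "\<dots> = T * exp (- (K / 2))" unfolding exp_add L(4) ..
  finally show ?thesis .
qed

text \<open>\<open>W\<close> is the oscillating exponential, \<open>F\<close> its truncation, and |W
  - F| <= D - 1 pointwise, on the line and in the model alike. \<open>F\<close> and \<open>D\<close>
  are trigonometric polynomials of length X and coefficient sum X^2, so \<open>F\<close> transfers
  with error O(X^3), and the mean of D - 1 on the line is read off from its expectation.\<close>

lemma char_fun_blocks_close:
  assumes rm: "random_model M Xr"
    and c1: "0 \<le> c1" "2 * exp 1 * c1 \<le> 1" "2 * exp 1 * c1 * (nonprime_const \<sigma> + CP) \<le> c"
    and CP: "\<And>A. finite A \<Longrightarrow> (\<And>p. p \<in> A \<Longrightarrow> prime p) \<Longrightarrow> (\<Sum>p\<in>A. prime_wt \<sigma> L p) \<le> CP * K"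
    and b: "\<And>n. n \<ge> 1 \<Longrightarrow> norm (b n) \<le> 2 * c1 * L powr \<sigma> * real n powr (-\<sigma>)"
    and LK: "L powr \<sigma> \<le> K" and bL: "2 * c1 * L powr \<sigma> \<le> L"
    and small: "(2 + exp (2 * C3)) * exp (- c * K) \<le> 1"
  shows "norm (integral {T..2*T} (\<lambda>t. cis (Re (Gsum {2..Yb I} b (nit t))))
      - of_real T * (LINT \<omega>|M. cis (Re (Gsum {2..Yb I} b (chi (\<lambda>p. Xr p \<omega>))))))
    \<le> T * (4 * (2 + exp (2 * C3)) * exp (- c * K) + 4 * exp (- (K / 2)))"
proof -
  interpret R: rmodel M Xr by unfold_locales (rule rm)
  define g where "g = (\<lambda>h i. Re (Gsum (blk i) b h))"
  define F where "F = (\<lambda>h. \<Prod>i<Suc I. \<Sum>j<kk i. (\<i> * of_real (g h i)) ^ j / fact j)"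
  define D where "D = (\<lambda>h. \<Prod>i<Suc I. 1 + complex_of_real (g h i) ^ kk i / fact (kk i))"
  define W where "W = (\<lambda>h. cis (Re (Gsum {2..Yb I} b h)))"
  define x where "x = (\<lambda>\<omega>. chi (\<lambda>p. Xr p \<omega>))"
  have bL': "norm (b n) \<le> L" if "n \<ge> 1" for n
  proof -
    have "real n powr (-\<sigma>) \<le> real n powr 0" using that \<sigma> by (intro powr_mono) auto
    then have "2 * c1 * L powr \<sigma> * real n powr (-\<sigma>) \<le> L * 1" using bL that L by (intro mult_mono) auto
    then show ?thesis using b[OF that] by linarith
  qed
  have tp: "tpoly X (X\<^sup>2) F" "tpoly X (X\<^sup>2) D"
    unfolding F_def D_def g_def by (rule trunc_prod_tpoly, erule bL')+
  have gm [measurable]: "(\<lambda>\<omega>. g (x \<omega>) i) \<in> borel_measurable M" for i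
    unfolding g_def x_def using R.Gsum_measurable by measurable
  have Fm [measurable]: "(\<lambda>\<omega>. F (x \<omega>)) \<in> borel_measurable M" unfolding F_def by measurable
  have Dm [measurable]: "(\<lambda>\<omega>. D (x \<omega>)) \<in> borel_measurable M" unfolding D_def by measurable
  have Wm [measurable]: "(\<lambda>\<omega>. W (x \<omega>)) \<in> borel_measurable M"
  proof -
    have [measurable]: "(\<lambda>\<omega>. Gsum {2..Yb I} b (x \<omega>)) \<in> borel_measurable M" unfolding x_def by (rule R.Gsum_measurable)
    have [measurable]: "cis \<in> borel_measurable borel" by (intro borel_measurable_continuous_onI continuous_intros)
    show ?thesis unfolding W_def by measurable
  qed
  have X0: "0 \<le> X" and T0: "0 < T" "T \<le> 2 * T" using X_le T4 by auto
  note tF = R.tpoly_transference[OF tp(1) X0 T0(2) Fm[unfolded x_def], folded x_def]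
  note tD = R.tpoly_transference[OF tp(2) X0 T0(2) Dm[unfolded x_def], folded x_def]
  have WF: "norm (W h - F h) \<le> Re (D h) - 1" for h
  proof -
    have "Re (Gsum {2..Yb I} b h) = (\<Sum>i<Suc I. g h i)" unfolding Gsum_blocks g_def by simp
    moreover have "D h = of_real (\<Prod>i<Suc I. 1 + g h i ^ kk i / fact (kk i))" unfolding D_def by simp
    ultimately show ?thesis
      unfolding W_def F_def by (simp only: Re_complex_of_real) (intro trunc_exp_prod_approx, use kk_even kk_pos in auto)
  qed
  have E: "2 * X\<^sup>2 * X \<le> 2 * (T * exp (- (K / 2)))"
    using X_cube_le by (simp add: power2_eq_square power3_eq_cube mult_ac)
  define m where "m = R.expectation (\<lambda>\<omega>. Re (D (x \<omega>)))"
  have ED: "m \<le> 1 + 2 * (2 + exp (2 * C3)) * exp (- c * K)"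
  proof -
    have "Re (D (x \<omega>)) = (\<Prod>i<Suc I. 1 + Re (Gsum (blk i) b (chi (\<lambda>p. Xr p \<omega>))) ^ kk i / fact (kk i))" for \<omega>
    proof -
      have "D (x \<omega>) = of_real (\<Prod>i<Suc I. 1 + g (x \<omega>) i ^ kk i / fact (kk i))" unfolding D_def by simp
      then show ?thesis by (simp only: Re_complex_of_real g_def x_def)
    qed
    then show ?thesis unfolding m_def using block_moments[OF rm c1 CP b LK bL small] by (simp only:)
  qed
  have iD: "integrable M (\<lambda>\<omega>. D (x \<omega>))" "integrable M (\<lambda>\<omega>. F (x \<omega>))" unfolding x_def using tD(2) tF(2) by auto
  have iW: "integrable M (\<lambda>\<omega>. W (x \<omega>))" by (rule R.integrable_const_bound[where B = 1, OF _ Wm]) (simp add: W_def)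
  have hW: "(\<lambda>t. W (nit t)) integrable_on {T..2*T}"
    unfolding W_def Gsum_def nit_def by (intro integrable_continuous_interval continuous_intros)
  have hF: "(\<lambda>t. F (nit t)) integrable_on {T..2*T}" and hD: "(\<lambda>t. D (nit t)) integrable_on {T..2*T}"
    using tD(1) tF(1) by auto
  have hRD: "(\<lambda>t. Re (D (nit t))) integrable_on {T..2*T}" "integral {T..2*T} (\<lambda>t. Re (D (nit t))) = Re (integral {T..2*T} (\<lambda>t. D (nit t)))"
    using integrable_linear[OF hD bounded_linear_Re] integral_linear[OF hD bounded_linear_Re] by (simp_all add: o_def)
  have 1: "norm (integral {T..2*T} (\<lambda>t. W (nit t)) - integral {T..2*T} (\<lambda>t. F (nit t))) \<le> Re (integral {T..2*T} (\<lambda>t. D (nit t))) - T"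
  proof -
    have "norm (integral {T..2*T} (\<lambda>t. W (nit t) - F (nit t))) \<le> integral {T..2*T} (\<lambda>t. Re (D (nit t)) - 1)"
      using hW hF hRD(1) WF by (intro integral_norm_bound_integral integrable_diff) auto
    also have "\<dots> = Re (integral {T..2*T} (\<lambda>t. D (nit t))) - T"
      using hRD T0 by (subst Henstock_Kurzweil_Integration.integral_diff) auto
    finally show ?thesis using hW hF by (simp add: Henstock_Kurzweil_Integration.integral_diff)
  qed
  have mRe: "m = Re (R.expectation (\<lambda>\<omega>. D (x \<omega>)))"
    unfolding m_def by (rule integral_bounded_linear[OF bounded_linear_Re iD(1)])
  have 2: "Re (integral {T..2*T} (\<lambda>t. D (nit t))) \<le> T * m + 2 * X\<^sup>2 * X"
  proof -
    have "Re (integral {T..2*T} (\<lambda>t. D (nit t)) - of_real (2 * T - T) * R.expectation (\<lambda>\<omega>. D (x \<omega>))) \<le> 2 * X\<^sup>2 * X"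
      by (rule order_trans[OF complex_Re_le_cmod]) (unfold x_def, rule tD(3))
    moreover have "Re (of_real (2 * T - T) * R.expectation (\<lambda>\<omega>. D (x \<omega>))) = T * m" unfolding mRe by simp
    ultimately show ?thesis unfolding mRe by simp
  qed
  have 3: "norm (integral {T..2*T} (\<lambda>t. F (nit t)) - of_real T * R.expectation (\<lambda>\<omega>. F (x \<omega>))) \<le> 2 * X\<^sup>2 * X"
    unfolding x_def using tF(3) by simp
  have 4: "norm (R.expectation (\<lambda>\<omega>. F (x \<omega>)) - R.expectation (\<lambda>\<omega>. W (x \<omega>))) \<le> m - 1"
  proof -
    have iRD: "integrable M (\<lambda>\<omega>. Re (D (x \<omega>)))" by (rule integrable_bounded_linear[OF bounded_linear_Re iD(1)])
    have "norm (R.expectation (\<lambda>\<omega>. F (x \<omega>) - W (x \<omega>))) \<le> R.expectation (\<lambda>\<omega>. Re (D (x \<omega>)) - 1)"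
      using WF iD iW iRD
      by (intro order_trans[OF integral_norm_bound integral_mono]) (auto simp: norm_minus_commute)
    then show ?thesis using iD iW iRD by (simp add: m_def R.prob_space)
  qed
  have "norm (integral {T..2*T} (\<lambda>t. W (nit t)) - of_real T * R.expectation (\<lambda>\<omega>. W (x \<omega>)))
      \<le> norm (integral {T..2*T} (\<lambda>t. W (nit t)) - integral {T..2*T} (\<lambda>t. F (nit t)))
        + norm (integral {T..2*T} (\<lambda>t. F (nit t)) - of_real T * R.expectation (\<lambda>\<omega>. F (x \<omega>)))
        + norm (of_real T * (R.expectation (\<lambda>\<omega>. F (x \<omega>)) - R.expectation (\<lambda>\<omega>. W (x \<omega>))))"
    by (rule order_trans[OF _ add_right_mono[OF norm_triangle_ineq]], rule order_trans[OF _ norm_triangle_ineq]) (simp add: algebra_simps)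
  also have "norm (of_real T * (R.expectation (\<lambda>\<omega>. F (x \<omega>)) - R.expectation (\<lambda>\<omega>. W (x \<omega>)))) \<le> T * (m - 1)"
    using 4 T0 by (simp add: norm_mult)
  finally have "norm (integral {T..2*T} (\<lambda>t. W (nit t)) - of_real T * R.expectation (\<lambda>\<omega>. W (x \<omega>)))
      \<le> 2 * (T * (m - 1)) + 2 * (2 * X\<^sup>2 * X)"
    using 1 2 3 by (simp add: algebra_simps)
  also have "\<dots> \<le> 2 * (T * (2 * (2 + exp (2 * C3)) * exp (- c * K))) + 2 * (2 * (T * exp (- (K / 2))))"
    using ED T0 E by (intro add_mono mult_left_mono) auto
  finally show ?thesis unfolding W_def x_def by (simp add: algebra_simps)
qed

end

lemma norm_cis_diff_le: "norm (cis a - cis b) \<le> \<bar>a - b\<bar>"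
proof -
  have "cis a - cis b = cis b * (cis (a - b) - 1)" by (simp add: algebra_simps cis_mult)
  then have "norm (cis a - cis b) = norm (iexp (a - b) - 1)" by (simp add: norm_mult cis_conv_exp)
  also have "\<dots> \<le> \<bar>a - b\<bar>" using iexp_approx1[of "a - b" 0] by simp
  finally show ?thesis .
qed

text \<open>Since u Re z + v Im z = Re ((u - i v) z), the whole phase is the real part of a single
  polynomial.\<close>

lemma Gsum_combination:
  "(\<Sum>j=1..J. u j * Re (Gsum A (\<beta> j) h) + v j * Im (Gsum A (\<beta> j) h))
    = Re (Gsum A (\<lambda>n. \<Sum>j=1..J. (of_real (u j) - \<i> * of_real (v j)) * \<beta> j n) h)"
proof -
  have "Gsum A (\<lambda>n. \<Sum>j=1..J. (of_real (u j) - \<i> * of_real (v j)) * \<beta> j n) h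
    = (\<Sum>j=1..J. (of_real (u j) - \<i> * of_real (v j)) * Gsum A (\<beta> j) h)"
    unfolding Gsum_def sum_distrib_left sum_distrib_right
    by (subst sum.swap) (simp only: mult_ac)
  then show ?thesis by (simp add: sum.distrib[symmetric])
qed

lemma linear_combination_diff_le:
  fixes z w :: "nat \<Rightarrow> complex"
  shows "\<bar>(\<Sum>j=1..J. u j * Re (z j) + v j * Im (z j)) - (\<Sum>j=1..J. u j * Re (w j) + v j * Im (w j))\<bar>
    \<le> (\<Sum>j=1..J. (\<bar>u j\<bar> + \<bar>v j\<bar>) * norm (z j - w j))"
proof -
  have "\<bar>(\<Sum>j=1..J. u j * Re (z j) + v j * Im (z j)) - (\<Sum>j=1..J. u j * Re (w j) + v j * Im (w j))\<bar>
    = \<bar>\<Sum>j=1..J. u j * Re (z j - w j) + v j * Im (z j - w j)\<bar>"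
    unfolding sum_subtractf[symmetric] by (intro arg_cong[where f = abs] sum.cong) (auto simp: algebra_simps)
  also have "\<dots> \<le> (\<Sum>j=1..J. \<bar>u j * Re (z j - w j) + v j * Im (z j - w j)\<bar>)" by (rule sum_abs)
  also have "\<dots> \<le> (\<Sum>j=1..J. (\<bar>u j\<bar> + \<bar>v j\<bar>) * norm (z j - w j))"
  proof (rule sum_mono)
    fix j
    have "\<bar>u j * Re (z j - w j) + v j * Im (z j - w j)\<bar> \<le> \<bar>u j\<bar> * \<bar>Re (z j - w j)\<bar> + \<bar>v j\<bar> * \<bar>Im (z j - w j)\<bar>"
      by (rule order_trans[OF abs_triangle_ineq]) (simp only: abs_mult)
    also have "\<dots> \<le> \<bar>u j\<bar> * norm (z j - w j) + \<bar>v j\<bar> * norm (z j - w j)"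
      by (intro add_mono mult_left_mono abs_Re_le_cmod abs_Im_le_cmod) auto
    finally show "\<bar>u j * Re (z j - w j) + v j * Im (z j - w j)\<bar> \<le> (\<bar>u j\<bar> + \<bar>v j\<bar>) * norm (z j - w j)"
      by (simp only: distrib_right)
  qed
  finally show ?thesis .
qed

lemma emeasure_lborel_translate:
  fixes E :: "real set"
  assumes "E \<in> sets borel" shows "emeasure lborel ((+) a -` E) = emeasure lborel E"
proof -
  have "emeasure lborel E = emeasure (distr lborel borel ((+) a)) E" by (simp only: lborel_distr_plus)
  also have "\<dots> = emeasure lborel ((+) a -` E)" using assms by (subst emeasure_distr) auto
  finally show ?thesis ..
qed

lemma cis_measurable': "cis \<in> borel_measurable borel"
  by (intro borel_measurable_continuous_onI continuous_intros)

context scales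
begin

lemma P_nit: "P (s + \<i> * of_real t) = Gsum {2..Yb I} (\<lambda>n. of_nat n powr (-s)) (nit t)"
  unfolding P_def Pb_nit Gsum_blocks ..

text \<open>Where no shifted ordinate is exceptional, the two phases differ by at most K times the
  approximation error. On the remaining set, a union of J <= K translates of the exceptional set,
  the integrands differ by at most 2.\<close>

lemma char_fun_zeta_close:
  assumes rm: "random_model M Xr" and mb: "moll_bound \<delta> C1 T" "C1 > 0"
    and q8: "qq < 1 / 8" and tl: "(\<Sum>n. real n powr (- (3 / 2))) * exp (- 100 * K) < 1"
    and J: "real J \<le> K" and s: "\<And>j. j \<in> {1..J} \<Longrightarrow> \<sigma> \<le> Re (s j) \<and> \<bar>Im (s j)\<bar> \<le> T / 2"
    and U: "(\<Sum>j=1..J. \<bar>u j\<bar> + \<bar>v j\<bar>) \<le> K"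
  shows "norm ((LINT t:{T..2*T}|lborel. exp (\<i> * of_real (\<Sum>j=1..J. u j * Re (log_zeta (s j + \<i> * of_real t))
                            + v j * Im (log_zeta (s j + \<i> * of_real t)))))
      - integral {T..2*T} (\<lambda>t. cis (Re (Gsum {2..Yb I} (\<lambda>n. \<Sum>j=1..J. (of_real (u j) - \<i> * of_real (v j)) * of_nat n powr (- s j)) (nit t)))))
    \<le> T * (((8 + (\<Sum>n. real n powr (- (3 / 2)))) + 2 * \<bar>4 / \<delta> * (2 * C1 + mom_const \<delta>)\<bar>) * (K * qq))"
proof -
  define C4 where "C4 = 8 + (\<Sum>n. real n powr (- (3 / 2)))"
  define C5 where "C5 = \<bar>4 / \<delta> * (2 * C1 + mom_const \<delta>)\<bar>"
  obtain E where E: "E \<in> sets borel" "E \<subseteq> {T/2..3*T}" "measure lborel E \<le> 4 / \<delta> * (2 * C1 + mom_const \<delta>) * T * qq"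
    "\<And>x y. y \<in> {T/2..3*T} - E \<Longrightarrow> \<sigma> \<le> x \<Longrightarrow> norm (log_zeta (Complex x y) - P (Complex x y)) \<le> C4 * qq"
    unfolding C4_def using log_zeta_near_P[OF rm mb q8 tl] by blast
  have T0: "0 < T" using T4 by simp
  have qq0: "0 \<le> qq" by (simp add: qq_def)
  have C4: "0 \<le> C4" unfolding C4_def by (intro add_nonneg_nonneg suminf_nonneg summable_nat_powr) auto
  have mE: "measure lborel E \<le> C5 * T * qq"
  proof (rule order_trans[OF E(3)], intro mult_right_mono)
    show "4 / \<delta> * (2 * C1 + mom_const \<delta>) \<le> C5" unfolding C5_def by (rule abs_ge_self)
  qed (use T0 qq0 in auto)
  have fE: "emeasure lborel E < \<infinity>"
    by (rule le_less_trans[OF emeasure_mono[OF E(2)]]) (auto simp: emeasure_lborel_Icc_eq)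
  \<comment> \<open>The t for which the ordinate Im (s j) + t is exceptional. For t in [T, 2T] this
    ordinate lies in [T/2, 3T], the range covered by \<open>log_zeta_near_P\<close>.\<close>
  define B where "B = (\<lambda>j. (+) (Im (s j)) -` E)"
  have Bs: "B j \<in> sets borel" for j
    using measurable_sets[of "(+) (Im (s j))" borel borel E] E(1) by (simp add: B_def)
  have Be: "emeasure lborel (B j) = emeasure lborel E" for j unfolding B_def by (rule emeasure_lborel_translate[OF E(1)])
  have Bm: "measure lborel (B j) = measure lborel E" for j unfolding measure_def Be ..
  have Bi: "integrable lborel (indicat_real (B j))" for j
    using Bs[of j] Be[of j] fE by (intro integrable_real_indicator) auto
  define \<theta> where "\<theta> = (\<lambda>t. \<Sum>j=1..J. u j * Re (log_zeta (s j + \<i> * of_real t)) + v j * Im (log_zeta (s j + \<i> * of_real t)))"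
  define \<theta>' where "\<theta>' = (\<lambda>t. Re (Gsum {2..Yb I} (\<lambda>n. \<Sum>j=1..J. (of_real (u j) - \<i> * of_real (v j)) * of_nat n powr (- s j)) (nit t)))"
  define f where "f = (\<lambda>t. cis (\<theta> t))"
  define W where "W = (\<lambda>t. cis (\<theta>' t))"
  define \<eta> where "\<eta> = K * (C4 * qq)"
  have \<theta>': "\<theta>' t = (\<Sum>j=1..J. u j * Re (P (s j + \<i> * of_real t)) + v j * Im (P (s j + \<i> * of_real t)))" for t
    unfolding \<theta>'_def P_nit Gsum_combination ..
  have fm: "f \<in> borel_measurable lborel"
  proof -
    have [measurable]: "(\<lambda>t. log_zeta (s j + \<i> * of_real t)) \<in> borel_measurable borel" if "j \<in> {1..J}" for j
      using s[OF that] \<sigma> by (intro log_zeta_line_measurable) linarith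
    have [measurable]: "\<theta> \<in> borel_measurable borel" unfolding \<theta>_def by (intro borel_measurable_sum) measurable
    note [measurable] = cis_measurable'
    show ?thesis unfolding f_def by measurable
  qed
  have Wm: "W \<in> borel_measurable lborel"
    unfolding W_def \<theta>'_def Gsum_def nit_def by (simp, intro borel_measurable_continuous_onI continuous_intros)
  have int: "set_integrable lborel {T..2*T} g" if "g \<in> borel_measurable lborel" "\<And>t. norm (g t) = 1" for g :: "real \<Rightarrow> complex"
    unfolding set_integrable_def using that
    by (intro integrableI_bounded_set_indicator[where B = 1]) (auto simp: emeasure_lborel_Icc_eq)
  have fi: "set_integrable lborel {T..2*T} f" by (rule int[OF fm]) (simp add: f_def)
  have Wi: "set_integrable lborel {T..2*T} W" by (rule int[OF Wm]) (simp add: W_def)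
  have pt: "norm (indicat_real {T..2*T} t *\<^sub>R (f t - W t)) \<le> \<eta> * indicat_real {T..2*T} t + (\<Sum>j=1..J. 2 * indicat_real (B j) t)" for t
  proof (cases "t \<in> {T..2*T}")
    case True
    have \<eta>0: "0 \<le> \<eta>" using C4 qq0 L by (simp add: \<eta>_def)
    show ?thesis
    proof (cases "\<exists>j\<in>{1..J}. t \<in> B j")
      case bad: True
      then obtain j where j: "j \<in> {1..J}" "t \<in> B j" by blast
      have "norm (f t - W t) \<le> 2" using norm_triangle_ineq4[of "f t" "W t"] by (simp add: f_def W_def)
      also have "2 = 2 * indicat_real (B j) t" using j by simp
      also have "\<dots> \<le> (\<Sum>j=1..J. 2 * indicat_real (B j) t)" using j by (intro member_le_sum) auto
      finally show ?thesis using True \<eta>0 by simp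
    next
      case False
      have "norm (f t - W t) \<le> \<bar>\<theta> t - \<theta>' t\<bar>" unfolding f_def W_def by (rule norm_cis_diff_le)
      also have "\<dots> \<le> (\<Sum>j=1..J. (\<bar>u j\<bar> + \<bar>v j\<bar>) * norm (log_zeta (s j + \<i> * of_real t) - P (s j + \<i> * of_real t)))"
        unfolding \<theta>' \<theta>_def by (rule linear_combination_diff_le)
      also have "\<dots> \<le> (\<Sum>j=1..J. (\<bar>u j\<bar> + \<bar>v j\<bar>) * (C4 * qq))"
      proof (intro sum_mono mult_left_mono)
        fix j assume j: "j \<in> {1..J}"
        have e: "s j + \<i> * of_real t = Complex (Re (s j)) (Im (s j) + t)" by (simp add: complex_eq_iff)
        have "Im (s j) + t \<in> {T/2..3*T} - E" using True False j s[OF j] T0 by (auto simp: B_def)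
        then show "norm (log_zeta (s j + \<i> * of_real t) - P (s j + \<i> * of_real t)) \<le> C4 * qq"
          unfolding e using s[OF j] by (intro E(4)) auto
      qed auto
      also have "\<dots> = (\<Sum>j=1..J. \<bar>u j\<bar> + \<bar>v j\<bar>) * (C4 * qq)" by (rule sum_distrib_right[symmetric])
      also have "\<dots> \<le> \<eta>" unfolding \<eta>_def using U C4 qq0 by (intro mult_right_mono) auto
      finally have "norm (f t - W t) \<le> \<eta>" .
      moreover have "0 \<le> (\<Sum>j=1..J. 2 * indicat_real (B j) t)" by (intro sum_nonneg) auto
      ultimately show ?thesis using True by simp
    qed
  next
    case False
    then show ?thesis by (simp add: sum_nonneg)
  qed
  have ii: "integrable lborel (indicat_real {T..2*T})"
    by (intro integrable_real_indicator) (auto simp: emeasure_lborel_Icc_eq)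
  have "norm ((LINT t:{T..2*T}|lborel. f t) - (LINT t:{T..2*T}|lborel. W t)) = norm (LINT t|lborel. indicat_real {T..2*T} t *\<^sub>R (f t - W t))"
    using set_integral_diff(2)[OF fi Wi] by (simp add: set_lebesgue_integral_def)
  also have "\<dots> \<le> (LINT t|lborel. \<eta> * indicat_real {T..2*T} t + (\<Sum>j=1..J. 2 * indicat_real (B j) t))"
  proof (rule order_trans[OF integral_norm_bound integral_mono])
    show "integrable lborel (\<lambda>t. norm (indicat_real {T..2*T} t *\<^sub>R (f t - W t)))"
      using set_integral_diff(1)[OF fi Wi] unfolding set_integrable_def by (rule integrable_norm)
    show "integrable lborel (\<lambda>t. \<eta> * indicat_real {T..2*T} t + (\<Sum>j=1..J. 2 * indicat_real (B j) t))"
      using Bi ii by (intro Bochner_Integration.integrable_add Bochner_Integration.integrable_sum integrable_mult_right)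
  qed (rule pt)
  also have "\<dots> = \<eta> * T + (\<Sum>j=1..J. 2 * measure lborel (B j))"
  proof -
    have i2: "integrable lborel (\<lambda>t. 2 * indicat_real (B j) t)" for j using Bi by (rule integrable_mult_right)
    have "(LINT t|lborel. \<eta> * indicat_real {T..2*T} t + (\<Sum>j=1..J. 2 * indicat_real (B j) t))
        = (LINT t|lborel. \<eta> * indicat_real {T..2*T} t) + (\<Sum>j=1..J. LINT t|lborel. 2 * indicat_real (B j) t)"
      unfolding Bochner_Integration.integral_sum[OF i2, symmetric]
      by (intro Bochner_Integration.integral_add Bochner_Integration.integrable_sum integrable_mult_right ii i2)
    moreover have "(LINT t|lborel. 2 * indicat_real (B j) t) = 2 * measure lborel (B j)" for j
      unfolding integral_mult_right_zero by simp
    moreover have "(LINT t|lborel. \<eta> * indicat_real {T..2*T} t) = \<eta> * T"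
      unfolding integral_mult_right_zero using T0 by simp
    ultimately show ?thesis by (simp only:)
  qed
  also have "\<dots> \<le> \<eta> * T + K * (2 * (C5 * T * qq))"
  proof -
    have "(\<Sum>j=1..J. 2 * measure lborel (B j)) = real J * (2 * measure lborel E)" by (simp add: Bm)
    also have "\<dots> \<le> K * (2 * (C5 * T * qq))" using J mE L by (intro mult_mono) auto
    finally show ?thesis by simp
  qed
  also have "\<dots> = T * ((C4 + 2 * C5) * (K * qq))" by (simp add: \<eta>_def algebra_simps)
  finally have "norm ((LINT t:{T..2*T}|lborel. f t) - integral {T..2*T} W) \<le> T * ((C4 + 2 * C5) * (K * qq))"
    unfolding set_borel_integral_eq_integral(2)[OF Wi] .
  then show ?thesis unfolding f_def W_def \<theta>_def \<theta>'_def C4_def C5_def cis_conv_exp .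
qed

text \<open>The exponential is Lipschitz in the phase, so the bound in mean from
  \<open>log_zeta_rand_approx\<close> suffices. With \<open>Yb I\<close> of size at least exp (A K)
  / 2, its rate is better than \<open>qq\<close>.\<close>

lemma char_fun_rand_close:
  assumes rm: "random_model M Xr" and s: "\<And>j. j \<in> {1..J} \<Longrightarrow> \<sigma> \<le> Re (s j)"
    and U: "(\<Sum>j=1..J. \<bar>u j\<bar> + \<bar>v j\<bar>) \<le> K"
  shows "norm ((LINT \<omega>|M. cis (Re (Gsum {2..Yb I} (\<lambda>n. \<Sum>j=1..J. (of_real (u j) - \<i> * of_real (v j)) * of_nat n powr (- s j)) (chi (\<lambda>p. Xr p \<omega>)))))
      - \<Phi>_rand M Xr J s u v) \<le> 2 * rand_const \<delta> * (K * qq)"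
proof -
  interpret R: rmodel M Xr by unfold_locales (rule rm)
  define G where "G = (\<lambda>j \<omega>. Gsum {2..Yb I} (\<lambda>n. of_nat n powr (- s j)) (chi (\<lambda>p. Xr p \<omega>)))"
  define Z where "Z = (\<lambda>j. log_zeta_rand Xr (s j))"
  define \<theta> where "\<theta> = (\<lambda>\<omega>. \<Sum>j=1..J. u j * Re (Z j \<omega>) + v j * Im (Z j \<omega>))"
  define \<theta>' where "\<theta>' = (\<lambda>\<omega>. \<Sum>j=1..J. u j * Re (G j \<omega>) + v j * Im (G j \<omega>))"
  have [measurable]: "G j \<in> borel_measurable M" "Z j \<in> borel_measurable M" for j
    unfolding G_def Z_def by (rule R.Gsum_measurable R.log_zeta_rand_measurable)+
  note [measurable] = cis_measurable'
  have [measurable]: "\<theta> \<in> borel_measurable M" "\<theta>' \<in> borel_measurable M" unfolding \<theta>_def \<theta>'_def by measurable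
  have i: "integrable M (\<lambda>\<omega>. cis (\<theta> \<omega>))" "integrable M (\<lambda>\<omega>. cis (\<theta>' \<omega>))"
    by (rule R.integrable_const_bound[where B = 1]; simp)+
  define q where "q = rand_const \<delta> * real (Yb I) powr (- \<delta> / 2)"
  have rc: "0 \<le> rand_const \<delta>" unfolding rand_const_def using \<delta> by (intro add_nonneg_nonneg nonprime_const_nonneg) auto
  have q0: "0 \<le> q" using rc by (simp add: q_def)
  have "ennreal (norm (LINT \<omega>|M. cis (\<theta>' \<omega>) - cis (\<theta> \<omega>))) \<le> (\<integral>\<^sup>+\<omega>. ennreal (norm (cis (\<theta>' \<omega>) - cis (\<theta> \<omega>))) \<partial>M)"
    using i by (intro integral_norm_bound_ennreal) auto
  also have "\<dots> \<le> (\<integral>\<^sup>+\<omega>. (\<Sum>j=1..J. ennreal (\<bar>u j\<bar> + \<bar>v j\<bar>) * ennreal (norm (Z j \<omega> - G j \<omega>))) \<partial>M)"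
  proof (rule nn_integral_mono)
    fix \<omega>
    have "norm (cis (\<theta>' \<omega>) - cis (\<theta> \<omega>)) \<le> \<bar>\<theta> \<omega> - \<theta>' \<omega>\<bar>" using norm_cis_diff_le[of "\<theta>' \<omega>" "\<theta> \<omega>"] by (simp only: abs_minus_commute)
    also have "\<dots> \<le> (\<Sum>j=1..J. (\<bar>u j\<bar> + \<bar>v j\<bar>) * norm (Z j \<omega> - G j \<omega>))"
      unfolding \<theta>_def \<theta>'_def by (rule linear_combination_diff_le)
    finally have "ennreal (norm (cis (\<theta>' \<omega>) - cis (\<theta> \<omega>))) \<le> ennreal (\<Sum>j=1..J. (\<bar>u j\<bar> + \<bar>v j\<bar>) * norm (Z j \<omega> - G j \<omega>))" by (rule ennreal_leI)
    also have "\<dots> = (\<Sum>j=1..J. ennreal (\<bar>u j\<bar> + \<bar>v j\<bar>) * ennreal (norm (Z j \<omega> - G j \<omega>)))"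
      by (subst sum_ennreal[symmetric]) (auto intro!: sum.cong simp: ennreal_mult)
    finally show "ennreal (norm (cis (\<theta>' \<omega>) - cis (\<theta> \<omega>))) \<le> (\<Sum>j=1..J. ennreal (\<bar>u j\<bar> + \<bar>v j\<bar>) * ennreal (norm (Z j \<omega> - G j \<omega>)))" .
  qed
  also have "\<dots> = (\<Sum>j=1..J. ennreal (\<bar>u j\<bar> + \<bar>v j\<bar>) * (\<integral>\<^sup>+\<omega>. ennreal (norm (Z j \<omega> - G j \<omega>)) \<partial>M))"
    by (subst nn_integral_sum) (auto intro!: sum.cong nn_integral_cmult)
  also have "\<dots> \<le> (\<Sum>j=1..J. ennreal (\<bar>u j\<bar> + \<bar>v j\<bar>) * ennreal q)"
  proof (intro sum_mono mult_left_mono)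
    fix j assume j: "j \<in> {1..J}"
    have "1 / 2 + \<delta> \<le> Re (s j)" using s[OF j] unfolding \<delta>_def by simp
    then show "(\<integral>\<^sup>+\<omega>. ennreal (norm (Z j \<omega> - G j \<omega>)) \<partial>M) \<le> ennreal q"
      unfolding Z_def G_def q_def using \<delta> Yb(3)[of I] by (intro R.log_zeta_rand_approx) auto
  qed auto
  also have "\<dots> = ennreal ((\<Sum>j=1..J. \<bar>u j\<bar> + \<bar>v j\<bar>) * q)"
    unfolding sum_distrib_right using q0 by (subst sum_ennreal[symmetric]) (auto intro!: sum.cong simp: ennreal_mult)
  finally have "norm (LINT \<omega>|M. cis (\<theta>' \<omega>) - cis (\<theta> \<omega>)) \<le> (\<Sum>j=1..J. \<bar>u j\<bar> + \<bar>v j\<bar>) * q"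
    using q0 by (subst (asm) ennreal_le_iff) (auto intro!: mult_nonneg_nonneg sum_nonneg)
  also have "\<dots> \<le> K * q" using U q0 by (rule mult_right_mono)
  also have "\<dots> \<le> K * (rand_const \<delta> * (2 * qq))"
    unfolding q_def
  proof (intro mult_left_mono rc)
    have "Yr I / 2 \<le> real (Yb I)" using Yb(2,3)[of I] by simp
    then have "real (Yb I) powr (- \<delta> / 2) \<le> (Yr I / 2) powr (- \<delta> / 2)" using \<delta> Yr_ge(2)[of I] by (intro powr_mono2') auto
    also have "\<dots> = Yr I powr (- \<delta> / 2) * (1 / 2) powr (- \<delta> / 2)" using Yr_ge(2)[of I] by (subst powr_mult[symmetric]) auto
    also have "\<dots> \<le> qq * 2"
    proof (rule mult_mono)
      have "(1 / 2) powr (- \<delta> / 2) \<le> (1 / 2 :: real) powr (- 1)" using \<delta> by (intro powr_mono') auto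
      then show "(1 / 2) powr (- \<delta> / 2) \<le> (2::real)" by (simp add: powr_minus)
      have "Yr I powr (- \<delta> / 2) = exp (- 50 * (l * 2 ^ I))" using \<delta> by (simp add: Yr_def powr_def A_def)
      also have "\<dots> \<le> qq"
      proof -
        have "c * \<delta> / 16 * K \<le> 50 * K" using c \<delta> L mult_mono[of c 1 \<delta> 1] by (intro mult_right_mono) auto
        then show ?thesis using I_ge unfolding qq_def by simp
      qed
      finally show "Yr I powr (- \<delta> / 2) \<le> qq" .
    qed (auto simp: qq_def)
    finally show "real (Yb I) powr (- \<delta> / 2) \<le> 2 * qq" by simp
  qed (use L in auto)
  finally have "norm ((LINT \<omega>|M. cis (\<theta>' \<omega>)) - (LINT \<omega>|M. cis (\<theta> \<omega>))) \<le> 2 * rand_const \<delta> * (K * qq)"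
    using i by (simp add: mult_ac)
  then show ?thesis unfolding \<Phi>_rand_def \<theta>_def \<theta>'_def G_def Z_def Gsum_combination by (simp only: cis_conv_exp)
qed

end

context scales
begin

text \<open>The triangle inequality through \<open>A1\<close>, the polynomial phase averaged over
  the line, and \<open>A2\<close>, its expectation in the model.\<close>

lemma char_fun_close:
  assumes rm: "random_model M Xr" and mb: "moll_bound \<delta> C1 T" "C1 > 0"
    and q8: "exp (- (c * \<delta> / 16 * K)) < 1 / 8" and tl: "(\<Sum>n. real n powr (- (3 / 2))) * exp (- 100 * K) < 1"
    and c1: "0 \<le> c1" "2 * exp 1 * c1 \<le> 1" "2 * exp 1 * c1 * (nonprime_const \<sigma> + CP) \<le> c"
    and CP: "\<And>A. finite A \<Longrightarrow> (\<And>p. p \<in> A \<Longrightarrow> prime p) \<Longrightarrow> (\<Sum>p\<in>A. prime_wt \<sigma> L p) \<le> CP * K"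
    and LK: "L powr \<sigma> \<le> K" and small: "(2 + exp (2 * blk_const \<delta>)) * exp (- c * K) \<le> 1"
    and J: "1 \<le> J" "real J \<le> L powr \<sigma>" and s: "\<And>j. j \<in> {1..J} \<Longrightarrow> \<sigma> \<le> Re (s j) \<and> \<bar>Im (s j)\<bar> \<le> T / 2"
    and uv: "\<And>j. j \<in> {1..J} \<Longrightarrow> \<bar>u j\<bar> \<le> c1 * L powr \<sigma> / real J \<and> \<bar>v j\<bar> \<le> c1 * L powr \<sigma> / real J"
  shows "norm (\<Phi>_T T J s u v - \<Phi>_rand M Xr J s u v)
    \<le> ((8 + (\<Sum>n. real n powr (- (3 / 2))) + 2 * \<bar>4 / \<delta> * (2 * C1 + mom_const \<delta>)\<bar> + 2 * rand_const \<delta>) * (32 / (c * \<delta>))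
        + 4 * (2 + exp (2 * blk_const \<delta>)) + 4) * exp (- (c * \<delta> / 32 * K))"
proof -
  define b where "b = (\<lambda>n. \<Sum>j=1..J. (of_real (u j) - \<i> * of_real (v j)) * complex_of_nat n powr (- s j))"
  define A1 where "A1 = integral {T..2*T} (\<lambda>t. cis (Re (Gsum {2..Yb I} b (nit t))))"
  define A2 where "A2 = (LINT \<omega>|M. cis (Re (Gsum {2..Yb I} b (chi (\<lambda>p. Xr p \<omega>)))))"
  define C4 where "C4 = 8 + (\<Sum>n. real n powr (- (3 / 2)))"
  define C5 where "C5 = \<bar>4 / \<delta> * (2 * C1 + mom_const \<delta>)\<bar>"
  define e where "e = exp (- (c * \<delta> / 32 * K))"
  have C45: "0 \<le> C4" "0 \<le> C5" unfolding C4_def C5_def by (auto intro!: add_nonneg_nonneg suminf_nonneg summable_nat_powr)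
  have rc: "0 \<le> rand_const \<delta>" unfolding rand_const_def using \<delta> by (intro add_nonneg_nonneg nonprime_const_nonneg) auto
  have U: "(\<Sum>j=1..J. \<bar>u j\<bar> + \<bar>v j\<bar>) \<le> 2 * c1 * L powr \<sigma>"
  proof -
    have "(\<Sum>j=1..J. \<bar>u j\<bar> + \<bar>v j\<bar>) \<le> (\<Sum>j=1..J. c1 * L powr \<sigma> / real J + c1 * L powr \<sigma> / real J)"
      using uv by (intro sum_mono add_mono) auto
    also have "\<dots> = 2 * c1 * L powr \<sigma>" using J by simp
    finally show ?thesis .
  qed
  have c12: "2 * c1 \<le> 1"
  proof -
    have "1 * (2 * c1) \<le> exp 1 * (2 * c1)" using c1 by (intro mult_right_mono) auto
    then show ?thesis using c1(2) by (simp add: mult_ac)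
  qed
  have UK: "(\<Sum>j=1..J. \<bar>u j\<bar> + \<bar>v j\<bar>) \<le> K"
    using U LK mult_right_mono[OF c12, of "L powr \<sigma>"] by simp
  have bL: "2 * c1 * L powr \<sigma> \<le> L"
    using mult_right_mono[OF c12, of "L powr \<sigma>"] LK L(6) by simp
  have b: "norm (b n) \<le> 2 * c1 * L powr \<sigma> * real n powr (-\<sigma>)" if n: "n \<ge> 1" for n
  proof -
    have "norm (b n) \<le> (\<Sum>j=1..J. (\<bar>u j\<bar> + \<bar>v j\<bar>) * real n powr (-\<sigma>))"
      unfolding b_def
    proof (rule sum_norm_le)
      fix j assume j: "j \<in> {1..J}"
      have "norm (complex_of_real (u j) - \<i> * of_real (v j)) \<le> \<bar>u j\<bar> + \<bar>v j\<bar>"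
        using norm_triangle_ineq4[of "complex_of_real (u j)" "\<i> * of_real (v j)"] by (simp add: norm_mult)
      moreover have "norm (complex_of_nat n powr (- s j)) \<le> real n powr (-\<sigma>)"
        using n s[OF j] by (intro norm_nat_powr_le) auto
      ultimately show "norm ((complex_of_real (u j) - \<i> * of_real (v j)) * complex_of_nat n powr (- s j)) \<le> (\<bar>u j\<bar> + \<bar>v j\<bar>) * real n powr (-\<sigma>)"
        unfolding norm_mult by (intro mult_mono) auto
    qed
    also have "\<dots> = (\<Sum>j=1..J. \<bar>u j\<bar> + \<bar>v j\<bar>) * real n powr (-\<sigma>)" by (rule sum_distrib_right[symmetric])
    also have "\<dots> \<le> 2 * c1 * L powr \<sigma> * real n powr (-\<sigma>)" using U by (rule mult_right_mono) simp
    finally show ?thesis .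
  qed
  have JK: "real J \<le> K" using J LK by simp
  have T0: "T > 0" using T4 by simp
  have h: "1 / T * y \<le> x" if "y \<le> T * x" for x y :: real using that T0 by (simp add: field_simps)
  have nT: "norm (1 / complex_of_real T * z) = 1 / T * norm z" for z using T0 by (simp add: norm_mult norm_divide)
  have 1: "norm (\<Phi>_T T J s u v - 1 / of_real T * A1) \<le> (C4 + 2 * C5) * (K * qq)"
    unfolding \<Phi>_T_def right_diff_distrib[symmetric] nT A1_def b_def C4_def C5_def
    by (rule h, rule char_fun_zeta_close[OF rm mb q8[folded qq_def] tl JK s UK])
  have 2: "norm (1 / of_real T * A1 - A2) \<le> 4 * (2 + exp (2 * C3)) * exp (- c * K) + 4 * exp (- (K / 2))"
  proof -
    have e: "1 / of_real T * A1 - A2 = 1 / of_real T * (A1 - of_real T * A2)" using T0 by (simp add: right_diff_distrib)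
    show ?thesis unfolding e nT unfolding A1_def A2_def
      by (rule h, rule char_fun_blocks_close[OF rm c1 CP b LK bL small])
  qed
  have 3: "norm (A2 - \<Phi>_rand M Xr J s u v) \<le> 2 * rand_const \<delta> * (K * qq)"
    unfolding A2_def b_def using s by (intro char_fun_rand_close[OF rm _ UK]) auto
  \<comment> \<open>Half of the exponent in \<open>qq\<close> absorbs the factor K, by y <= exp y.
    Hence the rate c \<delta> / 32 in the result.\<close>
  have Kq: "K * qq \<le> 32 / (c * \<delta>) * e"
  proof -
    define y where "y = c * \<delta> / 32 * K"
    have cd: "0 < c * \<delta>" using c \<delta> by simp
    have "y \<le> exp y" using exp_ge_add_one_self[of y] by linarith
    then have "y * exp (- 2 * y) \<le> exp y * exp (- 2 * y)" by (rule mult_right_mono) simp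
    also have "\<dots> = e" by (simp add: e_def y_def exp_add[symmetric])
    also have "y * exp (- 2 * y) = c * \<delta> / 32 * (K * qq)" by (simp add: y_def qq_def mult_ac)
    finally show ?thesis using cd by (simp add: field_simps)
  qed
  have cd: "c * \<delta> / 32 \<le> c" "c * \<delta> / 32 \<le> 1 / 2"
  proof -
    have "c * \<delta> \<le> 1 * 1" using c \<delta> by (intro mult_mono) auto
    moreover have "c * \<delta> \<le> c * 1" using c \<delta> by (intro mult_left_mono) auto
    ultimately show "c * \<delta> / 32 \<le> c" "c * \<delta> / 32 \<le> 1 / 2" using c(1) by linarith+
  qed
  have ec: "exp (- c * K) \<le> e" and eK: "exp (- (K / 2)) \<le> e"
    using mult_right_mono[OF cd(1), of K] mult_right_mono[OF cd(2), of K] L unfolding e_def by auto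
  have "norm (\<Phi>_T T J s u v - \<Phi>_rand M Xr J s u v)
    \<le> norm (\<Phi>_T T J s u v - 1 / of_real T * A1) + norm (1 / of_real T * A1 - A2) + norm (A2 - \<Phi>_rand M Xr J s u v)"
    by (rule order_trans[OF _ add_right_mono[OF norm_triangle_ineq]], rule order_trans[OF _ norm_triangle_ineq]) simp
  also have "\<dots> \<le> (C4 + 2 * C5 + 2 * rand_const \<delta>) * (K * qq) + (4 * (2 + exp (2 * C3)) * exp (- c * K) + 4 * exp (- (K / 2)))"
    using 1 2 3 by (simp add: distrib_right)
  also have "\<dots> \<le> (C4 + 2 * C5 + 2 * rand_const \<delta>) * (32 / (c * \<delta>) * e) + (4 * (2 + exp (2 * C3)) * e + 4 * e)"
    using Kq ec eK C45 rc by (intro add_mono mult_left_mono) auto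
  also have "\<dots> = ((C4 + 2 * C5 + 2 * rand_const \<delta>) * (32 / (c * \<delta>)) + 4 * (2 + exp (2 * C3)) + 4) * e"
    by (simp add: distrib_right mult.assoc)
  finally show ?thesis unfolding C4_def C5_def e_def .
qed

end

theorem theorem2p4:
  fixes \<sigma> :: real
  assumes "1 / 2 < \<sigma>" and "\<sigma> < 1"
  shows "\<exists>c\<^sub>1>0. \<exists>c\<^sub>2>0. \<exists>C>0. \<exists>T\<^sub>0::real.
    \<forall>(M :: 'a measure) X. random_model M X \<longrightarrow>
    (\<forall>T\<ge>T\<^sub>0. \<forall>J::nat. 1 \<le> J \<and> real J \<le> ln T powr \<sigma> \<longrightarrow>
    (\<forall>s :: nat \<Rightarrow> complex.
       (MIN j\<in>{1..J}. Re (s j)) = \<sigma> \<and>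
       (MAX j\<in>{1..J}. \<bar>Im (s j)\<bar>) < T powr ((\<sigma> - 1 / 2) / 4) \<longrightarrow>
    (\<forall>u v :: nat \<Rightarrow> real.
       (MAX j\<in>{1..J}. \<bar>u j\<bar>) \<le> c\<^sub>1 * ln T powr \<sigma> / real J \<and>
       (MAX j\<in>{1..J}. \<bar>v j\<bar>) \<le> c\<^sub>1 * ln T powr \<sigma> / real J \<longrightarrow>
       norm (\<Phi>_T T J s u v - \<Phi>_rand M X J s u v) \<le> C * exp (- c\<^sub>2 * ln T / ln (ln T)))))"
proof -
  define \<delta> where "\<delta> = \<sigma> - 1 / 2"
  \<comment> \<open>The constant \<open>c\<close> of the locale \<open>scales\<close>, written out
    so that it is available before T is chosen.\<close>
  define c where "c = \<delta> / 64 / (12 * (100 / \<delta>))"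
  have \<delta>: "0 < \<delta>" "\<delta> < 1 / 2" using assms by (auto simp: \<delta>_def)
  have c: "0 < c" using \<delta> by (simp add: c_def)
  obtain CP where CP: "CP > 0" "\<And>L A. L \<ge> 2 \<Longrightarrow> finite A \<Longrightarrow> (\<And>p. p \<in> A \<Longrightarrow> prime p) \<Longrightarrow> (\<Sum>p\<in>A. prime_wt \<sigma> L p) \<le> CP * L / ln L"
    using sum_prime_wt_le[OF assms] by blast
  obtain C1 T1 where C1: "C1 > 0" "\<And>T. T \<ge> T1 \<Longrightarrow> moll_bound \<delta> C1 T"
    using moll_bound_exists[OF \<delta>] by blast
  have np: "0 \<le> nonprime_const \<sigma>" using assms by (intro nonprime_const_nonneg) auto
  \<comment> \<open>The first bound brings the scaling factor 2 e c1 of \<open>hmin_mult_le\<close>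
    below 1. The second keeps the logarithm of the moment of block 0 below c K, half of the
    guaranteed gain 2 c K.\<close>
  define c1 where "c1 = min (1 / (2 * exp 1)) (c / (2 * exp 1 * (nonprime_const \<sigma> + CP)))"
  have c1: "0 < c1" "2 * exp 1 * c1 \<le> 1" "2 * exp 1 * c1 * (nonprime_const \<sigma> + CP) \<le> c"
  proof -
    have n: "0 < nonprime_const \<sigma> + CP" using np CP(1) by simp
    show "0 < c1" using c n by (simp add: c1_def)
    have "c1 \<le> 1 / (2 * exp 1)" by (simp add: c1_def)
    then show "2 * exp 1 * c1 \<le> 1" by (simp add: field_simps)
    have "c1 \<le> c / (2 * exp 1 * (nonprime_const \<sigma> + CP))" by (simp add: c1_def)
    then have "c1 * (2 * exp 1 * (nonprime_const \<sigma> + CP)) \<le> c" using n by (subst (asm) pos_le_divide_eq) auto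
    then show "2 * exp 1 * c1 * (nonprime_const \<sigma> + CP) \<le> c" by (simp only: mult_ac)
  qed
  define C where "C = (8 + (\<Sum>n. real n powr (- (3 / 2))) + 2 * \<bar>4 / \<delta> * (2 * C1 + mom_const \<delta>)\<bar> + 2 * rand_const \<delta>) * (32 / (c * \<delta>))
        + 4 * (2 + exp (2 * blk_const \<delta>)) + 4"
  have C: "C > 0"
  proof -
    have "0 \<le> rand_const \<delta>" unfolding rand_const_def using \<delta> by (intro add_nonneg_nonneg nonprime_const_nonneg) auto
    moreover have "0 \<le> (\<Sum>n. real n powr (- (3 / 2)))" by (intro suminf_nonneg summable_nat_powr) auto
    ultimately show ?thesis unfolding C_def using c \<delta>
      by (intro add_nonneg_pos add_nonneg_nonneg mult_nonneg_nonneg) auto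
  qed
  have K: "filterlim (\<lambda>T::real. ln T / ln (ln T)) at_top at_top" by real_asymp
  have "((\<lambda>x. exp (- (g * x))) \<longlongrightarrow> 0) at_top" if "0 < g" for g :: real using that by real_asymp
  from this[of "c * \<delta> / 16"] have "((\<lambda>x. exp (- (c * \<delta> / 16 * x))) \<longlongrightarrow> 0) at_top" using c \<delta> by simp
  from order_tendstoD(2)[OF filterlim_compose[OF this K], of "1 / 8"]
  have e1: "eventually (\<lambda>T. exp (- (c * \<delta> / 16 * (ln T / ln (ln T)))) < 1 / 8) at_top" by simp
  have "((\<lambda>x::real. (\<Sum>n. real n powr (- (3 / 2))) * exp (- 100 * x)) \<longlongrightarrow> (\<Sum>n. real n powr (- (3 / 2))) * 0) at_top"
    by (intro tendsto_mult tendsto_const) real_asymp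
  from order_tendstoD(2)[OF filterlim_compose[OF this K], of 1]
  have e2: "eventually (\<lambda>T. (\<Sum>n. real n powr (- (3 / 2))) * exp (- 100 * (ln T / ln (ln T))) < 1) at_top" by simp
  have "((\<lambda>x::real. exp (- c * x)) \<longlongrightarrow> 0) at_top" using c by real_asymp
  then have "((\<lambda>x::real. (2 + exp (2 * blk_const \<delta>)) * exp (- c * x)) \<longlongrightarrow> (2 + exp (2 * blk_const \<delta>)) * 0) at_top"
    by (intro tendsto_mult tendsto_const)
  from order_tendstoD(2)[OF filterlim_compose[OF this K], of 1]
  have e3: "eventually (\<lambda>T. (2 + exp (2 * blk_const \<delta>)) * exp (- c * (ln T / ln (ln T))) < 1) at_top" by simp
  have e4: "eventually (\<lambda>T. ln T powr \<sigma> \<le> ln T / ln (ln T)) at_top" using assms by real_asymp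
  have e5: "eventually (\<lambda>T. T powr ((\<sigma> - 1 / 2) / 4) \<le> T / 2) at_top" using assms by real_asymp
  have e6: "eventually (\<lambda>T::real. 2 \<le> ln T) at_top" by real_asymp
  have "eventually (\<lambda>T. scales \<sigma> T \<and> exp (- (c * \<delta> / 16 * (ln T / ln (ln T)))) < 1 / 8 \<and>
      (\<Sum>n. real n powr (- (3 / 2))) * exp (- 100 * (ln T / ln (ln T))) < 1 \<and>
      (2 + exp (2 * blk_const \<delta>)) * exp (- c * (ln T / ln (ln T))) < 1 \<and>
      ln T powr \<sigma> \<le> ln T / ln (ln T) \<and> T powr ((\<sigma> - 1 / 2) / 4) \<le> T / 2 \<and> 2 \<le> ln T \<and> T1 \<le> T) at_top"
    using eventually_scales[OF assms] e1 e2 e3 e4 e5 e6 eventually_ge_at_top[of T1] by eventually_elim blast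
  then obtain T0 where T0: "\<And>T. T \<ge> T0 \<Longrightarrow> scales \<sigma> T \<and> exp (- (c * \<delta> / 16 * (ln T / ln (ln T)))) < 1 / 8 \<and>
      (\<Sum>n. real n powr (- (3 / 2))) * exp (- 100 * (ln T / ln (ln T))) < 1 \<and>
      (2 + exp (2 * blk_const \<delta>)) * exp (- c * (ln T / ln (ln T))) < 1 \<and>
      ln T powr \<sigma> \<le> ln T / ln (ln T) \<and> T powr ((\<sigma> - 1 / 2) / 4) \<le> T / 2 \<and> 2 \<le> ln T \<and> T1 \<le> T"
    unfolding eventually_at_top_linorder by blast
  show ?thesis
  proof (rule exI[of _ c1], intro conjI c1, rule exI[of _ "c * \<delta> / 32"], intro conjI, use c \<delta> in simp,
      rule exI[of _ C], intro conjI C, rule exI[of _ T0], intro allI impI)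
    fix M :: "'a measure" and X :: "nat \<Rightarrow> 'a \<Rightarrow> complex" and T :: real and J :: nat and s :: "nat \<Rightarrow> complex" and u v :: "nat \<Rightarrow> real"
    assume rm: "random_model M X" and T: "T0 \<le> T" and J: "1 \<le> J \<and> real J \<le> ln T powr \<sigma>"
      and s: "(MIN j\<in>{1..J}. Re (s j)) = \<sigma> \<and> (MAX j\<in>{1..J}. \<bar>Im (s j)\<bar>) < T powr ((\<sigma> - 1 / 2) / 4)"
      and uv: "(MAX j\<in>{1..J}. \<bar>u j\<bar>) \<le> c1 * ln T powr \<sigma> / real J \<and> (MAX j\<in>{1..J}. \<bar>v j\<bar>) \<le> c1 * ln T powr \<sigma> / real J"
    note t = T0[OF T]
    have sc: "scales \<sigma> T" using t by blast
    have max: "f j \<le> B" if "(MAX j\<in>{1..J}. f j) \<le> B" "j \<in> {1..J}" for f :: "nat \<Rightarrow> real" and B j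
      using that Max_ge[of "f ` {1..J}" "f j"] by simp
    have s': "\<sigma> \<le> Re (s j) \<and> \<bar>Im (s j)\<bar> \<le> T / 2" if j: "j \<in> {1..J}" for j
    proof
      show "\<sigma> \<le> Re (s j)" using s j Min_le[of "(\<lambda>j. Re (s j)) ` {1..J}" "Re (s j)"] by simp
      have "(MAX j\<in>{1..J}. \<bar>Im (s j)\<bar>) \<le> T / 2" using s t by linarith
      then show "\<bar>Im (s j)\<bar> \<le> T / 2" using j by (rule max)
    qed
    have uv': "\<bar>u j\<bar> \<le> c1 * ln T powr \<sigma> / real J \<and> \<bar>v j\<bar> \<le> c1 * ln T powr \<sigma> / real J" if j: "j \<in> {1..J}" for j
      using uv max[OF _ j, of "\<lambda>j. \<bar>u j\<bar>"] max[OF _ j, of "\<lambda>j. \<bar>v j\<bar>"] by blast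
    have CP': "(\<Sum>p\<in>A. prime_wt \<sigma> (ln T) p) \<le> CP * (ln T / ln (ln T))" if "finite A" "\<And>p. p \<in> A \<Longrightarrow> prime p" for A
      using CP(2)[of "ln T" A] t that by simp
    have "norm (\<Phi>_T T J s u v - \<Phi>_rand M X J s u v) \<le> C * exp (- (c * \<delta> / 32 * (ln T / ln (ln T))))"
      unfolding C_def c_def \<delta>_def
    proof (rule scales.char_fun_close[OF sc rm])
      show "moll_bound (\<sigma> - 1 / 2) C1 T" using C1(2) t unfolding \<delta>_def by blast
      show "0 < C1" by (rule C1(1))
      show "0 \<le> c1" using c1 by simp
      show "2 * exp 1 * c1 \<le> 1" by (rule c1)
      show "2 * exp 1 * c1 * (nonprime_const \<sigma> + CP) \<le> (\<sigma> - 1 / 2) / 64 / (12 * (100 / (\<sigma> - 1 / 2)))"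
        using c1(3) unfolding c_def \<delta>_def .
    qed (use t J s' uv' CP' in \<open>auto simp: c_def \<delta>_def\<close>)
    also have "- (c * \<delta> / 32 * (ln T / ln (ln T))) = - (c * \<delta> / 32) * ln T / ln (ln T)" by simp
    finally show "norm (\<Phi>_T T J s u v - \<Phi>_rand M X J s u v) \<le> C * exp (- (c * \<delta> / 32) * ln T / ln (ln T))" .
  qed
qed

end
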